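(* Let $T>0$, $I=(0,T)$, let $a,A,q$ be constant positive definite symmetric $d\times d$ matrices, and let $\alpha\ge0$. Let $\gamma_{ta}$ denote the weight $(t,x)\mapsto\gamma_{ta}(x)$. Then $$K_\alpha(I;\gamma_{ta},A,q)=\mathfrak P_\alpha(\delta_0,a,A,q),$$ and $$K_\alpha(I;\gamma_{ta},A,q)<\infty\quad\Longleftrightarrow\quad a-A\succ0.$$ When $a-A\succ0$, a finite upper bound for this constant depends only on $d,\alpha$, the ellipticity bounds of $a,A,q$, and $\lambda_{\min}(a-A)^{-1}$.
   Context: Notation. $\gamma_C$ is the centered Gaussian density on $\mathbb R^d$ with covariance $C$. Matrix norms are Frobenius, $C:D=\operatorname{tr}(C^{\mathsf T}D)$, $0/0=0$, positive$/0=+\infty$. $P_Au=-u_t-A:D^2u$, $\mathcal H_qu=q^{1/2}D^2u\,q^{1/2}$. For $J=(s_0,s_1)$, $0\le s_0<s_1<\infty$, and a positive continuous weight $F$ on $(s_0,s_1]\times\mathbb R^d$: $\|f\|_{\alpha,J;F}^2=\int_J\int_{\mathbb R^d}t^\alpha F(t,x)|f(t,x)|^2\,dx\,dt$; $\mathcal W_\alpha(J;F)$ is the space of $u$ with $u,u_t,Du,D^2u$ (distributional derivatives) of finite $\|\cdot\|_{\alpha,J;F}$ norm; such $u$ have an $H^1_{\mathrm{loc}}(\mathbb R^d)$ trace at $t=s_1$; $\mathcal W_{\alpha,0}(J;F)$ is the subspace with zero trace at $s_1$ (no condition at $s_0$). Set $k_\alpha(J;F,A,q)=\sup_{u\in\mathcal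 W_{\alpha,0}(J;F)}\|\mathcal H_qu\|_{\alpha,J;F}/\|P_Au\|_{\alpha,J;F}$ and $K_\alpha(I;F,A,q)=\lim_{h\downarrow0}\sup_{J\subseteq I,\,0<|J|\le h}k_\alpha(J;F,A,q)$ (over open intervals $J$). $\mathfrak P_\alpha(\delta_0,a,A,q)=\sup_{0<c<B<\infty}k_\alpha((c,B);F_0,A,q)$ with $F_0(\tau,z)=\gamma_{\tau a}(z)$. *)

theory Defs
  imports "HOL-Analysis.Analysis"
begin

section \<open>Matrices and the Gaussian density\<close>

definition posdef :: "real^'n^'n \<Rightarrow> bool" where
  "posdef M \<longleftrightarrow> transpose M = M \<and> (\<forall>x. x \<noteq> 0 \<longrightarrow> x \<bullet> (M *v x) > 0)"

definition elliptic :: "real \<Rightarrow> real \<Rightarrow> real^'n^'n \<Rightarrow> bool" where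
  "elliptic l L M \<longleftrightarrow> (\<forall>x. l * (x \<bullet> x) \<le> x \<bullet> (M *v x) \<and> x \<bullet> (M *v x) \<le> L * (x \<bullet> x))"

definition lambda_min :: "real^'n^'n \<Rightarrow> real" where
  "lambda_min M = (LEAST l. \<exists>x. x \<noteq> 0 \<and> M *v x = l *\<^sub>R x)"

text \<open>The positive definite square root of a positive definite matrix.\<close>

definition sqrt_mat :: "real^'n^'n \<Rightarrow> real^'n^'n" where
  "sqrt_mat q = (THE r. posdef r \<and> r ** r = q)"

definition frob_inner :: "real^'n^'n \<Rightarrow> real^'n^'n \<Rightarrow> real" where
  "frob_inner C D = trace (transpose C ** D)"

definition gauss :: "real^'n^'n \<Rightarrow> real^'n \<Rightarrow> real" where
  "gauss C x = exp (- (x \<bullet> (matrix_inv C *v x)) / 2) / sqrt ((2 * pi) ^ CARD('n) * det C)"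

section \<open>Weak derivatives\<close>

primrec Ck :: "nat \<Rightarrow> ('a::euclidean_space \<Rightarrow> real) \<Rightarrow> bool" where
  "Ck 0 f \<longleftrightarrow> continuous_on UNIV f"
| "Ck (Suc k) f \<longleftrightarrow> (\<forall>x. f differentiable (at x)) \<and>
     (\<forall>e. Ck k (\<lambda>x. frechet_derivative f (at x) e))"

definition test_functions :: "'a::euclidean_space set \<Rightarrow> ('a \<Rightarrow> real) set" where
  "test_functions \<Omega> = {\<phi>. (\<forall>k. Ck k \<phi>) \<and> compact (closure {x. \<phi> x \<noteq> 0}) \<and>
     closure {x. \<phi> x \<noteq> 0} \<subseteq> \<Omega>}"

definition locally_integrable :: "'a::euclidean_space set \<Rightarrow> ('a \<Rightarrow> real) \<Rightarrow> bool" where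
  "locally_integrable \<Omega> f \<longleftrightarrow> (\<forall>K. compact K \<and> K \<subseteq> \<Omega> \<longrightarrow> set_integrable lborel K f)"

text \<open>\<open>v\<close> is a version of the distributional derivative of \<open>u\<close> on \<open>\<Omega>\<close> in the direction \<open>e\<close>.\<close>

definition weak_deriv ::
    "'a::euclidean_space set \<Rightarrow> 'a \<Rightarrow> ('a \<Rightarrow> real) \<Rightarrow> ('a \<Rightarrow> real) \<Rightarrow> bool" where
  "weak_deriv \<Omega> e u v \<longleftrightarrow> locally_integrable \<Omega> u \<and> locally_integrable \<Omega> v \<and>
     (\<forall>\<phi>\<in>test_functions \<Omega>.
        (LINT x:\<Omega>|lborel. u x * frechet_derivative \<phi> (at x) e) = - (LINT x:\<Omega>|lborel. v x * \<phi> x))"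

section \<open>Weighted spaces on time strips\<close>

text \<open>An interval \<open>J = (s0, s1)\<close> is passed as its two endpoints. Functions of \<open>(t, x)\<close> are
  real-valued functions on pairs; only their values on the strip matter.\<close>

definition strip :: "real \<Rightarrow> real \<Rightarrow> (real \<times> (real^'n)) set" where
  "strip s0 s1 = {s0<..<s1} \<times> UNIV"

definition ennreal_sqrt :: "ennreal \<Rightarrow> ennreal" where
  "ennreal_sqrt y = (if y = top then top else ennreal (sqrt (enn2real y)))"

text \<open>For matrix-valued \<open>f\<close> the library norm on \<open>real^'n^'n\<close> is the Frobenius norm.\<close>

definition wnorm :: "real \<Rightarrow> real \<Rightarrow> real \<Rightarrow> (real \<Rightarrow> real^'n \<Rightarrow> real)
    \<Rightarrow> (real \<times> (real^'n) \<Rightarrow> 'b::real_normed_vector) \<Rightarrow> ennreal" where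
  "wnorm \<alpha> s0 s1 F f = ennreal_sqrt
     (\<integral>\<^sup>+t\<in>{s0<..<s1}. (\<integral>\<^sup>+x. ennreal (t powr \<alpha> * F t x * (norm (f (t, x)))\<^sup>2) \<partial>lborel) \<partial>lborel)"

text \<open>A function \<open>u\<close> is carried together with versions \<open>ut\<close>, \<open>Du\<close>, \<open>Hu\<close> of its distributional
  derivatives \<open>u\<^sub>t\<close>, \<open>Du\<close>, \<open>D\<^sup>2u\<close>. These are determined by \<open>u\<close> up to null sets, so no quantity
  below depends on the choice.\<close>

definition W_space :: "real \<Rightarrow> real \<Rightarrow> real \<Rightarrow> (real \<Rightarrow> real^'n \<Rightarrow> real) \<Rightarrow>
    ((real \<times> (real^'n) \<Rightarrow> real) \<times> (real \<times> (real^'n) \<Rightarrow> real) \<times>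
     (real \<times> (real^'n) \<Rightarrow> real^'n) \<times> (real \<times> (real^'n) \<Rightarrow> real^'n^'n)) set" where
  "W_space \<alpha> s0 s1 F = {(u, ut, Du, Hu).
     weak_deriv (strip s0 s1) (1, 0) u ut \<and>
     (\<forall>i. weak_deriv (strip s0 s1) (0, axis i 1) u (\<lambda>p. Du p $ i)) \<and>
     (\<forall>i j. weak_deriv (strip s0 s1) (0, axis j 1) (\<lambda>p. Du p $ i) (\<lambda>p. Hu p $ i $ j)) \<and>
     wnorm \<alpha> s0 s1 F u < top \<and> wnorm \<alpha> s0 s1 F ut < top \<and>
     wnorm \<alpha> s0 s1 F Du < top \<and> wnorm \<alpha> s0 s1 F Hu < top}"

definition H1loc :: "(real^'n \<Rightarrow> real) \<Rightarrow> (real^'n \<Rightarrow> real^'n) \<Rightarrow> bool" where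
  "H1loc g Dg \<longleftrightarrow> (\<forall>i. weak_deriv UNIV (axis i 1) g (\<lambda>x. Dg x $ i)) \<and>
     (\<forall>R. (\<integral>\<^sup>+x\<in>cball 0 R. ennreal ((g x)\<^sup>2 + (norm (Dg x))\<^sup>2) \<partial>lborel) < top)"

definition H1loc_tendsto ::
    "('t \<Rightarrow> real^'n \<Rightarrow> real) \<Rightarrow> (real^'n \<Rightarrow> real) \<Rightarrow> 't filter \<Rightarrow> bool" where
  "H1loc_tendsto v g \<F> \<longleftrightarrow> (\<exists>Dv Dg. H1loc g Dg \<and> (\<forall>\<^sub>F t in \<F>. H1loc (v t) (Dv t)) \<and>
     (\<forall>R. ((\<lambda>t. \<integral>\<^sup>+x\<in>cball 0 R. ennreal ((v t x - g x)\<^sup>2 + (norm (Dv t x - Dg x))\<^sup>2) \<partial>lborel)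
        \<longlongrightarrow> 0) \<F>))"

text \<open>\<open>u\<close> is only determined almost everywhere on the strip, so its trace at \<open>t = s1\<close> is the
  limit in \<open>H\<^sup>1\<^sub>l\<^sub>o\<^sub>c\<close> of the time slices of a suitable version of \<open>u\<close>.\<close>

definition has_trace ::
    "real \<Rightarrow> real \<Rightarrow> (real \<times> (real^'n) \<Rightarrow> real) \<Rightarrow> (real^'n \<Rightarrow> real) \<Rightarrow> bool" where
  "has_trace s0 s1 u g \<longleftrightarrow> (\<exists>v. (AE p in lborel. p \<in> strip s0 s1 \<longrightarrow> v p = u p) \<and>
     H1loc_tendsto (\<lambda>t x. v (t, x)) g (at_left s1))"

definition W0_space :: "real \<Rightarrow> real \<Rightarrow> real \<Rightarrow> (real \<Rightarrow> real^'n \<Rightarrow> real) \<Rightarrow>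
    ((real \<times> (real^'n) \<Rightarrow> real) \<times> (real \<times> (real^'n) \<Rightarrow> real) \<times>
     (real \<times> (real^'n) \<Rightarrow> real^'n) \<times> (real \<times> (real^'n) \<Rightarrow> real^'n^'n)) set" where
  "W0_space \<alpha> s0 s1 F = {(u, ut, Du, Hu) \<in> W_space \<alpha> s0 s1 F. has_trace s0 s1 u (\<lambda>_. 0)}"

section \<open>The constants\<close>

definition P_op :: "real^'n^'n \<Rightarrow> ('p \<Rightarrow> real) \<Rightarrow> ('p \<Rightarrow> real^'n^'n) \<Rightarrow> 'p \<Rightarrow> real" where
  "P_op A ut Hu p = - ut p - frob_inner A (Hu p)"

definition H_op :: "real^'n^'n \<Rightarrow> ('p \<Rightarrow> real^'n^'n) \<Rightarrow> 'p \<Rightarrow> real^'n^'n" where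
  "H_op q Hu p = sqrt_mat q ** Hu p ** sqrt_mat q"

text \<open>Division on \<open>ennreal\<close> satisfies \<open>0 / 0 = 0\<close> and \<open>x / 0 = top\<close> for \<open>x > 0\<close>.\<close>

definition k_const :: "real \<Rightarrow> real \<Rightarrow> real \<Rightarrow> (real \<Rightarrow> real^'n \<Rightarrow> real) \<Rightarrow>
    real^'n^'n \<Rightarrow> real^'n^'n \<Rightarrow> ennreal" where
  "k_const \<alpha> s0 s1 F A q = (SUP (u, ut, Du, Hu) \<in> W0_space \<alpha> s0 s1 F.
     wnorm \<alpha> s0 s1 F (H_op q Hu) / wnorm \<alpha> s0 s1 F (P_op A ut Hu))"

definition k_sup :: "real \<Rightarrow> real set \<Rightarrow> (real \<Rightarrow> real^'n \<Rightarrow> real) \<Rightarrow>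
    real^'n^'n \<Rightarrow> real^'n^'n \<Rightarrow> real \<Rightarrow> ennreal" where
  "k_sup \<alpha> I F A q h =
     (SUP (s0, s1) \<in> {(s0, s1). s0 < s1 \<and> s1 - s0 \<le> h \<and> {s0<..<s1} \<subseteq> I}. k_const \<alpha> s0 s1 F A q)"

definition K_const :: "real \<Rightarrow> real set \<Rightarrow> (real \<Rightarrow> real^'n \<Rightarrow> real) \<Rightarrow>
    real^'n^'n \<Rightarrow> real^'n^'n \<Rightarrow> ennreal" where
  "K_const \<alpha> I F A q = Lim (at_right 0) (k_sup \<alpha> I F A q)"

text \<open>The limit defining \<open>K_const\<close> always exists, by monotonicity in \<open>h\<close>.\<close>

lemma k_sup_tendsto: "(k_sup \<alpha> I F A q \<longlongrightarrow> (INF h\<in>{0<..}. k_sup \<alpha> I F A q h)) (at_right 0)"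
proof (rule order_tendstoI)
  fix y assume "y < (INF h\<in>{0<..}. k_sup \<alpha> I F A q h)"
  then show "\<forall>\<^sub>F h in at_right 0. y < k_sup \<alpha> I F A q h"
    unfolding eventually_at_right_field
    by (intro exI[of _ 1]) (auto intro: less_le_trans INF_lower)
next
  fix y assume "(INF h\<in>{0<..}. k_sup \<alpha> I F A q h) < y"
  then obtain h0 where h0: "h0 > 0" "k_sup \<alpha> I F A q h0 < y"
    by (auto simp: INF_less_iff)
  have "k_sup \<alpha> I F A q h \<le> k_sup \<alpha> I F A q h0" if "h < h0" for h
    unfolding k_sup_def using that by (intro SUP_subset_mono) auto
  then show "\<forall>\<^sub>F h in at_right 0. k_sup \<alpha> I F A q h < y"
    unfolding eventually_at_right_field using h0
    by (intro exI[of _ h0]) (auto intro: le_less_trans)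
qed

lemma K_const_eq_INF: "K_const \<alpha> I F A q = (INF h\<in>{0<..}. k_sup \<alpha> I F A q h)"
  unfolding K_const_def by (rule tendsto_Lim[OF _ k_sup_tendsto]) simp

text \<open>The parabolic constant of the Dirac measure at the origin.\<close>

definition P_delta0 :: "real \<Rightarrow> real^'n^'n \<Rightarrow> real^'n^'n \<Rightarrow> real^'n^'n \<Rightarrow> ennreal" where
  "P_delta0 \<alpha> a A q = (SUP (c, B) \<in> {(c, B). 0 < c \<and> c < B}.
     k_const \<alpha> c B (\<lambda>\<tau> z. gauss (\<tau> *\<^sub>R a) z) A q)"

end

theory Submission
  imports Defs
begin

text \<open>
 The parabolic dilations \<open>(t, x) \<mapsto> (t / c\<^sup>2, x / c)\<close> leave the quotient of norms invariant, so every time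
 interval can be moved into \<open>(0, T)\<close> and made short; an interval that starts at \<open>0\<close> is exhausted from
 inside. This gives the equality of the two constants.

 The upper bound is proved by duality. For a test function \<open>G\<close> let \<open>\<Psi>\<close> be the heat potential of
 \<open>D\<^sub>i D\<^sub>j G\<close>, so that \<open>\<integral> D\<^sub>i D\<^sub>j u G = \<integral> P\<^sub>A u \<Psi>\<close>; no boundary term appears at the initial time because
 \<open>\<Psi>\<close> vanishes there, nor at the final time because the trace of \<open>u\<close> is zero. In the dual weight, the inverse of
 \<open>t\<^sup>\<alpha> \<gamma>\<^sub>t\<^sub>a\<close>, two energy inequalities and a Schur test for the lower-order term bound \<open>\<Psi>\<close> by \<open>G\<close>. Positivity of
 \<open>a - A\<close> makes the energy form coercive and makes the kernel decay faster than the dual weight grows.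

 If \<open>\<xi> \<bullet> (a - A) \<xi> \<le> 0\<close> for some \<open>\<xi> \<noteq> 0\<close>, then \<open>(2 - t) exp (\<lambda> \<xi> \<bullet> x - \<lambda>\<^sup>2 t \<xi> \<bullet> A \<xi>)\<close> on \<open>(1, 2)\<close> has a
 quotient of order \<open>\<lambda>\<^sup>2\<close>, so the constant is infinite.
\<close>

text \<open>Duality is forced by the weight: finite norms let \<open>u\<close> grow almost like
  \<open>exp (Q x / (4 t))\<close>, where \<open>Q\<close> is the quadratic form of the inverse of
  \<open>a\<close>, and \<open>u\<close> has only weak derivatives. An energy identity for
  \<open>u\<close> itself would have no control at infinity. The heat potential of a test function
  is smooth and decays like \<open>exp (- \<kappa> * Q x / t)\<close>, so the delicate integrations
  by parts are done there.

  The dual weight is \<open>t powr \<beta> * exp (Q x / (2 t))\<close> with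
  \<open>\<beta> = d/2 - \<alpha>\<close>. For positive \<open>\<beta>\<close> the energy inequality
  leaves a term with weight \<open>\<beta> - 1\<close> of the wrong sign; bounding it is the purpose
  of the Schur test.

  Every constant must be independent of the interval \<open>(c, B)\<close>, since a supremum over
  all intervals is taken. Hence two kinds of bounds: scale-invariant ones with explicit constants,
  and qualitative ones (\<open>decays\<close>, \<open>bnd\<close>), whose constants may depend on
  the interval and which only justify integrability and integration by parts.\<close>

abbreviation (input) nn_integral_lborel (binder "NN " 10) where
  "nn_integral_lborel f \<equiv> integral\<^sup>N lborel f"

abbreviation (input) integral_lborel (binder "LB " 10) where
  "integral_lborel f \<equiv> integral\<^sup>L lborel f"

section \<open>Smooth functions and cutoffs\<close>

definition dd :: "'a::euclidean_space \<Rightarrow> ('a \<Rightarrow> real) \<Rightarrow> 'a \<Rightarrow> real" where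
 "dd e f x = frechet_derivative f (at x) e"

definition smooth :: "('a::euclidean_space \<Rightarrow> real) \<Rightarrow> bool" where
 "smooth f \<longleftrightarrow> (\<forall>k. Ck k f)"

lemma Ck_Suc_iff: "Ck (Suc k) f \<longleftrightarrow> (\<forall>x. f differentiable (at x)) \<and> (\<forall>e. Ck k (dd e f))"
 by (simp add: dd_def[abs_def])

text \<open>Frechet derivatives are unique, so any known formula may stand for
  \<open>frechet_derivative\<close>. The smoothness proofs below induct through this rule.\<close>

lemma Ck_SucI:
 assumes "\<And>x. (f has_derivative f' x) (at x)" and "\<And>e. Ck k (\<lambda>x. f' x e)"
 shows "Ck (Suc k) f"
proof -
 have "dd e f = (\<lambda>x. f' x e)" for e
  using frechet_derivative_at[OF assms(1)] by (auto simp: dd_def fun_eq_iff)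
 then show ?thesis using assms by (auto simp: Ck_Suc_iff differentiable_def simp del: Ck.simps)
qed

lemma Ck_SucD: "Ck (Suc k) f \<Longrightarrow> Ck k f"
proof (induction k arbitrary: f)
 case 0
 then show ?case
  by (auto intro!: continuous_at_imp_continuous_on differentiable_imp_continuous_within)
next
 case (Suc k)
 from Suc.prems show ?case unfolding Ck_Suc_iff[of "Suc k"] Ck_Suc_iff[of k f] using Suc.IH by blast
qed

lemma has_derivative_dd: "f differentiable (at x) \<Longrightarrow> (f has_derivative (\<lambda>e. dd e f x)) (at x)"
 unfolding dd_def by (simp add: frechet_derivative_works)

lemma dd_eqI: "(f has_derivative f') (at x) \<Longrightarrow> dd e f x = f' e"
 using frechet_derivative_at[of f f' x] by (simp add: dd_def)

lemma Ck_const: "Ck k (\<lambda>_. c)"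
proof (induction k arbitrary: c)
 case (Suc k)
 show ?case by (rule Ck_SucI[of _ "\<lambda>x e. 0"]) (auto intro!: derivative_eq_intros Suc)
qed auto

lemma Ck_add: "Ck k f \<Longrightarrow> Ck k g \<Longrightarrow> Ck k (\<lambda>x. f x + g x)"
proof (induction k arbitrary: f g)
 case (Suc k)
 show ?case
  by (rule Ck_SucI[of _ "\<lambda>x e. dd e f x + dd e g x"])
   (use Suc in \<open>auto simp: Ck_Suc_iff simp del: Ck.simps intro!: derivative_intros has_derivative_dd\<close>)
qed (auto intro: continuous_intros)

lemma Ck_mult: "Ck k f \<Longrightarrow> Ck k g \<Longrightarrow> Ck k (\<lambda>x. f x * g x)"
proof (induction k arbitrary: f g)
 case (Suc k)
 have "Ck k f" "Ck k g" using Suc.prems by (auto dest: Ck_SucD simp del: Ck.simps)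
 with Suc show ?case
  by (intro Ck_SucI[of _ "\<lambda>x e. f x * dd e g x + dd e f x * g x"])
   (auto simp: Ck_Suc_iff simp del: Ck.simps intro!: has_derivative_mult has_derivative_dd Ck_add)
qed (auto intro: continuous_intros)

lemma Ck_bounded_linear: "bounded_linear f \<Longrightarrow> Ck k f"
proof (cases k)
 case (Suc m)
 assume f: "bounded_linear f"
 show ?thesis unfolding Suc
  by (rule Ck_SucI[of _ "\<lambda>x. f"]) (auto intro: Ck_const bounded_linear_imp_has_derivative f)
qed (auto intro: linear_continuous_on)

lemma Ck_compose_linear:
 assumes "bounded_linear D"
 shows "Ck k f \<Longrightarrow> Ck k (\<lambda>x. f (D x))"
proof (induction k arbitrary: f)
 case 0
 then show ?case
  using continuous_on_compose2[of UNIV f UNIV D] linear_continuous_on[OF assms] by auto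
next
 case (Suc k)
 show ?case
 proof (rule Ck_SucI[of _ "\<lambda>x e. dd (D e) f (D x)"])
  show "((\<lambda>x. f (D x)) has_derivative (\<lambda>e. dd (D e) f (D x))) (at x)" for x
   by (rule has_derivative_compose[OF bounded_linear_imp_has_derivative[OF assms] has_derivative_dd])
    (use Suc in \<open>auto simp: Ck_Suc_iff simp del: Ck.simps\<close>)
 qed (use Suc in \<open>auto simp: Ck_Suc_iff simp del: Ck.simps\<close>)
qed

text \<open>For an outer function of one real variable the chain rule is a single product, whose
  factor \<open>dd 1 f (g x)\<close> is again a composition with the same \<open>g\<close>, one
  order lower.\<close>

lemma Ck_compose_real:
 fixes f :: "real \<Rightarrow> real"
 shows "Ck k f \<Longrightarrow> Ck k g \<Longrightarrow> Ck k (\<lambda>x. f (g x))"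
proof (induction k arbitrary: f)
 case 0
 then show ?case
  using continuous_on_compose2[of UNIV f UNIV g] by auto
next
 case (Suc k)
 have g: "Ck k g" using Suc by (auto dest: Ck_SucD simp del: Ck.simps)
 show ?case
 proof (rule Ck_SucI[of _ "\<lambda>x e. dd e g x * dd 1 f (g x)"])
  fix x
  have f: "f differentiable (at (g x))" and dg: "g differentiable (at x)"
   using Suc by (auto simp: Ck_Suc_iff simp del: Ck.simps)
  have "linear (\<lambda>e. dd e f (g x))"
   using has_derivative_dd[OF f] by (simp add: has_derivative_linear)
  then have *: "dd e f (g x) = e * dd 1 f (g x)" for e
   using linear_scale[of "\<lambda>e. dd e f (g x)" e 1] by simp
  show "((\<lambda>x. f (g x)) has_derivative (\<lambda>e. dd e g x * dd 1 f (g x))) (at x)"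
   using has_derivative_compose[OF has_derivative_dd[OF dg] has_derivative_dd[OF f]]
   by (subst (asm) *)
  fix e show "Ck k (\<lambda>x. dd e g x * dd 1 f (g x))"
   using Suc g by (intro Ck_mult) (auto simp: Ck_Suc_iff simp del: Ck.simps)
 qed
qed

lemma Ck_inverse: "Ck k f \<Longrightarrow> (\<And>x. f x \<noteq> 0) \<Longrightarrow> Ck k (\<lambda>x. inverse (f x))"
proof (induction k)
 case (Suc k)
 have "Ck k f" using Suc by (auto dest: Ck_SucD simp del: Ck.simps)
 then have i: "Ck k (\<lambda>x. inverse (f x))" using Suc by auto
 show ?case
 proof (rule Ck_SucI[of _ "\<lambda>x e. (-1) * (inverse (f x) * dd e f x * inverse (f x))"])
  show "((\<lambda>x. inverse (f x)) has_derivative (\<lambda>e. (-1) * (inverse (f x) * dd e f x * inverse (f x)))) (at x)" for x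
   using Deriv.has_derivative_inverse[OF Suc.prems(2) has_derivative_dd[of f x]] Suc.prems(1)
   by (auto simp: Ck_Suc_iff simp del: Ck.simps)
 qed (intro Ck_mult Ck_const i, use Suc in \<open>auto simp: Ck_Suc_iff simp del: Ck.simps\<close>)
qed (auto intro: continuous_intros)

lemma smooth_const [intro]: "smooth (\<lambda>_. c)"
 and smooth_add [intro]: "smooth f \<Longrightarrow> smooth g \<Longrightarrow> smooth (\<lambda>x. f x + g x)"
 and smooth_mult [intro]: "smooth f \<Longrightarrow> smooth g \<Longrightarrow> smooth (\<lambda>x. f x * g x)"
 and smooth_linear: "bounded_linear l \<Longrightarrow> smooth l"
 and smooth_compose_linear: "smooth f \<Longrightarrow> bounded_linear D \<Longrightarrow> smooth (\<lambda>x. f (D x))"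
 and smooth_compose_real: "smooth \<psi> \<Longrightarrow> smooth f \<Longrightarrow> smooth (\<lambda>x. \<psi> (f x))"
 and smooth_inverse: "smooth f \<Longrightarrow> (\<And>x. f x \<noteq> 0) \<Longrightarrow> smooth (\<lambda>x. inverse (f x))"
 by (auto simp: smooth_def intro: Ck_const Ck_add Ck_mult Ck_bounded_linear Ck_compose_linear
   Ck_compose_real Ck_inverse)

lemma smooth_diff: "smooth f \<Longrightarrow> smooth g \<Longrightarrow> smooth (\<lambda>x. f x - g x)"
 using smooth_add[OF _ smooth_mult[OF smooth_const[of "-1"]], of f g] by simp

lemma smooth_sum: "(\<And>i. i \<in> I \<Longrightarrow> smooth (f i)) \<Longrightarrow> smooth (\<lambda>x. \<Sum>i\<in>I. f i x)"
 by (induction I rule: infinite_finite_induct) auto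

lemma smooth_dd [intro]: "smooth f \<Longrightarrow> smooth (dd e f)"
 unfolding smooth_def using Ck_Suc_iff by blast

lemma smooth_differentiable: "smooth f \<Longrightarrow> f differentiable (at x)"
 unfolding smooth_def using Ck_Suc_iff by blast

lemma smooth_has_derivative: "smooth f \<Longrightarrow> (f has_derivative (\<lambda>e. dd e f x)) (at x)"
 by (simp add: smooth_differentiable has_derivative_dd)

lemma smooth_continuous_on: "smooth f \<Longrightarrow> continuous_on S f"
 unfolding smooth_def using Ck.simps(1) continuous_on_subset by blast

lemma smooth_measurable: "smooth f \<Longrightarrow> f \<in> borel_measurable borel"
 by (intro borel_measurable_continuous_onI smooth_continuous_on)

lemma smooth_linear_dd: "smooth f \<Longrightarrow> linear (\<lambda>e. dd e f x)"
 using smooth_has_derivative by (blast intro: has_derivative_linear)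

lemma dd_mult: "smooth f \<Longrightarrow> smooth g \<Longrightarrow> dd e (\<lambda>x. f x * g x) = (\<lambda>x. f x * dd e g x + dd e f x * g x)"
 by (rule ext, rule dd_eqI, rule has_derivative_mult) (auto intro: smooth_has_derivative)

lemma dd_add: "smooth f \<Longrightarrow> smooth g \<Longrightarrow> dd e (\<lambda>x. f x + g x) = (\<lambda>x. dd e f x + dd e g x)"
 by (rule ext, rule dd_eqI, rule has_derivative_add) (auto intro: smooth_has_derivative)

lemma dd_const: "dd e (\<lambda>_. c) = (\<lambda>_. 0)"
 by (rule ext, rule dd_eqI) auto

lemma smooth_polynomial: "real_polynomial_function p \<Longrightarrow> smooth p"
 by (induction rule: real_polynomial_function.induct) (auto intro: smooth_linear)

section \<open>The exponential, flat functions and a smooth step\<close>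

lemma smooth_exp: "smooth (exp :: real \<Rightarrow> real)"
proof -
 have "Ck k (\<lambda>x::real. c * exp x)" for k c
 proof (induction k arbitrary: c)
  case (Suc k)
  have *: "(\<lambda>x. e * c * exp x) = (\<lambda>x. (c * e) * exp x)" for e :: real
   by auto
  show ?case
   by (rule Ck_SucI[of _ "\<lambda>x e. (c * e) * exp x"]) (auto intro!: derivative_eq_intros Suc)
 qed (auto intro!: continuous_intros)
 from this[of _ 1] show ?thesis by (simp add: smooth_def)
qed

text \<open>The flat function \<open>exp (-1/x)\<close> is carried together with a polynomial factor
  in \<open>1/x\<close> because this family is closed under differentiation: one induction over the
  order covers all of it. The case \<open>p = 1\<close> is the classical flat function.\<close>

definition flat_poly :: "real poly \<Rightarrow> real \<Rightarrow> real" where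
 "flat_poly p x = (if x > 0 then poly p (1/x) * exp (-1/x) else 0)"

lemma flat_poly_tendsto: "((\<lambda>x::real. poly p (1/x) * exp (-1/x)) \<longlongrightarrow> 0) (at_right 0)"
proof -
 have 1: "((\<lambda>y::real. y ^ k * exp (-y)) \<longlongrightarrow> 0) at_top" for k
  using tendsto_power_div_exp_0[of k] by (simp add: exp_minus divide_inverse)
 have "((\<lambda>y. \<Sum>i\<le>degree p. coeff p i * (y ^ i * exp (-y))) \<longlongrightarrow> (\<Sum>i\<le>degree p. coeff p i * 0)) at_top"
  by (intro tendsto_sum tendsto_mult_left 1)
 then have "((\<lambda>y. poly p y * exp (-y)) \<longlongrightarrow> 0) at_top"
  by (simp add: poly_altdef sum_distrib_right mult.assoc)
 from filterlim_compose[OF this filterlim_inverse_at_top_right]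
 show ?thesis by (simp add: inverse_eq_divide)
qed

lemma flat_poly_has_real_derivative:
 "(flat_poly p has_real_derivative flat_poly ([:0,0,1:] * (p - pderiv p)) x) (at x)"
proof -
 consider "x > 0" | "x < 0" | "x = 0" by linarith
 then show ?thesis
 proof cases
  case 1
  have "((\<lambda>x. poly p (1/x) * exp (-1/x)) has_real_derivative
    flat_poly ([:0,0,1:] * (p - pderiv p)) x) (at x)"
   using 1 by (auto intro!: derivative_eq_intros DERIV_chain2[OF poly_DERIV]
     simp: flat_poly_def field_simps power2_eq_square)
  then show ?thesis
   by (rule has_field_derivative_transform_within_open[of _ _ _ "{0<..}"])
    (use 1 in \<open>auto simp: flat_poly_def\<close>)
 next
  case 2
  have "((\<lambda>x. 0) has_real_derivative flat_poly ([:0,0,1:] * (p - pderiv p)) x) (at x)"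
   using 2 by (auto simp: flat_poly_def)
  then show ?thesis
   by (rule has_field_derivative_transform_within_open[of _ _ _ "{..<0}"])
    (use 2 in \<open>auto simp: flat_poly_def\<close>)
 next
  case 3
  have "((\<lambda>h. flat_poly p h / h) \<longlongrightarrow> 0) (at 0)"
  proof (rule filterlim_split_at)
   show "((\<lambda>h. flat_poly p h / h) \<longlongrightarrow> 0) (at_left 0)"
    by (rule tendsto_eventually) (auto simp: flat_poly_def eventually_at_filter)
   \<comment> \<open>The difference quotient at 0 belongs to the same family, with the polynomial
     multiplied by its variable.\<close>
   show "((\<lambda>h. flat_poly p h / h) \<longlongrightarrow> 0) (at_right 0)"
    by (rule Lim_transform_eventually[OF flat_poly_tendsto[of "[:0,1:] * p"]])
     (auto simp: flat_poly_def eventually_at_filter)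
  qed
  then show ?thesis using 3 by (simp add: DERIV_def flat_poly_def)
 qed
qed

lemma smooth_flat_poly: "smooth (flat_poly p)"
proof -
 have "Ck k (flat_poly p)" for k
 proof (induction k arbitrary: p)
  case 0
  show ?case
   using DERIV_isCont[OF flat_poly_has_real_derivative] by (auto intro: continuous_at_imp_continuous_on)
 next
  case (Suc k)
  show ?case
   by (rule Ck_SucI[OF flat_poly_has_real_derivative[unfolded has_field_derivative_def]])
    (intro Ck_mult Suc Ck_const)
 qed
 then show ?thesis by (simp add: smooth_def)
qed

text \<open>The usual smooth transition from 0 on the left of 0 to 1 on the right of 1. All cutoffs
  in space and time are made from it.\<close>

definition sstep :: "real \<Rightarrow> real" where
 "sstep x = flat_poly 1 x * inverse (flat_poly 1 x + flat_poly 1 (1 - x))"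

lemma flat_one: "flat_poly 1 x = (if x > 0 then exp (-1/x) else 0)"
 by (simp add: flat_poly_def)

lemma flat_one_sum_pos: "flat_poly 1 x + flat_poly 1 (1 - x) > 0"
 by (simp add: flat_one add_pos_pos)

lemma smooth_sstep: "smooth sstep"
proof -
 have "smooth (\<lambda>x::real. 1 - x)"
  by (intro smooth_diff smooth_const smooth_linear bounded_linear_ident)
 moreover have "flat_poly 1 x + flat_poly 1 (1 - x) \<noteq> 0" for x
  using flat_one_sum_pos[of x] by simp
 ultimately show ?thesis
  unfolding sstep_def[abs_def]
  by (intro smooth_mult smooth_inverse smooth_add smooth_flat_poly smooth_compose_real[of "flat_poly 1"])
qed

lemma sstep_le_0: "x \<le> 0 \<Longrightarrow> sstep x = 0"
 and sstep_ge_1: "x \<ge> 1 \<Longrightarrow> sstep x = 1"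
 and sstep_nonneg: "0 \<le> sstep x"
 and sstep_le_1: "sstep x \<le> 1"
proof -
 have "sstep x = flat_poly 1 x / (flat_poly 1 x + flat_poly 1 (1 - x))"
  unfolding sstep_def divide_inverse ..
 moreover have "flat_poly 1 x \<ge> 0" "flat_poly 1 (1 - x) \<ge> 0"
  by (simp_all add: flat_one)
 ultimately show "0 \<le> sstep x" "sstep x \<le> 1"
  using flat_one_sum_pos[of x] by (simp_all add: divide_le_eq_1)
 show "x \<le> 0 \<Longrightarrow> sstep x = 0" "x \<ge> 1 \<Longrightarrow> sstep x = 1"
  by (auto simp: sstep_def flat_one)
qed

section \<open>Integration by parts\<close>

lemma lborel_translate:
 fixes f :: "'a::euclidean_space \<Rightarrow> 'b::{banach,second_countable_topology}"
 assumes "f \<in> borel_measurable borel"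
 shows "(LB x. f (x + c)) = (LB x. f x)"
  and "integrable lborel (\<lambda>x. f (x + c)) \<longleftrightarrow> integrable lborel f"
proof -
 have d: "distr lborel borel ((+) c) = (lborel :: 'a measure)" by (rule lborel_distr_plus)
 have "(\<integral>x. f x \<partial>distr lborel borel ((+) c)) = (LB x. f (c + x))"
  using assms by (intro integral_distr) auto
 then show "(LB x. f (x + c)) = (LB x. f x)" by (simp add: d add.commute)
 have "integrable (distr lborel borel ((+) c)) f \<longleftrightarrow> integrable lborel (\<lambda>x. f (c + x))"
  using assms by (intro integrable_distr_eq) auto
 then show "integrable lborel (\<lambda>x. f (x + c)) \<longleftrightarrow> integrable lborel f"
  by (simp add: d add.commute)
qed

lemma nn_integral_lborel_translate:
 fixes f :: "'a::euclidean_space \<Rightarrow> ennreal"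
 assumes "f \<in> borel_measurable borel"
 shows "(NN x. f (x + c)) = (NN x. f x)"
proof -
 have d: "distr lborel borel ((+) c) = (lborel :: 'a measure)" by (rule lborel_distr_plus)
 have "(\<integral>\<^sup>+x. f x \<partial>distr lborel borel ((+) c)) = (NN x. f (c + x))"
  using assms by (intro nn_integral_distr) auto
 then show ?thesis by (simp add: d add.commute)
qed

text \<open>Integrate \<open>F (x + e) - F x = \<integral>\<^sub>0\<^sup>1 F' (x + s e) e ds\<close> over \<open>x\<close> and use translation invariance.\<close>

lemma integral_derivative_eq_0:
 fixes F :: "'a::euclidean_space \<Rightarrow> real"
 assumes der: "\<And>x. (F has_derivative F' x) (at x)"
  and F: "integrable lborel F" and F': "integrable lborel (\<lambda>x. F' x e)"
  and cont: "continuous_on UNIV (\<lambda>x. F' x e)"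
 shows "(LB x. F' x e) = 0"
proof -
 define g where "g x = F' x e" for x
 have cg: "continuous_on UNIV g" using cont by (simp add: g_def[abs_def])
 have mg: "g \<in> borel_measurable borel" using cg by (rule borel_measurable_continuous_onI)
 have mF: "F \<in> borel_measurable borel" using F by auto
 have ftc: "(LB s. g (x + s *\<^sub>R e) * indicator {0..1} s) = F (x + e) - F x" for x
 proof -
  have "(LB s. g (x + s *\<^sub>R e) * indicator {0..1} s) = F (x + 1 *\<^sub>R e) - F (x + 0 *\<^sub>R e)"
  proof (rule integral_FTC_Icc_real)
   fix s :: real
   have "((\<lambda>s. F (x + s *\<^sub>R e)) has_derivative (\<lambda>h. F' (x + s *\<^sub>R e) (h *\<^sub>R e))) (at s)"
    by (rule has_derivative_compose[OF _ der]) (auto intro!: derivative_eq_intros)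
   then show "((\<lambda>s. F (x + s *\<^sub>R e)) has_real_derivative g (x + s *\<^sub>R e)) (at s)"
    using linear_scale[OF has_derivative_linear[OF der]]
    by (simp add: has_field_derivative_def g_def mult.commute[of _ "F' _ _"] del: scaleR_conv_of_real)
   show "isCont (\<lambda>s. g (x + s *\<^sub>R e)) s"
    using cg by (intro isCont_o2[OF _ _ , of s _ g]) (auto intro!: continuous_intros simp: continuous_on_eq_continuous_at)
  qed auto
  then show ?thesis by simp
 qed
 \<comment> \<open>Joint integrability: by translation invariance the integral of
   \<open>norm g\<close> over a slice does not depend on \<open>s\<close>, and \<open>s\<close>
   ranges over a bounded interval.\<close>
 have int: "integrable (lborel \<Otimes>\<^sub>M lborel) (\<lambda>(s, x). g (x + s *\<^sub>R e) * indicator {0..1::real} s)"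
 proof (rule lborel_pair.Fubini_integrable)
  have "continuous_on UNIV (\<lambda>(s::real, x). g (x + s *\<^sub>R e))"
   using cg by (auto simp: split_beta' intro!: continuous_on_compose2[OF cg] continuous_intros)
  then have "(\<lambda>(s::real, x). g (x + s *\<^sub>R e)) \<in> borel_measurable (borel \<Otimes>\<^sub>M borel)"
   by (simp add: borel_prod borel_measurable_continuous_onI)
  then show "(\<lambda>(s, x). g (x + s *\<^sub>R e) * indicator {0..1::real} s) \<in> borel_measurable (lborel \<Otimes>\<^sub>M lborel)"
   by (simp add: split_beta')
  have "(LB x. norm (g (x + s *\<^sub>R e) * indicator {0..1} s)) = (LB x. norm (g x)) * indicator {0..1} s" for s :: real
   using lborel_translate(1)[of "\<lambda>x. norm (g x)" "s *\<^sub>R e"] mg by (simp add: abs_mult)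
  then show "integrable lborel (\<lambda>s. LB x. norm (case (s, x) of (s, x) \<Rightarrow> g (x + s *\<^sub>R e) * indicator {0..1::real} s))"
   by simp
  show "AE s in lborel. integrable lborel (\<lambda>x. case (s, x) of (s, x) \<Rightarrow> g (x + s *\<^sub>R e) * indicator {0..1::real} s)"
   using F' lborel_translate(2)[OF mg] by (auto simp: g_def[abs_def])
 qed
 have "0 = (LB x. F (x + e) - F x)"
  using F lborel_translate[OF mF, of e] by (simp add: Bochner_Integration.integral_diff)
 also have "\<dots> = (LB x. (LB s. g (x + s *\<^sub>R e) * indicator {0..1} s))"
  by (simp add: ftc)
 also have "\<dots> = (LB s. (LB x. g (x + s *\<^sub>R e) * indicator {0..1::real} s))"
  by (rule lborel_pair.Fubini_integral[OF int])
 also have "\<dots> = (LB s. (LB x. g x) * indicator {0..1::real} s)"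
  by (simp add: lborel_translate(1)[OF mg])
 also have "\<dots> = (LB x. g x)" by simp
 finally show ?thesis by (simp add: g_def)
qed

section \<open>Test functions\<close>

lemma test_smooth: "\<phi> \<in> test_functions \<Omega> \<Longrightarrow> smooth \<phi>"
 by (simp add: test_functions_def smooth_def)

lemma test_functionsI:
 assumes "smooth \<phi>" "compact K" "K \<subseteq> \<Omega>" "\<And>x. x \<notin> K \<Longrightarrow> \<phi> x = 0"
 shows "\<phi> \<in> test_functions \<Omega>"
proof -
 have "closure {x. \<phi> x \<noteq> 0} \<subseteq> K"
  using assms by (intro closure_minimal) (auto simp: compact_imp_closed)
 then show ?thesis using assms compact_Int_closed[OF assms(2) closed_closure, of "{x. \<phi> x \<noteq> 0}"]
  by (auto simp: test_functions_def smooth_def Int_absorb1)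
qed

text \<open>The support is closed, so around a point outside it the function vanishes on a
  neighbourhood. One compact set therefore serves the function and its derivatives.\<close>

lemma test_functionsE:
 assumes "\<phi> \<in> test_functions \<Omega>"
 obtains K where "compact K" "K \<subseteq> \<Omega>" "\<And>x. x \<notin> K \<Longrightarrow> \<phi> x = 0" "\<And>x e. x \<notin> K \<Longrightarrow> dd e \<phi> x = 0"
proof -
 let ?K = "closure {x. \<phi> x \<noteq> 0}"
 have "dd e \<phi> x = 0" if "x \<notin> ?K" for x e
 proof -
  have "(\<phi> has_derivative (\<lambda>_. 0)) (at x)"
   by (rule has_derivative_transform_within_open[of "\<lambda>_. 0" _ _ _ "- ?K"])
    (use that closure_subset[of "{x. \<phi> x \<noteq> 0}"] in auto)
  then show ?thesis by (rule dd_eqI)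
 qed
 then show ?thesis
  using assms closure_subset[of "{x. \<phi> x \<noteq> 0}"] by (intro that[of ?K]) (auto simp: test_functions_def)
qed

lemma test_dd: "\<phi> \<in> test_functions \<Omega> \<Longrightarrow> dd e \<phi> \<in> test_functions \<Omega>"
 by (metis smooth_dd test_functionsE test_functionsI test_smooth)

lemma test_mult: "\<phi> \<in> test_functions \<Omega> \<Longrightarrow> smooth f \<Longrightarrow> (\<lambda>x. f x * \<phi> x) \<in> test_functions \<Omega>"
 by (rule test_functionsE[of \<phi> \<Omega>]) (auto intro!: test_functionsI dest: test_smooth)

lemma test_add:
 assumes "\<phi> \<in> test_functions \<Omega>" "\<psi> \<in> test_functions \<Omega>"
 shows "(\<lambda>x. \<phi> x + \<psi> x) \<in> test_functions \<Omega>"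
proof -
 obtain K1 where K1: "compact K1" "K1 \<subseteq> \<Omega>" "\<And>x. x \<notin> K1 \<Longrightarrow> \<phi> x = 0"
  using assms(1) by (auto elim!: test_functionsE)
 obtain K2 where K2: "compact K2" "K2 \<subseteq> \<Omega>" "\<And>x. x \<notin> K2 \<Longrightarrow> \<psi> x = 0"
  using assms(2) by (auto elim!: test_functionsE)
 show ?thesis
  by (rule test_functionsI[of _ "K1 \<union> K2"]) (use assms K1 K2 in \<open>auto intro: test_smooth\<close>)
qed

lemma test_sum: "(\<And>i. i \<in> I \<Longrightarrow> f i \<in> test_functions \<Omega>) \<Longrightarrow> (\<lambda>x. \<Sum>i\<in>I. f i x) \<in> test_functions \<Omega>"
proof (induction I rule: infinite_finite_induct)
 case (insert i I)
 then show ?case using test_add[of "f i" \<Omega> "\<lambda>x. \<Sum>i\<in>I. f i x"] by simp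
qed (auto intro: test_functionsI[of _ "{}"])

lemma test_mono: "\<phi> \<in> test_functions \<Omega> \<Longrightarrow> \<Omega> \<subseteq> \<Omega>' \<Longrightarrow> \<phi> \<in> test_functions \<Omega>'"
 by (auto simp: test_functions_def)

lemma test_zero_outside: "\<phi> \<in> test_functions \<Omega> \<Longrightarrow> x \<notin> \<Omega> \<Longrightarrow> \<phi> x = 0"
 by (metis subsetD test_functionsE)

lemma test_bounded:
 assumes "\<phi> \<in> test_functions \<Omega>"
 obtains M where "M > 0" "\<And>x. \<bar>\<phi> x\<bar> \<le> M"
proof -
 obtain K where K: "compact K" "\<And>x. x \<notin> K \<Longrightarrow> \<phi> x = 0"
  using assms by (auto elim!: test_functionsE)
 have "bounded (\<phi> ` K)"
  by (intro compact_imp_bounded compact_continuous_image smooth_continuous_on test_smooth[OF assms] K)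
 then obtain M where "M > 0" "\<And>x. x \<in> K \<Longrightarrow> \<bar>\<phi> x\<bar> \<le> M" by (auto simp: bounded_pos)
 with K(2) show ?thesis by (intro that[of M]) (auto, metis abs_0 less_imp_le)
qed

lemma integrable_compact_support:
 fixes f :: "'a::euclidean_space \<Rightarrow> real"
 assumes "continuous_on UNIV f" "compact K" "\<And>x. x \<notin> K \<Longrightarrow> f x = 0"
 shows "integrable lborel f"
proof -
 have "integrable lborel (\<lambda>x. indicator K x *\<^sub>R f x)"
  using borel_integrable_compact[OF assms(2) continuous_on_subset[OF assms(1)]]
  by (simp add: indicator_def if_distrib mult.commute cong: if_cong)
 also have "(\<lambda>x. indicator K x *\<^sub>R f x) = f" using assms(3) by (auto simp: indicator_def fun_eq_iff)
 finally show ?thesis .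
qed

lemma test_integrable: "\<phi> \<in> test_functions \<Omega> \<Longrightarrow> integrable lborel \<phi>"
 by (rule test_functionsE[of \<phi> \<Omega>]) (auto intro!: integrable_compact_support smooth_continuous_on test_smooth)

lemma integral_test_dd: "\<phi> \<in> test_functions \<Omega> \<Longrightarrow> (LB x. dd e \<phi> x) = 0"
 by (rule integral_derivative_eq_0[of \<phi> "\<lambda>x e. dd e \<phi> x"])
  (auto intro!: smooth_has_derivative test_integrable smooth_continuous_on dest: test_smooth test_dd)

lemma set_integral_test:
 "\<phi> \<in> test_functions \<Omega> \<Longrightarrow> (LINT x:\<Omega>|lborel. u x * \<phi> x) = (LINT x|lborel. u x * \<phi> x)"
 unfolding set_lebesgue_integral_def
 by (rule Bochner_Integration.integral_cong) (auto simp: indicator_def dest: test_zero_outside)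

lemma weak_derivD:
 assumes "weak_deriv \<Omega> e u v" "\<phi> \<in> test_functions \<Omega>"
 shows "(LINT x|lborel. u x * dd e \<phi> x) = - (LINT x|lborel. v x * \<phi> x)"
 using assms set_integral_test[OF assms(2), of v] set_integral_test[OF test_dd[OF assms(2)], of u e]
 by (simp add: weak_deriv_def dd_def)

lemma weak_derivI:
 assumes "locally_integrable \<Omega> u" "locally_integrable \<Omega> v"
  "\<And>\<phi>. \<phi> \<in> test_functions \<Omega> \<Longrightarrow> (LINT x|lborel. u x * dd e \<phi> x) = - (LINT x|lborel. v x * \<phi> x)"
 shows "weak_deriv \<Omega> e u v"
 unfolding weak_deriv_def dd_def[symmetric]
 using assms set_integral_test[of _ \<Omega>] test_dd[of _ \<Omega>] by auto

lemma locally_integrable_continuous: "continuous_on UNIV u \<Longrightarrow> locally_integrable \<Omega> u"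
 unfolding locally_integrable_def set_integrable_def
 using borel_integrable_compact[OF _ continuous_on_subset, of _ UNIV u]
 by (auto simp: indicator_def if_distrib mult.commute cong: if_cong)

lemma weak_deriv_smooth:
 assumes "smooth u" shows "weak_deriv \<Omega> e u (dd e u)"
proof (rule weak_derivI)
 fix \<phi> assume t: "\<phi> \<in> test_functions \<Omega>"
 have "0 = (LINT x|lborel. dd e (\<lambda>x. u x * \<phi> x) x)"
  by (rule integral_test_dd[OF test_mult[OF t assms], symmetric])
 also have "\<dots> = (LINT x|lborel. u x * dd e \<phi> x + dd e u x * \<phi> x)"
  by (simp add: dd_mult assms test_smooth[OF t])
 also have "\<dots> = (LINT x|lborel. u x * dd e \<phi> x) + (LINT x|lborel. dd e u x * \<phi> x)"
  by (rule Bochner_Integration.integral_add)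
   (auto intro!: test_integrable[of _ \<Omega>] test_mult test_dd t assms)
 finally show "(LINT x|lborel. u x * dd e \<phi> x) = - (LINT x|lborel. dd e u x * \<phi> x)" by simp
qed (auto intro!: locally_integrable_continuous smooth_continuous_on assms)

lemma integrable_mult_test:
 assumes u: "locally_integrable \<Omega> u" and t: "\<phi> \<in> test_functions \<Omega>"
 shows "integrable lborel (\<lambda>x. u x * \<phi> x)"
proof -
 obtain K where K: "compact K" "K \<subseteq> \<Omega>" "\<And>x. x \<notin> K \<Longrightarrow> \<phi> x = 0" using t by (auto elim!: test_functionsE)
 obtain M where M: "\<And>x. \<bar>\<phi> x\<bar> \<le> M" using test_bounded[OF t] by blast
 have i: "integrable lborel (\<lambda>x. indicator K x *\<^sub>R u x)"
  using u K by (auto simp: locally_integrable_def set_integrable_def)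
 have m: "\<phi> \<in> borel_measurable borel" by (rule smooth_measurable[OF test_smooth[OF t]])
 \<comment> \<open>\<open>u\<close> may be arbitrary outside \<open>\<Omega>\<close>; measurability
   is available only for its restriction to \<open>K\<close>.\<close>
 have eq: "(\<lambda>x. u x * \<phi> x) = (\<lambda>x. (indicator K x *\<^sub>R u x) * \<phi> x)"
  using K(3) by (auto simp: indicator_def fun_eq_iff)
 show ?thesis unfolding eq
 proof (rule Bochner_Integration.integrable_bound)
  show "integrable lborel (\<lambda>x. M * (indicator K x *\<^sub>R u x))" using i by simp
  show "(\<lambda>x. (indicator K x *\<^sub>R u x) * \<phi> x) \<in> borel_measurable lborel"
   using borel_measurable_integrable[OF i] m by simp
  have "M \<ge> 0" using M[of undefined] by (meson abs_ge_zero order_trans)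
  then show "AE x in lborel. norm ((indicator K x *\<^sub>R u x) * \<phi> x) \<le> norm (M * (indicator K x *\<^sub>R u x))"
   using M by (auto simp: abs_mult mult.commute[of M] intro!: mult_left_mono)
 qed
qed

section \<open>Symmetric matrices\<close>

lemma symmetric_inner: "transpose (M::real^'n^'n) = M \<Longrightarrow> x \<bullet> (M *v y) = (M *v x) \<bullet> y"
 by (metis dot_lmul_matrix transpose_matrix_vector)

lemma posdef_symmetric_inner: "posdef M \<Longrightarrow> x \<bullet> (M *v y) = (M *v x) \<bullet> y"
 by (simp add: posdef_def symmetric_inner)

text \<open>The quadratic form attains its minimum on the unit sphere of \<open>S\<close>. There the
  residual \<open>z = M *v x - l *\<^sub>R x\<close> must vanish, since a small step against
  \<open>z\<close> would lower the quotient at first order; invariance of \<open>S\<close> makes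
  this step admissible.\<close>

lemma Rayleigh_minimum:
 fixes M :: "real^'n^'n"
 assumes sym: "transpose M = M" and S: "subspace S" "\<And>x. x \<in> S \<Longrightarrow> M *v x \<in> S"
  and ne: "y0 \<in> S" "y0 \<noteq> 0"
 obtains x l where "x \<in> S" "norm x = 1" "M *v x = l *\<^sub>R x" "\<And>y. y \<in> S \<Longrightarrow> l * (y \<bullet> y) \<le> y \<bullet> (M *v y)"
proof -
 let ?f = "\<lambda>x. x \<bullet> (M *v x)"
 have "compact (S \<inter> sphere 0 1)"
  by (simp add: closed_Int_compact closed_subspace S)
 moreover have "(1 / norm y0) *\<^sub>R y0 \<in> S \<inter> sphere 0 1"
  using ne S by (auto simp: subspace_scale)
 moreover have "continuous_on (S \<inter> sphere 0 1) ?f"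
  by (intro continuous_intros linear_continuous_on_compose[OF continuous_on_id] matrix_vector_mul_linear)
 ultimately obtain x where x: "x \<in> S" "norm x = 1" and min: "\<And>y. y \<in> S \<Longrightarrow> norm y = 1 \<Longrightarrow> ?f x \<le> ?f y"
  using continuous_attains_inf[of "S \<inter> sphere 0 1" ?f] by fastforce
 define l where "l = ?f x"
 have ray: "l * (y \<bullet> y) \<le> ?f y" if "y \<in> S" for y
 proof (cases "y = 0")
  case False
  have "l \<le> ?f ((1 / norm y) *\<^sub>R y)"
   unfolding l_def using False that S by (intro min) (auto simp: subspace_scale)
  also have "\<dots> = ?f y / (y \<bullet> y)"
   by (simp add: matrix_vector_mult_scaleR dot_square_norm power2_eq_square)
  finally show ?thesis using False by (simp add: field_simps)
 qed simp
 define z where "z = M *v x - l *\<^sub>R x"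
 have z: "z \<in> S" using x S by (simp add: z_def subspace_diff subspace_scale)
 define G where "G = ?f z - l * (z \<bullet> z)"
 have G0: "G \<ge> 0" using ray[OF z] by (simp add: G_def)
 have quad: "2 * t * (z \<bullet> z) + t\<^sup>2 * G \<ge> 0" for t
 proof -
  have "?f (x + t *\<^sub>R z) - l * ((x + t *\<^sub>R z) \<bullet> (x + t *\<^sub>R z))
   = (?f x - l * (x \<bullet> x)) + 2 * t * (z \<bullet> (M *v x) - l * (z \<bullet> x)) + t\<^sup>2 * G"
   using symmetric_inner[OF sym, of x z]
   by (simp add: G_def algebra_simps matrix_vector_right_distrib matrix_vector_mult_scaleR inner_commute power2_eq_square)
  moreover have "?f x - l * (x \<bullet> x) = 0" using x(2) by (simp add: l_def dot_square_norm)
  moreover have "z \<bullet> (M *v x) - l * (z \<bullet> x) = z \<bullet> z" by (simp add: z_def inner_diff_right)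
  ultimately show ?thesis using ray[of "x + t *\<^sub>R z"] x z S by (simp add: subspace_add subspace_scale)
 qed
 have "z \<bullet> z = 0"
 proof (rule ccontr)
  assume "z \<bullet> z \<noteq> 0"
  then have p: "z \<bullet> z > 0" by simp
  \<comment> \<open>Every step with \<open>t * G < 2 * (z \<bullet> z)\<close> contradicts
    \<open>quad\<close> at \<open>- t\<close>; the denominator \<open>G + 1\<close> also covers
    \<open>G = 0\<close>.\<close>
  define t where "t = (z \<bullet> z) / (G + 1)"
  have t: "t > 0" "z \<bullet> z = t * (G + 1)" using p G0 by (auto simp: t_def)
  have "2 * (- t) * (z \<bullet> z) + (- t)\<^sup>2 * G = - (t\<^sup>2 * (G + 2))"
   unfolding t(2) by (simp add: algebra_simps power2_eq_square)
  moreover have "t\<^sup>2 * (G + 2) > 0" using t G0 by simp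
  ultimately show False using quad[of "- t"] by linarith
 qed
 then have "M *v x = l *\<^sub>R x" by (simp add: z_def)
 with x ray show ?thesis by (intro that) auto
qed

text \<open>Induction on the dimension: a Rayleigh minimiser is split off, and by symmetry of
  \<open>M\<close> its orthogonal complement inside \<open>S\<close> is again invariant.\<close>

lemma spectral_theorem_subspace:
 fixes M :: "real^'n^'n"
 assumes sym: "transpose M = M"
 shows "subspace S \<Longrightarrow> (\<And>x. x \<in> S \<Longrightarrow> M *v x \<in> S) \<Longrightarrow>
  \<exists>B. B \<subseteq> S \<and> finite B \<and> pairwise orthogonal B \<and> span B = S \<and> (\<forall>b\<in>B. norm b = 1 \<and> (\<exists>l. M *v b = l *\<^sub>R b))"
proof (induction "dim S" arbitrary: S rule: less_induct)
 case less
 show ?case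
 proof (cases "S = {0}")
  case True
  then show ?thesis by (intro exI[of _ "{}"]) auto
 next
  case False
  then obtain y0 where "y0 \<in> S" "y0 \<noteq> 0" using subspace_0[OF less.prems(1)] by blast
  from Rayleigh_minimum[OF sym less.prems this] obtain x l
   where x: "x \<in> S" "norm x = 1" "M *v x = l *\<^sub>R x" by metis
  define S' where "S' = S \<inter> {y. x \<bullet> y = 0}"
  have S': "subspace S'"
   unfolding S'_def by (intro subspace_inter less.prems(1) subspace_hyperplane)
  have inv: "M *v y \<in> S'" if "y \<in> S'" for y
   using that less.prems(2) x symmetric_inner[OF sym, of x y] by (auto simp: S'_def)
  have "x \<notin> S'" using x by (auto simp: S'_def dot_square_norm)
  then have "S' \<subset> S" using x(1) by (auto simp only: S'_def)
  then have "dim S' < dim S"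
   using dim_psubset[of S' S] S' less.prems(1) by (simp add: span_eq_iff[THEN iffD2])
  from less.hyps[OF this S' inv] obtain B where B: "B \<subseteq> S'" "finite B" "pairwise orthogonal B" "span B = S'"
   "\<forall>b\<in>B. norm b = 1 \<and> (\<exists>l. M *v b = l *\<^sub>R b)" by blast
  have "span (insert x B) = S"
  proof
   show "span (insert x B) \<subseteq> S"
    using B x less.prems(1) by (intro span_minimal) (auto simp: S'_def)
   show "S \<subseteq> span (insert x B)"
   proof
    fix y assume "y \<in> S"
    then have "y - (x \<bullet> y) *\<^sub>R x \<in> S'"
     using x less.prems(1) by (auto simp: S'_def subspace_diff subspace_scale inner_diff_right dot_square_norm)
    then have "y - (x \<bullet> y) *\<^sub>R x \<in> span (insert x B)" using B span_mono[of B "insert x B"] by auto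
    moreover have "(x \<bullet> y) *\<^sub>R x \<in> span (insert x B)" by (intro span_scale span_base) simp
    ultimately show "y \<in> span (insert x B)" by (metis diff_add_cancel span_add)
   qed
  qed
  moreover have "pairwise orthogonal (insert x B)"
   using B by (auto simp: pairwise_insert S'_def orthogonal_def inner_commute)
  ultimately show ?thesis using B x by (intro exI[of _ "insert x B"]) (auto simp: S'_def)
 qed
qed

lemma spectral_theorem:
 fixes M :: "real^'n^'n"
 assumes "transpose M = M"
 obtains B l where "finite B" "pairwise orthogonal B" "span B = UNIV" "\<And>b. b \<in> B \<Longrightarrow> norm b = 1"
  "\<And>b. b \<in> B \<Longrightarrow> M *v b = l b *\<^sub>R b"
proof -
 obtain B where "finite B" "pairwise orthogonal B" "span B = UNIV" "\<forall>b\<in>B. norm b = 1 \<and> (\<exists>l. M *v b = l *\<^sub>R b)"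
  using spectral_theorem_subspace[OF assms, of UNIV] by auto
 then show ?thesis by (intro that[of B "\<lambda>b. SOME l. M *v b = l *\<^sub>R b"]) (auto intro: someI_ex)
qed

lemma matrix_eq_on_spanning:
 fixes M N :: "real^'n^'n"
 assumes "span B = UNIV" "\<And>b. b \<in> B \<Longrightarrow> M *v b = N *v b"
 shows "M = N"
proof -
 have "M *v x = N *v x" for x
  using linear_eq_on_span[of "(*v) M" "(*v) N" B x] assms by auto
 then show ?thesis by (simp add: matrix_eq)
qed

text \<open>For an eigenvector \<open>b\<close> of \<open>r - s\<close> with eigenvalue
  \<open>l\<close>, the difference of the squared norms of \<open>r *v b\<close> and
  \<open>s *v b\<close> is \<open>l\<close> times a positive number, namely the sum of the two
  quadratic forms at \<open>b\<close>. Equal squares force \<open>l = 0\<close>.\<close>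

lemma posdef_sqrt_unique:
 assumes r: "posdef r" and s: "posdef s" and eq: "r ** r = s ** (s :: real^'n^'n)"
 shows "r = s"
proof -
 have "transpose (r - s) = r - s"
  using r s by (simp add: posdef_def transpose_def vec_eq_iff)
 then obtain B l where B: "span B = UNIV" "\<And>b. b \<in> B \<Longrightarrow> norm b = 1" "\<And>b. b \<in> B \<Longrightarrow> (r - s) *v b = l b *\<^sub>R b"
  using spectral_theorem[of "r - s"] by metis
 show ?thesis
 proof (rule matrix_eq_on_spanning[OF B(1)])
  fix b assume b: "b \<in> B"
  have e: "r *v b = s *v b + l b *\<^sub>R b" using B(3)[OF b] by (simp add: matrix_vector_mult_diff_rdistrib algebra_simps)
  have "(r *v b) \<bullet> (r *v b) = (s *v b) \<bullet> (s *v b)"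
   using arg_cong[OF eq, of "\<lambda>m. b \<bullet> (m *v b)"]
   by (simp add: matrix_vector_mul_assoc[symmetric] posdef_symmetric_inner r s)
  then have "l b * (b \<bullet> (r *v b) + b \<bullet> (s *v b)) = 0"
   by (simp add: e algebra_simps inner_commute)
  moreover have "b \<noteq> 0" using B(2)[OF b] by auto
  then have "b \<bullet> (r *v b) + b \<bullet> (s *v b) > 0" using r s by (auto simp: posdef_def intro: add_pos_pos)
  ultimately have "l b = 0" by simp
  then show "r *v b = s *v b" using e by simp
 qed
qed

text \<open>The root multiplies each vector of an orthonormal eigenbasis by the square root of its
  eigenvalue. Written as a sum over the basis it is visibly symmetric.\<close>

lemma posdef_sqrt_exists:
 assumes q: "posdef (q :: real^'n^'n)"
 obtains r where "posdef r" "r ** r = q"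
proof -
 obtain B l where B: "finite B" "pairwise orthogonal B" "span B = UNIV" "\<And>b. b \<in> B \<Longrightarrow> norm b = 1"
  "\<And>b. b \<in> B \<Longrightarrow> q *v b = l b *\<^sub>R b"
  using q spectral_theorem[of q] unfolding posdef_def by metis
 have lpos: "l b > 0" if "b \<in> B" for b
  using q B(4,5)[OF that] by (auto simp: posdef_def dest!: spec[of _ b] simp: dot_square_norm)
 have orth: "b \<bullet> b' = (if b = b' then 1 else 0)" if "b \<in> B" "b' \<in> B" for b b'
  using that B(2,4) by (auto simp: pairwise_def orthogonal_def dot_square_norm)
 define R where "R x = (\<Sum>b\<in>B. (sqrt (l b) * (b \<bullet> x)) *\<^sub>R b)" for x
 have lin: "linear R"
  unfolding R_def by (rule linearI) (simp_all add: algebra_simps sum.distrib scaleR_sum_right)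
 define r where "r = matrix R"
 have rv: "r *v x = R x" for x unfolding r_def using lin by (simp add: matrix_works)
 have Rb: "R b = sqrt (l b) *\<^sub>R b" if "b \<in> B" for b
 proof -
  have "R b = (\<Sum>c\<in>B. if c = b then sqrt (l b) *\<^sub>R b else 0)"
   unfolding R_def by (intro sum.cong) (auto simp: orth that)
  then show ?thesis using B(1) that by simp
 qed
 have symR: "x \<bullet> R y = R x \<bullet> y" for x y
  by (simp add: R_def inner_sum_left inner_sum_right mult_ac inner_commute)
 have "(r ** r) *v b = q *v b" if "b \<in> B" for b
  using that lin lpos[OF that] by (simp add: matrix_vector_mul_assoc[symmetric] rv Rb linear_scale B(5))
 then have 1: "r ** r = q" by (rule matrix_eq_on_spanning[OF B(3)])
 have "transpose r = r"
 proof -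
  have "y \<bullet> (transpose r *v x) = y \<bullet> (r *v x)" for x y
   by (metis dot_lmul_matrix transpose_matrix_vector rv symR inner_commute)
  then have "transpose r *v x = r *v x" for x by (metis vector_eq_rdot inner_commute)
  then show ?thesis by (simp add: matrix_eq)
 qed
 moreover have "x \<bullet> (r *v x) > 0" if "x \<noteq> 0" for x
 proof -
  have nn: "\<forall>b\<in>B. sqrt (l b) * (b \<bullet> x)\<^sup>2 \<ge> 0" using lpos by (auto intro!: mult_nonneg_nonneg simp: less_imp_le)
  have eq: "x \<bullet> (r *v x) = (\<Sum>b\<in>B. sqrt (l b) * (b \<bullet> x)\<^sup>2)"
   by (simp add: rv R_def inner_sum_right power2_eq_square mult_ac inner_commute)
  have "x \<bullet> (r *v x) \<noteq> 0"
  proof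
   assume "x \<bullet> (r *v x) = 0"
   then have "\<forall>b\<in>B. sqrt (l b) * (b \<bullet> x)\<^sup>2 = 0" using eq sum_nonneg_eq_0_iff[OF B(1), of "\<lambda>b. sqrt (l b) * (b \<bullet> x)\<^sup>2"] nn by simp
   then have "\<forall>b\<in>B. b \<bullet> x = 0" using lpos by fastforce
   moreover have "x \<in> span B" using B(3) by simp
   ultimately have "orthogonal x x"
    by (intro orthogonal_to_span[of x B x]) (auto simp: orthogonal_def inner_commute)
   then show False using that by (simp add: orthogonal_self)
  qed
  then show ?thesis using eq sum_nonneg[of B "\<lambda>b. sqrt (l b) * (b \<bullet> x)\<^sup>2"] nn by simp
 qed
 ultimately have "posdef r" by (simp add: posdef_def)
 with 1 show ?thesis by (intro that)
qed

lemma sqrt_mat: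
 assumes "posdef q" shows "posdef (sqrt_mat q)" "sqrt_mat q ** sqrt_mat q = q"
proof -
 have "\<exists>!r. posdef r \<and> r ** r = q"
  using posdef_sqrt_exists[OF assms] posdef_sqrt_unique by metis
 from theI'[OF this] show "posdef (sqrt_mat q)" "sqrt_mat q ** sqrt_mat q = q"
  by (auto simp: sqrt_mat_def)
qed

lemma posdef_invertible: "posdef (a :: real^'n^'n) \<Longrightarrow> invertible a"
 unfolding invertible_left_inverse matrix_left_invertible_ker posdef_def by fastforce

lemma posdef_det_pos:
 assumes "posdef (a :: real^'n^'n)" shows "det a > 0"
proof -
 have "det a = (det (sqrt_mat a))\<^sup>2"
  by (metis sqrt_mat(2)[OF assms] det_mul power2_eq_square)
 moreover have "det a \<noteq> 0" using posdef_invertible[OF assms] by (simp add: invertible_det_nz)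
 ultimately show ?thesis by (metis zero_le_power2 order_le_less)
qed

lemma matrix_inv_inverse:
 assumes "invertible (a :: real^'n^'n)"
 shows "a ** matrix_inv a = mat 1" "matrix_inv a ** a = mat 1"
 using someI_ex[OF assms[unfolded invertible_def]] by (auto simp: matrix_inv_def)

lemma matrix_inv_eqI:
 assumes "(a :: real^'n^'n) ** b = mat 1" "b ** a = mat 1"
 shows "matrix_inv a = b"
proof -
 have "invertible a" using assms by (auto simp: invertible_def)
 from matrix_inv_inverse[OF this] show ?thesis
  by (metis assms(1) matrix_mul_assoc matrix_mul_lid matrix_mul_rid)
qed

lemma matrix_inv_mult:
 assumes "invertible (a :: real^'n^'n)"
 shows "matrix_inv a *v (a *v x) = x" "a *v (matrix_inv a *v x) = x"
 using matrix_inv_inverse[OF assms] by (simp_all add: matrix_vector_mul_assoc)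

lemma matrix_inv_symmetric_inner:
 assumes "posdef (a :: real^'n^'n)"
 shows "x \<bullet> (matrix_inv a *v y) = (matrix_inv a *v x) \<bullet> y"
 by (metis assms matrix_inv_mult posdef_invertible posdef_symmetric_inner)

lemma matrix_inv_scaleR:
 assumes "invertible (a :: real^'n^'n)" "c \<noteq> 0"
 shows "matrix_inv (c *\<^sub>R a) = (1/c) *\<^sub>R matrix_inv a"
proof -
 have "(c *\<^sub>R a) ** ((1/c) *\<^sub>R matrix_inv a) = mat 1" "((1/c) *\<^sub>R matrix_inv a) ** (c *\<^sub>R a) = mat 1"
  using assms matrix_inv_inverse[OF assms(1)] by (simp_all add: matrix_scalar_ac scalar_matrix_assoc[symmetric])
 then show ?thesis by (rule matrix_inv_eqI)
qed

lemma det_scaleR: "det (c *\<^sub>R (a :: real^'n^'n)) = c ^ CARD('n) * det a"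
proof -
 have "det (c *\<^sub>R a) = (\<Sum>p\<in>{p. p permutes (UNIV::'n set)}. c ^ CARD('n) * (of_int (sign p) * (\<Prod>i\<in>UNIV. a $ i $ p i)))"
  unfolding det_def by (intro sum.cong) (auto simp: prod.distrib)
 then show ?thesis by (simp add: det_def sum_distrib_left)
qed

text \<open>The order of symmetric matrices is reversed by inversion, via the variational formula
 \<open>z \<bullet> A\<inverse> z = sup\<^sub>w (2 z \<bullet> w - w \<bullet> A w)\<close> evaluated at \<open>w = a\<inverse> z / \<theta>\<close>.\<close>

lemma inverse_quadratic_mono:
 assumes a: "posdef (a :: real^'n^'n)" and A: "posdef A" and \<theta>: "\<theta> > 0"
  and le: "\<And>x. x \<bullet> (A *v x) \<le> \<theta> * (x \<bullet> (a *v x))"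
 shows "(1/\<theta>) * (z \<bullet> (matrix_inv a *v z)) \<le> z \<bullet> (matrix_inv A *v z)"
proof -
 define w where "w = (1/\<theta>) *\<^sub>R (matrix_inv a *v z)"
 define y where "y = matrix_inv A *v z"
 have z: "z = A *v y" using matrix_inv_mult[OF posdef_invertible[OF A]] by (simp add: y_def)
 have "0 \<le> (y - w) \<bullet> (A *v (y - w))"
  using A by (cases "y - w = 0") (auto simp: posdef_def less_imp_le)
 also have "\<dots> = z \<bullet> y - 2 * (z \<bullet> w) + w \<bullet> (A *v w)"
  unfolding z by (simp add: matrix_vector_mult_diff_distrib inner_diff_left inner_diff_right
    posdef_symmetric_inner[OF A, symmetric] inner_commute) (metis A inner_commute posdef_symmetric_inner)
 also have "w \<bullet> (A *v w) \<le> \<theta> * (w \<bullet> (a *v w))" by (rule le)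
 also have "w \<bullet> (a *v w) = (1/\<theta>)\<^sup>2 * (z \<bullet> (matrix_inv a *v z))"
  using matrix_inv_mult[OF posdef_invertible[OF a]]
  by (simp add: w_def matrix_vector_mult_scaleR power2_eq_square inner_commute)
 also have "z \<bullet> w = (1/\<theta>) * (z \<bullet> (matrix_inv a *v z))" by (simp add: w_def)
 finally show ?thesis using \<theta> by (simp add: y_def power2_eq_square)
qed

text \<open>Both bounds are the order reversal under inversion, applied to \<open>a\<close> and the
  identity.\<close>

lemma matrix_inv_bounds:
 assumes a: "posdef (a :: real^'n^'n)" and e: "elliptic l L a" and l: "l > 0" and L: "L > 0"
 shows "(x \<bullet> x) / L \<le> x \<bullet> (matrix_inv a *v x)" "x \<bullet> (matrix_inv a *v x) \<le> (x \<bullet> x) / l"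
proof -
 have 1: "posdef (mat 1 :: real^'n^'n)" by (simp add: posdef_def transpose_mat)
 have inv1: "matrix_inv (mat 1 :: real^'n^'n) = mat 1" by (rule matrix_inv_eqI) simp_all
 show "(x \<bullet> x) / L \<le> x \<bullet> (matrix_inv a *v x)"
  using inverse_quadratic_mono[OF 1 a L, of x] e by (simp add: inv1 elliptic_def)
 have "x \<bullet> (mat 1 *v x) \<le> (1/l) * (x \<bullet> (a *v x))" for x
  using e l by (simp add: elliptic_def field_simps)
 from inverse_quadratic_mono[OF a 1, of "1/l", of x] this l
 show "x \<bullet> (matrix_inv a *v x) \<le> (x \<bullet> x) / l" by (simp add: inv1 field_simps)
qed

text \<open>The Rayleigh minimum is an eigenvalue, and each eigenvalue is a value of the Rayleigh
  quotient; so the least eigenvalue exists and bounds the quadratic form from below.\<close>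

lemma lambda_min:
 assumes M: "posdef (M :: real^'n^'n)"
 shows "lambda_min M > 0" "lambda_min M * (x \<bullet> x) \<le> x \<bullet> (M *v x)"
proof -
 have sym: "transpose M = M" using M by (simp add: posdef_def)
 obtain v l where v: "norm v = 1" "M *v v = l *\<^sub>R v" "\<And>y. l * (y \<bullet> y) \<le> y \<bullet> (M *v y)"
  using Rayleigh_minimum[OF sym, of UNIV "axis undefined 1"] by auto
 have "lambda_min M = l" unfolding lambda_min_def
 proof (rule Least_equality)
  show "\<exists>x. x \<noteq> 0 \<and> M *v x = l *\<^sub>R x" using v by (intro exI[of _ v]) auto
  fix k assume "\<exists>x. x \<noteq> 0 \<and> M *v x = k *\<^sub>R x"
  then obtain x where "x \<noteq> 0" "M *v x = k *\<^sub>R x" by blast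
  with v(3)[of x] show "l \<le> k" by simp
 qed
 moreover have "v \<noteq> 0" using v by auto
 then have "l > 0" using M v(1,2) by (auto simp: posdef_def dot_square_norm dest!: spec[of _ v])
 ultimately show "lambda_min M > 0" "lambda_min M * (x \<bullet> x) \<le> x \<bullet> (M *v x)" using v(3) by auto
qed

lemma quadratic_upper_bound:
 obtains L where "L > 0" "\<And>x. x \<bullet> ((M :: real^'n^'n) *v x) \<le> L * (x \<bullet> x)"
proof -
 obtain K where K: "K > 0" "\<And>x. norm (M *v x) \<le> norm x * K"
  using bounded_linear.pos_bounded[OF matrix_vector_mul_bounded_linear[of M]] by blast
 have "x \<bullet> (M *v x) \<le> K * (x \<bullet> x)" for x
 proof -
  have "x \<bullet> (M *v x) \<le> norm x * norm (M *v x)" by (rule norm_cauchy_schwarz)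
  also have "\<dots> \<le> norm x * (norm x * K)" by (intro mult_left_mono K) auto
  finally show ?thesis by (simp add: dot_square_norm power2_eq_square mult_ac)
 qed
 with K show ?thesis by (intro that)
qed

lemma posdef_elliptic:
 assumes "posdef (M :: real^'n^'n)" obtains l L where "0 < l" "elliptic l L M"
 using lambda_min[OF assms] quadratic_upper_bound[of M] that[of "lambda_min M"]
 unfolding elliptic_def by metis

lemma elliptic_mono: "elliptic l L M \<Longrightarrow> l' \<le> l \<Longrightarrow> L \<le> L' \<Longrightarrow> elliptic l' L' M"
 unfolding elliptic_def by (meson inner_ge_zero mult_right_mono order_trans)

lemma norm_matrix_power2: "(norm (M :: real^'n^'m))\<^sup>2 = (\<Sum>i\<in>UNIV. \<Sum>j\<in>UNIV. (M $ i $ j)\<^sup>2)"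
 by (simp add: norm_vec_def L2_set_def sum_nonneg real_sqrt_pow2)

lemma norm_matrix_mult_le: "norm (M ** N) \<le> norm M * norm (N :: real^'n^'n)"
proof (rule power2_le_imp_le)
 have "(norm (M ** N))\<^sup>2 = (\<Sum>i\<in>UNIV. \<Sum>j\<in>UNIV. (\<Sum>k\<in>UNIV. M $ i $ k * N $ k $ j)\<^sup>2)"
  by (simp add: norm_matrix_power2 matrix_matrix_mult_def)
 also have "\<dots> \<le> (\<Sum>i\<in>UNIV. \<Sum>j\<in>UNIV. (\<Sum>k\<in>UNIV. (M $ i $ k)\<^sup>2) * (\<Sum>k\<in>UNIV. (N $ k $ j)\<^sup>2))"
  by (intro sum_mono Cauchy_Schwarz_ineq_sum)
 also have "\<dots> = (norm M)\<^sup>2 * (\<Sum>j\<in>UNIV. \<Sum>k\<in>UNIV. (N $ k $ j)\<^sup>2)"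
  by (simp add: norm_matrix_power2 sum_product)
 also have "(\<Sum>j\<in>UNIV. \<Sum>k\<in>UNIV. (N $ k $ j)\<^sup>2) = (norm N)\<^sup>2"
  unfolding norm_matrix_power2 by (rule sum.swap)
 finally show "(norm (M ** N))\<^sup>2 \<le> (norm M * norm N)\<^sup>2" by (simp add: power_mult_distrib)
qed simp

text \<open>For a symmetric root the squared Frobenius norm is the trace of \<open>q\<close>, and
  each diagonal entry of \<open>q\<close> is a value of its quadratic form.\<close>

lemma norm_sqrt_mat:
 fixes L :: real
 assumes "posdef q" "elliptic l L (q :: real^'n^'n)"
 shows "(norm (sqrt_mat q))\<^sup>2 \<le> CARD('n) * L"
proof -
 let ?r = "sqrt_mat q"
 have sym: "?r $ i $ j = ?r $ j $ i" for i j
 proof -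
  have "transpose ?r = ?r" using sqrt_mat(1)[OF assms(1)] by (simp add: posdef_def)
  moreover have "transpose ?r $ j $ i = ?r $ i $ j" by (simp add: transpose_def)
  ultimately show ?thesis by simp
 qed
 have "(norm ?r)\<^sup>2 = (\<Sum>i\<in>UNIV. (?r ** ?r) $ i $ i)"
 proof -
  have "(?r $ i $ j)\<^sup>2 = ?r $ i $ j * ?r $ j $ i" for i j using sym[of i j] by (simp add: power2_eq_square)
  then show ?thesis unfolding norm_matrix_power2 matrix_matrix_mult_def by simp
 qed
 also have "\<dots> = (\<Sum>i\<in>UNIV. q $ i $ i)" by (simp add: sqrt_mat(2)[OF assms(1)])
 also have "\<dots> \<le> (\<Sum>i\<in>(UNIV::'n set). L)"
 proof (rule sum_mono)
  fix i
  have "q $ i $ i = axis i 1 \<bullet> (q *v axis i 1)"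
   by (simp add: inner_axis' matrix_vector_mult_basis column_def)
  also have "\<dots> \<le> L * (axis i 1 \<bullet> (axis i 1 :: real^'n))" using assms(2) unfolding elliptic_def by blast
  finally show "q $ i $ i \<le> L" by (simp add: inner_axis_axis)
 qed
 finally show ?thesis by simp
qed

section \<open>Gaussian integrals\<close>

lemma integrable_gauss_real:
 assumes "s > 0" shows "integrable lborel (\<lambda>x::real. exp (- s * x\<^sup>2))"
proof (rule Bochner_Integration.integrable_bound)
 have 1: "integrable lborel (\<lambda>x::real. exp (- s * x) * indicator {0..} x)"
 proof (rule integrableI_nonneg)
  have "(\<integral>\<^sup>+x\<in>{0..}. ennreal (exp (- s * x)) \<partial>lborel) = ennreal (exp (- s * 0) / s)"
   by (rule nn_integral_has_integral_lebesgue'[OF _ has_integral_exp_minus_to_infinity[OF assms]])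
    (use assms in auto)
  then show "(NN x. ennreal (exp (- s * x) * indicator {0..} x)) < \<infinity>"
   by (simp add: nn_integral_set_ennreal)
 qed auto
 then have "integrable lborel (\<lambda>x::real. exp (- s * (0 + (-1) * x)) * indicator {0..} (0 + (-1) * x))"
  by (subst lborel_integrable_real_affine_iff) auto
 with 1 show "integrable lborel (\<lambda>x::real. exp s * (exp (- s * x) * indicator {0..} x + exp (- s * (0 + (-1) * x)) * indicator {0..} (0 + (-1) * x)))"
  by (intro integrable_mult_right Bochner_Integration.integrable_add)
 have "exp (- s * x\<^sup>2) \<le> exp s * exp (- s * \<bar>x\<bar>)" for x
 proof -
  \<comment> \<open>This is \<open>\<bar>x\<bar> \<le> x^2 + 1\<close>, which replaces the Gaussian
    by an exponential tail with a known integral.\<close>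
  have "0 \<le> (\<bar>x\<bar> - 1)\<^sup>2 + \<bar>x\<bar>" by simp
  then have "s * \<bar>x\<bar> \<le> s * (x\<^sup>2 + 1)"
   using assms by (intro mult_left_mono) (auto simp: power2_eq_square algebra_simps)
  then show ?thesis by (simp add: exp_add[symmetric] algebra_simps)
 qed
 note * = this
 show "AE x in lborel. norm (exp (- s * x\<^sup>2)) \<le> norm (exp s * (exp (- s * x) * indicator {0..} x + exp (- s * (0 + (-1) * x)) * indicator {0..} (0 + (-1) * x)))"
 proof (rule AE_I2)
  fix x :: real
  have "exp (- s * \<bar>x\<bar>) \<le> exp (- s * x) * indicator {0..} x + exp (- s * (0 + (-1) * x)) * indicator {0..} (0 + (-1) * x)"
   by (cases "x \<ge> 0") (auto simp: indicator_def)
  then have "exp s * exp (- s * \<bar>x\<bar>) \<le> exp s * (exp (- s * x) * indicator {0..} x + exp (- s * (0 + (-1) * x)) * indicator {0..} (0 + (-1) * x))"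
   by (rule mult_left_mono) simp
  with *[of x] have "exp (- s * x\<^sup>2) \<le> exp s * (exp (- s * x) * indicator {0..} x + exp (- s * (0 + (-1) * x)) * indicator {0..} (0 + (-1) * x))"
   by linarith
  then show "norm (exp (- s * x\<^sup>2)) \<le> norm (exp s * (exp (- s * x) * indicator {0..} x + exp (- s * (0 + (-1) * x)) * indicator {0..} (0 + (-1) * x)))"
   unfolding real_norm_def by (metis abs_exp_cancel abs_ge_self order_trans)
 qed
qed auto

lemma gauss_prod: "exp (- s * (x \<bullet> x)) = (\<Prod>b\<in>Basis. exp (- s * (x \<bullet> b)\<^sup>2))" for x :: "'a::euclidean_space"
 by (simp add: exp_sum[symmetric] sum_distrib_left[symmetric] sum_negf euclidean_inner[of x x] power2_eq_square)

lemma integrable_gauss: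
 assumes "s > 0" shows "integrable lborel (\<lambda>x::'a::euclidean_space. exp (- s * (x \<bullet> x)))"
proof (rule integrableI_nonneg)
 have "(\<integral>\<^sup>+x. ennreal (exp (- s * (x \<bullet> x))) \<partial>(lborel :: 'a measure))
  = (\<integral>\<^sup>+x. (\<Prod>b\<in>Basis. ennreal (exp (- s * (x \<bullet> b)\<^sup>2))) \<partial>(lborel :: 'a measure))"
  unfolding gauss_prod by (subst prod_ennreal) auto
 also have "\<dots> = (\<Prod>b\<in>(Basis::'a set). (NN x. ennreal (exp (- s * x\<^sup>2))))"
  by (rule nn_integral_lborel_prod) auto
 also have "\<dots> < \<infinity>"
  using integrable_gauss_real[OF assms] by (simp add: integrable_iff_bounded power_less_top_ennreal)
 finally show "(\<integral>\<^sup>+x. ennreal (exp (- s * (x \<bullet> x))) \<partial>(lborel :: 'a measure)) < \<infinity>" .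
qed auto

text \<open>The value is never computed. What matters is that it is positive and determined by
  \<open>s\<close> and the dimension, hence the type argument.\<close>

definition gauss_int :: "'a::euclidean_space itself \<Rightarrow> real \<Rightarrow> real" where
 "gauss_int _ s = (LB x. exp (- s * ((x::'a) \<bullet> x)))"

lemma integral_pos_lborel:
 fixes f :: "'a::euclidean_space \<Rightarrow> real"
 assumes "integrable lborel f" "\<And>x. f x > 0" shows "(LB x. f x) > 0"
proof -
 have "(LB x. f x) \<noteq> 0"
 proof
  assume "(LB x. f x) = 0"
  then have "AE x in lborel. f x = 0"
   using integral_nonneg_eq_0_iff_AE[OF assms(1)] assms(2) by (simp add: less_imp_le)
  then have "AE x in (lborel :: 'a measure). False" by eventually_elim (use assms(2) in \<open>metis less_irrefl\<close>)
  then show False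
   using ae_filter_eq_bot_iff[of "lborel :: 'a measure"] by (simp add: trivial_limit_def)
 qed
 moreover have "(LB x. f x) \<ge> 0" by (intro Bochner_Integration.integral_nonneg less_imp_le assms(2))
 ultimately show ?thesis by simp
qed

lemma gauss_int_pos: "s > 0 \<Longrightarrow> gauss_int TYPE('a::euclidean_space) s > 0"
 unfolding gauss_int_def by (intro integral_pos_lborel integrable_gauss) auto

lemma poly_gauss_bound:
 assumes s: "s > 0"
 obtains C where "C > 0" "\<And>x::'a::euclidean_space. (1 + norm x)\<^sup>2 * exp (- s * (x \<bullet> x)) \<le> C * exp (- (s/2) * (x \<bullet> x))"
proof (rule that[of "2 + 4/s"])
 fix x :: 'a
 define E where "E = exp ((s/2) * (x \<bullet> x))"
 have "(s/2) * (x \<bullet> x) \<le> E"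
  unfolding E_def using exp_ge_add_one_self[of "(s/2) * (x \<bullet> x)"] by linarith
 then have "2 * norm x ^ 2 \<le> (4/s) * E"
  using s by (simp add: field_simps power2_norm_eq_inner)
 moreover have "1 \<le> E" using s by (simp add: E_def)
 moreover have "(1 + norm x)\<^sup>2 \<le> 2 + 2 * norm x ^ 2"
  using sum_squares_bound[of 1 "norm x"] by (simp add: power2_eq_square algebra_simps)
 moreover have "(2 + 4/s) * E = 2 * E + (4/s) * E" by (simp add: distrib_right)
 ultimately have "(1 + norm x)\<^sup>2 \<le> (2 + 4/s) * exp ((s/2) * (x \<bullet> x))"
  unfolding E_def[symmetric] by linarith
 then have "(1 + norm x)\<^sup>2 * exp (- s * (x \<bullet> x)) \<le> (2 + 4/s) * exp ((s/2) * (x \<bullet> x)) * exp (- s * (x \<bullet> x))"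
  by (intro mult_right_mono) auto
 also have "\<dots> = (2 + 4/s) * exp (- (s/2) * (x \<bullet> x))"
  by (simp add: exp_add[symmetric] algebra_simps)
 finally show "(1 + norm x)\<^sup>2 * exp (- s * (x \<bullet> x)) \<le> (2 + 4/s) * exp (- (s/2) * (x \<bullet> x))" .
qed (use s in \<open>simp add: add_pos_pos\<close>)

section \<open>Differentiation under the integral\<close>

lemma test_derivative_bounded:
 fixes G :: "'a::euclidean_space \<Rightarrow> real"
 assumes "G \<in> test_functions \<Omega>"
 obtains M where "M > 0" "\<And>x e. \<bar>dd e G x\<bar> \<le> M * norm e"
proof -
 have "\<exists>M. \<forall>b\<in>Basis. M b > 0 \<and> (\<forall>x. \<bar>dd b G x\<bar> \<le> M b)"
  using test_bounded[OF test_dd[OF assms]] by (intro bchoice) metis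
 then obtain M where M: "\<And>b. b \<in> Basis \<Longrightarrow> M b > 0" "\<And>b x. b \<in> Basis \<Longrightarrow> \<bar>dd b G x\<bar> \<le> M b" by blast
 show ?thesis
 proof (rule that[of "\<Sum>b\<in>Basis. M b"])
  show "(\<Sum>b\<in>Basis. M b) > 0" using M(1) by (intro sum_pos) auto
  fix x e
  have "dd e G x = dd (\<Sum>b\<in>Basis. (e \<bullet> b) *\<^sub>R b) G x" by (simp add: euclidean_representation)
  also have "\<dots> = (\<Sum>b\<in>Basis. (e \<bullet> b) * dd b G x)"
   by (subst linear_sum[OF smooth_linear_dd[OF test_smooth[OF assms]]])
    (simp add: linear_scale[OF smooth_linear_dd[OF test_smooth[OF assms]]])
  also have "\<bar>\<dots>\<bar> \<le> (\<Sum>b\<in>Basis. \<bar>(e \<bullet> b) * dd b G x\<bar>)" by (rule sum_abs)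
  also have "\<dots> \<le> (\<Sum>b\<in>Basis. M b * norm e)"
   unfolding abs_mult using M by (intro sum_mono) (auto intro!: mult_mono simp: mult.commute[of "M _"] Basis_le_norm less_imp_le)
  finally show "\<bar>dd e G x\<bar> \<le> (\<Sum>b\<in>Basis. M b) * norm e" by (simp add: sum_distrib_right)
 qed
qed

lemma test_Lipschitz:
 fixes G :: "'a::euclidean_space \<Rightarrow> real"
 assumes "G \<in> test_functions \<Omega>" "\<And>x e. \<bar>dd e G x\<bar> \<le> M * norm e"
 shows "\<bar>G y - G x\<bar> \<le> M * norm (y - x)"
proof -
 have "norm (G y - G x) \<le> M * norm (y - x)"
 proof (rule differentiable_bound[of UNIV G "\<lambda>x e. dd e G x"])
  show "onorm (\<lambda>e. dd e G x) \<le> M" for x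
   using assms(2) by (intro onorm_le) auto
 qed (use smooth_has_derivative[OF test_smooth[OF assms(1)]] in auto)
 then show ?thesis by simp
qed

text \<open>Convolution of \<open>G\<close> with the image under \<open>S\<close> of the measure
  with density \<open>N\<close>. Keeping the map \<open>S\<close> apart from the density lets a
  kernel with a singularity be written with an integrable \<open>N\<close>, while all derivatives
  fall on \<open>G\<close>.\<close>

definition wconv :: "('q::euclidean_space \<Rightarrow> real) \<Rightarrow> ('q \<Rightarrow> 'a::euclidean_space) \<Rightarrow> ('a \<Rightarrow> real) \<Rightarrow> 'a \<Rightarrow> real" where
 "wconv N S G p = (LB q. N q * G (p - S q))"

lemma wconv_integrable:
 fixes N :: "'q::euclidean_space \<Rightarrow> real" and G :: "'a::euclidean_space \<Rightarrow> real"
 assumes N: "integrable lborel N" and S: "S \<in> borel_measurable borel"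
  and G: "G \<in> borel_measurable borel" "\<And>x. \<bar>G x\<bar> \<le> M"
 shows "integrable lborel (\<lambda>q. N q * G (p - S q))"
proof (rule Bochner_Integration.integrable_bound)
 show "integrable lborel (\<lambda>q. M * N q)" using N by simp
 have "M \<ge> 0" using G(2)[of undefined] by (meson abs_ge_zero order_trans)
 then show "AE q in lborel. norm (N q * G (p - S q)) \<le> norm (M * N q)"
  using G(2) by (auto simp: abs_mult mult.commute[of M] intro!: mult_left_mono)
 show "(\<lambda>q. N q * G (p - S q)) \<in> borel_measurable lborel"
  using borel_measurable_integrable[OF N] S G(1) by simp
qed

lemma wconv_test_integrable:
 fixes N :: "'q::euclidean_space \<Rightarrow> real" and G :: "'a::euclidean_space \<Rightarrow> real"
 assumes "integrable lborel N" "S \<in> borel_measurable borel" "G \<in> test_functions \<Omega>"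
 shows "integrable lborel (\<lambda>q. N q * G (p - S q))"
proof -
 obtain M where "\<And>x. \<bar>G x\<bar> \<le> M" using test_bounded[OF assms(3)] by blast
 then show ?thesis by (rule wconv_integrable[OF assms(1,2) smooth_measurable[OF test_smooth[OF assms(3)]]])
qed

text \<open>The Taylor remainder of \<open>G\<close>, divided by the increment, is at most
  \<open>2 * M\<close> by the Lipschitz bound and tends to zero pointwise, so dominated convergence
  against \<open>N\<close> applies. The derivative is again a \<open>wconv\<close>, which makes the
  induction for smoothness immediate.\<close>

lemma wconv_has_derivative:
 fixes N :: "'q::euclidean_space \<Rightarrow> real" and G :: "'a::euclidean_space \<Rightarrow> real"
 assumes N: "integrable lborel N" and S: "S \<in> borel_measurable borel" and G: "G \<in> test_functions \<Omega>"
 shows "(wconv N S G has_derivative (\<lambda>e. wconv N S (dd e G) p)) (at p)"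
proof -
 note int = wconv_test_integrable[OF N S]
 have sG: "smooth G" by (rule test_smooth[OF G])
 obtain M where M: "M > 0" "\<And>x e. \<bar>dd e G x\<bar> \<le> M * norm e" using test_derivative_bounded[OF G] by blast
 have lin: "bounded_linear (\<lambda>e. wconv N S (dd e G) p)"
  unfolding wconv_def linear_conv_bounded_linear[symmetric]
  using linear_add[OF smooth_linear_dd[OF sG]] linear_scale[OF smooth_linear_dd[OF sG]]
   Bochner_Integration.integral_add[OF int[OF test_dd[OF G]] int[OF test_dd[OF G]]]
  by (intro linearI) (simp_all add: distrib_left mult.left_commute[of _ "_::real" "dd _ _ _"])
 define R where "R y q = (G (y - S q) - G (p - S q)) - dd (y - p) G (p - S q)" for y q
 have Rint: "integrable lborel (\<lambda>q. N q * R y q)" for y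
  unfolding R_def right_diff_distrib
  by (intro Bochner_Integration.integrable_diff int[OF G] int[OF test_dd[OF G]])
 have eq: "(wconv N S G y - wconv N S G p) - wconv N S (dd (y - p) G) p = (LB q. N q * R y q)" for y
  unfolding wconv_def R_def right_diff_distrib
  by (simp add: Bochner_Integration.integral_diff int[OF G] int[OF test_dd[OF G]])
 have Rb: "\<bar>R y q\<bar> / norm (y - p) \<le> 2 * M" if "y \<noteq> p" for y q
 proof -
  have "\<bar>R y q\<bar> \<le> M * norm (y - p) + M * norm (y - p)"
   unfolding R_def using test_Lipschitz[OF G M(2), of "y - S q" "p - S q"] M(2)[of "y - p" "p - S q"]
   by (intro order_trans[OF abs_triangle_ineq4]) simp
  then show ?thesis using that by (simp add: field_simps)
 qed
 have "((\<lambda>y. LB q. N q * (R y q / norm (y - p))) \<longlongrightarrow> 0) (at p)"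
  unfolding tendsto_at_iff_sequentially
 proof (intro allI impI)
  fix X :: "nat \<Rightarrow> _" assume X: "\<forall>i. X i \<in> UNIV - {p}" "X \<longlonglongrightarrow> p"
  have "(\<lambda>i. LB q. N q * (R (X i) q / norm (X i - p))) \<longlonglongrightarrow> (\<integral>q. 0 \<partial>(lborel :: 'q measure))"
  proof (rule integral_dominated_convergence[where w="\<lambda>q. 2 * M * \<bar>N q\<bar>"])
   show "integrable lborel (\<lambda>q. 2 * M * \<bar>N q\<bar>)" using N by simp
   show "(\<lambda>q. N q * (R (X i) q / norm (X i - p))) \<in> borel_measurable lborel" for i
    using borel_measurable_integrable[OF Rint[of "X i"]] by simp
   show "AE q in lborel. norm (N q * (R (X i) q / norm (X i - p))) \<le> 2 * M * \<bar>N q\<bar>" for i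
   proof (rule AE_I2)
    fix q
    have "\<bar>N q\<bar> * (\<bar>R (X i) q\<bar> / norm (X i - p)) \<le> \<bar>N q\<bar> * (2 * M)"
     using X(1) by (intro mult_left_mono Rb) auto
    then show "norm (N q * (R (X i) q / norm (X i - p))) \<le> 2 * M * \<bar>N q\<bar>"
     by (simp add: abs_mult mult_ac)
   qed
   show "AE q in lborel. (\<lambda>i. N q * (R (X i) q / norm (X i - p))) \<longlonglongrightarrow> 0"
   proof (rule AE_I2)
    fix q
    have "((\<lambda>z. norm ((G z - G (p - S q)) - dd (z - (p - S q)) G (p - S q)) / norm (z - (p - S q))) \<longlongrightarrow> 0) (at (p - S q))"
     using smooth_has_derivative[OF sG, of "p - S q"] unfolding has_derivative_iff_norm by simp
    then have "((\<lambda>i. norm ((G i - G (p - S q)) - dd (i - (p - S q)) G (p - S q)) / norm (i - (p - S q))) \<circ> (\<lambda>i. X i - S q)) \<longlonglongrightarrow> 0"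
     unfolding tendsto_at_iff_sequentially
    proof (elim allE impE)
     show "\<forall>i. X i - S q \<in> UNIV - {p - S q}" using X(1) by simp
     show "(\<lambda>i. X i - S q) \<longlonglongrightarrow> p - S q" by (intro tendsto_diff X(2) tendsto_const)
    qed
    then have "(\<lambda>i. \<bar>R (X i) q / norm (X i - p)\<bar>) \<longlonglongrightarrow> 0" by (simp add: R_def o_def)
    then have "(\<lambda>i. R (X i) q / norm (X i - p)) \<longlonglongrightarrow> 0" by (rule tendsto_rabs_zero_cancel)
    from tendsto_mult_right_zero[OF this] show "(\<lambda>i. N q * (R (X i) q / norm (X i - p))) \<longlonglongrightarrow> 0" .
   qed
  qed auto
  then show "((\<lambda>y. LB q. N q * (R y q / norm (y - p))) \<circ> X) \<longlonglongrightarrow> 0" by (simp add: o_def)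
 qed
 then have "((\<lambda>y. (LB q. N q * R y q) / norm (y - p)) \<longlongrightarrow> 0) (at p)" by simp
 then have "((\<lambda>y. norm ((wconv N S G y - wconv N S G p) - wconv N S (dd (y - p) G) p) / norm (y - p)) \<longlongrightarrow> 0) (at p)"
  unfolding eq using tendsto_norm_zero by fastforce
 then show ?thesis unfolding has_derivative_iff_norm using lin by simp
qed

lemma dd_wconv:
 assumes "integrable lborel N" "S \<in> borel_measurable borel" "G \<in> test_functions \<Omega>"
 shows "dd e (wconv N S G) = wconv N S (dd e G)"
 by (rule ext, rule dd_eqI, rule wconv_has_derivative[OF assms])

lemma smooth_wconv:
 assumes N: "integrable lborel N" and S: "S \<in> borel_measurable borel" and G: "G \<in> test_functions \<Omega>"
 shows "smooth (wconv N S G)"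
proof -
 have "Ck k (wconv N S G)" if "G \<in> test_functions \<Omega>" for k G
  using that
 proof (induction k arbitrary: G)
  case 0
  then show ?case
   using has_derivative_continuous[OF wconv_has_derivative[OF N S 0]]
   by (auto intro: continuous_at_imp_continuous_on)
 next
  case (Suc k)
  show ?case by (rule Ck_SucI[OF wconv_has_derivative[OF N S Suc.prems] Suc.IH[OF test_dd[OF Suc.prems]]])
 qed
 with G show ?thesis by (auto simp: smooth_def)
qed

lemma has_real_derivative_integral_dominated:
 fixes f :: "real \<Rightarrow> 'q::euclidean_space \<Rightarrow> real"
 assumes r0: "r0 \<in> {a<..<b}"
  and int: "\<And>r. r \<in> {a<..<b} \<Longrightarrow> integrable lborel (f r)"
  and der: "\<And>r y. r \<in> {a<..<b} \<Longrightarrow> ((\<lambda>r. f r y) has_real_derivative f' r y) (at r)"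
  and bd: "\<And>r y. r \<in> {a<..<b} \<Longrightarrow> \<bar>f' r y\<bar> \<le> w y"
  and w: "integrable lborel w" and meas: "f' r0 \<in> borel_measurable borel"
 shows "((\<lambda>r. LB y. f r y) has_real_derivative (LB y. f' r0 y)) (at r0)"
proof -
 have "((\<lambda>r. LB y. (f r y - f r0 y) / (r - r0)) \<longlongrightarrow> (LB y. f' r0 y)) (at r0 within {a<..<b})"
  unfolding tendsto_at_iff_sequentially
 proof (intro allI impI)
  fix X :: "nat \<Rightarrow> real" assume X: "\<forall>i. X i \<in> {a<..<b} - {r0}" "X \<longlonglongrightarrow> r0"
  have "(\<lambda>i. LB y. (f (X i) y - f r0 y) / (X i - r0)) \<longlonglongrightarrow> (LB y. f' r0 y)"
  proof (rule integral_dominated_convergence[where w=w])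
   show "(\<lambda>y. (f (X i) y - f r0 y) / (X i - r0)) \<in> borel_measurable lborel" for i
    using int[of "X i"] int[of r0] X(1) r0 by (auto intro!: borel_measurable_divide borel_measurable_diff borel_measurable_integrable)
   show "AE y in lborel. norm ((f (X i) y - f r0 y) / (X i - r0)) \<le> w y" for i
   proof (rule AE_I2)
    fix y
    have "norm (f (X i) y - f r0 y) \<le> w y * norm (X i - r0)"
     by (rule field_differentiable_bound[of "{a<..<b}" "\<lambda>r. f r y" "\<lambda>r. f' r y"])
      (use der bd X(1) r0 in \<open>auto intro: has_field_derivative_at_within\<close>)
    then show "norm ((f (X i) y - f r0 y) / (X i - r0)) \<le> w y"
     using X(1) by (simp add: field_simps norm_divide)
   qed
   show "AE y in lborel. (\<lambda>i. (f (X i) y - f r0 y) / (X i - r0)) \<longlonglongrightarrow> f' r0 y"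
    using der[OF r0] X unfolding has_field_derivative_iff tendsto_at_iff_sequentially
    by (auto simp: o_def)
  qed (use w meas in auto)
  then show "((\<lambda>r. LB y. (f r y - f r0 y) / (r - r0)) \<circ> X) \<longlonglongrightarrow> (LB y. f' r0 y)"
   by (simp add: o_def)
 qed
 moreover have "at r0 within {a<..<b} = at r0" using r0 by (intro at_within_open) auto
 ultimately have "((\<lambda>r. LB y. (f r y - f r0 y) / (r - r0)) \<longlongrightarrow> (LB y. f' r0 y)) (at r0)" by simp
 moreover have "\<forall>\<^sub>F r in at r0. (LB y. (f r y - f r0 y) / (r - r0)) = ((LB y. f r y) - (LB y. f r0 y)) / (r - r0)"
  by (rule eventually_mono[OF eventually_at_in_open'[of "{a<..<b}" r0]])
   (use r0 in \<open>auto simp: Bochner_Integration.integral_diff int\<close>)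
 ultimately show ?thesis
  unfolding has_field_derivative_iff by (rule Lim_transform_eventually)
qed

section \<open>The heat potential\<close>

text \<open>The fundamental solution of the heat equation with matrix \<open>A\<close> at time 1, up
  to normalisation. It is normalised by its integral \<open>hZ\<close>, so that no closed formula
  with a determinant is needed.\<close>

definition hker :: "real^'n^'n \<Rightarrow> real^'n \<Rightarrow> real" where
 "hker A y = exp (- (y \<bullet> (matrix_inv A *v y)) / 4)"

definition hZ :: "real^'n^'n \<Rightarrow> real" where
 "hZ A = (LB y. hker A y)"

definition hk :: "real^'n^'n \<Rightarrow> real^'n \<Rightarrow> real" where
 "hk A y = hker A y / hZ A"

definition heat_wt :: "real \<Rightarrow> real^'n^'n \<Rightarrow> real \<times> (real^'n) \<Rightarrow> real" where
 "heat_wt B A q = indicator {0<..<B} (fst q) * hk A (snd q)"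

definition heat_map :: "real \<times> (real^'n) \<Rightarrow> real \<times> (real^'n)" where
 "heat_map q = (fst q, sqrt (fst q) *\<^sub>R snd q)"

text \<open>Substituting \<open>z = \<surd>r y\<close>, this is the convolution of \<open>G\<close> with the fundamental solution of
 \<open>\<partial>\<^sub>t - A : D\<^sup>2\<close>, cut off at time \<open>B\<close> so that the measure is finite.\<close>

definition heat_pot :: "real \<Rightarrow> real^'n^'n \<Rightarrow> (real \<times> (real^'n) \<Rightarrow> real) \<Rightarrow> real \<times> (real^'n) \<Rightarrow> real" where
 "heat_pot B A = wconv (heat_wt B A) heat_map"

text \<open>The formal adjoint of \<open>P_op A\<close>: the time derivative changes sign, the
  second-order part does not. Its natural problem runs forward in time.\<close>

definition heat_op :: "real^'n^'n \<Rightarrow> (real \<times> (real^'n) \<Rightarrow> real) \<Rightarrow> real \<times> (real^'n) \<Rightarrow> real" where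
 "heat_op A G p = dd (1, 0) G p - (\<Sum>i\<in>UNIV. \<Sum>j\<in>UNIV. A $ i $ j * dd (0, axis i 1) (dd (0, axis j 1) G) p)"

lemma continuous_on_matrix_vector [continuous_intros]:
 "continuous_on S f \<Longrightarrow> continuous_on S (\<lambda>x. (M :: real^'n^'m) *v f x)"
 by (rule bounded_linear.continuous_on[OF matrix_vector_mul_bounded_linear])

lemma continuous_hker: "continuous_on S (hker A)"
 unfolding hker_def by (intro continuous_intros) auto

lemma vec_nth_measurable [measurable]: "(\<lambda>y. (y :: real^'n) $ j) \<in> borel_measurable borel"
 by (intro borel_measurable_continuous_onI continuous_intros)

lemma hker_measurable [measurable]: "hker A \<in> borel_measurable borel"
 by (intro borel_measurable_continuous_onI continuous_hker)

lemma hk_measurable [measurable]: "hk A \<in> borel_measurable borel"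
 unfolding hk_def by measurable

lemma heat_map_measurable: "(heat_map :: real \<times> (real^'n) \<Rightarrow> _) \<in> borel_measurable borel"
 unfolding heat_map_def[abs_def]
 by (intro borel_measurable_continuous_onI continuous_intros)

lemma hker_le:
 assumes "posdef A" "elliptic l L A" "0 < l" "0 < L"
 shows "hker A y \<le> exp (- (1/(4*L)) * (y \<bullet> y))"
 using matrix_inv_bounds(1)[OF assms, of y] by (simp add: hker_def)

lemma hker_poly_integrable:
 assumes A: "posdef A" shows "integrable lborel (\<lambda>y. (1 + norm y) * hker A y)" "integrable lborel (hker A)"
proof -
 obtain l L where lL: "0 < l" "elliptic l L A" using posdef_elliptic[OF A] .
 have e: "elliptic l (max 1 L) A" using elliptic_mono[OF lL(2)] by simp
 define s where "s = 1 / (4 * max 1 L)"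
 have s: "s > 0" by (simp add: s_def)
 have le: "hker A y \<le> exp (- s * (y \<bullet> y))" for y
  using hker_le[OF A e lL(1), of y] by (simp add: s_def)
 obtain C where C: "C > 0" "\<And>x::real^'a. (1 + norm x)\<^sup>2 * exp (- s * (x \<bullet> x)) \<le> C * exp (- (s/2) * (x \<bullet> x))"
  using poly_gauss_bound[OF s] by blast
 show 1: "integrable lborel (\<lambda>y. (1 + norm y) * hker A y)"
 proof (rule Bochner_Integration.integrable_bound[where f="\<lambda>y. C * exp (- (s/2) * (y \<bullet> y))"])
  show "integrable lborel (\<lambda>y::real^'a. C * exp (- (s/2) * (y \<bullet> y)))"
   using s by (intro integrable_mult_right integrable_gauss) simp
  show "AE y in lborel. norm ((1 + norm y) * hker A y) \<le> norm (C * exp (- (s/2) * (y \<bullet> y)))"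
  proof (rule AE_I2)
   fix y :: "real^'a"
   have "(1 + norm y) * hker A y \<le> (1 + norm y)\<^sup>2 * exp (- s * (y \<bullet> y))"
   proof (rule mult_mono)
    show "1 + norm y \<le> (1 + norm y)\<^sup>2"
     using mult_right_mono[of 1 "1 + norm y" "1 + norm y"] by (simp add: power2_eq_square)
   qed (use le in \<open>auto simp: hker_def\<close>)
   also have "\<dots> \<le> C * exp (- (s/2) * (y \<bullet> y))" by (rule C)
   finally show "norm ((1 + norm y) * hker A y) \<le> norm (C * exp (- (s/2) * (y \<bullet> y)))"
    using C(1) by (simp add: hker_def abs_mult)
  qed
 qed simp
 show "integrable lborel (hker A)"
  by (rule Bochner_Integration.integrable_bound[OF 1]) (auto simp: hker_def mult_le_cancel_right1 abs_mult)
qed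

lemma hZ_pos: "posdef A \<Longrightarrow> hZ A > 0"
 unfolding hZ_def by (intro integral_pos_lborel hker_poly_integrable) (auto simp: hker_def)

lemma hk_pos: "posdef A \<Longrightarrow> hk A y > 0"
 using hZ_pos[of A] by (simp add: hk_def hker_def)

lemma hk_integrable:
 assumes "posdef A" shows "integrable lborel (hk A)" "integrable lborel (\<lambda>y. (1 + norm y) * hk A y)"
  "(LB y. hk A y) = 1"
 unfolding hk_def using hker_poly_integrable[OF assms] hZ_pos[OF assms] by (auto simp: hZ_def[symmetric])

lemma hk_has_derivative:
 assumes "posdef A"
 shows "(hk A has_derivative (\<lambda>e. - (1/2) * (y \<bullet> (matrix_inv A *v e)) * hk A y)) (at y)"
proof -
 have "((\<lambda>y. y \<bullet> (matrix_inv A *v y)) has_derivative (\<lambda>e. y \<bullet> (matrix_inv A *v e) + e \<bullet> (matrix_inv A *v y))) (at y)"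
  by (intro has_derivative_inner has_derivative_ident bounded_linear_imp_has_derivative matrix_vector_mul_bounded_linear)
 then have "((\<lambda>y. y \<bullet> (matrix_inv A *v y)) has_derivative (\<lambda>e. 2 * (y \<bullet> (matrix_inv A *v e)))) (at y)"
 proof (rule has_derivative_eq_rhs)
  have "e \<bullet> (matrix_inv A *v y) = y \<bullet> (matrix_inv A *v e)" for e
   using matrix_inv_symmetric_inner[OF assms, of e y] by (simp add: inner_commute)
  then show "(\<lambda>e. y \<bullet> (matrix_inv A *v e) + e \<bullet> (matrix_inv A *v y)) = (\<lambda>e. 2 * (y \<bullet> (matrix_inv A *v e)))" by simp
 qed
 moreover have "((\<lambda>u. exp (- u / 4) / hZ A) has_real_derivative (- (1/4) * (exp (- u / 4) / hZ A))) (at u)" for u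
  using hZ_pos[OF assms] by (auto intro!: derivative_eq_intros)
 ultimately have "((\<lambda>y. exp (- (y \<bullet> (matrix_inv A *v y)) / 4) / hZ A) has_derivative
   (\<lambda>e. - (1/4) * (exp (- (y \<bullet> (matrix_inv A *v y)) / 4) / hZ A) * (2 * (y \<bullet> (matrix_inv A *v e))))) (at y)"
  unfolding has_field_derivative_def by (rule has_derivative_compose)
 then show ?thesis unfolding hk_def[abs_def] hker_def
  by (rule has_derivative_eq_rhs) (simp add: fun_eq_iff)
qed

lemma heat_wt_integrable:
 assumes "posdef A" shows "integrable lborel (heat_wt B A)"
proof -
 have "integrable (lborel \<Otimes>\<^sub>M lborel) (\<lambda>(r, y). indicator {0<..<B} r * hk A y)"
 proof (rule lborel_pair.Fubini_integrable)
  have "integrable lborel (indicat_real {0<..<B})"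
   using emeasure_bounded_finite[of "{0<..<B}"] by (intro integrable_real_indicator) auto
  then show "integrable lborel (\<lambda>r. LB y. norm (case (r, y) of (r, y) \<Rightarrow> indicator {0<..<B} r * hk A y))"
   using hk_integrable(3)[OF assms] hk_pos[OF assms] by (simp add: abs_mult less_imp_le)
 qed (use hk_integrable[OF assms] in \<open>auto simp: split_beta'\<close>)
 then show ?thesis by (simp add: lborel_prod heat_wt_def[abs_def] split_beta')
qed

lemma dd_heat_pot:
 "posdef A \<Longrightarrow> G \<in> test_functions \<Omega> \<Longrightarrow> dd e (heat_pot B A G) = heat_pot B A (dd e G)"
 unfolding heat_pot_def by (rule dd_wconv[OF heat_wt_integrable heat_map_measurable])

lemma smooth_heat_pot:
 "posdef A \<Longrightarrow> G \<in> test_functions \<Omega> \<Longrightarrow> smooth (heat_pot B A G)"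
 unfolding heat_pot_def by (rule smooth_wconv[OF heat_wt_integrable heat_map_measurable])

lemma heat_pot_iterated:
 assumes A: "posdef A" and G: "G \<in> test_functions \<Omega>"
 shows "heat_pot B A G (t, x) = (LB r. indicator {0<..<B} r * (LB y. hk A y * G (t - r, x - sqrt r *\<^sub>R y)))"
  and "integrable lborel (\<lambda>r. indicator {0<..<B} r * (LB y. hk A y * G (t - r, x - sqrt r *\<^sub>R y)))"
proof -
 let ?f = "\<lambda>q. heat_wt B A q * G ((t, x) - heat_map q)"
 have i: "integrable (lborel \<Otimes>\<^sub>M lborel) ?f"
  using wconv_test_integrable[OF heat_wt_integrable[OF A] heat_map_measurable G] by (simp add: lborel_prod)
 have eq: "(LB y. ?f (r, y)) = indicator {0<..<B} r * (LB y. hk A y * G (t - r, x - sqrt r *\<^sub>R y))" for r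
  by (simp add: heat_wt_def heat_map_def mult.assoc)
 show "heat_pot B A G (t, x) = (LB r. indicator {0<..<B} r * (LB y. hk A y * G (t - r, x - sqrt r *\<^sub>R y)))"
  using lborel_pair.integral_fst'[OF i] unfolding eq by (simp add: heat_pot_def wconv_def lborel_prod)
 show "integrable lborel (\<lambda>r. indicator {0<..<B} r * (LB y. hk A y * G (t - r, x - sqrt r *\<^sub>R y)))"
  using lborel_pair.integrable_fst'[OF i] unfolding eq .
qed

lemma dd_pair_sum:
 fixes G :: "real \<times> (real^'n) \<Rightarrow> real"
 assumes "smooth G"
 shows "dd (a, y) G p = a * dd (1, 0) G p + (\<Sum>i\<in>UNIV. y $ i * dd (0, axis i 1) G p)"
proof -
 interpret l: linear "\<lambda>e. dd e G p" by (rule smooth_linear_dd[OF assms])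
 have "(0, y) = (\<Sum>i\<in>UNIV. y $ i *\<^sub>R (0::real, axis i 1 :: real^'n))"
  using basis_expansion[of y] by (simp add: scalar_mult_eq_scaleR sum_prod[symmetric] prod_eq_iff fst_sum snd_sum)
 then have "dd (0, y) G p = (\<Sum>i\<in>UNIV. y $ i * dd (0, axis i 1) G p)"
  by (simp add: l.sum l.scale del: scaleR_Pair)
 moreover have "dd (a, y) G p = dd (a *\<^sub>R (1, 0) + (0, y)) G p" by simp
 then have "dd (a, y) G p = a * dd (1, 0) G p + dd (0, y) G p" by (simp only: l.add l.scale real_scaleR_def)
 ultimately show ?thesis by simp
qed

text \<open>The derivative of \<open>hk A\<close> in the direction \<open>A *v axis j 1\<close> is
  \<open>- y $ j / 2\<close> times \<open>hk A\<close>. So a factor \<open>y $ j\<close> can be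
  traded for a derivative of \<open>G\<close>. This converts the first-order term produced by
  differentiating \<open>sqrt r\<close> into the second-order part of the heat operator.\<close>

lemma heat_kernel_ibp:
 fixes A :: "real^'n^'n"
 assumes A: "posdef A" and G: "G \<in> test_functions \<Omega>"
 shows "(LB y. hk A y * (\<Sum>j\<in>UNIV. y $ j * dd (0, axis j 1) G (s :: real, x - \<rho> *\<^sub>R y)))
  = - 2 * \<rho> * (LB y. hk A y * (\<Sum>i\<in>UNIV. \<Sum>j\<in>UNIV. A $ i $ j * dd (0, axis i 1) (dd (0, axis j 1) G) (s, x - \<rho> *\<^sub>R y)))"
proof -
 let ?c = "\<lambda>y. (s, x - \<rho> *\<^sub>R y)"
 have cont: "continuous_on UNIV (\<lambda>y. g (?c y))" if "smooth g" for g :: "real \<times> (real^'n) \<Rightarrow> real"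
  by (rule continuous_on_compose2[OF smooth_continuous_on[OF that, of UNIV]]) (auto intro!: continuous_intros)
 have chk: "continuous_on UNIV (hk A)"
  unfolding hk_def using hZ_pos[OF A] by (intro continuous_intros continuous_hker) auto
 have bint: "integrable lborel (\<lambda>y. h y * g (?c y))"
  if h: "integrable lborel h" and g: "g \<in> test_functions \<Omega>" for h :: "real^'n \<Rightarrow> real" and g
 proof (rule test_bounded[OF g])
  fix M assume M: "M > 0" "\<And>z. \<bar>g z\<bar> \<le> M"
  show ?thesis
  proof (rule Bochner_Integration.integrable_bound)
   show "integrable lborel (\<lambda>y. M * h y)" using h by simp
   show "AE y in lborel. norm (h y * g (?c y)) \<le> norm (M * h y)"
    using M by (auto simp: abs_mult mult.commute[of M] intro!: mult_left_mono)
   show "(\<lambda>y. h y * g (?c y)) \<in> borel_measurable lborel"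
    using borel_measurable_integrable[OF h] borel_measurable_continuous_onI[OF cont[OF test_smooth[OF g]]] by simp
  qed
 qed
 have ymom: "integrable lborel (\<lambda>y. y $ j * hk A y)" for j
 proof (rule Bochner_Integration.integrable_bound[OF hk_integrable(2)[OF A]])
  show "AE y in lborel. norm (y $ j * hk A y) \<le> norm ((1 + norm y) * hk A y)"
  proof (rule AE_I2)
   fix y :: "real^'n"
   have "\<bar>y $ j\<bar> * \<bar>hk A y\<bar> \<le> (1 + norm y) * \<bar>hk A y\<bar>"
    using component_le_norm_cart[of y j] by (intro mult_right_mono) auto
   then show "norm (y $ j * hk A y) \<le> norm ((1 + norm y) * hk A y)" by (simp add: abs_mult)
  qed
 qed measurable
 have step: "(LB y. hk A y * (y $ j * dd (0, axis j 1) G (?c y)))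
   = - 2 * \<rho> * (LB y. hk A y * (\<Sum>i\<in>UNIV. A $ i $ j * dd (0, axis i 1) (dd (0, axis j 1) G) (?c y)))"
  (is "?L = - 2 * \<rho> * ?R") for j
 proof -
  define g where "g = dd (0, axis j 1) G"
  have g: "g \<in> test_functions \<Omega>" "smooth g" using test_dd[OF G] test_smooth by (auto simp: g_def)
  define v where "v = A *v axis j 1"
  have v: "v $ i = A $ i $ j" for i by (simp add: v_def matrix_vector_mult_basis column_def)
  define F' where "F' y e = hk A y * dd (0, - \<rho> *\<^sub>R e) g (?c y) + - (1/2) * (y \<bullet> (matrix_inv A *v e)) * hk A y * g (?c y)" for y e
  have dg: "((\<lambda>y. g (?c y)) has_derivative (\<lambda>e. dd (0, - \<rho> *\<^sub>R e) g (?c y))) (at y)" for y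
   by (rule has_derivative_compose[OF _ smooth_has_derivative[OF g(2)]]) (auto intro!: derivative_eq_intros)
  have Fv: "F' y v = - \<rho> * (hk A y * dd (0, v) g (?c y)) - (1/2) * (hk A y * (y $ j * g (?c y)))" for y
  proof -
   have "y \<bullet> (matrix_inv A *v v) = y $ j"
    by (simp add: v_def matrix_inv_mult[OF posdef_invertible[OF A]] inner_axis)
   moreover have "dd (0, - \<rho> *\<^sub>R v) g (?c y) = - \<rho> * dd (0, v) g (?c y)"
    using linear_scale[OF smooth_linear_dd[OF g(2)], of "- \<rho>" "(0, v)"] by simp
   ultimately show ?thesis by (simp add: F'_def)
  qed
  have ddv: "dd (0, v) g p = (\<Sum>i\<in>UNIV. A $ i $ j * dd (0, axis i 1) g p)" for p
   using dd_pair_sum[OF g(2), of 0 v p] by (simp add: v)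
  have i1: "integrable lborel (\<lambda>y. hk A y * dd (0, v) g (?c y))"
   by (rule bint[OF hk_integrable(1)[OF A] test_dd[OF g(1)]])
  have i2: "integrable lborel (\<lambda>y. hk A y * (y $ j * g (?c y)))"
   using bint[OF ymom[of j] g(1)] by (simp add: mult_ac)
  have "(LB y. F' y v) = 0"
  proof (rule integral_derivative_eq_0[where F="\<lambda>y. hk A y * g (?c y)"])
   show "((\<lambda>y. hk A y * g (?c y)) has_derivative F' y) (at y)" for y
    unfolding F'_def by (rule has_derivative_mult[OF hk_has_derivative[OF A] dg])
   show "integrable lborel (\<lambda>y. hk A y * g (?c y))" by (rule bint[OF hk_integrable(1)[OF A] g(1)])
   show "integrable lborel (\<lambda>y. F' y v)" unfolding Fv using i1 i2 by simp
   show "continuous_on UNIV (\<lambda>y. F' y v)" unfolding Fv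
    by (intro continuous_intros chk cont g smooth_dd)
  qed
  then have "- \<rho> * (LB y. hk A y * dd (0, v) g (?c y)) - (1/2) * (LB y. hk A y * (y $ j * g (?c y))) = 0"
   unfolding Fv using i1 i2 by simp
  then show ?thesis unfolding g_def[symmetric] ddv[symmetric] by simp
 qed
 have "(LB y. hk A y * (\<Sum>j\<in>UNIV. y $ j * dd (0, axis j 1) G (?c y)))
  = (\<Sum>j\<in>UNIV. LB y. hk A y * (y $ j * dd (0, axis j 1) G (?c y)))"
  unfolding sum_distrib_left using bint[OF ymom test_dd[OF G]]
  by (intro Bochner_Integration.integral_sum) (simp add: mult_ac)
 also have "\<dots> = - 2 * \<rho> * (\<Sum>j\<in>UNIV. LB y. hk A y * (\<Sum>i\<in>UNIV. A $ i $ j * dd (0, axis i 1) (dd (0, axis j 1) G) (?c y)))"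
  unfolding step by (simp add: sum_distrib_left)
 also have "(\<Sum>j\<in>UNIV. LB y. hk A y * (\<Sum>i\<in>UNIV. A $ i $ j * dd (0, axis i 1) (dd (0, axis j 1) G) (?c y)))
  = (LB y. (\<Sum>j\<in>UNIV. hk A y * (\<Sum>i\<in>UNIV. A $ i $ j * dd (0, axis i 1) (dd (0, axis j 1) G) (?c y))))"
 proof (intro Bochner_Integration.integral_sum[symmetric])
  fix j
  have "integrable lborel (\<lambda>y. \<Sum>i\<in>UNIV. A $ i $ j * (hk A y * dd (0, axis i 1) (dd (0, axis j 1) G) (?c y)))"
   by (intro Bochner_Integration.integrable_sum integrable_mult_right bint hk_integrable A test_dd G)
  then show "integrable lborel (\<lambda>y. hk A y * (\<Sum>i\<in>UNIV. A $ i $ j * dd (0, axis i 1) (dd (0, axis j 1) G) (?c y)))"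
   by (simp add: sum_distrib_left mult_ac)
 qed
 also have "(\<lambda>y. (\<Sum>j\<in>UNIV. hk A y * (\<Sum>i\<in>UNIV. A $ i $ j * dd (0, axis i 1) (dd (0, axis j 1) G) (?c y))))
  = (\<lambda>y. hk A y * (\<Sum>i\<in>UNIV. \<Sum>j\<in>UNIV. A $ i $ j * dd (0, axis i 1) (dd (0, axis j 1) G) (?c y)))"
  by (rule ext, subst sum.swap) (simp add: sum_distrib_left)
 finally show ?thesis .
qed

lemma test_heat_op:
 assumes "G \<in> test_functions \<Omega>" shows "heat_op A G \<in> test_functions \<Omega>"
proof -
 have "(\<lambda>p. dd (1, 0) G p + (\<lambda>_. - 1) p * (\<Sum>i\<in>UNIV. \<Sum>j\<in>UNIV. (\<lambda>_. A $ i $ j) p * dd (0, axis i 1) (dd (0, axis j 1) G) p)) \<in> test_functions \<Omega>"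
  by (intro test_add test_sum test_mult test_dd assms smooth_const)
 then show ?thesis by (simp add: heat_op_def[abs_def])
qed

text \<open>Let \<open>m r\<close> be the average of \<open>G\<close> over the heat kernel at the
  time \<open>r\<close> before \<open>t\<close>. Then \<open>m\<close> starts at
  \<open>G (t, x)\<close> and has derivative \<open>- h\<close>, where the integral of
  \<open>h\<close> is the potential. It ends at zero because \<open>t - B \<le> 0\<close> and
  \<open>G\<close> vanishes at such times, so the truncation at \<open>B\<close> loses
  nothing.\<close>

lemma heat_pot_heat_op:
 fixes A :: "real^'n^'n"
 assumes A: "posdef A" and G: "G \<in> test_functions \<Omega>" and G0: "\<And>s y. s \<le> 0 \<Longrightarrow> G (s, y) = 0"
  and B: "0 < B" "t \<le> B"
 shows "heat_pot B A (heat_op A G) (t, x) = G (t, x)"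
proof -
 let ?c = "\<lambda>r y. (t - r, x - sqrt r *\<^sub>R y)"
 define m where "m r = (LB y. hk A y * G (?c r y))" for r
 define h where "h r = (LB y. hk A y * heat_op A G (?c r y))" for r
 have sG: "smooth G" by (rule test_smooth[OF G])
 have cont: "continuous_on UNIV (\<lambda>y. g (?c r y))" if "smooth g" for r and g :: "real \<times> (real^'n) \<Rightarrow> real"
  by (rule continuous_on_compose2[OF smooth_continuous_on[OF that, of UNIV]]) (auto intro!: continuous_intros)
 have meas: "(\<lambda>y. g (?c r y)) \<in> borel_measurable borel" if "smooth g" for r and g :: "real \<times> (real^'n) \<Rightarrow> real"
  by (rule borel_measurable_continuous_onI[OF cont[OF that]])
 have bint: "integrable lborel (\<lambda>y. hk A y * g (?c r y))" if g: "g \<in> test_functions \<Omega>" for r g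
 proof (rule test_bounded[OF g])
  fix M assume M: "M > 0" "\<And>z. \<bar>g z\<bar> \<le> M"
  show ?thesis
  proof (rule Bochner_Integration.integrable_bound)
   show "integrable lborel (\<lambda>y. M * hk A y)" using hk_integrable[OF A] by simp
   show "AE y in lborel. norm (hk A y * g (?c r y)) \<le> norm (M * hk A y)"
    using M by (auto simp: abs_mult mult.commute[of M] intro!: mult_left_mono)
   show "(\<lambda>y. hk A y * g (?c r y)) \<in> borel_measurable lborel"
    using meas[OF test_smooth[OF g]] by simp
  qed
 qed
 obtain M where M: "M > 0" "\<And>x e. \<bar>dd e G x\<bar> \<le> M * norm e" using test_derivative_bounded[OF G] by blast
 have der: "(m has_real_derivative - h r0) (at r0)" if r0: "r0 \<in> {0<..<B}" for r0
 proof -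
  define f' where "f' r y = hk A y * dd (- 1, - (1/(2 * sqrt r)) *\<^sub>R y) G (?c r y)" for r y
  \<comment> \<open>The derivative of \<open>sqrt r\<close> blows up at 0; a dominating function
    exists only on an interval bounded away from 0.\<close>
  define a where "a = r0 / 2"
  have a: "a > 0" "r0 \<in> {a<..<B}" using r0 by (auto simp: a_def)
  have sqa: "1 / (2 * sqrt r) \<le> 1 / (2 * sqrt a)" if "r \<in> {a<..<B}" for r
   using that a by (intro divide_left_mono mult_left_mono mult_pos_pos) auto
  have "((\<lambda>r. LB y. hk A y * G (?c r y)) has_real_derivative (LB y. f' r0 y)) (at r0)"
  proof (rule has_real_derivative_integral_dominated[OF a(2), where w="\<lambda>y. M * (1 + 1 / (2 * sqrt a)) * ((1 + norm y) * hk A y)"])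
   show "integrable lborel (\<lambda>y. hk A y * G (?c r y))" for r by (rule bint[OF G])
   show "((\<lambda>r. hk A y * G (?c r y)) has_real_derivative f' r y) (at r)" if "r \<in> {a<..<B}" for r y
   proof -
    have r: "r > 0" using that a by auto
    have "((\<lambda>r. ?c r y) has_derivative (\<lambda>h. (- h, - ((inverse (sqrt r) / 2 * h) *\<^sub>R y)))) (at r)"
     using r by (auto intro!: derivative_eq_intros DERIV_real_sqrt[THEN has_field_derivative_imp_has_derivative] simp: fun_eq_iff)
    from has_derivative_compose[OF this smooth_has_derivative[OF sG]]
    have "((\<lambda>r. G (?c r y)) has_derivative (\<lambda>h. dd (- h, - ((inverse (sqrt r) / 2 * h) *\<^sub>R y)) G (?c r y))) (at r)" .
    moreover have "dd (- h, - ((inverse (sqrt r) / 2 * h) *\<^sub>R y)) G (?c r y) = dd (- 1, - (1/(2 * sqrt r)) *\<^sub>R y) G (?c r y) * h" for h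
     using linear_scale[OF smooth_linear_dd[OF sG], of h "(- 1, - (1/(2 * sqrt r)) *\<^sub>R y)" "?c r y"]
     by (simp add: field_simps)
    ultimately have "((\<lambda>r. G (?c r y)) has_real_derivative dd (- 1, - (1/(2 * sqrt r)) *\<^sub>R y) G (?c r y)) (at r)"
     by (simp add: has_field_derivative_def)
    then show ?thesis unfolding f'_def by (rule DERIV_cmult)
   qed
   show "\<bar>f' r y\<bar> \<le> M * (1 + 1 / (2 * sqrt a)) * ((1 + norm y) * hk A y)" if r: "r \<in> {a<..<B}" for r y
   proof -
    have "norm (- 1 :: real, - (1/(2 * sqrt r)) *\<^sub>R y) \<le> 1 + 1/(2 * sqrt r) * norm y"
     using norm_Pair_le[of "- 1 :: real" "- (1/(2 * sqrt r)) *\<^sub>R y"] r a by simp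
    also have "\<dots> \<le> 1 + 1/(2 * sqrt a) * norm y" using sqa[OF r] by (intro add_left_mono mult_right_mono) auto
    also have "\<dots> \<le> (1 + 1 / (2 * sqrt a)) * (1 + norm y)"
    proof -
     have "1 + k * norm y \<le> (1 + k) * (1 + norm y)" if "k \<ge> 0" for k
      using that by (simp add: algebra_simps)
     from this[of "1 / (2 * sqrt a)"] show ?thesis using a by simp
    qed
    finally have "norm (- 1 :: real, - (1/(2 * sqrt r)) *\<^sub>R y) \<le> (1 + 1 / (2 * sqrt a)) * (1 + norm y)" .
    then have "\<bar>dd (- 1, - (1/(2 * sqrt r)) *\<^sub>R y) G (?c r y)\<bar> \<le> M * ((1 + 1 / (2 * sqrt a)) * (1 + norm y))"
     by (intro order_trans[OF M(2)] mult_left_mono) (use M in auto)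
    then have "hk A y * \<bar>dd (- 1, - (1/(2 * sqrt r)) *\<^sub>R y) G (?c r y)\<bar> \<le> hk A y * (M * ((1 + 1 / (2 * sqrt a)) * (1 + norm y)))"
     by (intro mult_left_mono) (use hk_pos[OF A] in \<open>auto intro: less_imp_le\<close>)
    then show ?thesis using hk_pos[OF A, of y] by (simp add: f'_def abs_mult mult_ac)
   qed
   show "integrable lborel (\<lambda>y. M * (1 + 1 / (2 * sqrt a)) * ((1 + norm y) * hk A y))"
    using hk_integrable(2)[OF A] by (rule integrable_mult_right)
   have "f' r0 = (\<lambda>y. hk A y * (- dd (1, 0) G (?c r0 y) + (\<Sum>i\<in>UNIV. (- (1/(2 * sqrt r0)) * y $ i) * dd (0, axis i 1) G (?c r0 y))))"
    unfolding f'_def by (subst dd_pair_sum[OF sG]) simp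
   also have "\<dots> \<in> borel_measurable borel"
    using meas[OF smooth_dd[OF sG]] by (intro borel_measurable_times borel_measurable_add borel_measurable_sum) auto
   finally show "f' r0 \<in> borel_measurable borel" .
  qed
  moreover have "(LB y. f' r0 y) = - h r0"
  proof -
   let ?S = "\<lambda>y. \<Sum>j\<in>UNIV. y $ j * dd (0, axis j 1) G (?c r0 y)"
   let ?H = "\<lambda>y. \<Sum>i\<in>UNIV. \<Sum>j\<in>UNIV. A $ i $ j * dd (0, axis i 1) (dd (0, axis j 1) G) (?c r0 y)"
   have f': "f' r0 y = - (hk A y * dd (1, 0) G (?c r0 y)) - (1/(2 * sqrt r0)) * (hk A y * ?S y)" for y
    unfolding f'_def by (subst dd_pair_sum[OF sG]) (simp add: algebra_simps sum_distrib_left sum_negf)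
   have iS: "integrable lborel (\<lambda>y. hk A y * ?S y)"
   proof -
    have "integrable lborel (\<lambda>y. hk A y * (y $ j * dd (0, axis j 1) G (?c r0 y)))" for j
    proof (rule Bochner_Integration.integrable_bound)
     show "integrable lborel (\<lambda>y. M * ((1 + norm y) * hk A y))" using hk_integrable(2)[OF A] by (rule integrable_mult_right)
     show "AE y in lborel. norm (hk A y * (y $ j * dd (0, axis j 1) G (?c r0 y))) \<le> norm (M * ((1 + norm y) * hk A y))"
     proof (rule AE_I2)
      fix y :: "real^'n"
      have "\<bar>y $ j\<bar> * \<bar>dd (0, axis j 1) G (?c r0 y)\<bar> \<le> (1 + norm y) * M"
       using M(2)[of "(0, axis j 1)"] component_le_norm_cart[of y j] by (intro mult_mono) auto
      then have "hk A y * (\<bar>y $ j\<bar> * \<bar>dd (0, axis j 1) G (?c r0 y)\<bar>) \<le> hk A y * ((1 + norm y) * M)"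
       by (intro mult_left_mono) (use hk_pos[OF A] in \<open>auto intro: less_imp_le\<close>)
      then show "norm (hk A y * (y $ j * dd (0, axis j 1) G (?c r0 y))) \<le> norm (M * ((1 + norm y) * hk A y))"
       using hk_pos[OF A, of y] M by (simp add: abs_mult mult_ac)
     qed
     show "(\<lambda>y. hk A y * (y $ j * dd (0, axis j 1) G (?c r0 y))) \<in> borel_measurable lborel"
      using meas[OF smooth_dd[OF sG]] by simp
    qed
    then show ?thesis unfolding sum_distrib_left by (intro Bochner_Integration.integrable_sum)
   qed
   have iH: "integrable lborel (\<lambda>y. hk A y * ?H y)"
   proof -
    have "integrable lborel (\<lambda>y. \<Sum>i\<in>UNIV. \<Sum>j\<in>UNIV. A $ i $ j * (hk A y * dd (0, axis i 1) (dd (0, axis j 1) G) (?c r0 y)))"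
     by (intro Bochner_Integration.integrable_sum integrable_mult_right bint test_dd G)
    then show ?thesis by (simp add: sum_distrib_left mult_ac)
   qed
   have "(LB y. f' r0 y) = - (LB y. hk A y * dd (1, 0) G (?c r0 y)) - (1/(2 * sqrt r0)) * (LB y. hk A y * ?S y)"
    unfolding f' using iS bint[OF test_dd[OF G]] by simp
   also have "(LB y. hk A y * ?S y) = - 2 * sqrt r0 * (LB y. hk A y * ?H y)"
    by (rule heat_kernel_ibp[OF A G])
   also have "- (LB y. hk A y * dd (1, 0) G (?c r0 y)) - (1/(2 * sqrt r0)) * (- 2 * sqrt r0 * (LB y. hk A y * ?H y))
    = - ((LB y. hk A y * dd (1, 0) G (?c r0 y)) - (LB y. hk A y * ?H y))"
    using r0 by simp
   also have "\<dots> = - h r0"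
    unfolding h_def heat_op_def right_diff_distrib
    using iH bint[OF test_dd[OF G]] by simp
   finally show ?thesis .
  qed
  ultimately show ?thesis by (simp add: m_def[abs_def])
 qed
 have mcont: "continuous_on {0..B} m"
  unfolding continuous_on_sequentially
 proof (intro allI ballI impI)
  fix X r assume X: "(\<forall>n. X n \<in> {0..B}) \<and> X \<longlonglongrightarrow> r"
  obtain K where K: "\<And>z. \<bar>G z\<bar> \<le> K" using test_bounded[OF G] by blast
  have "(\<lambda>n. m (X n)) \<longlonglongrightarrow> m r" unfolding m_def
  proof (rule integral_dominated_convergence[where w="\<lambda>y. K * hk A y"])
   show "AE y in lborel. (\<lambda>i. hk A y * G (?c (X i) y)) \<longlonglongrightarrow> hk A y * G (?c r y)"
    using X by (intro AE_I2 tendsto_mult tendsto_const isCont_tendsto_compose[of _ G] tendsto_intros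
      continuous_on_interior[OF smooth_continuous_on[OF sG, of UNIV]]) auto
   show "AE y in lborel. norm (hk A y * G (?c (X i) y)) \<le> K * hk A y" for i
    using K hk_pos[OF A] by (auto simp: abs_mult mult.commute[of K] less_imp_le intro!: mult_left_mono)
  qed (use hk_integrable[OF A] meas[OF sG] in auto)
  then show "(m \<circ> X) \<longlonglongrightarrow> m r" by (simp add: o_def)
 qed
 \<comment> \<open>Differentiability of \<open>m\<close> is known in the interior only, so the
   fundamental theorem is used in the version that asks for continuity at the endpoints.\<close>
 have "(h has_integral (- m B - (- m 0))) {0..B}"
 proof (rule fundamental_theorem_of_calculus_interior)
  show "((\<lambda>r. - m r) has_vector_derivative h r) (at r)" if "r \<in> {0<..<B}" for r
   using DERIV_minus[OF der[OF that]] by (simp add: has_real_derivative_iff_has_vector_derivative)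
 qed (use B mcont in \<open>auto intro: continuous_intros\<close>)
 moreover have "m B = 0" unfolding m_def using G0 B by simp
 moreover have "m 0 = G (t, x)" unfolding m_def using hk_integrable(3)[OF A] by simp
 ultimately have "(h has_integral G (t, x)) {0..B}" by simp
 then have H: "(h has_integral G (t, x)) {0<..<B}"
  by (simp add: has_integral_Icc_iff_Ioo)
 have "set_integrable lborel {0<..<B} h"
  using heat_pot_iterated(2)[OF A test_heat_op[OF G, of A], where B=B and t=t and x=x] by (simp add: set_integrable_def h_def)
 from set_borel_integral_eq_integral(2)[OF this] H
 have "(LINT r:{0<..<B}|lborel. h r) = G (t, x)" by (simp add: integral_unique)
 then show ?thesis
  using heat_pot_iterated(1)[OF A test_heat_op[OF G, of A], where B=B and t=t and x=x] by (simp add: set_lebesgue_integral_def h_def)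
qed

section \<open>The weighted Schur test for the heat potential\<close>

lemma fst_borel [measurable]: "fst \<in> borel_measurable (borel :: ('a::second_countable_topology \<times> 'b::second_countable_topology) measure)"
 and snd_borel [measurable]: "snd \<in> borel_measurable (borel :: ('a \<times> 'b) measure)"
 by (auto intro!: borel_measurable_continuous_onI continuous_intros)

lemma nn_integral_scale:
 fixes f :: "'a::euclidean_space \<Rightarrow> ennreal"
 assumes [measurable]: "f \<in> borel_measurable borel" and c: "c > 0"
 shows "(NN x. f x) = ennreal (c ^ DIM('a)) * (NN x. f (c *\<^sub>R x))"
proof -
 have "(NN x. f x) = (\<integral>\<^sup>+x. f x \<partial>density (distr lborel borel (\<lambda>x. 0 + c *\<^sub>R x)) (\<lambda>_. \<bar>c\<bar> ^ DIM('a)))"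
  using lborel_affine[of c "0 :: 'a"] c by simp
 also have "\<dots> = ennreal (c ^ DIM('a)) * (NN x. f (c *\<^sub>R x))"
  using c by (simp add: nn_integral_density nn_integral_distr nn_integral_cmult)
 finally show ?thesis .
qed

lemma nn_integral_reflect:
 fixes f :: "'a::euclidean_space \<Rightarrow> ennreal"
 assumes [measurable]: "f \<in> borel_measurable borel"
 shows "(NN y. f (x - y)) = (NN x. f x)"
proof -
 have "(NN y. f y) = (\<integral>\<^sup>+y. f y \<partial>density (distr lborel borel (\<lambda>y. x + (- 1) *\<^sub>R y)) (\<lambda>_. ennreal (\<bar>- 1\<bar> ^ DIM('a))))"
  using lborel_affine[of "- 1" x] by simp
 also have "\<dots> = (NN y. f (x - y))"
  by (simp add: nn_integral_density nn_integral_distr)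
 finally show ?thesis by simp
qed

lemma nn_integral_lborel_pair:
 fixes f :: "'a::euclidean_space \<times> 'b::euclidean_space \<Rightarrow> ennreal"
 assumes [measurable]: "f \<in> borel_measurable borel"
 shows "(NN p. f p) = (NN t. NN x. f (t, x))"
proof -
 have "(NN t. NN x. f (t, x)) = integral\<^sup>N (lborel \<Otimes>\<^sub>M lborel) f"
  by (rule lborel.nn_integral_fst) (simp add: lborel_prod)
 then show ?thesis by (simp add: lborel_prod)
qed

lemma nn_integral_powr_0:
 assumes "t > 0"
 shows "(NN s. ennreal (indicator {0<..<t} s * s powr (-1/2))) = ennreal (2 * t powr (1/2))"
proof -
 have h: "((\<lambda>s. s powr (-1/2)) has_integral (t powr (-1/2 + 1) / (-1/2 + 1))) {0..t}"
  using assms by (intro has_integral_powr_from_0) auto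
 have "(NN s. ennreal (indicator {0<..<t} s * s powr (-1/2))) = (\<integral>\<^sup>+s\<in>{0<..<t}. ennreal (s powr (-1/2)) \<partial>lborel)"
  by (intro nn_integral_cong) (auto simp: indicator_def)
 also have "\<dots> = ennreal (t powr (-1/2 + 1) / (-1/2 + 1))"
  by (rule nn_integral_has_integral_lebesgue') (use h in \<open>auto simp: has_integral_Icc_iff_Ioo\<close>)
 finally show ?thesis by (simp add: mult.commute)
qed

lemma nn_integral_powr_inf:
 assumes "s > 0" "e < - 1"
 shows "(NN t. ennreal (indicator {s<..} t * t powr e)) \<le> ennreal (s powr (e + 1) / (- e - 1))"
proof -
 have h: "((\<lambda>t. t powr e) has_integral (- (s powr (e + 1)) / (e + 1))) {s..}"
  using assms by (intro has_integral_powr_to_inf) auto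
 have "(NN t. ennreal (indicator {s<..} t * t powr e)) \<le> (\<integral>\<^sup>+t\<in>{s..}. ennreal (t powr e) \<partial>lborel)"
  by (intro nn_integral_mono) (auto simp: indicator_def)
 also have "\<dots> = ennreal (- (s powr (e + 1)) / (e + 1))"
  by (rule nn_integral_has_integral_lebesgue') (use h in auto)
 also have "- (s powr (e + 1)) / (e + 1) = s powr (e + 1) / (- e - 1)"
  using assms by (simp add: field_simps)
 finally show ?thesis .
qed

text \<open>\<open>lam\<close> is any positive lower bound of the gap. It is later taken to be
  \<open>lambda_min (a - A)\<close> for finiteness, and \<open>inverse M\<close> for the uniform
  bound.\<close>

locale parab =
 fixes a A :: "real^'n^'n" and l L lam \<alpha> :: real
 assumes a: "posdef a" and A: "posdef A" and l: "0 < l"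
  and ea: "elliptic l L a" and eA: "elliptic l L A"
  and lam: "0 < lam" and gap: "\<And>x. lam * (x \<bullet> x) \<le> x \<bullet> ((a - A) *v x)"
  and \<alpha>: "0 \<le> \<alpha>"
begin

definition Q :: "real^'n \<Rightarrow> real" where "Q z = z \<bullet> (matrix_inv a *v z)"

text \<open>A factor with \<open>A \<le> \<theta> a\<close> as quadratic forms. The gap would allow
  \<open>1 - lam / L\<close>; halving \<open>lam / L\<close> keeps \<open>\<theta>\<close> above
  1/2, hence \<open>\<kappa>\<close> below 1/2.\<close>

definition \<theta> :: real where "\<theta> = 1 - lam / (2 * L)"

text \<open>Decay rate of the heat kernel of \<open>A\<close> measured by the form \<open>Q\<close>
  of \<open>a\<close>. Two such factors beat the dual weight because \<open>\<kappa> > 1/4\<close>;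
  the bound \<open>\<kappa> < 1/2\<close> gives \<open>Schur2\<close> the sign it needs for
  convexity.\<close>

definition \<kappa> :: real where "\<kappa> = 1 / (4 * \<theta>)"

definition d :: real where "d = real CARD('n)"

definition J :: real where "J = (LB z. exp (- Q z))"

lemma L_bounds: "l \<le> L" "lam < L" "0 < L"
proof -
 let ?x = "axis undefined 1 :: real^'n"
 have x: "?x \<bullet> ?x = 1" by (simp add: inner_axis_axis)
 show 1: "l \<le> L" using ea x unfolding elliptic_def by (metis mult.right_neutral order_trans)
 have "lam \<le> ?x \<bullet> (a *v ?x) - ?x \<bullet> (A *v ?x)"
  using gap[of ?x] x by (simp add: matrix_vector_mult_diff_rdistrib inner_diff_right)
 moreover have "?x \<bullet> (a *v ?x) \<le> L" using ea x unfolding elliptic_def by (metis mult.right_neutral)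
 moreover have "l \<le> ?x \<bullet> (A *v ?x)" using eA x unfolding elliptic_def by (metis mult.right_neutral)
 ultimately show "lam < L" using l by linarith
 show "0 < L" using 1 l by simp
qed

lemma \<theta>: "1/2 < \<theta>" "\<theta> < 1"
 using L_bounds lam by (auto simp: \<theta>_def field_simps)

lemma \<kappa>: "1/4 < \<kappa>" "\<kappa> < 1/2" "0 < \<kappa>" "0 < 2 * \<kappa> - 1/2"
proof -
 show 1: "1/4 < \<kappa>" using \<theta> by (simp add: \<kappa>_def field_simps)
 show "\<kappa> < 1/2" using \<theta> by (simp add: \<kappa>_def field_simps)
 show "0 < \<kappa>" "0 < 2 * \<kappa> - 1/2" using 1 by simp_all
qed

lemma A_le_theta_a: "x \<bullet> (A *v x) \<le> \<theta> * (x \<bullet> (a *v x))"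
proof -
 have "x \<bullet> (a *v x) \<le> L * (x \<bullet> x)" using ea by (simp add: elliptic_def)
 then have "(lam / L) * (x \<bullet> (a *v x)) \<le> (lam / L) * (L * (x \<bullet> x))"
  using lam L_bounds by (intro mult_left_mono) auto
 also have "\<dots> = lam * (x \<bullet> x)" using L_bounds by simp
 also have "\<dots> \<le> x \<bullet> (a *v x) - x \<bullet> (A *v x)"
  using gap[of x] by (simp add: matrix_vector_mult_diff_rdistrib inner_diff_right)
 finally have 1: "x \<bullet> (A *v x) \<le> (1 - lam / L) * (x \<bullet> (a *v x))" by (simp add: algebra_simps)
 have "x \<bullet> (a *v x) \<ge> 0" using a by (cases "x = 0") (auto simp: posdef_def less_imp_le)
 moreover have "1 - lam / L \<le> \<theta>" using lam L_bounds by (simp add: \<theta>_def field_simps)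
 ultimately show ?thesis using 1 by (meson mult_right_mono order_trans)
qed

lemma Q_kernel: "\<kappa> * Q z \<le> (z \<bullet> (matrix_inv A *v z)) / 4"
 using inverse_quadratic_mono[OF a A _ A_le_theta_a, of z] \<theta> by (simp add: \<kappa>_def Q_def)

lemma Q_bounds: "(x \<bullet> x) / L \<le> Q x" "Q x \<le> (x \<bullet> x) / l" "0 \<le> Q x"
proof -
 show "(x \<bullet> x) / L \<le> Q x" "Q x \<le> (x \<bullet> x) / l"
  using matrix_inv_bounds[OF a ea l L_bounds(3)] by (auto simp: Q_def)
 then show "0 \<le> Q x" using L_bounds by (meson divide_nonneg_pos inner_ge_zero order_trans)
qed

lemma Q_scaleR: "Q (c *\<^sub>R x) = c\<^sup>2 * Q x"
 by (simp add: Q_def matrix_vector_mult_scaleR power2_eq_square)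

lemma Q_diff: "Q (x - y) = Q x - 2 * (x \<bullet> (matrix_inv a *v y)) + Q y"
proof -
 have "y \<bullet> (matrix_inv a *v x) = x \<bullet> (matrix_inv a *v y)"
  using matrix_inv_symmetric_inner[OF a, of y x] by (simp add: inner_commute)
 then show ?thesis
  by (simp add: Q_def matrix_vector_mult_diff_distrib inner_diff_left inner_diff_right)
qed

lemma continuous_Q: "continuous_on S Q"
 unfolding Q_def by (intro continuous_intros)

lemma Q_measurable [measurable]: "Q \<in> borel_measurable borel"
 by (intro borel_measurable_continuous_onI continuous_Q)

text \<open>Completing the square in \<open>y\<close>: a product of Gaussians of ages
  \<open>t - s\<close> and \<open>s\<close> is a Gaussian of age \<open>t\<close> in
  \<open>x\<close> times a Gaussian in \<open>y\<close> centred at \<open>(s/t) x\<close>.\<close>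

lemma Q_identity:
 assumes "0 < s" "s < t"
 shows "Q (x - y) / (t - s) + Q y / s = Q x / t + t / ((t - s) * s) * Q (y - (s/t) *\<^sub>R x)"
proof -
 have "Q (y - (s/t) *\<^sub>R x) = Q y - 2 * (s/t) * (x \<bullet> (matrix_inv a *v y)) + (s/t)\<^sup>2 * Q x"
  using matrix_inv_symmetric_inner[OF a, of y x]
  by (simp add: Q_diff Q_scaleR matrix_vector_mult_scaleR inner_commute)
 then show ?thesis unfolding Q_diff using assms
  by (simp add: field_simps power2_eq_square) algebra
qed

text \<open>Convexity of \<open>(z, t) \<mapsto> Q z / t\<close>, obtained by dropping the square in
  \<open>Q_identity\<close>.\<close>

lemma Q_convex:
 assumes "0 < s" "s < t"
 shows "Q x / t \<le> Q (x - y) / (t - s) + Q y / s"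
 using Q_identity[OF assms, of x y] Q_bounds(3)[of "y - (s/t) *\<^sub>R x"] assms by simp

lemma Q_gauss_integrable: "integrable lborel (\<lambda>z. exp (- Q z))"
proof (rule Bochner_Integration.integrable_bound)
 show "integrable lborel (\<lambda>z::real^'n. exp (- (1/L) * (z \<bullet> z)))"
  using L_bounds by (intro integrable_gauss) simp
qed (use Q_bounds(1) in auto)

lemma J: "0 < J" "J \<le> gauss_int TYPE(real^'n) (1/L)"
proof -
 show "0 < J" unfolding J_def by (intro integral_pos_lborel Q_gauss_integrable) auto
 show "J \<le> gauss_int TYPE(real^'n) (1/L)" unfolding J_def gauss_int_def
  using Q_bounds(1) L_bounds by (intro integral_mono Q_gauss_integrable integrable_gauss) auto
qed

lemma nn_integral_Q:
 assumes s: "s > 0"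
 shows "(NN z. ennreal (exp (- s * Q (z - v)))) = ennreal (s powr (- d/2) * J)"
proof -
 define c where "c = 1 / sqrt s"
 have c: "c > 0" "s * c\<^sup>2 = 1" using s by (auto simp: c_def power2_eq_square)
 have cp: "c ^ CARD('n) = s powr (- d/2)"
 proof -
  have "c = s powr (-1/2)" using s by (simp add: c_def powr_minus_divide powr_half_sqrt)
  then show ?thesis using s by (simp add: powr_power d_def)
 qed
 have "(NN z. ennreal (exp (- s * Q (z - v)))) = (NN z. ennreal (exp (- s * Q z)))"
  using nn_integral_lborel_translate[of "\<lambda>z. ennreal (exp (- s * Q z))" "- v"] by simp
 also have "\<dots> = ennreal (c ^ DIM(real^'n)) * (NN z. ennreal (exp (- s * Q (c *\<^sub>R z))))"
  by (rule nn_integral_scale) (use c in auto)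
 also have "(\<lambda>z. ennreal (exp (- s * Q (c *\<^sub>R z)))) = (\<lambda>z. ennreal (exp (- Q z)))"
  using c(2) by (simp add: Q_scaleR mult.assoc[symmetric])
 also have "(NN z. ennreal (exp (- Q z))) = ennreal J"
  unfolding J_def by (intro nn_integral_eq_integral Q_gauss_integrable) auto
 finally show ?thesis using J by (simp add: cp ennreal_mult)
qed

text \<open>The kernel \<open>Kr\<close> dominates the heat kernel of \<open>A\<close>, up to the constant \<open>1 / hZ A\<close>.\<close>

definition Kr :: "real \<times> (real^'n) \<Rightarrow> real \<times> (real^'n) \<Rightarrow> real" where
 "Kr p q = (if 0 < fst q \<and> fst q < fst p
   then (fst p - fst q) powr (- d/2) * exp (- \<kappa> * Q (snd p - snd q) / (fst p - fst q)) else 0)"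

text \<open>The test function of the Schur test: a Gaussian kernel issued from the origin with an
  extra \<open>t powr (-1/2)\<close>. The Gaussian is reproduced by \<open>Kr\<close>, and this
  extra power makes both time integrals converge, the one from 0 in \<open>Schur1\<close> and the
  one to infinity in \<open>Schur2\<close>.\<close>

definition pt :: "real \<times> (real^'n) \<Rightarrow> real" where
 "pt q = fst q powr (- 1/2 - d/2) * exp (- \<kappa> * Q (snd q) / fst q)"

text \<open>The dual weight: the reciprocal of \<open>t powr \<alpha>\<close> times the Gaussian
  density, up to the constant \<open>ca\<close> introduced later.\<close>

definition \<rho> :: "real \<times> (real^'n) \<Rightarrow> real" where
 "\<rho> p = fst p powr (d/2 - \<alpha>) * exp (Q (snd p) / (2 * fst p))"

lemma Kr_measurable [measurable]: "(\<lambda>(p, q). Kr p q) \<in> borel_measurable (borel \<Otimes>\<^sub>M borel)"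
 unfolding Kr_def by measurable

lemma pt_measurable [measurable]: "pt \<in> borel_measurable borel"
 unfolding pt_def[abs_def] by measurable

lemma \<rho>_measurable [measurable]: "\<rho> \<in> borel_measurable borel"
 unfolding \<rho>_def[abs_def] by measurable

lemma Kr_nonneg: "0 \<le> Kr p q" by (simp add: Kr_def)

text \<open>By \<open>Q_identity\<close> the integral over \<open>y\<close> is a full Gaussian
  integral; the time factors that remain reduce to \<open>s powr (-1/2)\<close>, integrable at 0.
  Nothing is lost, the result is an equality.\<close>

lemma Schur1:
 assumes t: "t > 0"
 shows "(NN q. ennreal (Kr (t, x) q * pt q)) = ennreal (2 * \<kappa> powr (- d/2) * J * (t * pt (t, x)))"
proof -
 have inner: "(NN y. ennreal (Kr (t, x) (s, y) * pt (s, y)))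
  = ennreal (\<kappa> powr (- d/2) * J * t powr (- d/2) * exp (- \<kappa> * Q x / t)) * ennreal (indicator {0<..<t} s * s powr (-1/2))" for s
 proof (cases "0 < s \<and> s < t")
  case True
  define C where "C = (t - s) powr (- d/2) * s powr (- 1/2 - d/2) * exp (- \<kappa> * Q x / t)"
  define e where "e = \<kappa> * (t / ((t - s) * s))"
  have e: "e > 0" using True \<kappa> by (simp add: e_def)
  have "Kr (t, x) (s, y) * pt (s, y) = C * exp (- e * Q (y - (s/t) *\<^sub>R x))" for y
  proof -
   have "- \<kappa> * Q (x - y) / (t - s) + - \<kappa> * Q y / s = - \<kappa> * (Q (x - y) / (t - s) + Q y / s)"
    by (simp add: algebra_simps)
   also have "\<dots> = - \<kappa> * Q x / t + - e * Q (y - (s/t) *\<^sub>R x)"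
    using True by (subst Q_identity) (auto simp: e_def algebra_simps)
   finally show ?thesis using True by (simp add: Kr_def pt_def C_def mult_ac flip: exp_add)
  qed
  then have "(NN y. ennreal (Kr (t, x) (s, y) * pt (s, y)))
   = (NN y. ennreal C * ennreal (exp (- e * Q (y - (s/t) *\<^sub>R x))))"
   by (simp add: C_def flip: ennreal_mult')
  also have "\<dots> = ennreal C * ennreal (e powr (- d/2) * J)"
   by (subst nn_integral_cmult) (auto simp only: nn_integral_Q[OF e], measurable)
  also have "\<dots> = ennreal (C * (e powr (- d/2) * J))"
   using J by (simp add: ennreal_mult C_def)
  also have "C * (e powr (- d/2) * J) = \<kappa> powr (- d/2) * J * t powr (- d/2) * exp (- \<kappa> * Q x / t) * s powr (-1/2)"
  proof -
   have "e powr (- d/2) = \<kappa> powr (- d/2) * t powr (- d/2) * (t - s) powr (d/2) * s powr (d/2)"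
   proof -
    have "e powr (- d/2) = \<kappa> powr (- d/2) * (t powr (- d/2) / ((t - s) powr (- d/2) * s powr (- d/2)))"
     using True \<kappa> by (simp add: e_def powr_mult powr_divide)
    then show ?thesis using True by (simp add: powr_minus_divide)
   qed
   then have "C * (e powr (- d/2) * J) = ((t - s) powr (- d/2) * (t - s) powr (d/2)) * (s powr (- 1/2 - d/2) * s powr (d/2))
     * (\<kappa> powr (- d/2) * J * t powr (- d/2) * exp (- \<kappa> * Q x / t))"
    unfolding C_def by (simp only: mult_ac)
   moreover have "(t - s) powr (- d/2) * (t - s) powr (d/2) = 1" using True by (simp flip: powr_add)
   moreover have "s powr (- 1/2 - d/2) * s powr (d/2) = s powr (-1/2)" using True by (simp flip: powr_add)
   ultimately have "C * (e powr (- d/2) * J) = 1 * s powr (-1/2) * (\<kappa> powr (- d/2) * J * t powr (- d/2) * exp (- \<kappa> * Q x / t))"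
    by (simp only:)
   then show ?thesis by (simp only: mult_1 mult_ac)
  qed
  finally show ?thesis using True J by (simp add: ennreal_mult'[symmetric] indicator_def)
 qed (auto simp: Kr_def indicator_def)
 have "(NN q. ennreal (Kr (t, x) q * pt q)) = (NN s. NN y. ennreal (Kr (t, x) (s, y) * pt (s, y)))"
  by (rule nn_integral_lborel_pair) (simp add: measurable_Pair2[OF Kr_measurable, simplified])
 also have "\<dots> = ennreal (\<kappa> powr (- d/2) * J * t powr (- d/2) * exp (- \<kappa> * Q x / t)) * ennreal (2 * t powr (1/2))"
  unfolding inner nn_integral_powr_0[OF t, symmetric] by (rule nn_integral_cmult) measurable
 also have "\<dots> = ennreal (\<kappa> powr (- d/2) * J * t powr (- d/2) * exp (- \<kappa> * Q x / t) * (2 * t powr (1/2)))"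
  using J by (simp add: ennreal_mult)
 also have "\<kappa> powr (- d/2) * J * t powr (- d/2) * exp (- \<kappa> * Q x / t) * (2 * t powr (1/2)) = 2 * \<kappa> powr (- d/2) * J * (t * pt (t, x))"
 proof -
  have "t powr (- d/2) * t powr (1/2) = t * t powr (- 1/2 - d/2)"
   using t powr_add[of t 1 "- 1/2 - d/2"] by (simp flip: powr_add)
  then show ?thesis by (simp add: pt_def mult_ac)
 qed
 finally show ?thesis .
qed

text \<open>The weight contributes \<open>Q x / (2 t)\<close> and \<open>pt\<close> contributes
  \<open>- \<kappa> * Q x / t\<close>. As \<open>1/2 - \<kappa>\<close> is positive,
  \<open>Q_convex\<close> distributes the sum over \<open>Q (x - y) / (t - s)\<close> and
  \<open>Q y / s\<close>. The kernel keeps the rate \<open>\<eta> = 2 * \<kappa> - 1/2 > 0\<close>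
  and remains integrable in \<open>x\<close>.\<close>

lemma Schur2:
 assumes s: "s > 0"
 shows "(NN p. ennreal (Kr p (s, y) * (\<rho> p * pt p / fst p)))
  \<le> ennreal (2 * (2 * \<kappa> - 1/2) powr (- d/2) * J * (\<rho> (s, y) * pt (s, y)))"
proof -
 define \<eta> where "\<eta> = 2 * \<kappa> - 1/2"
 have \<eta>: "\<eta> > 0" using \<kappa> by (simp add: \<eta>_def)
 have inner: "(NN x. ennreal (Kr (t, x) (s, y) * (\<rho> (t, x) * pt (t, x) / t)))
  \<le> ennreal (\<eta> powr (- d/2) * J * exp ((1/2 - \<kappa>) * Q y / s)) * ennreal (indicator {s<..} t * t powr (- 3/2 - \<alpha>))" for t
 proof (cases "s < t")
  case True
  define C where "C = t powr (- 3/2 - \<alpha>) * (t - s) powr (- d/2) * exp ((1/2 - \<kappa>) * Q y / s)"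
  have "Kr (t, x) (s, y) * (\<rho> (t, x) * pt (t, x) / t) \<le> C * exp (- (\<eta> / (t - s)) * Q (x - y))" for x
  proof -
   have pw: "t powr (d/2 - \<alpha>) * t powr (- 1/2 - d/2) / t = t powr (- 3/2 - \<alpha>)"
   proof -
    have t: "t > 0" using s True by simp
    then have "t powr (- 3/2 - \<alpha>) * t = t powr (- 3/2 - \<alpha> + 1)" by (subst powr_add) simp
    also have "\<dots> = t powr (d/2 - \<alpha>) * t powr (- 1/2 - d/2)" 
     unfolding powr_add[symmetric] by (rule arg_cong[where f="\<lambda>e. t powr e"]) simp
    finally show ?thesis using s True by (simp add: field_simps)
   qed
   have "(1/2 - \<kappa>) * (Q x / t) \<le> (1/2 - \<kappa>) * (Q (x - y) / (t - s) + Q y / s)"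
    using Q_convex[OF s True, of x y] \<kappa> by (intro mult_left_mono) auto
   then have "- \<kappa> * Q (x - y) / (t - s) + (Q x / (2 * t) + - \<kappa> * Q x / t) \<le> - (\<eta> / (t - s)) * Q (x - y) + (1/2 - \<kappa>) * Q y / s"
    by (simp add: \<eta>_def algebra_simps add_divide_distrib diff_divide_distrib)
   then have "exp (- \<kappa> * Q (x - y) / (t - s)) * (exp (Q x / (2 * t)) * exp (- \<kappa> * Q x / t))
     \<le> exp (- (\<eta> / (t - s)) * Q (x - y)) * exp ((1/2 - \<kappa>) * Q y / s)"
    by (simp flip: exp_add)
   then have "((t - s) powr (- d/2) * t powr (- 3/2 - \<alpha>)) * (exp (- \<kappa> * Q (x - y) / (t - s)) * (exp (Q x / (2 * t)) * exp (- \<kappa> * Q x / t)))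
     \<le> ((t - s) powr (- d/2) * t powr (- 3/2 - \<alpha>)) * (exp (- (\<eta> / (t - s)) * Q (x - y)) * exp ((1/2 - \<kappa>) * Q y / s))"
    by (intro mult_left_mono) auto
   moreover have "Kr (t, x) (s, y) * (\<rho> (t, x) * pt (t, x) / t)
    = (t - s) powr (- d/2) * (t powr (d/2 - \<alpha>) * t powr (- 1/2 - d/2) / t) * (exp (- \<kappa> * Q (x - y) / (t - s)) * (exp (Q x / (2 * t)) * exp (- \<kappa> * Q x / t)))"
    using True s by (simp add: Kr_def \<rho>_def pt_def)
   ultimately show ?thesis unfolding pw by (simp add: C_def mult_ac)
  qed
  moreover have "ennreal C * ennreal (exp (- (\<eta> / (t - s)) * Q (x - y))) = ennreal (C * exp (- (\<eta> / (t - s)) * Q (x - y)))" for x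
   by (rule ennreal_mult[symmetric]) (auto simp: C_def)
  ultimately have "(NN x. ennreal (Kr (t, x) (s, y) * (\<rho> (t, x) * pt (t, x) / t)))
   \<le> (NN x. ennreal C * ennreal (exp (- (\<eta> / (t - s)) * Q (x - y))))"
   by (intro nn_integral_mono) (simp only: ennreal_leI)
  also have "\<dots> = ennreal C * ennreal ((\<eta> / (t - s)) powr (- d/2) * J)"
  proof -
   have "\<eta> / (t - s) > 0" using \<eta> True by simp
   from nn_integral_Q[OF this, of y, symmetric] show ?thesis by (simp only:) (rule nn_integral_cmult, measurable)
  qed
  also have "\<dots> = ennreal (C * ((\<eta> / (t - s)) powr (- d/2) * J))"
   using J by (simp add: ennreal_mult C_def)
  also have "C * ((\<eta> / (t - s)) powr (- d/2) * J) = \<eta> powr (- d/2) * J * exp ((1/2 - \<kappa>) * Q y / s) * t powr (- 3/2 - \<alpha>)"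
  proof -
   have "(\<eta> / (t - s)) powr (- d/2) = \<eta> powr (- d/2) / (t - s) powr (- d/2)"
    using True \<eta> by (simp add: powr_divide)
   then show ?thesis using True by (simp add: C_def)
  qed
  finally show ?thesis using True J by (simp add: ennreal_mult'[symmetric] indicator_def)
 qed (auto simp: Kr_def indicator_def)
 have [measurable]: "(\<lambda>p. Kr p (s, y)) \<in> borel_measurable borel"
  by (simp add: measurable_Pair1[OF Kr_measurable, simplified])
 have "(NN p. ennreal (Kr p (s, y) * (\<rho> p * pt p / fst p)))
  = (NN t. NN x. ennreal (Kr (t, x) (s, y) * (\<rho> (t, x) * pt (t, x) / t)))"
  by (subst nn_integral_lborel_pair) auto
 also have "\<dots> \<le> (NN t. ennreal (\<eta> powr (- d/2) * J * exp ((1/2 - \<kappa>) * Q y / s)) * ennreal (indicator {s<..} t * t powr (- 3/2 - \<alpha>)))"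
  by (intro nn_integral_mono inner)
 also have "\<dots> = ennreal (\<eta> powr (- d/2) * J * exp ((1/2 - \<kappa>) * Q y / s)) * (NN t. ennreal (indicator {s<..} t * t powr (- 3/2 - \<alpha>)))"
  by (rule nn_integral_cmult) auto
 also have "\<dots> \<le> ennreal (\<eta> powr (- d/2) * J * exp ((1/2 - \<kappa>) * Q y / s)) * ennreal (s powr (- 3/2 - \<alpha> + 1) / (- (- 3/2 - \<alpha>) - 1))"
  using \<alpha> by (intro mult_left_mono nn_integral_powr_inf s) auto
 also have "\<dots> = ennreal (\<eta> powr (- d/2) * J * exp ((1/2 - \<kappa>) * Q y / s) * (s powr (- 1/2 - \<alpha>) / (1/2 + \<alpha>)))"
 proof -
  have e: "s powr (- 3/2 - \<alpha> + 1) / (- (- 3/2 - \<alpha>) - 1) = s powr (- 1/2 - \<alpha>) / (1/2 + \<alpha>)" by simp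
  show ?thesis unfolding e using J \<alpha> by (intro ennreal_mult[symmetric]) auto
 qed
 also have "\<dots> \<le> ennreal (\<eta> powr (- d/2) * J * exp ((1/2 - \<kappa>) * Q y / s) * (2 * s powr (- 1/2 - \<alpha>)))"
  using J \<alpha> by (intro ennreal_leI mult_left_mono) (auto simp: field_simps)
 also have "\<eta> powr (- d/2) * J * exp ((1/2 - \<kappa>) * Q y / s) * (2 * s powr (- 1/2 - \<alpha>)) = 2 * \<eta> powr (- d/2) * J * (\<rho> (s, y) * pt (s, y))"
 proof -
  have "s powr (- 1/2 - \<alpha>) = s powr (d/2 - \<alpha>) * s powr (- 1/2 - d/2)"
   unfolding powr_add[symmetric] by (rule arg_cong[where f="\<lambda>e. s powr e"]) simp
  moreover have "exp ((1/2 - \<kappa>) * Q y / s) = exp (Q y / (2 * s)) * exp (- \<kappa> * Q y / s)"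
   by (simp add: algebra_simps diff_divide_distrib flip: exp_add)
  ultimately show ?thesis by (simp add: \<rho>_def pt_def mult_ac)
 qed
 finally show ?thesis by (simp add: \<eta>_def)
qed

definition C1 :: real where "C1 = 2 * \<kappa> powr (- d/2) * J"

definition C2 :: real where "C2 = 2 * (2 * \<kappa> - 1/2) powr (- d/2) * J"

lemma C12: "0 \<le> C1" "0 \<le> C2"
 using J by (auto simp: C1_def C2_def)

lemma pt_pos: "fst q > 0 \<Longrightarrow> pt q > 0"
 by (simp add: pt_def)

lemma Kr_section_measurable [measurable]:
 "(\<lambda>q. Kr p q) \<in> borel_measurable borel" "(\<lambda>p. Kr p q) \<in> borel_measurable borel"
 using measurable_Pair2[OF Kr_measurable, of p] measurable_Pair1[OF Kr_measurable, of q] by auto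

text \<open>Cauchy-Schwarz after splitting \<open>Kr * g\<close> into the square roots of
  \<open>Kr * pt\<close> and of \<open>Kr * g^2 / pt\<close>; then \<open>Schur1\<close> for the
  first factor, Tonelli, and \<open>Schur2\<close> for the integral over \<open>p\<close>. The
  division by \<open>(fst p)^2\<close> makes the inequality scale invariant, as the potential gains
  one power of time.\<close>

lemma Schur:
 assumes g [measurable]: "g \<in> borel_measurable borel" and g0: "\<And>q. 0 \<le> g q"
 shows "(NN p. ennreal (indicator {0<..} (fst p) * \<rho> p / (fst p)\<^sup>2) * (NN q. ennreal (Kr p q * g q))\<^sup>2)
  \<le> ennreal (C1 * C2) * (NN q. ennreal (indicator {0<..} (fst q) * \<rho> q * (g q)\<^sup>2))"
proof -
 have pt0: "0 \<le> pt q" for q by (simp add: pt_def)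
 have \<rho>0: "0 \<le> \<rho> q" for q by (simp add: \<rho>_def)
 have CS: "(NN q. ennreal (Kr p q * g q))\<^sup>2
  \<le> ennreal (C1 * (fst p * pt p)) * (NN q. ennreal (Kr p q * ((g q)\<^sup>2 / pt q)))" if "fst p > 0" for p
 proof -
  have "(NN q. ennreal (Kr p q * g q))\<^sup>2
   = (NN q. ennreal (sqrt (Kr p q) * sqrt (pt q)) * ennreal (sqrt (Kr p q) * g q / sqrt (pt q)))\<^sup>2"
  proof (intro arg_cong[of _ _ "\<lambda>x. x\<^sup>2"] nn_integral_cong)
   fix q
   have "Kr p q * g q = (sqrt (Kr p q) * sqrt (pt q)) * (sqrt (Kr p q) * g q / sqrt (pt q))"
   proof (cases "Kr p q = 0")
    case False
    then have "pt q > 0" by (intro pt_pos) (auto simp: Kr_def split: if_splits)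
    then show ?thesis using Kr_nonneg[of p q] by simp
   qed simp
   then show "ennreal (Kr p q * g q) = ennreal (sqrt (Kr p q) * sqrt (pt q)) * ennreal (sqrt (Kr p q) * g q / sqrt (pt q))"
    using Kr_nonneg[of p q] pt0[of q] g0[of q] by (simp add: ennreal_mult[symmetric])
  qed
  also have "\<dots> \<le> (NN q. (ennreal (sqrt (Kr p q) * sqrt (pt q)))\<^sup>2) * (NN q. (ennreal (sqrt (Kr p q) * g q / sqrt (pt q)))\<^sup>2)"
   by (rule Cauchy_Schwarz_nn_integral) measurable
  also have "(NN q. (ennreal (sqrt (Kr p q) * sqrt (pt q)))\<^sup>2) = (NN q. ennreal (Kr p q * pt q))"
   by (intro nn_integral_cong) (simp add: ennreal_power Kr_nonneg pt0 power_mult_distrib)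
  also have "\<dots> = ennreal (C1 * (fst p * pt p))"
   using Schur1[of "fst p" "snd p"] that by (simp add: C1_def)
  also have "(NN q. (ennreal (sqrt (Kr p q) * g q / sqrt (pt q)))\<^sup>2) = (NN q. ennreal (Kr p q * ((g q)\<^sup>2 / pt q)))"
   by (intro nn_integral_cong) (simp add: ennreal_power Kr_nonneg pt0 g0 power_mult_distrib power_divide)
  finally show ?thesis .
 qed
 have "(NN p. ennreal (indicator {0<..} (fst p) * \<rho> p / (fst p)\<^sup>2) * (NN q. ennreal (Kr p q * g q))\<^sup>2)
  \<le> (NN p. ennreal C1 * (NN q. ennreal (indicator {0<..} (fst p) * (\<rho> p * pt p / fst p) * (Kr p q * ((g q)\<^sup>2 / pt q)))))"
 proof (intro nn_integral_mono)
  fix p :: "real \<times> (real^'n)"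
  show "ennreal (indicator {0<..} (fst p) * \<rho> p / (fst p)\<^sup>2) * (NN q. ennreal (Kr p q * g q))\<^sup>2
   \<le> ennreal C1 * (NN q. ennreal (indicator {0<..} (fst p) * (\<rho> p * pt p / fst p) * (Kr p q * ((g q)\<^sup>2 / pt q))))"
  proof (cases "fst p > 0")
   case True
   let ?I = "NN q. ennreal (Kr p q * ((g q)\<^sup>2 / pt q))"
   have "ennreal (\<rho> p / (fst p)\<^sup>2) * (NN q. ennreal (Kr p q * g q))\<^sup>2 \<le> ennreal (\<rho> p / (fst p)\<^sup>2) * (ennreal (C1 * (fst p * pt p)) * ?I)"
    by (intro mult_left_mono CS True) auto
   also have "\<dots> = ennreal (\<rho> p / (fst p)\<^sup>2 * (C1 * (fst p * pt p))) * ?I"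
    using C12 True pt0[of p] \<rho>0[of p] by (simp add: mult.assoc[symmetric] ennreal_mult[symmetric])
   also have "\<rho> p / (fst p)\<^sup>2 * (C1 * (fst p * pt p)) = C1 * (\<rho> p * pt p / fst p)"
    using True by (simp add: power2_eq_square)
   also have "ennreal (C1 * (\<rho> p * pt p / fst p)) * ?I = ennreal C1 * (ennreal (\<rho> p * pt p / fst p) * ?I)"
    using C12 True pt0[of p] \<rho>0[of p] by (subst ennreal_mult) (auto simp: mult.assoc)
   also have "ennreal (\<rho> p * pt p / fst p) * ?I = (NN q. ennreal (\<rho> p * pt p / fst p) * ennreal (Kr p q * ((g q)\<^sup>2 / pt q)))"
    by (rule nn_integral_cmult[symmetric]) measurable
   also have "\<dots> = (NN q. ennreal (\<rho> p * pt p / fst p * (Kr p q * ((g q)\<^sup>2 / pt q))))"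
    using True pt0 \<rho>0[of p] Kr_nonneg by (intro nn_integral_cong ennreal_mult[symmetric]) auto
   finally show ?thesis using True by simp
  qed simp
 qed
 also have "\<dots> = ennreal C1 * (NN p. NN q. ennreal (indicator {0<..} (fst p) * (\<rho> p * pt p / fst p) * (Kr p q * ((g q)\<^sup>2 / pt q))))"
  by (rule nn_integral_cmult) measurable
 also have "(NN p. NN q. ennreal (indicator {0<..} (fst p) * (\<rho> p * pt p / fst p) * (Kr p q * ((g q)\<^sup>2 / pt q))))
  = (NN q. NN p. ennreal (indicator {0<..} (fst p) * (\<rho> p * pt p / fst p) * (Kr p q * ((g q)\<^sup>2 / pt q))))"
  by (rule lborel_pair.Fubini'[symmetric]) measurable
 also have "\<dots> \<le> (NN q. ennreal C2 * ennreal (indicator {0<..} (fst q) * \<rho> q * (g q)\<^sup>2))"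
 proof (intro nn_integral_mono)
  fix q :: "real \<times> (real^'n)"
  show "(NN p. ennreal (indicator {0<..} (fst p) * (\<rho> p * pt p / fst p) * (Kr p q * ((g q)\<^sup>2 / pt q))))
   \<le> ennreal C2 * ennreal (indicator {0<..} (fst q) * \<rho> q * (g q)\<^sup>2)"
  proof (cases "fst q > 0")
   case True
   have "(NN p. ennreal (indicator {0<..} (fst p) * (\<rho> p * pt p / fst p) * (Kr p q * ((g q)\<^sup>2 / pt q))))
    = (NN p. ennreal ((g q)\<^sup>2 / pt q) * ennreal (Kr p q * (\<rho> p * pt p / fst p)))"
    using pt0[of q] True
    by (intro nn_integral_cong) (auto simp: ennreal_mult'[symmetric] Kr_def indicator_def mult_ac)
   also have "\<dots> = ennreal ((g q)\<^sup>2 / pt q) * (NN p. ennreal (Kr p q * (\<rho> p * pt p / fst p)))"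
    by (rule nn_integral_cmult) measurable
   also have "\<dots> \<le> ennreal ((g q)\<^sup>2 / pt q) * ennreal (C2 * (\<rho> q * pt q))"
    using Schur2[OF True, of "snd q"] by (intro mult_left_mono) (auto simp: C2_def)
   also have "\<dots> = ennreal ((g q)\<^sup>2 / pt q * (C2 * (\<rho> q * pt q)))"
    using pt0[of q] \<rho>0[of q] C12 by (intro ennreal_mult[symmetric]) auto
   also have "(g q)\<^sup>2 / pt q * (C2 * (\<rho> q * pt q)) = C2 * (\<rho> q * (g q)\<^sup>2)"
    using pt_pos[OF True] by simp
   finally show ?thesis using True C12 \<rho>0[of q] by (simp add: ennreal_mult)
  qed (auto simp: Kr_def)
 qed
 also have "\<dots> = ennreal C2 * (NN q. ennreal (indicator {0<..} (fst q) * \<rho> q * (g q)\<^sup>2))"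
  by (rule nn_integral_cmult) measurable
 finally show ?thesis using C12 by (simp add: ennreal_mult mult.assoc mult_left_mono)
qed

text \<open>Undoing the substitution \<open>z = sqrt r *\<^sub>R y\<close> and reversing time gives
  an integral against the heat kernel of \<open>A\<close>, which \<open>Q_kernel\<close> bounds by
  \<open>Kr\<close>. Since \<open>G\<close> vanishes at nonpositive times, only sources at times
  between 0 and \<open>t\<close> contribute.\<close>

lemma heat_pot_le_kernel:
 assumes G: "G \<in> test_functions \<Omega>" and G0: "\<And>s y. s \<le> 0 \<Longrightarrow> G (s, y) = 0"
 shows "ennreal \<bar>heat_pot B A G (t, x)\<bar> \<le> ennreal (1 / hZ A) * (NN q. ennreal (Kr (t, x) q * \<bar>G q\<bar>))"
proof -
 have [measurable]: "G \<in> borel_measurable borel" by (rule smooth_measurable[OF test_smooth[OF G]])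
 have [measurable]: "(\<lambda>q. (t, x) - heat_map q) \<in> borel_measurable borel"
  using heat_map_measurable by measurable
 have mG: "(\<lambda>z. G (u, f z)) \<in> borel_measurable borel" if "continuous_on UNIV f" for u and f :: "real^'n \<Rightarrow> real^'n"
  by (intro borel_measurable_continuous_onI continuous_on_compose2[OF smooth_continuous_on[OF test_smooth[OF G], of UNIV]]
    continuous_intros that) auto
 have [measurable]: "heat_wt B A \<in> borel_measurable borel"
  using heat_wt_integrable[OF A] by auto
 define \<phi> where "\<phi> s = (NN y. ennreal (Kr (t, x) (s, y) * \<bar>G (s, y)\<bar>))" for s
 have [measurable]: "\<phi> \<in> borel_measurable borel"
 proof -
  have "(\<lambda>q. ennreal (Kr (t, x) q * \<bar>G q\<bar>)) \<in> borel_measurable (lborel \<Otimes>\<^sub>M lborel)" by (simp add: lborel_prod)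
  from lborel.borel_measurable_nn_integral_fst[OF this] show ?thesis by (simp add: \<phi>_def[abs_def])
 qed
 have inner: "(NN y. ennreal \<bar>heat_wt B A (r, y) * G ((t, x) - heat_map (r, y))\<bar>) \<le> ennreal (1 / hZ A) * \<phi> (t - r)" for r
 proof (cases "0 < r \<and> r < B \<and> r < t")
  case True
  define c where "c = sqrt r"
  have c: "c > 0" "c\<^sup>2 = r" using True by (auto simp: c_def)
  define f where "f z = ennreal (hk A ((1/c) *\<^sub>R z) * \<bar>G (t - r, x - z)\<bar>)" for z
  have [measurable]: "f \<in> borel_measurable borel"
   unfolding f_def using mG[of "\<lambda>z. x - z"] by (auto intro!: continuous_intros)
  have cp: "r powr (- d/2) * c ^ DIM(real^'n) = 1"
  proof -
   have "c = r powr (1/2)" using True by (simp add: c_def powr_half_sqrt)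
   then have "c ^ CARD('n) = r powr (d/2)" using True by (simp add: powr_power d_def)
   then show ?thesis using True by (simp flip: powr_add)
  qed
  have "(NN y. ennreal \<bar>heat_wt B A (r, y) * G ((t, x) - heat_map (r, y))\<bar>) = (NN y. f (c *\<^sub>R y))"
   using True c by (simp add: f_def heat_wt_def heat_map_def c_def abs_mult abs_of_pos[OF hk_pos[OF A]])
  also have "\<dots> = ennreal (r powr (- d/2) * c ^ DIM(real^'n)) * (NN y. f (c *\<^sub>R y))"
   unfolding cp by simp
  also have "\<dots> = ennreal (r powr (- d/2)) * (NN z. f z)"
   using c by (subst nn_integral_scale[OF _ c(1)]) (auto simp: ennreal_mult mult.assoc)
  also have "\<dots> = (NN y. ennreal (r powr (- d/2)) * f (x - y))"
   by (subst nn_integral_reflect[symmetric, of f x]) (auto simp: nn_integral_cmult)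
  also have "\<dots> \<le> (NN y. ennreal (1 / hZ A) * ennreal (Kr (t, x) (t - r, y) * \<bar>G (t - r, y)\<bar>))"
  proof (rule nn_integral_mono)
   fix y
   have "\<kappa> * Q ((1/c) *\<^sub>R (x - y)) \<le> ((1/c) *\<^sub>R (x - y)) \<bullet> (matrix_inv A *v ((1/c) *\<^sub>R (x - y))) / 4" by (rule Q_kernel)
   then have "hk A ((1/c) *\<^sub>R (x - y)) \<le> exp (- \<kappa> * Q ((1/c) *\<^sub>R (x - y))) / hZ A"
    unfolding hk_def hker_def using hZ_pos[OF A] by (intro divide_right_mono) auto
   also have "Q ((1/c) *\<^sub>R (x - y)) = Q (x - y) / r" using c by (simp add: Q_scaleR power_divide)
   finally have "hk A ((1/c) *\<^sub>R (x - y)) \<le> (1 / hZ A) * exp (- \<kappa> * Q (x - y) / r)" by simp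
   then have "r powr (- d/2) * (hk A ((1/c) *\<^sub>R (x - y)) * \<bar>G (t - r, y)\<bar>) \<le> r powr (- d/2) * ((1 / hZ A * exp (- \<kappa> * Q (x - y) / r)) * \<bar>G (t - r, y)\<bar>)"
    by (intro mult_left_mono mult_right_mono) auto
   also have "\<dots> = (1 / hZ A) * (Kr (t, x) (t - r, y) * \<bar>G (t - r, y)\<bar>)"
    using True by (simp add: Kr_def)
   finally show "ennreal (r powr (- d/2)) * f (x - y) \<le> ennreal (1 / hZ A) * ennreal (Kr (t, x) (t - r, y) * \<bar>G (t - r, y)\<bar>)"
    using hk_pos[OF A] hZ_pos[OF A] by (simp add: f_def ennreal_mult'[symmetric] ennreal_leI less_imp_le)
  qed
  also have "\<dots> = ennreal (1 / hZ A) * \<phi> (t - r)"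
  proof -
   have "(\<lambda>y. G (t - r, y)) \<in> borel_measurable borel" by (rule mG) (intro continuous_intros)
   moreover have "(\<lambda>y. Kr (t, x) (t - r, y)) \<in> borel_measurable borel" unfolding Kr_def by measurable
   ultimately show ?thesis unfolding \<phi>_def by (intro nn_integral_cmult) auto
  qed
  finally show ?thesis .
 next
  case False
  then have "heat_wt B A (r, y) * G ((t, x) - heat_map (r, y)) = 0" for y
   using G0[of "t - r"] by (auto simp: heat_wt_def heat_map_def indicator_def)
  note z = this
  show ?thesis unfolding z by simp
 qed
 have "ennreal \<bar>heat_pot B A G (t, x)\<bar> \<le> (NN q. ennreal \<bar>heat_wt B A q * G ((t, x) - heat_map q)\<bar>)"
  unfolding heat_pot_def wconv_def
  using integral_norm_bound_ennreal[OF wconv_test_integrable[OF heat_wt_integrable[OF A] heat_map_measurable G]]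
  by simp
 also have "\<dots> = (NN r. NN y. ennreal \<bar>heat_wt B A (r, y) * G ((t, x) - heat_map (r, y))\<bar>)"
  by (rule nn_integral_lborel_pair) measurable
 also have "\<dots> \<le> (NN r. ennreal (1 / hZ A) * \<phi> (t - r))"
  by (intro nn_integral_mono inner)
 also have "\<dots> = ennreal (1 / hZ A) * (NN r. \<phi> (t - r))"
  by (rule nn_integral_cmult) measurable
 also have "(NN r. \<phi> (t - r)) = (NN s. \<phi> s)"
  by (rule nn_integral_reflect) measurable
 also have "\<dots> = (NN q. ennreal (Kr (t, x) q * \<bar>G q\<bar>))"
  unfolding \<phi>_def by (rule nn_integral_lborel_pair[symmetric]) measurable
 finally show ?thesis .
qed

lemma heat_pot_weighted_bound:
 assumes G: "G \<in> test_functions \<Omega>" and G0: "\<And>s y. s \<le> 0 \<Longrightarrow> G (s, y) = 0"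
 shows "(NN p. ennreal (indicator {0<..} (fst p) * \<rho> p / (fst p)\<^sup>2 * (heat_pot B A G p)\<^sup>2))
  \<le> ennreal ((1 / hZ A)\<^sup>2 * (C1 * C2)) * (NN q. ennreal (indicator {0<..} (fst q) * \<rho> q * (G q)\<^sup>2))"
proof -
 have [measurable]: "G \<in> borel_measurable borel" by (rule smooth_measurable[OF test_smooth[OF G]])
 let ?I = "\<lambda>p. NN q. ennreal (Kr p q * \<bar>G q\<bar>)"
 have \<rho>0: "0 \<le> \<rho> q" for q by (simp add: \<rho>_def)
 have "(NN p. ennreal (indicator {0<..} (fst p) * \<rho> p / (fst p)\<^sup>2 * (heat_pot B A G p)\<^sup>2))
  \<le> (NN p. ennreal ((1 / hZ A)\<^sup>2) * (ennreal (indicator {0<..} (fst p) * \<rho> p / (fst p)\<^sup>2) * (?I p)\<^sup>2))"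
 proof (rule nn_integral_mono)
  fix p :: "real \<times> (real^'n)"
  have "ennreal ((heat_pot B A G p)\<^sup>2) = (ennreal \<bar>heat_pot B A G p\<bar>)\<^sup>2" by (simp add: ennreal_power)
  also have "\<dots> \<le> (ennreal (1 / hZ A) * ?I p)\<^sup>2"
   using heat_pot_le_kernel[OF G G0, of B "fst p" "snd p"] by (intro power_mono) auto
  also have "\<dots> = ennreal ((1 / hZ A)\<^sup>2) * (?I p)\<^sup>2"
   using hZ_pos[OF A] by (simp add: power_mult_distrib ennreal_power)
  finally have "ennreal (indicator {0<..} (fst p) * \<rho> p / (fst p)\<^sup>2) * ennreal ((heat_pot B A G p)\<^sup>2)
   \<le> ennreal (indicator {0<..} (fst p) * \<rho> p / (fst p)\<^sup>2) * (ennreal ((1 / hZ A)\<^sup>2) * (?I p)\<^sup>2)"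
   by (intro mult_left_mono) auto
  then show "ennreal (indicator {0<..} (fst p) * \<rho> p / (fst p)\<^sup>2 * (heat_pot B A G p)\<^sup>2)
   \<le> ennreal ((1 / hZ A)\<^sup>2) * (ennreal (indicator {0<..} (fst p) * \<rho> p / (fst p)\<^sup>2) * (?I p)\<^sup>2)"
   using \<rho>0[of p] ennreal_mult[of "indicator {0<..} (fst p) * \<rho> p / (fst p)\<^sup>2" "(heat_pot B A G p)\<^sup>2"]
   by (simp only: mult.left_commute[of "ennreal ((1 / hZ A)\<^sup>2)"]) simp
 qed
 also have "\<dots> = ennreal ((1 / hZ A)\<^sup>2) * (NN p. ennreal (indicator {0<..} (fst p) * \<rho> p / (fst p)\<^sup>2) * (?I p)\<^sup>2)"
  by (rule nn_integral_cmult) measurable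
 also have "\<dots> \<le> ennreal ((1 / hZ A)\<^sup>2) * (ennreal (C1 * C2) * (NN q. ennreal (indicator {0<..} (fst q) * \<rho> q * \<bar>G q\<bar>\<^sup>2)))"
  by (intro mult_left_mono Schur) auto
 finally show ?thesis using C12 by (simp add: ennreal_mult mult.assoc)
qed

text \<open>The support is compact and lies in positive times, where \<open>pt\<close> is continuous
  and positive, hence bounded below on it.\<close>

lemma test_le_pt:
 assumes G: "G \<in> test_functions \<Omega>" and \<Omega>: "\<Omega> \<subseteq> {0<..} \<times> UNIV"
 obtains m where "m > 0" "\<And>q. \<bar>G q\<bar> \<le> m * pt q"
proof -
 obtain K where K: "compact K" "K \<subseteq> \<Omega>" "\<And>x. x \<notin> K \<Longrightarrow> G x = 0" using G by (auto elim!: test_functionsE)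
 obtain M0 where M0: "M0 > 0" "\<And>x. \<bar>G x\<bar> \<le> M0" using test_bounded[OF G] by blast
 obtain \<epsilon> where \<epsilon>: "\<epsilon> > 0" "\<And>q. q \<in> K \<Longrightarrow> \<epsilon> \<le> pt q"
 proof (cases "K = {}")
  case False
  have "continuous_on K pt" unfolding pt_def[abs_def]
   using K \<Omega> by (intro continuous_intros continuous_on_compose2[OF continuous_Q[of UNIV]]) force+
  then obtain q0 where "q0 \<in> K" "\<And>q. q \<in> K \<Longrightarrow> pt q0 \<le> pt q"
   using continuous_attains_inf[OF K(1) False] by blast
  moreover have "pt q0 > 0" using \<open>q0 \<in> K\<close> K \<Omega> by (intro pt_pos) force
  ultimately show ?thesis by (intro that[of "pt q0"]) auto
 qed (auto intro: that[of 1])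
 define m where "m = M0 / \<epsilon>"
 have m: "m > 0" using M0 \<epsilon> by (simp add: m_def)
 have Gm: "\<bar>G q\<bar> \<le> m * pt q" for q
 proof (cases "q \<in> K")
  case True
  have "\<bar>G q\<bar> \<le> m * \<epsilon>" using M0(2)[of q] \<epsilon> by (simp add: m_def)
  also have "\<dots> \<le> m * pt q" using m \<epsilon>(2)[OF True] by simp
  finally show ?thesis .
 next
  case False
  then show ?thesis using K(3) m by (simp add: pt_def)
 qed
 with m show ?thesis by (rule that)
qed

text \<open>A source below \<open>m * pt\<close> has a potential below a multiple of
  \<open>t * pt\<close>, by \<open>Schur1\<close>: the Schur test function doubles as a barrier. The
  bound is uniform in the truncation and is the origin of the Gaussian decay of the
  potentials.\<close>

lemma heat_pot_pointwise:
 assumes G: "G \<in> test_functions \<Omega>" and \<Omega>: "\<Omega> \<subseteq> {0<..} \<times> UNIV"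
 obtains M where "M \<ge> 0" "\<And>B t x. t > 0 \<Longrightarrow> \<bar>heat_pot B A G (t, x)\<bar> \<le> M * (t * pt (t, x))"
proof -
 have [measurable]: "G \<in> borel_measurable borel" by (rule smooth_measurable[OF test_smooth[OF G]])
 have G0: "G (s, y) = 0" if "s \<le> 0" for s y using test_zero_outside[OF G, of "(s, y)"] \<Omega> that by force
 obtain m where m: "m > 0" and Gm: "\<And>q. \<bar>G q\<bar> \<le> m * pt q" using test_le_pt[OF G \<Omega>] by blast
 show ?thesis
 proof (rule that[of "1 / hZ A * (m * C1)"])
  show "0 \<le> 1 / hZ A * (m * C1)" using hZ_pos[OF A] m C12 by simp
  fix B t :: real and x assume t: "t > 0"
  have "ennreal \<bar>heat_pot B A G (t, x)\<bar> \<le> ennreal (1 / hZ A) * (NN q. ennreal (Kr (t, x) q * \<bar>G q\<bar>))"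
   by (rule heat_pot_le_kernel[OF G G0])
  also have "\<dots> \<le> ennreal (1 / hZ A) * (NN q. ennreal m * ennreal (Kr (t, x) q * pt q))"
  proof (intro mult_left_mono nn_integral_mono)
   fix q
   have "Kr (t, x) q * \<bar>G q\<bar> \<le> Kr (t, x) q * (m * pt q)" by (intro mult_left_mono Gm Kr_nonneg)
   then show "ennreal (Kr (t, x) q * \<bar>G q\<bar>) \<le> ennreal m * ennreal (Kr (t, x) q * pt q)"
    using m by (simp add: ennreal_mult'[symmetric] ennreal_leI mult_ac)
  qed simp
  also have "\<dots> = ennreal (1 / hZ A) * (ennreal m * ennreal (C1 * (t * pt (t, x))))"
   by (subst nn_integral_cmult) (auto simp: Schur1[OF t] C1_def)
  also have "\<dots> = ennreal (1 / hZ A * (m * C1) * (t * pt (t, x)))"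
   using hZ_pos[OF A] m C12 t pt_pos[of "(t, x)"] by (simp add: ennreal_mult[symmetric] mult_ac less_imp_le)
  finally show "\<bar>heat_pot B A G (t, x)\<bar> \<le> 1 / hZ A * (m * C1) * (t * pt (t, x))"
   using hZ_pos[OF A] m C12 t pt_pos[of "(t, x)"] by (subst (asm) ennreal_le_iff) (auto simp: less_imp_le)
 qed
qed

text \<open>The normalisation enters the constants through its inverse, so uniformity requires a
  lower bound in terms of \<open>l\<close>.\<close>

lemma hZ_lower: "gauss_int TYPE(real^'n) (1/(4*l)) \<le> hZ A"
 unfolding gauss_int_def hZ_def
proof (intro integral_mono integrable_gauss hker_poly_integrable A)
 show "exp (- (1/(4*l)) * (y \<bullet> y)) \<le> hker A y" for y
  using matrix_inv_bounds(2)[OF A eA l L_bounds(3), of y] l by (simp add: hker_def field_simps)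
qed (use l in simp)

end

section \<open>The weighted energy estimate\<close>

context parab
begin

text \<open>The dual weight with a free power of time: \<open>\<rho>\<close> is the case
  \<open>d/2 - \<alpha>\<close>, and the energy estimates also produce the powers one and two
  lower.\<close>

definition Wt :: "real \<Rightarrow> real \<times> (real^'n) \<Rightarrow> real" where
 "Wt \<beta> p = fst p powr \<beta> * exp (Q (snd p) / (2 * fst p))"

definition \<delta> :: real where "\<delta> = 2 * \<kappa> - 1/2"

text \<open>The class of the potentials and their derivatives on a strip away from time 0. The
  constant is uncontrolled; membership only serves to justify manipulations.\<close>

definition decays :: "real \<Rightarrow> real \<Rightarrow> (real \<times> (real^'n) \<Rightarrow> real) \<Rightarrow> bool" where
 "decays c0 B f \<longleftrightarrow> (\<exists>M\<ge>0. \<forall>t\<in>{c0..B}. \<forall>x. \<bar>f (t, x)\<bar> \<le> M * exp (- \<kappa> * Q x / t))"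

text \<open>What is left of a product of two decaying functions after multiplication by the weight:
  the rate \<open>\<delta> = 2 * \<kappa> - 1/2\<close> is still positive. The quadratic factor
  leaves room for \<open>Q x\<close> and for the linear terms from differentiating the
  weight.\<close>

definition bnd :: "real \<Rightarrow> real \<Rightarrow> (real \<times> (real^'n) \<Rightarrow> real) \<Rightarrow> bool" where
 "bnd c0 B f \<longleftrightarrow> (\<exists>M\<ge>0. \<forall>t\<in>{c0..B}. \<forall>x. \<bar>f (t, x)\<bar> \<le> M * (1 + norm x)\<^sup>2 * exp (- \<delta> * Q x / t))"

lemma \<delta>_pos: "\<delta> > 0" using \<kappa> by (simp add: \<delta>_def)

lemma Wt_measurable [measurable]: "Wt \<beta> \<in> borel_measurable borel"
 unfolding Wt_def[abs_def] by measurable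

lemma bnd_add: "bnd c0 B f \<Longrightarrow> bnd c0 B g \<Longrightarrow> bnd c0 B (\<lambda>p. f p + g p)"
 unfolding bnd_def
proof (elim exE conjE)
 fix M N assume M: "0 \<le> M" "\<forall>t\<in>{c0..B}. \<forall>x. \<bar>f (t, x)\<bar> \<le> M * (1 + norm x)\<^sup>2 * exp (- \<delta> * Q x / t)"
  and N: "0 \<le> N" "\<forall>t\<in>{c0..B}. \<forall>x. \<bar>g (t, x)\<bar> \<le> N * (1 + norm x)\<^sup>2 * exp (- \<delta> * Q x / t)"
 show "\<exists>M\<ge>0. \<forall>t\<in>{c0..B}. \<forall>x. \<bar>f (t, x) + g (t, x)\<bar> \<le> M * (1 + norm x)\<^sup>2 * exp (- \<delta> * Q x / t)"
 proof (intro exI[of _ "M + N"] conjI ballI allI)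
  fix t x assume "t \<in> {c0..B}"
  then show "\<bar>f (t, x) + g (t, x)\<bar> \<le> (M + N) * (1 + norm x)\<^sup>2 * exp (- \<delta> * Q x / t)"
   using M(2)[rule_format, of t x] N(2)[rule_format, of t x] abs_triangle_ineq[of "f (t, x)" "g (t, x)"]
   by (simp add: distrib_right)
 qed (use M N in simp)
qed

lemma bnd_cmult: "bnd c0 B f \<Longrightarrow> bnd c0 B (\<lambda>p. c * f p)"
 unfolding bnd_def
proof (elim exE conjE)
 fix M assume M: "0 \<le> M" "\<forall>t\<in>{c0..B}. \<forall>x. \<bar>f (t, x)\<bar> \<le> M * (1 + norm x)\<^sup>2 * exp (- \<delta> * Q x / t)"
 show "\<exists>M\<ge>0. \<forall>t\<in>{c0..B}. \<forall>x. \<bar>c * f (t, x)\<bar> \<le> M * (1 + norm x)\<^sup>2 * exp (- \<delta> * Q x / t)"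
 proof (intro exI[of _ "\<bar>c\<bar> * M"] conjI ballI allI)
  fix t x assume "t \<in> {c0..B}"
  then have "\<bar>c\<bar> * \<bar>f (t, x)\<bar> \<le> \<bar>c\<bar> * (M * (1 + norm x)\<^sup>2 * exp (- \<delta> * Q x / t))"
   using M(2) by (intro mult_left_mono) auto
  then show "\<bar>c * f (t, x)\<bar> \<le> \<bar>c\<bar> * M * (1 + norm x)\<^sup>2 * exp (- \<delta> * Q x / t)"
   by (simp add: abs_mult mult.assoc)
 qed (use M in simp)
qed

lemma bnd_sum: "(\<And>i. i \<in> I \<Longrightarrow> bnd c0 B (f i)) \<Longrightarrow> bnd c0 B (\<lambda>p. \<Sum>i\<in>I. f i p)"
proof (induction I rule: infinite_finite_induct)
 case (insert i I)
 then show ?case using bnd_add[of c0 B "f i" "\<lambda>p. \<Sum>i\<in>I. f i p"] by simp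
qed (auto simp: bnd_def intro!: exI[of _ 0])

lemma bnd_cong: "bnd c0 B f \<Longrightarrow> (\<And>t x. t \<in> {c0..B} \<Longrightarrow> \<bar>g (t, x)\<bar> \<le> \<bar>f (t, x)\<bar>) \<Longrightarrow> bnd c0 B g"
 unfolding bnd_def by (meson order_trans)

text \<open>The weight gains \<open>exp (Q x / 2t)\<close>, which two factors \<open>exp (-\<kappa> Q x / t)\<close> absorb since \<open>\<kappa> > 1/4\<close>.\<close>

lemma bnd_product:
 assumes c0: "0 < c0" and f: "decays c0 B f" and g: "decays c0 B g"
  and h: "\<And>t x. t \<in> {c0..B} \<Longrightarrow> \<bar>h (t, x)\<bar> \<le> H * (1 + norm x)\<^sup>2"
 shows "bnd c0 B (\<lambda>p. Wt \<beta> p * (h p * (f p * g p)))"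
proof -
 obtain M where M: "M \<ge> 0" "\<And>t x. t \<in> {c0..B} \<Longrightarrow> \<bar>f (t, x)\<bar> \<le> M * exp (- \<kappa> * Q x / t)"
  using f unfolding decays_def by blast
 obtain N where N: "N \<ge> 0" "\<And>t x. t \<in> {c0..B} \<Longrightarrow> \<bar>g (t, x)\<bar> \<le> N * exp (- \<kappa> * Q x / t)"
  using g unfolding decays_def by blast
 have "compact ((\<lambda>t. t powr \<beta>) ` {c0..B})"
  using c0 by (intro compact_continuous_image continuous_intros) auto
 then have "bounded ((\<lambda>t. t powr \<beta>) ` {c0..B})" by (rule compact_imp_bounded)
 then obtain K where K: "K > 0" "\<And>t. t \<in> {c0..B} \<Longrightarrow> \<bar>t powr \<beta>\<bar> \<le> K"
  unfolding bounded_pos by (metis image_eqI real_norm_def)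
 have H: "H \<ge> 0" if "t \<in> {c0..B}" for t using h[OF that, of 0] by (simp add: order_trans[OF abs_ge_zero])
 show ?thesis unfolding bnd_def
 proof (intro exI[of _ "\<bar>K * H * M * N\<bar>"] conjI ballI allI)
  fix t x assume t: "t \<in> {c0..B}"
  have "\<bar>Wt \<beta> (t, x) * (h (t, x) * (f (t, x) * g (t, x)))\<bar>
   \<le> (K * exp (Q x / (2 * t))) * ((H * (1 + norm x)\<^sup>2) * ((M * exp (- \<kappa> * Q x / t)) * (N * exp (- \<kappa> * Q x / t))))"
   unfolding abs_mult Wt_def using K t h[OF t, of x] M(2)[OF t, of x] N(2)[OF t, of x] H[OF t] M(1) N(1)
   by (intro mult_mono) (auto intro!: mult_nonneg_nonneg)
  also have "\<dots> = (K * H * M * N) * (1 + norm x)\<^sup>2 * (exp (Q x / (2 * t)) * exp (- \<kappa> * Q x / t) * exp (- \<kappa> * Q x / t))"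
   by (simp only: mult_ac)
  also have "exp (Q x / (2 * t)) * exp (- \<kappa> * Q x / t) * exp (- \<kappa> * Q x / t) = exp (- \<delta> * Q x / t)"
  proof -
   have "Q x / (2 * t) + - \<kappa> * Q x / t + - \<kappa> * Q x / t = - \<delta> * Q x / t"
    using t c0 by (simp add: \<delta>_def field_simps)
   then show ?thesis by (metis exp_add)
  qed
  also have "K * H * M * N = \<bar>K * H * M * N\<bar>" using K H[OF t] M N by (simp add: abs_mult)
  finally show "\<bar>Wt \<beta> (t, x) * (h (t, x) * (f (t, x) * g (t, x)))\<bar> \<le> \<bar>K * H * M * N\<bar> * (1 + norm x)\<^sup>2 * exp (- \<delta> * Q x / t)" .
 qed simp
qed

lemma bnd_gauss:
 assumes c0: "0 < c0" and f: "bnd c0 B f"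
 obtains C s where "C \<ge> 0" "s > 0" "\<And>t (x::real^'n). t \<in> {c0..B} \<Longrightarrow> \<bar>f (t, x)\<bar> \<le> C * exp (- s * (x \<bullet> x))"
proof (cases "c0 \<le> B")
 case False
 then show ?thesis by (intro that[of 0 1]) auto
next
 case True
 obtain M where M: "M \<ge> 0" "\<And>t x. t \<in> {c0..B} \<Longrightarrow> \<bar>f (t, x)\<bar> \<le> M * (1 + norm x)\<^sup>2 * exp (- \<delta> * Q x / t)"
  using f unfolding bnd_def by blast
 define s where "s = \<delta> / (L * B)"
 have B: "B > 0" using True c0 by simp
 have s: "s > 0" using \<delta>_pos B L_bounds by (simp add: s_def)
 obtain C where C: "C > 0" "\<And>x::real^'n. (1 + norm x)\<^sup>2 * exp (- s * (x \<bullet> x)) \<le> C * exp (- (s/2) * (x \<bullet> x))"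
  using poly_gauss_bound[OF s] by blast
 show ?thesis
 proof (rule that[of "M * C" "s/2"])
  fix t and x :: "real^'n" assume t: "t \<in> {c0..B}"
  have "s * (x \<bullet> x) = (\<delta> / B) * ((x \<bullet> x) / L)" by (simp add: s_def)
  also have "\<dots> \<le> (\<delta> / B) * Q x" using \<delta>_pos B by (intro mult_left_mono Q_bounds) auto
  also have "\<dots> \<le> \<delta> * Q x / t"
   using t c0 \<delta>_pos B Q_bounds(3)[of x] by (simp add: divide_left_mono)
  finally have "exp (- \<delta> * Q x / t) \<le> exp (- s * (x \<bullet> x))" by simp
  then have "M * (1 + norm x)\<^sup>2 * exp (- \<delta> * Q x / t) \<le> M * ((1 + norm x)\<^sup>2 * exp (- s * (x \<bullet> x)))"
   using M by (simp add: mult.assoc mult_left_mono)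
  also have "\<dots> \<le> M * (C * exp (- (s/2) * (x \<bullet> x)))" using M C by (intro mult_left_mono) auto
  finally show "\<bar>f (t, x)\<bar> \<le> M * C * exp (- (s/2) * (x \<bullet> x))" using M(2)[OF t, of x] by (simp add: mult.assoc)
 qed (use M C s in auto)
qed

lemma bnd_slice_integrable:
 assumes c0: "0 < c0" and f: "bnd c0 B f" and t: "t \<in> {c0..B}" and m: "(\<lambda>x. f (t, x)) \<in> borel_measurable borel"
 shows "integrable lborel (\<lambda>x. f (t, x))"
proof -
 obtain C s where C: "C \<ge> 0" "s > 0" "\<And>t x. t \<in> {c0..B} \<Longrightarrow> \<bar>f (t, x)\<bar> \<le> C * exp (- s * (x \<bullet> x))"
  using bnd_gauss[OF c0 f] by blast
 show ?thesis
 proof (rule Bochner_Integration.integrable_bound)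
  show "integrable lborel (\<lambda>x::real^'n. C * exp (- s * (x \<bullet> x)))"
   using C by (intro integrable_mult_right integrable_gauss)
  show "AE x in lborel. norm (f (t, x)) \<le> norm (C * exp (- s * (x \<bullet> x)))"
   using C t by (auto simp: abs_mult)
 qed (use m in simp)
qed

lemma indicator_Icc_integrable:
 fixes c0 B :: real
 shows "integrable lborel (indicat_real {c0..B})"
 using emeasure_bounded_finite[of "{c0..B}"] by (intro integrable_real_indicator) auto

lemma bnd_integrable:
 assumes c0: "0 < c0" and f: "bnd c0 B f" and m [measurable]: "f \<in> borel_measurable borel"
 shows "integrable lborel (\<lambda>p. indicator {c0..B} (fst p) * f p)"
proof -
 obtain C s where C: "C \<ge> 0" "s > 0" "\<And>t x. t \<in> {c0..B} \<Longrightarrow> \<bar>f (t, x)\<bar> \<le> C * exp (- s * (x \<bullet> x))"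
  using bnd_gauss[OF c0 f] by blast
 have "integrable (lborel \<Otimes>\<^sub>M lborel) (\<lambda>(t, x::real^'n). indicator {c0..B} t * (C * exp (- s * (x \<bullet> x))))"
 proof (rule lborel_pair.Fubini_integrable)
  show "integrable lborel (\<lambda>t. LB x. norm (case (t, x) of (t, x::real^'n) \<Rightarrow> indicator {c0..B} t * (C * exp (- s * (x \<bullet> x)))))"
   using C indicator_Icc_integrable by (simp add: abs_mult)
  show "AE t in lborel. integrable lborel (\<lambda>x. case (t, x) of (t, x::real^'n) \<Rightarrow> indicator {c0..B} t * (C * exp (- s * (x \<bullet> x))))"
   unfolding prod.case using C by (intro AE_I2 integrable_mult_right integrable_gauss)
 qed measurable
 then have "integrable lborel (\<lambda>p :: real \<times> (real^'n). indicator {c0..B} (fst p) * (C * exp (- s * (snd p \<bullet> snd p))))"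
  by (simp add: lborel_prod split_beta')
 then show ?thesis
 proof (rule Bochner_Integration.integrable_bound)
  show "AE p in lborel. norm (indicator {c0..B} (fst p) * f p) \<le> norm (indicator {c0..B} (fst p) * (C * exp (- s * (snd p \<bullet> snd p))))"
  proof (rule AE_I2)
   fix p :: "real \<times> (real^'n)"
   show "norm (indicator {c0..B} (fst p) * f p) \<le> norm (indicator {c0..B} (fst p) * (C * exp (- s * (snd p \<bullet> snd p))))"
    using C(1) C(3)[of "fst p" "snd p"] by (auto simp: indicator_def abs_mult)
  qed
 qed simp
qed

definition IS :: "real \<Rightarrow> real \<Rightarrow> (real \<times> (real^'n) \<Rightarrow> real) \<Rightarrow> real" where
 "IS c0 B f = (LB p. indicator {c0..B} (fst p) * f p)"

lemma IS_iterated: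
 assumes c0: "0 < c0" and f: "bnd c0 B f" and m [measurable]: "f \<in> borel_measurable borel"
 shows "IS c0 B f = (LB t. indicator {c0..B} t * (LB x. f (t, x)))"
  and "IS c0 B f = (LB x. (LB t. f (t, x) * indicator {c0..B} t))"
proof -
 have i: "integrable (lborel \<Otimes>\<^sub>M lborel) (\<lambda>p. indicator {c0..B} (fst p) * f p)"
  using bnd_integrable[OF assms] by (simp add: lborel_prod)
 show "IS c0 B f = (LB t. indicator {c0..B} t * (LB x. f (t, x)))"
  unfolding IS_def using lborel_pair.integral_fst'[OF i] by (simp add: lborel_prod)
 have i': "integrable (lborel \<Otimes>\<^sub>M lborel) (\<lambda>(t, x). indicator {c0..B} t * f (t, x))"
  using i by (simp add: split_beta')
 show "IS c0 B f = (LB x. (LB t. f (t, x) * indicator {c0..B} t))"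
  unfolding IS_def using lborel_pair.integral_snd[OF i'] by (simp add: lborel_prod split_beta' mult.commute)
qed

lemma IS_add:
 assumes "0 < c0" "bnd c0 B f" "f \<in> borel_measurable borel" "bnd c0 B g" "g \<in> borel_measurable borel"
 shows "IS c0 B (\<lambda>p. f p + g p) = IS c0 B f + IS c0 B g"
 unfolding IS_def distrib_left using assms bnd_integrable by (intro Bochner_Integration.integral_add) auto

lemma IS_cmult: "IS c0 B (\<lambda>p. c * f p) = c * IS c0 B f"
 unfolding IS_def by (simp add: mult.left_commute[of _ c])

lemma IS_mono:
 assumes "0 < c0" "bnd c0 B f" "f \<in> borel_measurable borel" "bnd c0 B g" "g \<in> borel_measurable borel"
  "\<And>t x. t \<in> {c0..B} \<Longrightarrow> f (t, x) \<le> g (t, x)"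
 shows "IS c0 B f \<le> IS c0 B g"
 unfolding IS_def
proof (rule integral_mono)
 fix p :: "real \<times> (real^'n)"
 show "indicator {c0..B} (fst p) * f p \<le> indicator {c0..B} (fst p) * g p"
  using assms(6)[of "fst p" "snd p"] by (auto simp: indicator_def)
qed (use assms bnd_integrable in auto)

lemma Q_has_derivative: "(Q has_derivative (\<lambda>e. 2 * (x \<bullet> (matrix_inv a *v e)))) (at x)"
proof -
 have "((\<lambda>y. y \<bullet> (matrix_inv a *v y)) has_derivative (\<lambda>e. x \<bullet> (matrix_inv a *v e) + e \<bullet> (matrix_inv a *v x))) (at x)"
  by (intro has_derivative_inner has_derivative_ident bounded_linear_imp_has_derivative matrix_vector_mul_bounded_linear)
 moreover have "x \<bullet> (matrix_inv a *v e) + e \<bullet> (matrix_inv a *v x) = 2 * (x \<bullet> (matrix_inv a *v e))" for e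
  using matrix_inv_symmetric_inner[OF a, of e x] inner_commute[of "matrix_inv a *v e" x] by linarith
 ultimately show ?thesis unfolding Q_def[abs_def] by (simp only:)
qed

lemma Wt_has_derivative_x:
 assumes "t > 0"
 shows "((\<lambda>x. Wt \<beta> (t, x)) has_derivative (\<lambda>e. Wt \<beta> (t, x) * ((x \<bullet> (matrix_inv a *v e)) / t))) (at x)"
proof -
 have "((\<lambda>u. t powr \<beta> * exp (u / (2 * t))) has_real_derivative t powr \<beta> * exp (u / (2 * t)) / (2 * t)) (at u)" for u
  using assms by (auto intro!: derivative_eq_intros)
 then have "((\<lambda>x. t powr \<beta> * exp (Q x / (2 * t))) has_derivative (\<lambda>e. t powr \<beta> * exp (Q x / (2 * t)) / (2 * t) * (2 * (x \<bullet> (matrix_inv a *v e))))) (at x)"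
  unfolding has_field_derivative_def by (rule has_derivative_compose[OF Q_has_derivative])
 then show ?thesis using assms by (simp add: Wt_def field_simps)
qed

lemma slice_has_derivative:
 fixes u :: "real \<times> (real^'n) \<Rightarrow> real"
 assumes "smooth u"
 shows "((\<lambda>x. u (t, x)) has_derivative (\<lambda>e. dd (0, e) u (t, x))) (at x)"
 by (rule has_derivative_compose[OF _ smooth_has_derivative[OF assms]]) (auto intro!: derivative_eq_intros)

lemma slice_continuous:
 fixes u :: "real \<times> (real^'n) \<Rightarrow> real"
 assumes "smooth u" shows "continuous_on UNIV (\<lambda>x. u (t, x))"
 by (rule continuous_on_compose2[OF smooth_continuous_on[OF assms, of UNIV]]) (auto intro!: continuous_intros)

lemma linear_over_t_bound:
 assumes "0 < c0"
 obtains H where "H \<ge> 0" "\<And>t x. t \<in> {c0..B} \<Longrightarrow> \<bar>(x \<bullet> w) / t\<bar> \<le> H * (1 + norm (x :: real^'n))\<^sup>2"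
proof (rule that[of "norm w / c0"])
 fix t and x :: "real^'n" assume t: "t \<in> {c0..B}"
 have "\<bar>(x \<bullet> w) / t\<bar> \<le> (norm x * norm w) / c0"
  unfolding abs_divide using t assms Cauchy_Schwarz_ineq2[of x w] by (intro frac_le) auto
 also have "\<dots> = norm w / c0 * norm x" by simp
 also have "\<dots> \<le> norm w / c0 * (1 + norm x)\<^sup>2"
  using assms by (intro mult_left_mono) (auto simp: power2_eq_square algebra_simps)
 finally show "\<bar>(x \<bullet> w) / t\<bar> \<le> norm w / c0 * (1 + norm x)\<^sup>2" .
qed (use assms in simp)

lemma one_le_poly: "\<bar>1 :: real\<bar> \<le> 1 * (1 + norm x)\<^sup>2"
 by (simp add: power2_eq_square algebra_simps)

lemma bnd_product1:
 assumes "0 < c0" "decays c0 B f" "decays c0 B g" shows "bnd c0 B (\<lambda>p. Wt \<beta> p * (f p * g p))"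
 using bnd_product[OF assms, of "\<lambda>_. 1" 1] one_le_poly by simp

text \<open>The integrand is the derivative of \<open>Wt * u * v\<close> along \<open>e\<close>; the
  first term is the logarithmic derivative of the weight. Decay makes each of the three terms
  integrable.\<close>

lemma ibp_slice:
 assumes c0: "0 < c0" and t: "t \<in> {c0..B}" and su: "smooth u" and sv: "smooth v"
  and d: "decays c0 B u" "decays c0 B v" "decays c0 B (dd (0, e) u)" "decays c0 B (dd (0, e) v)"
 shows "(LB x. Wt \<beta> (t, x) * ((x \<bullet> (matrix_inv a *v e)) / t * (u (t, x) * v (t, x)))
   + Wt \<beta> (t, x) * (u (t, x) * dd (0, e) v (t, x)) + Wt \<beta> (t, x) * (dd (0, e) u (t, x) * v (t, x))) = 0"
proof -
 have t0: "t > 0" using t c0 by auto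
 define F' where "F' x e = Wt \<beta> (t, x) * (u (t, x) * dd (0, e) v (t, x) + dd (0, e) u (t, x) * v (t, x))
  + Wt \<beta> (t, x) * ((x \<bullet> (matrix_inv a *v e)) / t) * (u (t, x) * v (t, x))" for x e
 obtain H where H: "\<And>t x. t \<in> {c0..B} \<Longrightarrow> \<bar>(x \<bullet> (matrix_inv a *v e)) / t\<bar> \<le> H * (1 + norm x)\<^sup>2"
  using linear_over_t_bound[OF c0, where w="matrix_inv a *v e" and B=B] by blast
 have cW: "continuous_on UNIV (\<lambda>x. Wt \<beta> (t, x))"
  unfolding Wt_def using t0 by (auto intro!: continuous_intros continuous_Q)
 note cs = slice_continuous[OF su] slice_continuous[OF sv] slice_continuous[OF smooth_dd[OF su]] slice_continuous[OF smooth_dd[OF sv]]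
 have "(LB x. F' x e) = 0"
 proof (rule integral_derivative_eq_0[where F="\<lambda>x. Wt \<beta> (t, x) * (u (t, x) * v (t, x))"])
  show "((\<lambda>x. Wt \<beta> (t, x) * (u (t, x) * v (t, x))) has_derivative F' x) (at x)" for x
   unfolding F'_def
   by (rule has_derivative_mult[OF Wt_has_derivative_x[OF t0] has_derivative_mult[OF slice_has_derivative[OF su] slice_has_derivative[OF sv]]])
  show "continuous_on UNIV (\<lambda>x. F' x e)" unfolding F'_def using t0
   by (auto intro!: continuous_intros cW cs)
  show "integrable lborel (\<lambda>x. Wt \<beta> (t, x) * (u (t, x) * v (t, x)))"
   by (rule bnd_slice_integrable[OF c0 bnd_product1[OF c0 d(1,2)] t])
    (intro borel_measurable_continuous_onI continuous_intros cW cs)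
  have "integrable lborel (\<lambda>x. Wt \<beta> (t, x) * (u (t, x) * dd (0, e) v (t, x)))"
   by (rule bnd_slice_integrable[OF c0 bnd_product1[OF c0 d(1,4)] t])
    (intro borel_measurable_continuous_onI continuous_intros cW cs)
  moreover have "integrable lborel (\<lambda>x. Wt \<beta> (t, x) * (dd (0, e) u (t, x) * v (t, x)))"
   by (rule bnd_slice_integrable[OF c0 bnd_product1[OF c0 d(3,2)] t])
    (intro borel_measurable_continuous_onI continuous_intros cW cs)
  moreover have "integrable lborel (\<lambda>x. (\<lambda>p. Wt \<beta> p * ((snd p \<bullet> (matrix_inv a *v e)) / fst p * (u p * v p))) (t, x))"
  proof (rule bnd_slice_integrable[OF c0 _ t])
   show "bnd c0 B (\<lambda>p. Wt \<beta> p * ((snd p \<bullet> (matrix_inv a *v e)) / fst p * (u p * v p)))"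
    by (rule bnd_product[OF c0 d(1,2), of _ H]) (use H in simp)
   show "(\<lambda>x. (\<lambda>p. Wt \<beta> p * ((snd p \<bullet> (matrix_inv a *v e)) / fst p * (u p * v p))) (t, x)) \<in> borel_measurable borel"
    using t0 by (auto intro!: borel_measurable_continuous_onI continuous_intros cW cs)
  qed
  ultimately show "integrable lborel (\<lambda>x. F' x e)"
   unfolding F'_def by (simp add: distrib_left mult.assoc)
 qed
 then show ?thesis by (simp add: F'_def algebra_simps)
qed

section \<open>The energy density and the energy inequality\<close>

definition grad :: "(real \<times> (real^'n) \<Rightarrow> real) \<Rightarrow> real \<times> (real^'n) \<Rightarrow> real^'n" where
 "grad u p = (\<chi> i. dd (0, axis i 1) u p)"

text \<open>Half of \<open>u\<close> times the logarithmic gradient of the weight. In this variable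
  the cross term of the energy is \<open>2 * (\<zeta> \<bullet> A Du)\<close>, which a square can
  absorb.\<close>

definition \<zeta> :: "(real \<times> (real^'n) \<Rightarrow> real) \<Rightarrow> real \<times> (real^'n) \<Rightarrow> real^'n" where
 "\<zeta> u p = (u p / (2 * fst p)) *\<^sub>R (matrix_inv a *v snd p)"

text \<open>The energy density after completing the square. The term
  \<open>\<zeta> \<bullet> a \<zeta>\<close> comes from the time derivative of the weight, while the
  square of \<open>Du + \<zeta>\<close> consumes \<open>\<zeta> \<bullet> A \<zeta>\<close>; what
  remains is the form of \<open>a - A\<close>.\<close>

definition quad :: "(real \<times> (real^'n) \<Rightarrow> real) \<Rightarrow> real \<times> (real^'n) \<Rightarrow> real" where
 "quad u p = (grad u p + \<zeta> u p) \<bullet> (A *v (grad u p + \<zeta> u p)) + \<zeta> u p \<bullet> ((a - A) *v \<zeta> u p)"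

lemma quad_expand:
 "quad u p = grad u p \<bullet> (A *v grad u p) + 2 * (\<zeta> u p \<bullet> (A *v grad u p)) + (u p)\<^sup>2 * Q (snd p) / (4 * (fst p)\<^sup>2)"
proof -
 have 1: "grad u p \<bullet> (A *v \<zeta> u p) = \<zeta> u p \<bullet> (A *v grad u p)"
  using posdef_symmetric_inner[OF A, of "grad u p" "\<zeta> u p"] by (simp add: inner_commute)
 have "\<zeta> u p \<bullet> (a *v \<zeta> u p) = (u p / (2 * fst p))\<^sup>2 * Q (snd p)"
  by (simp add: \<zeta>_def matrix_vector_mult_scaleR matrix_inv_mult[OF posdef_invertible[OF a]] Q_def power2_eq_square inner_commute)
 also have "\<dots> = (u p)\<^sup>2 * Q (snd p) / (4 * (fst p)\<^sup>2)" by (simp add: power_divide power_mult_distrib)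
 finally show ?thesis using 1
  by (simp add: quad_def matrix_vector_right_distrib matrix_vector_mult_diff_rdistrib inner_add_left inner_add_right inner_diff_right)
qed

lemma quad_coercive: "min l lam / 3 * ((norm (grad u p))\<^sup>2 + (norm (\<zeta> u p))\<^sup>2) \<le> quad u p"
proof -
 let ?m = "min l lam" and ?g = "grad u p" and ?z = "\<zeta> u p"
 have "?m * ((?g + ?z) \<bullet> (?g + ?z)) \<le> l * ((?g + ?z) \<bullet> (?g + ?z))" by (intro mult_right_mono) auto
 also have "\<dots> \<le> (?g + ?z) \<bullet> (A *v (?g + ?z))" using eA by (simp add: elliptic_def)
 finally have 1: "?m * ((?g + ?z) \<bullet> (?g + ?z)) \<le> (?g + ?z) \<bullet> (A *v (?g + ?z))" .
 have "?m * (?z \<bullet> ?z) \<le> lam * (?z \<bullet> ?z)" by (intro mult_right_mono) auto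
 also have "\<dots> \<le> ?z \<bullet> ((a - A) *v ?z)" by (rule gap)
 finally have 2: "?m * (?z \<bullet> ?z) \<le> ?z \<bullet> ((a - A) *v ?z)" .
 \<comment> \<open>The difference of the two sides of the next inequality is the sum of the squared
   norms of \<open>?g + 2 *\<^sub>R ?z\<close> and \<open>?g + ?z\<close>; hence the constant
   3.\<close>
 have "0 \<le> (?g + 2 *\<^sub>R ?z) \<bullet> (?g + 2 *\<^sub>R ?z)" by simp
 then have "?g \<bullet> ?g + ?z \<bullet> ?z \<le> 3 * ((?g + ?z) \<bullet> (?g + ?z) + ?z \<bullet> ?z)"
  using inner_ge_zero[of ?z] inner_ge_zero[of "?g + ?z"]
  by (simp add: inner_add_left inner_add_right inner_commute algebra_simps)
 then have "?m * (?g \<bullet> ?g + ?z \<bullet> ?z) \<le> ?m * (3 * ((?g + ?z) \<bullet> (?g + ?z) + ?z \<bullet> ?z))"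
  using l lam by (intro mult_left_mono) auto
 then show ?thesis using 1 2 unfolding quad_def by (simp add: power2_norm_eq_inner algebra_simps)
qed

lemma smooth_grad_component: "smooth u \<Longrightarrow> smooth (\<lambda>p. (A *v grad u p) $ i)"
 unfolding grad_def matrix_vector_mult_def by (auto intro!: smooth_sum smooth_mult smooth_const)

lemma decays_cmult: "decays c0 B f \<Longrightarrow> decays c0 B (\<lambda>p. c * f p)"
 unfolding decays_def
proof (elim exE conjE)
 fix M assume M: "0 \<le> M" "\<forall>t\<in>{c0..B}. \<forall>x. \<bar>f (t, x)\<bar> \<le> M * exp (- \<kappa> * Q x / t)"
 show "\<exists>M\<ge>0. \<forall>t\<in>{c0..B}. \<forall>x. \<bar>c * f (t, x)\<bar> \<le> M * exp (- \<kappa> * Q x / t)"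
 proof (intro exI[of _ "\<bar>c\<bar> * M"] conjI ballI allI)
  fix t x assume "t \<in> {c0..B}"
  then have "\<bar>c\<bar> * \<bar>f (t, x)\<bar> \<le> \<bar>c\<bar> * (M * exp (- \<kappa> * Q x / t))"
   using M(2) by (intro mult_left_mono) auto
  then show "\<bar>c * f (t, x)\<bar> \<le> \<bar>c\<bar> * M * exp (- \<kappa> * Q x / t)"
   by (simp add: abs_mult mult.assoc)
 qed (use M in simp)
qed

lemma decays_add: "decays c0 B f \<Longrightarrow> decays c0 B g \<Longrightarrow> decays c0 B (\<lambda>p. f p + g p)"
 unfolding decays_def
proof (elim exE conjE)
 fix M N assume M: "0 \<le> M" "\<forall>t\<in>{c0..B}. \<forall>x. \<bar>f (t, x)\<bar> \<le> M * exp (- \<kappa> * Q x / t)"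
  and N: "0 \<le> N" "\<forall>t\<in>{c0..B}. \<forall>x. \<bar>g (t, x)\<bar> \<le> N * exp (- \<kappa> * Q x / t)"
 show "\<exists>M\<ge>0. \<forall>t\<in>{c0..B}. \<forall>x. \<bar>f (t, x) + g (t, x)\<bar> \<le> M * exp (- \<kappa> * Q x / t)"
 proof (intro exI[of _ "M + N"] conjI ballI allI)
  fix t x assume "t \<in> {c0..B}"
  then show "\<bar>f (t, x) + g (t, x)\<bar> \<le> (M + N) * exp (- \<kappa> * Q x / t)"
   using M(2)[rule_format, of t x] N(2)[rule_format, of t x] abs_triangle_ineq[of "f (t, x)" "g (t, x)"]
   by (simp add: distrib_right)
 qed (use M N in simp)
qed

lemma decays_sum: "(\<And>i. i \<in> I \<Longrightarrow> decays c0 B (f i)) \<Longrightarrow> decays c0 B (\<lambda>p. \<Sum>i\<in>I. f i p)"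
proof (induction I rule: infinite_finite_induct)
 case (insert i I)
 then show ?case using decays_add[of c0 B "f i" "\<lambda>p. \<Sum>i\<in>I. f i p"] by simp
qed (auto simp: decays_def intro!: exI[of _ 0])

text \<open>Integrate \<open>\<partial>\<^sub>t (W u\<^sup>2 / 2) - div (W u A Du) = W u g + \<beta> W u\<^sup>2 / (2 t) - W quad u\<close> over the strip.\<close>

lemma energy:
 assumes c0: "0 < c0" "c0 \<le> B" and su: "smooth u"
  and d0: "decays c0 B u" and d1: "\<And>e. decays c0 B (dd e u)" and d2: "\<And>e e'. decays c0 B (dd e (dd e' u))"
  and init: "\<And>x. u (c0, x) = 0"
 shows "bnd c0 B (\<lambda>p. Wt \<beta> p * quad u p)" (is ?bnd)
  and "IS c0 B (\<lambda>p. Wt \<beta> p * quad u p)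
  \<le> IS c0 B (\<lambda>p. Wt \<beta> p * (u p * heat_op A u p)) + \<beta> / 2 * IS c0 B (\<lambda>p. Wt (\<beta> - 1) p * (u p)\<^sup>2)"
proof -
 let ?W = "Wt \<beta>"
 define LA where "LA p = (\<Sum>i\<in>UNIV. \<Sum>j\<in>UNIV. A $ i $ j * dd (0, axis i 1) (dd (0, axis j 1) u) p)" for p
 define V where "V i p = (A *v grad u p) $ i" for i p
 have V_eq: "V i = (\<lambda>p. \<Sum>j\<in>UNIV. A $ i $ j * dd (0, axis j 1) u p)" for i
  by (auto simp: V_def grad_def matrix_vector_mult_def)
 have sV: "smooth (V i)" for i unfolding V_def[abs_def] by (rule smooth_grad_component[OF su])
 have dV: "decays c0 B (V i)" for i unfolding V_eq by (intro decays_sum decays_cmult d1)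
 have ddV: "dd (0, axis i 1) (V i) = (\<lambda>p. \<Sum>j\<in>UNIV. A $ i $ j * dd (0, axis i 1) (dd (0, axis j 1) u) p)" for i
 proof (rule ext, rule dd_eqI[of _ "\<lambda>e. \<Sum>j\<in>UNIV. A $ i $ j * dd e (dd (0, axis j 1) u) p" for p, simplified])
  fix p
  show "(V i has_derivative (\<lambda>e. \<Sum>j\<in>UNIV. A $ i $ j * dd e (dd (0, axis j 1) u) p)) (at p)"
   unfolding V_eq by (intro has_derivative_sum has_derivative_mult_right smooth_has_derivative smooth_dd su)
 qed
 have dddV: "decays c0 B (dd (0, axis i 1) (V i))" for i unfolding ddV by (intro decays_sum decays_cmult d2)
 have dLA: "decays c0 B LA" unfolding LA_def by (intro decays_sum decays_cmult d2)
 have sLA: "smooth LA" unfolding LA_def by (intro smooth_sum smooth_mult smooth_const smooth_dd su)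
 define Z where "Z p = (\<Sum>i\<in>UNIV. (snd p \<bullet> (matrix_inv a *v axis i 1)) / fst p * (u p * V i p))" for p
 define D where "D p = (\<Sum>i\<in>UNIV. dd (0, axis i 1) u p * V i p)" for p
 have mu [measurable]: "u \<in> borel_measurable borel" "LA \<in> borel_measurable borel" "V i \<in> borel_measurable borel"
  "dd e u \<in> borel_measurable borel" for i e
  using su sV sLA by (auto intro: smooth_measurable)
 have minn [measurable]: "(\<lambda>p. snd p \<bullet> w) \<in> borel_measurable borel" for w :: "real^'n"
  by (intro borel_measurable_continuous_onI continuous_intros)
 have mZ [measurable]: "Z \<in> borel_measurable borel" "D \<in> borel_measurable borel"
  unfolding Z_def[abs_def] D_def[abs_def] by measurable
 have b1: "bnd c0 B (\<lambda>p. ?W p * (snd p \<bullet> (matrix_inv a *v axis i 1) / fst p * (u p * V i p)))" for i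
 proof (rule linear_over_t_bound[OF c0(1), where w="matrix_inv a *v axis i 1" and B=B])
  fix H assume "\<And>t x. t \<in> {c0..B} \<Longrightarrow> \<bar>(x \<bullet> (matrix_inv a *v axis i 1)) / t\<bar> \<le> H * (1 + norm x)\<^sup>2"
  then show ?thesis by (intro bnd_product[OF c0(1) d0 dV, of _ H]) simp
 qed
 have bZ: "bnd c0 B (\<lambda>p. ?W p * Z p)"
  unfolding Z_def sum_distrib_left by (rule bnd_sum) (rule b1)
 have bD: "bnd c0 B (\<lambda>p. ?W p * D p)"
  unfolding D_def sum_distrib_left by (intro bnd_sum bnd_product1 c0 d1 dV)
 have bL: "bnd c0 B (\<lambda>p. ?W p * (u p * LA p))" by (intro bnd_product1 c0 d0 dLA)
 \<comment> \<open>The divergence part: each component is a total derivative on every time slice.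
   \<open>Z\<close> collects the terms from the weight, \<open>D\<close> the quadratic form of the
   gradient.\<close>
 have div: "IS c0 B (\<lambda>p. ?W p * Z p) + IS c0 B (\<lambda>p. ?W p * (u p * LA p)) + IS c0 B (\<lambda>p. ?W p * D p) = 0"
 proof -
  let ?f = "\<lambda>p. ?W p * Z p + ?W p * (u p * LA p) + ?W p * D p"
  have LA_V: "LA p = (\<Sum>i\<in>UNIV. dd (0, axis i 1) (V i) p)" for p by (simp add: LA_def ddV)
  define F where "F i p = ?W p * ((snd p \<bullet> (matrix_inv a *v axis i 1)) / fst p * (u p * V i p))
    + ?W p * (u p * dd (0, axis i 1) (V i) p) + ?W p * (dd (0, axis i 1) u p * V i p)" for i p
  have bF: "bnd c0 B (F i)" for i
   unfolding F_def[abs_def]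
   by (rule bnd_add[OF bnd_add[OF b1 bnd_product1[OF c0(1) d0 dddV]] bnd_product1[OF c0(1) d1 dV]])
  have mF: "F i \<in> borel_measurable borel" for i
  proof -
   have [measurable]: "dd (0, axis i 1) (V i) \<in> borel_measurable borel"
    by (intro smooth_measurable smooth_dd sV)
   show ?thesis unfolding F_def[abs_def] by measurable
  qed
  have IF: "IS c0 B (F i) = 0" for i
  proof -
   have sl: "indicator {c0..B} t * (LB x. F i (t, x)) = 0" for t
   proof (cases "t \<in> {c0..B}")
    case True
    from ibp_slice[OF c0(1) True su sV[of i] d0 dV[of i] d1 dddV[of i], where \<beta>=\<beta>]
    show ?thesis by (simp add: F_def)
   qed simp
   show ?thesis unfolding IS_iterated(1)[OF c0(1) bF mF] sl by simp
  qed
  have "IS c0 B ?f = IS c0 B (\<lambda>p. \<Sum>i\<in>UNIV. F i p)"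
   by (simp add: F_def Z_def D_def LA_V sum.distrib sum_distrib_left)
  also have "\<dots> = (\<Sum>i\<in>UNIV. IS c0 B (F i))"
   unfolding IS_def sum_distrib_left by (intro Bochner_Integration.integral_sum bnd_integrable c0 bF mF)
  finally have "IS c0 B ?f = 0" by (simp add: IF)
  moreover have "IS c0 B ?f = IS c0 B (\<lambda>p. ?W p * Z p) + IS c0 B (\<lambda>p. ?W p * (u p * LA p)) + IS c0 B (\<lambda>p. ?W p * D p)"
   using c0 by (subst IS_add; (intro bnd_add bZ bD bL)?; simp?) (subst IS_add; (intro bZ bD bL)?; simp?)
  ultimately show ?thesis by simp
 qed
 define R where "R p = ?W p * (u p * dd (1, 0) u p) + (\<beta> / 2) * (Wt (\<beta> - 1) p * (u p * u p)) + (- 1/4) * (Wt (\<beta> - 2) p * (Q (snd p) * (u p * u p)))" for p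
 have bQ: "bnd c0 B (\<lambda>p. Wt \<beta>' p * (Q (snd p) * (u p * u p)))" for \<beta>'
 proof (rule bnd_product[OF c0(1) d0 d0, of _ "1/l"])
  fix t and x :: "real^'n"
  have "Q x \<le> (1/l) * (norm x)\<^sup>2" using Q_bounds(2)[of x] by (simp add: power2_norm_eq_inner)
  also have "\<dots> \<le> (1/l) * (1 + norm x)\<^sup>2" using l by (intro mult_left_mono power_mono) auto
  finally show "\<bar>Q (snd (t, x))\<bar> \<le> 1/l * (1 + norm x)\<^sup>2" using Q_bounds(3)[of x] by simp
 qed
 have bT: "bnd c0 B (\<lambda>p. ?W p * (u p * dd (1, 0) u p))" "bnd c0 B (\<lambda>p. Wt (\<beta> - 1) p * (u p * u p))"
  by (intro bnd_product1 c0 d0 d1)+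
 have [measurable]: "R \<in> borel_measurable borel" unfolding R_def[abs_def] by measurable
 \<comment> \<open>\<open>R\<close> is the time derivative of half the weighted square of
   \<open>u\<close>. Its time integral is the value at \<open>B\<close>, which has a favourable
   sign, minus the value at \<open>c0\<close>, which is zero by \<open>init\<close>.\<close>
 have Rnn: "IS c0 B R \<ge> 0"
 proof -
  have "(LB t. R (t, x) * indicator {c0..B} t) \<ge> 0" for x
  proof -
   have "(LB t. R (t, x) * indicator {c0..B} t) = 1/2 * ?W (B, x) * (u (B, x))\<^sup>2 - 1/2 * ?W (c0, x) * (u (c0, x))\<^sup>2"
   proof (rule integral_FTC_Icc_real[OF c0(2)])
    fix t assume t: "c0 \<le> t" "t \<le> B"
    have t0: "t > 0" using t c0 by simp
    have du: "((\<lambda>t. u (t, x)) has_real_derivative dd (1, 0) u (t, x)) (at t)"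
    proof -
     have "((\<lambda>t. u (t, x)) has_derivative (\<lambda>h. dd (h, 0) u (t, x))) (at t)"
      by (rule has_derivative_compose[OF _ smooth_has_derivative[OF su]]) (auto intro!: derivative_eq_intros)
     moreover have "(\<lambda>h. dd (h, 0) u (t, x)) = (*) (dd (1, 0) u (t, x))"
     proof
      show "dd (h, 0) u (t, x) = dd (1, 0) u (t, x) * h" for h
       using linear_scale[OF smooth_linear_dd[OF su], of h "(1, 0)" "(t, x)"] by simp
     qed
     ultimately show ?thesis unfolding has_field_derivative_def by (simp only:)
    qed
    have dW: "((\<lambda>t. ?W (t, x)) has_real_derivative (\<beta> * Wt (\<beta> - 1) (t, x) - 1/2 * Q x * Wt (\<beta> - 2) (t, x))) (at t)"
    proof -
     have "t powr (\<beta> - 2) = t powr \<beta> / t\<^sup>2" using t0 by (simp add: powr_diff)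
     then show ?thesis unfolding Wt_def using t0
      by (auto intro!: derivative_eq_intros simp: power2_eq_square field_simps)
    qed
    have "((\<lambda>t. 1/2 * ?W (t, x) * (u (t, x))\<^sup>2) has_real_derivative
      (1/2 * (\<beta> * Wt (\<beta> - 1) (t, x) - 1/2 * Q x * Wt (\<beta> - 2) (t, x)) * (u (t, x))\<^sup>2 + 1/2 * ?W (t, x) * (2 * u (t, x) * dd (1, 0) u (t, x)))) (at t)"
     by (auto intro!: derivative_eq_intros du dW)
    then show "((\<lambda>t. 1/2 * ?W (t, x) * (u (t, x))\<^sup>2) has_real_derivative R (t, x)) (at t)"
     by (rule DERIV_cong) (simp add: R_def power2_eq_square algebra_simps)
    have "isCont (\<lambda>t. g (t, x)) t" if "smooth g" for g :: "real \<times> (real^'n) \<Rightarrow> real"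
     using continuous_on_compose2[OF smooth_continuous_on[OF that, of UNIV], of UNIV "\<lambda>t. (t, x)"]
     by (auto simp: continuous_on_eq_continuous_at intro!: continuous_intros)
    moreover have "isCont (\<lambda>t. Wt \<beta>' (t, x)) t" for \<beta>'
     unfolding Wt_def using t0 by (auto intro!: continuous_intros)
    ultimately show "isCont (\<lambda>t. R (t, x)) t"
     unfolding R_def using su by (auto intro!: continuous_intros)
   qed
   also have "\<dots> \<ge> 0" by (simp add: init Wt_def)
   finally show ?thesis .
  qed
  moreover have "IS c0 B R = (LB x. (LB t. R (t, x) * indicator {c0..B} t))"
  proof (rule IS_iterated(2)[OF c0(1)])
   show "bnd c0 B R" unfolding R_def[abs_def] by (intro bnd_add bnd_cmult bT bQ)
  qed measurable
  ultimately show ?thesis by (simp add: integral_nonneg)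
 qed
 have R_split: "IS c0 B R = IS c0 B (\<lambda>p. ?W p * (u p * dd (1, 0) u p)) + \<beta> / 2 * IS c0 B (\<lambda>p. Wt (\<beta> - 1) p * (u p * u p))
   + (- 1/4) * IS c0 B (\<lambda>p. Wt (\<beta> - 2) p * (Q (snd p) * (u p * u p)))"
 proof -
  let ?X = "\<lambda>p. ?W p * (u p * dd (1, 0) u p)" and ?Y = "\<lambda>p. \<beta> / 2 * (Wt (\<beta> - 1) p * (u p * u p))"
   and ?Z = "\<lambda>p. (- 1/4) * (Wt (\<beta> - 2) p * (Q (snd p) * (u p * u p)))"
  have "IS c0 B (\<lambda>p. (?X p + ?Y p) + ?Z p) = IS c0 B (\<lambda>p. ?X p + ?Y p) + IS c0 B ?Z"
   by (rule IS_add[OF c0(1) bnd_add[OF bT(1) bnd_cmult[OF bT(2)]] _ bnd_cmult[OF bQ]]) measurable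
  also have "IS c0 B (\<lambda>p. ?X p + ?Y p) = IS c0 B ?X + IS c0 B ?Y"
   by (rule IS_add[OF c0(1) bT(1) _ bnd_cmult[OF bT(2)]]) measurable
  finally show ?thesis unfolding R_def[abs_def] IS_cmult .
 qed
 have sH: "heat_op A u p = dd (1, 0) u p - LA p" for p by (simp add: heat_op_def LA_def)
 have [measurable]: "heat_op A u \<in> borel_measurable borel" unfolding sH[abs_def] by measurable
 have bH: "bnd c0 B (\<lambda>p. ?W p * (u p * heat_op A u p))"
  using bnd_add[OF bT(1) bnd_cmult[OF bL, of "-1"]] by (simp add: sH algebra_simps)
 have H_split: "IS c0 B (\<lambda>p. ?W p * (u p * dd (1, 0) u p)) = IS c0 B (\<lambda>p. ?W p * (u p * heat_op A u p)) + IS c0 B (\<lambda>p. ?W p * (u p * LA p))"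
  using IS_add[OF c0(1) bH _ bL] by (simp add: sH algebra_simps)
 \<comment> \<open>The last term is the part of \<open>- R\<close> in which time differentiation
   hits the exponential of the weight; together with \<open>D\<close> and \<open>Z\<close> it makes
   up exactly the completed square.\<close>
 have pointwise: "?W p * quad u p = (?W p * D p + ?W p * Z p) + 1/4 * (Wt (\<beta> - 2) p * (Q (snd p) * (u p * u p)))"
  if True: "fst p \<in> {c0..B}" for p
 proof -
  from True have t0: "fst p > 0" using c0 by simp
  have "D p = grad u p \<bullet> (A *v grad u p)" by (simp add: D_def V_def grad_def inner_vec_def)
  moreover have "Z p = 2 * (\<zeta> u p \<bullet> (A *v grad u p))"
  proof -
   have "snd p \<bullet> (matrix_inv a *v axis i 1) = (matrix_inv a *v snd p) $ i" for i
    using matrix_inv_symmetric_inner[OF a, of "snd p" "axis i 1"] by (simp add: inner_axis)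
   then have "Z p = (u p / fst p) * ((matrix_inv a *v snd p) \<bullet> (A *v grad u p))"
    by (simp add: Z_def V_def inner_vec_def sum_distrib_left mult_ac)
   then show ?thesis by (simp add: \<zeta>_def)
  qed
  moreover have "?W p * ((u p)\<^sup>2 * Q (snd p) / (4 * (fst p)\<^sup>2)) = 1/4 * (Wt (\<beta> - 2) p * (Q (snd p) * (u p * u p)))"
   using t0 by (simp add: Wt_def powr_diff power2_eq_square)
  ultimately show ?thesis unfolding quad_expand by (simp only: distrib_left)
 qed
 show ?bnd
  by (rule bnd_cong[OF bnd_add[OF bnd_add[OF bD bZ] bnd_cmult[OF bQ, of "1/4" "\<beta> - 2"]]]) (simp add: pointwise)
 have Q_split: "IS c0 B (\<lambda>p. ?W p * quad u p) = IS c0 B (\<lambda>p. ?W p * D p) + IS c0 B (\<lambda>p. ?W p * Z p) + 1/4 * IS c0 B (\<lambda>p. Wt (\<beta> - 2) p * (Q (snd p) * (u p * u p)))"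
 proof -
  have "IS c0 B (\<lambda>p. ?W p * quad u p) = IS c0 B (\<lambda>p. (?W p * D p + ?W p * Z p) + 1/4 * (Wt (\<beta> - 2) p * (Q (snd p) * (u p * u p))))"
   unfolding IS_def
  proof (intro Bochner_Integration.integral_cong refl)
   fix p :: "real \<times> (real^'n)"
   show "indicator {c0..B} (fst p) * (?W p * quad u p) = indicator {c0..B} (fst p) * ((?W p * D p + ?W p * Z p) + 1/4 * (Wt (\<beta> - 2) p * (Q (snd p) * (u p * u p))))"
   proof (cases "fst p \<in> {c0..B}")
    case True
    then show ?thesis using pointwise[of p] by (simp only:)
   qed simp
  qed
  also have "\<dots> = IS c0 B (\<lambda>p. ?W p * D p) + IS c0 B (\<lambda>p. ?W p * Z p) + 1/4 * IS c0 B (\<lambda>p. Wt (\<beta> - 2) p * (Q (snd p) * (u p * u p)))"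
  proof -
   let ?Y = "\<lambda>p. 1/4 * (Wt (\<beta> - 2) p * (Q (snd p) * (u p * u p)))"
   have "IS c0 B (\<lambda>p. (?W p * D p + ?W p * Z p) + ?Y p) = IS c0 B (\<lambda>p. ?W p * D p + ?W p * Z p) + IS c0 B ?Y"
    by (rule IS_add[OF c0(1) bnd_add[OF bD bZ] _ bnd_cmult[OF bQ]]) measurable
   also have "IS c0 B (\<lambda>p. ?W p * D p + ?W p * Z p) = IS c0 B (\<lambda>p. ?W p * D p) + IS c0 B (\<lambda>p. ?W p * Z p)"
    by (rule IS_add[OF c0(1) bD _ bZ]) measurable
   finally show ?thesis unfolding IS_cmult .
  qed
  finally show ?thesis .
 qed
 show "IS c0 B (\<lambda>p. ?W p * quad u p)
  \<le> IS c0 B (\<lambda>p. ?W p * (u p * heat_op A u p)) + \<beta> / 2 * IS c0 B (\<lambda>p. Wt (\<beta> - 1) p * (u p)\<^sup>2)"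
  using div Rnn R_split H_split Q_split by (simp add: power2_eq_square)
qed

end

text \<open>An upper bound for the constant of the Schur test, with \<open>hZ\<close> replaced by
  its lower bound in terms of \<open>l\<close> and \<open>J\<close> by its upper bound in terms of
  \<open>L\<close>, so that \<open>a\<close> and \<open>A\<close> no longer occur.\<close>

definition schur_const :: "'n::finite itself \<Rightarrow> real \<Rightarrow> real \<Rightarrow> real \<Rightarrow> real" where
 "schur_const _ l L lam = (let n = real CARD('n); \<kappa> = 1 / (4 * (1 - lam / (2 * L))); g = gauss_int TYPE(real^'n) (1/L)
   in (1 / gauss_int TYPE(real^'n) (1/(4*l)))\<^sup>2 * ((2 * \<kappa> powr (- n/2) * g) * (2 * (2 * \<kappa> - 1/2) powr (- n/2) * g)))"

text \<open>The pieces stem from \<open>dual_estimate\<close>: \<open>3/m\<close> inverts the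
  coercivity of \<open>quad\<close>, \<open>15/m\<close> is the cost of Young's inequality,
  \<open>4/m\<close> is \<open>3/m\<close> after absorbing a quarter of the energy, and
  \<open>\<beta>\<close> is the power of time in the dual weight. No time and no matrix
  occurs.\<close>

definition dual_const :: "'n::finite itself \<Rightarrow> real \<Rightarrow> real \<Rightarrow> real \<Rightarrow> real \<Rightarrow> real" where
 "dual_const T l L lam \<alpha> = (let m = min l lam; \<beta> = real CARD('n) / 2 - \<alpha>
   in 4/m * (15/m + \<bar>\<beta>\<bar>/2 * (3/m * (1/2 + (1/2 + \<bar>\<beta> - 1\<bar>/2) * schur_const T l L lam))))"

text \<open>Derivatives commute with the convolution. Together with \<open>heat_pot_heat_op\<close>
  this says that the potential solves the forward heat equation.\<close>

lemma wconv_heat_op: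
 assumes A: "posdef (A :: real^'n^'n)" and G: "G \<in> test_functions \<Omega>"
 shows "heat_op A (heat_pot B A G) p = heat_pot B A (heat_op A G) p"
proof -
 note i = wconv_test_integrable[OF heat_wt_integrable[OF A] heat_map_measurable]
 have "heat_op A (heat_pot B A G) p = heat_pot B A (dd (1, 0) G) p
   - (\<Sum>i\<in>UNIV. \<Sum>j\<in>UNIV. A $ i $ j * heat_pot B A (dd (0, axis i 1) (dd (0, axis j 1) G)) p)"
  by (simp add: heat_op_def dd_heat_pot[OF A G] dd_heat_pot[OF A test_dd[OF G]])
 also have "\<dots> = heat_pot B A (heat_op A G) p"
 proof -
  let ?N = "heat_wt B A" and ?S = "\<lambda>q. p - heat_map q"
  have "heat_pot B A (heat_op A G) p = (LB q. ?N q * dd (1, 0) G (?S q)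
    - (\<Sum>i\<in>UNIV. \<Sum>j\<in>UNIV. A $ i $ j * (?N q * dd (0, axis i 1) (dd (0, axis j 1) G) (?S q))))"
   unfolding heat_pot_def wconv_def heat_op_def
   by (simp add: right_diff_distrib sum_distrib_left mult.left_commute)
  also have "\<dots> = (LB q. ?N q * dd (1, 0) G (?S q))
    - (LB q. (\<Sum>i\<in>UNIV. \<Sum>j\<in>UNIV. A $ i $ j * (?N q * dd (0, axis i 1) (dd (0, axis j 1) G) (?S q))))"
   by (intro Bochner_Integration.integral_diff Bochner_Integration.integrable_sum integrable_mult_right i[OF test_dd[OF G]] i[OF test_dd[OF test_dd[OF G]]])
  also have "(LB q. (\<Sum>i\<in>UNIV. \<Sum>j\<in>UNIV. A $ i $ j * (?N q * dd (0, axis i 1) (dd (0, axis j 1) G) (?S q))))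
   = (\<Sum>i\<in>UNIV. LB q. (\<Sum>j\<in>UNIV. A $ i $ j * (?N q * dd (0, axis i 1) (dd (0, axis j 1) G) (?S q))))"
   by (intro Bochner_Integration.integral_sum Bochner_Integration.integrable_sum integrable_mult_right i[OF test_dd[OF G]] i[OF test_dd[OF test_dd[OF G]]])
  also have "\<dots> = (\<Sum>i\<in>UNIV. \<Sum>j\<in>UNIV. LB q. A $ i $ j * (?N q * dd (0, axis i 1) (dd (0, axis j 1) G) (?S q)))"
   by (intro sum.cong refl Bochner_Integration.integral_sum integrable_mult_right i[OF test_dd[OF G]] i[OF test_dd[OF test_dd[OF G]]])
  finally show ?thesis by (simp add: heat_pot_def wconv_def)
 qed
 finally show ?thesis .
qed

context parab
begin

section \<open>Weighted estimates for the adjoint solution\<close>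

lemma CS_le: "(1 / hZ A)\<^sup>2 * (C1 * C2) \<le> schur_const TYPE('n) l L lam"
proof -
 let ?g = "gauss_int TYPE(real^'n) (1/L)" and ?h = "gauss_int TYPE(real^'n) (1/(4*l))"
 have h: "?h > 0" using l by (intro gauss_int_pos) simp
 have "1 / hZ A \<le> 1 / ?h" using h hZ_lower by (simp add: frac_le)
 moreover have "C1 \<le> 2 * \<kappa> powr (- d/2) * ?g" unfolding C1_def using J by (intro mult_left_mono) auto
 moreover have "C2 \<le> 2 * (2 * \<kappa> - 1/2) powr (- d/2) * ?g" unfolding C2_def using J by (intro mult_left_mono) auto
 ultimately have "(1 / hZ A)\<^sup>2 * (C1 * C2) \<le> (1 / ?h)\<^sup>2 * ((2 * \<kappa> powr (- d/2) * ?g) * (2 * (2 * \<kappa> - 1/2) powr (- d/2) * ?g))"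
  using C12 hZ_pos[OF A] J by (intro mult_mono power_mono) (auto intro!: mult_nonneg_nonneg)
 then show ?thesis by (simp add: schur_const_def Let_def d_def \<kappa>_def \<theta>_def)
qed

lemma \<rho>_Wt: "\<rho> = Wt (d/2 - \<alpha>)"
 by (simp add: \<rho>_def Wt_def fun_eq_iff)

lemma decays_pt:
 assumes c0: "0 < c0" and M: "\<And>t x. t > 0 \<Longrightarrow> \<bar>f (t, x)\<bar> \<le> M * (t powr s * pt (t, x))"
 shows "decays c0 B f"
proof -
 have "compact ((\<lambda>t. t powr (s + (- 1/2 - d/2))) ` {c0..B})"
  using c0 by (intro compact_continuous_image continuous_intros) auto
 then have "bounded ((\<lambda>t. t powr (s + (- 1/2 - d/2))) ` {c0..B})" by (rule compact_imp_bounded)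
 then obtain K where K: "K > 0" "\<And>t. t \<in> {c0..B} \<Longrightarrow> \<bar>t powr (s + (- 1/2 - d/2))\<bar> \<le> K"
  unfolding bounded_pos by (metis image_eqI real_norm_def)
 show ?thesis unfolding decays_def
 proof (intro exI[of _ "\<bar>M\<bar> * K"] conjI ballI allI)
  fix t x assume t: "t \<in> {c0..B}"
  have "\<bar>f (t, x)\<bar> \<le> \<bar>M\<bar> * (t powr s * pt (t, x))"
   using M[of t x] t c0 by (intro order_trans[OF M] mult_right_mono) (auto simp: pt_def)
  also have "t powr s * pt (t, x) = t powr (s + (- 1/2 - d/2)) * exp (- \<kappa> * Q x / t)"
   by (simp add: pt_def powr_add)
  also have "\<bar>M\<bar> * \<dots> \<le> \<bar>M\<bar> * (K * exp (- \<kappa> * Q x / t))"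
   using K(2)[OF t] by (intro mult_left_mono mult_right_mono) auto
  finally show "\<bar>f (t, x)\<bar> \<le> \<bar>M\<bar> * K * exp (- \<kappa> * Q x / t)" by (simp add: mult.assoc)
 qed (use K in simp)
qed

lemma decays_heat_pot:
 assumes "0 < c0" and G: "G \<in> test_functions (strip c B')" and "0 \<le> c"
 shows "decays c0 B (heat_pot T A G)" "decays c0 B G"
proof -
 have \<Omega>: "strip c B' \<subseteq> {0<..} \<times> (UNIV :: (real^'n) set)" using assms by (auto simp: strip_def)
 show "decays c0 B (heat_pot T A G)"
 proof (rule heat_pot_pointwise[OF G \<Omega>])
  fix M assume "\<And>B t x. t > 0 \<Longrightarrow> \<bar>heat_pot B A G (t, x)\<bar> \<le> M * (t * pt (t, x))"
  then show ?thesis by (intro decays_pt[OF assms(1), where M=M and s=1]) simp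
 qed
 show "decays c0 B G"
 proof (rule test_le_pt[OF G \<Omega>])
  fix m assume "\<And>q. \<bar>G q\<bar> \<le> m * pt q"
  then show ?thesis by (intro decays_pt[OF assms(1), where M=m and s=0]) simp
 qed
qed

text \<open>Causality: the convolution looks only backwards in time. This supplies the zero initial
  value required by the energy inequality.\<close>

lemma heat_pot_zero:
 assumes G: "G \<in> test_functions (strip c B')" and t: "t \<le> c"
 shows "heat_pot B A G (t, x) = 0"
proof -
 have "heat_wt B A q * G ((t, x) - heat_map q) = 0" for q
 proof (cases "0 < fst q")
  case True
  then show ?thesis using test_zero_outside[OF G, of "(t, x) - heat_map q"] t
   by (auto simp: strip_def heat_map_def)
 qed (auto simp: heat_wt_def)
 note z = this
 show ?thesis unfolding heat_pot_def wconv_def z by simp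
qed

lemma quad_measurable:
 assumes u: "smooth u" shows "quad u \<in> borel_measurable borel"
proof -
 have mv: "(\<lambda>p. M *v f p) \<in> borel_measurable borel" if "f \<in> borel_measurable borel"
  for M :: "real^'n^'n" and f :: "real \<times> (real^'n) \<Rightarrow> real^'n"
  by (rule borel_measurable_continuous_on[OF _ that]) (intro continuous_intros)
 have "continuous_on UNIV (grad u)" unfolding grad_def[abs_def]
  by (intro continuous_intros smooth_continuous_on smooth_dd u)
 then have g: "grad u \<in> borel_measurable borel" by (rule borel_measurable_continuous_onI)
 have [measurable]: "u \<in> borel_measurable borel" by (rule smooth_measurable[OF u])
 have z: "\<zeta> u \<in> borel_measurable borel" unfolding \<zeta>_def[abs_def]
  by (intro borel_measurable_scaleR mv) measurable
 show ?thesis unfolding quad_def[abs_def]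
  by (intro borel_measurable_add borel_measurable_inner mv g z)
qed

lemma dd_le_quad: "(dd (0, axis k 1) u p)\<^sup>2 \<le> 3 / min l lam * quad u p"
proof -
 have m: "min l lam > 0" using l lam by simp
 have "\<bar>dd (0, axis k 1) u p\<bar> \<le> norm (grad u p)"
  using component_le_norm_cart[of "grad u p" k] by (simp add: grad_def)
 then have "(dd (0, axis k 1) u p)\<^sup>2 \<le> (norm (grad u p))\<^sup>2" by (simp add: abs_le_square_iff[symmetric])
 then have "min l lam / 3 * (dd (0, axis k 1) u p)\<^sup>2 \<le> min l lam / 3 * ((norm (grad u p))\<^sup>2 + (norm (\<zeta> u p))\<^sup>2)"
  using m by (intro mult_left_mono) (auto intro: add_increasing2)
 also have "\<dots> \<le> quad u p" by (rule quad_coercive)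
 finally show ?thesis using m by (simp add: field_simps)
qed

text \<open>The second derivatives of the potential are controlled by two applications of the energy
 inequality, to \<open>\<Phi>\<close> and to \<open>\<partial>\<^sub>k \<Phi>\<close>; the lower-order term is bounded by the Schur test.\<close>

lemma dual_estimate:
 assumes c: "0 < c" "c < B" and G: "G \<in> test_functions (strip c B)"
 shows "IS c B (\<lambda>p. \<rho> p * (heat_pot B A (dd (0, axis i 1) (dd (0, axis k 1) G)) p)\<^sup>2)
  \<le> dual_const TYPE('n) l L lam \<alpha> * IS c B (\<lambda>p. \<rho> p * (G p)\<^sup>2)"
proof -
 define m where "m = min l lam"
 define \<beta> where "\<beta> = d/2 - \<alpha>"
 define CS where "CS = schur_const TYPE('n) l L lam"
 define \<Phi> where "\<Phi> = heat_pot B A G"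
 define u where "u = heat_pot B A (dd (0, axis k 1) G)"
 have m: "m > 0" using l lam by (simp add: m_def)
 have u: "u = dd (0, axis k 1) \<Phi>" by (simp add: u_def \<Phi>_def dd_heat_pot[OF A G])
 have sm: "smooth \<Phi>" "smooth u" "smooth G"
  unfolding \<Phi>_def u_def
  by (rule smooth_heat_pot[OF A G], rule smooth_heat_pot[OF A test_dd[OF G]], rule test_smooth[OF G])
 note [measurable] = smooth_measurable[OF sm(1)] smooth_measurable[OF sm(2)] smooth_measurable[OF sm(3)]
  smooth_measurable[OF smooth_dd[OF sm(3)]] smooth_measurable[OF smooth_dd[OF sm(2)]] quad_measurable[OF sm(1)] quad_measurable[OF sm(2)]
 have dec: "decays c B (heat_pot B A G')" "decays c B G'" if "G' \<in> test_functions (strip c B)" for G'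
  using decays_heat_pot[OF c(1) that] c by auto
 have t1: "dd e G \<in> test_functions (strip c B)" "dd e (dd e' G) \<in> test_functions (strip c B)"
  "dd e (dd e' (dd e'' G)) \<in> test_functions (strip c B)" for e e' e''
  using G by (auto intro: test_dd)
 have dP: "decays c B \<Phi>" "decays c B (dd e \<Phi>)" "decays c B (dd e (dd e' \<Phi>))" for e e'
  unfolding \<Phi>_def by (simp_all add: dd_heat_pot[OF A G] dd_heat_pot[OF A t1(1)] dec G t1)
 have du: "decays c B u" "decays c B (dd e u)" "decays c B (dd e (dd e' u))" for e e'
  unfolding u_def by (simp_all add: dd_heat_pot[OF A t1(1)] dd_heat_pot[OF A t1(2)] dec G t1)
 have dG: "decays c B G" "decays c B (dd e G)" for e by (simp_all add: dec G t1)
 have ho: "heat_op A (heat_pot B A G') (t, x) = G' (t, x)" if "G' \<in> test_functions (strip c B)" "t \<le> B" for G' t x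
  unfolding wconv_heat_op[OF A that(1)]
  by (rule heat_pot_heat_op[OF A that(1)]) (use c that test_zero_outside[OF that(1)] in \<open>auto simp: strip_def\<close>)
 have cong: "IS c B f = IS c B g" if "\<And>t x. t \<in> {c..B} \<Longrightarrow> f (t, x) = g (t, x)" for f g
  unfolding IS_def by (intro Bochner_Integration.integral_cong) (auto simp: indicator_def that)
 \<comment> \<open>The powers of time reflect parabolic scaling: relative to the source
   \<open>G\<close>, the potential \<open>\<Phi>\<close> has one more power of time and its gradient
   \<open>u\<close> half a power.\<close>
 define XG where "XG = IS c B (\<lambda>p. Wt \<beta> p * (G p * G p))"
 define X0 where "X0 = IS c B (\<lambda>p. Wt (\<beta> - 2) p * (\<Phi> p * \<Phi> p))"
 define X1 where "X1 = IS c B (\<lambda>p. Wt (\<beta> - 1) p * (u p * u p))"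
 have Wt_shift: "Wt (\<beta> - 1) p = Wt \<beta> p / fst p" "Wt (\<beta> - 2) p = Wt \<beta> p / (fst p)\<^sup>2" if "fst p > 0" for p
  using that by (simp_all add: Wt_def powr_diff)
 have Wt0: "Wt \<beta>' p \<ge> 0" for \<beta>' p by (simp add: Wt_def)
 have X0nn: "0 \<le> X0" "0 \<le> XG" "0 \<le> X1"
  unfolding X0_def XG_def X1_def IS_def by (auto intro!: integral_nonneg simp: Wt0 mult_nonneg_nonneg)
 have S: "X0 \<le> CS * XG"
 proof -
  have nn: "ennreal (IS c B (\<lambda>p. Wt \<beta>' p * (f p * f p))) = (NN p. ennreal (indicator {c..B} (fst p) * (Wt \<beta>' p * (f p * f p))))"
   if "decays c B f" "f \<in> borel_measurable borel" for f \<beta>'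
   unfolding IS_def
  proof (rule nn_integral_eq_integral[symmetric])
   have [measurable]: "f \<in> borel_measurable borel" by (rule that)
   show "integrable lborel (\<lambda>p. indicator {c..B} (fst p) * (Wt \<beta>' p * (f p * f p)))"
    by (rule bnd_integrable[OF c(1) bnd_product1[OF c(1) that(1) that(1)]]) measurable
   show "AE p in lborel. 0 \<le> indicator {c..B} (fst p) * (Wt \<beta>' p * (f p * f p))"
    by (intro AE_I2 mult_nonneg_nonneg[OF _ mult_nonneg_nonneg[OF Wt0 zero_le_square]]) simp
  qed
  have G0: "G (s, y) = 0" if "s \<le> 0" for s y using test_zero_outside[OF G, of "(s, y)"] c that by (auto simp: strip_def)
  have "ennreal X0 = (NN p. ennreal (indicator {c..B} (fst p) * (Wt (\<beta> - 2) p * (\<Phi> p * \<Phi> p))))"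
   unfolding X0_def by (rule nn[OF dP(1)]) measurable
  also have "\<dots> \<le> (NN p. ennreal (indicator {0<..} (fst p) * \<rho> p / (fst p)\<^sup>2 * (heat_pot B A G p)\<^sup>2))"
  proof (intro nn_integral_mono ennreal_leI)
   fix p :: "real \<times> (real^'n)"
   show "indicator {c..B} (fst p) * (Wt (\<beta> - 2) p * (\<Phi> p * \<Phi> p)) \<le> indicator {0<..} (fst p) * \<rho> p / (fst p)\<^sup>2 * (heat_pot B A G p)\<^sup>2"
    using c Wt0[of \<beta> p] by (auto simp: indicator_def Wt_shift \<rho>_Wt \<beta>_def[symmetric] \<Phi>_def power2_eq_square intro!: mult_nonneg_nonneg divide_nonneg_nonneg)
  qed
  also have "\<dots> \<le> ennreal ((1 / hZ A)\<^sup>2 * (C1 * C2)) * (NN q. ennreal (indicator {0<..} (fst q) * \<rho> q * (G q)\<^sup>2))"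
   by (rule heat_pot_weighted_bound[OF G G0])
  also have "(NN q. ennreal (indicator {0<..} (fst q) * \<rho> q * (G q)\<^sup>2))
   = (NN p. ennreal (indicator {c..B} (fst p) * (Wt \<beta> p * (G p * G p))))"
  proof (intro nn_integral_cong arg_cong[of _ _ ennreal])
   fix p :: "real \<times> (real^'n)"
   show "indicator {0<..} (fst p) * \<rho> p * (G p)\<^sup>2 = indicator {c..B} (fst p) * (Wt \<beta> p * (G p * G p))"
    using c test_zero_outside[OF G, of p] by (cases p) (auto simp: indicator_def strip_def \<rho>_Wt \<beta>_def[symmetric] power2_eq_square)
  qed
  also have "\<dots> = ennreal XG" unfolding XG_def by (rule nn[OF dG(1), symmetric]) measurable
  also have "ennreal ((1 / hZ A)\<^sup>2 * (C1 * C2)) * ennreal XG \<le> ennreal CS * ennreal XG"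
   unfolding CS_def by (intro mult_right_mono ennreal_leI CS_le) simp
  also have "\<dots> = ennreal (CS * XG)"
  proof -
   have "CS \<ge> 0" unfolding CS_def by (rule order_trans[OF _ CS_le]) (use C12 in simp)
   then show ?thesis using X0nn by (simp add: ennreal_mult)
  qed
  finally have "ennreal X0 \<le> ennreal (CS * XG)" .
  moreover have "CS \<ge> 0" unfolding CS_def by (rule order_trans[OF _ CS_le]) (use C12 in simp)
  ultimately show ?thesis using X0nn by (simp add: ennreal_le_iff)
 qed
 \<comment> \<open>Energy inequality for \<open>\<Phi>\<close> at the power
   \<open>\<beta> - 1\<close>. Its lower-order term has the power \<open>\<beta> - 2\<close>, which
   is the quantity just bounded by the Schur test.\<close>
 have X1: "X1 \<le> 3/m * (1/2 * XG + (1/2 + \<bar>\<beta> - 1\<bar>/2) * X0)"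
 proof -
  have e: "bnd c B (\<lambda>p. Wt (\<beta> - 1) p * quad \<Phi> p)"
   "IS c B (\<lambda>p. Wt (\<beta> - 1) p * quad \<Phi> p) \<le> IS c B (\<lambda>p. Wt (\<beta> - 1) p * (\<Phi> p * heat_op A \<Phi> p)) + (\<beta> - 1)/2 * IS c B (\<lambda>p. Wt (\<beta> - 1 - 1) p * (\<Phi> p)\<^sup>2)"
   by (rule energy[OF c(1) _ sm(1) dP]; use c heat_pot_zero[OF G order_refl] in \<open>simp add: \<Phi>_def\<close>)+
  have "X1 \<le> IS c B (\<lambda>p. 3/m * (Wt (\<beta> - 1) p * quad \<Phi> p))"
   unfolding X1_def
  proof (rule IS_mono[OF c(1) bnd_product1[OF c(1) du(1) du(1)] _ bnd_cmult[OF e(1)]])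
   fix t x
   have "u (t, x) * u (t, x) \<le> 3/m * quad \<Phi> (t, x)"
    using dd_le_quad[of k \<Phi> "(t, x)"] by (simp add: u m_def power2_eq_square)
   then have "Wt (\<beta> - 1) (t, x) * (u (t, x) * u (t, x)) \<le> Wt (\<beta> - 1) (t, x) * (3/m * quad \<Phi> (t, x))"
    by (intro mult_left_mono Wt0)
   then show "Wt (\<beta> - 1) (t, x) * (u (t, x) * u (t, x)) \<le> 3/m * (Wt (\<beta> - 1) (t, x) * quad \<Phi> (t, x))"
    by (simp add: mult_ac)
  qed measurable
  also have "\<dots> = 3/m * IS c B (\<lambda>p. Wt (\<beta> - 1) p * quad \<Phi> p)" by (rule IS_cmult)
  also have "\<dots> \<le> 3/m * (1/2 * XG + (1/2 + \<bar>\<beta> - 1\<bar>/2) * X0)"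
  proof (rule mult_left_mono)
   have "IS c B (\<lambda>p. Wt (\<beta> - 1) p * (\<Phi> p * heat_op A \<Phi> p)) = IS c B (\<lambda>p. Wt (\<beta> - 1) p * (\<Phi> p * G p))"
    by (rule cong) (simp add: \<Phi>_def ho[OF G])
   \<comment> \<open>Young's inequality for \<open>G\<close> and \<open>\<Phi> / t\<close>: the
     factor \<open>1/t\<close> of the weight is shared so that \<open>G\<close> gets the power
     \<open>\<beta>\<close> and \<open>\<Phi>\<close> the power \<open>\<beta> - 2\<close>.\<close>
   also have "\<dots> \<le> IS c B (\<lambda>p. 1/2 * (Wt \<beta> p * (G p * G p)) + 1/2 * (Wt (\<beta> - 2) p * (\<Phi> p * \<Phi> p)))"
   proof (rule IS_mono[OF c(1) bnd_product1[OF c(1) dP(1) dG(1)] _ bnd_add[OF bnd_cmult[OF bnd_product1[OF c(1) dG(1) dG(1)]] bnd_cmult[OF bnd_product1[OF c(1) dP(1) dP(1)]]]])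
    fix t x assume "t \<in> {c..B}"
    then have t: "t > 0" using c by simp
    have "0 \<le> (G (t, x) - \<Phi> (t, x) / t)\<^sup>2" by simp
    then have "\<Phi> (t, x) * G (t, x) / t \<le> 1/2 * (G (t, x) * G (t, x)) + 1/2 * (\<Phi> (t, x) * \<Phi> (t, x) / t\<^sup>2)"
     using t by (simp add: power2_eq_square algebra_simps)
    then have "Wt \<beta> (t, x) * (\<Phi> (t, x) * G (t, x) / t) \<le> Wt \<beta> (t, x) * (1/2 * (G (t, x) * G (t, x)) + 1/2 * (\<Phi> (t, x) * \<Phi> (t, x) / t\<^sup>2))"
     by (intro mult_left_mono Wt0)
    then show "Wt (\<beta> - 1) (t, x) * (\<Phi> (t, x) * G (t, x)) \<le> 1/2 * (Wt \<beta> (t, x) * (G (t, x) * G (t, x))) + 1/2 * (Wt (\<beta> - 2) (t, x) * (\<Phi> (t, x) * \<Phi> (t, x)))"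
     using Wt_shift[of "(t, x)"] t by (simp add: algebra_simps)
   qed measurable
   also have "\<dots> = 1/2 * XG + 1/2 * X0"
    unfolding XG_def X0_def IS_cmult[symmetric]
    by (rule IS_add[OF c(1) bnd_cmult[OF bnd_product1[OF c(1) dG(1) dG(1)]] _ bnd_cmult[OF bnd_product1[OF c(1) dP(1) dP(1)]]]) measurable
   finally have 1: "IS c B (\<lambda>p. Wt (\<beta> - 1) p * (\<Phi> p * heat_op A \<Phi> p)) \<le> 1/2 * XG + 1/2 * X0" .
   have 2: "IS c B (\<lambda>p. Wt (\<beta> - 1 - 1) p * (\<Phi> p)\<^sup>2) = X0" by (simp add: X0_def power2_eq_square)
   have "(\<beta> - 1)/2 * X0 \<le> \<bar>\<beta> - 1\<bar>/2 * X0"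
    using X0nn by (intro mult_right_mono divide_right_mono abs_ge_self) auto
   then show "IS c B (\<lambda>p. Wt (\<beta> - 1) p * quad \<Phi> p) \<le> 1/2 * XG + (1/2 + \<bar>\<beta> - 1\<bar>/2) * X0"
    using e(2) 1 2 by (simp add: distrib_right)
  qed (use m in simp)
  finally show ?thesis .
 qed
 define Y where "Y = IS c B (\<lambda>p. Wt \<beta> p * quad u p)"
 have eY: "bnd c B (\<lambda>p. Wt \<beta> p * quad u p)"
  "Y \<le> IS c B (\<lambda>p. Wt \<beta> p * (u p * heat_op A u p)) + \<beta>/2 * IS c B (\<lambda>p. Wt (\<beta> - 1) p * (u p)\<^sup>2)"
  unfolding Y_def by (rule energy[OF c(1) _ sm(2) du]; use c heat_pot_zero[OF t1(1) order_refl] in \<open>simp add: u_def\<close>)+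
 define w where "w = matrix_inv a *v axis k 1"
 have [measurable]: "(\<lambda>p. snd p \<bullet> w) \<in> borel_measurable borel"
  by (intro borel_measurable_continuous_onI continuous_intros)
 define F1 where "F1 p = Wt \<beta> p * ((snd p \<bullet> w) / fst p * (u p * G p))" for p
 define F2 where "F2 p = Wt \<beta> p * (u p * dd (0, axis k 1) G p)" for p
 define F3 where "F3 p = Wt \<beta> p * (dd (0, axis k 1) u p * G p)" for p
 have mF: "F1 \<in> borel_measurable borel" "F2 \<in> borel_measurable borel" "F3 \<in> borel_measurable borel"
  unfolding F1_def[abs_def] F2_def[abs_def] F3_def[abs_def] by measurable
 have bF1: "bnd c B F1"
 proof (rule linear_over_t_bound[OF c(1), where w=w and B=B])
  fix H assume "\<And>t x. t \<in> {c..B} \<Longrightarrow> \<bar>(x \<bullet> w) / t\<bar> \<le> H * (1 + norm x)\<^sup>2"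
  then show ?thesis unfolding F1_def[abs_def] by (intro bnd_product[OF c(1) du(1) dG(1), of _ H]) simp
 qed
 have bF: "bnd c B F2" "bnd c B F3"
  unfolding F2_def[abs_def] F3_def[abs_def] by (intro bnd_product1 c du dG)+
 \<comment> \<open>The source of \<open>u\<close> is a derivative of \<open>G\<close>, on which no
   bound is wanted. Moving the derivative costs a term from the weight (\<open>F1\<close>) and one
   with a derivative of \<open>u\<close> (\<open>F3\<close>); the energy of \<open>u\<close>
   controls both.\<close>
 have ibp: "IS c B (\<lambda>p. F1 p + F2 p + F3 p) = 0"
 proof -
  have sl: "indicator {c..B} t * (LB x. F1 (t, x) + F2 (t, x) + F3 (t, x)) = 0" for t
  proof (cases "t \<in> {c..B}")
   case True
   from ibp_slice[OF c(1) True sm(2) sm(3) du(1) dG(1) du(2) dG(2), where \<beta>=\<beta> and e="axis k 1"]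
   show ?thesis by (simp add: F1_def F2_def F3_def w_def)
  qed simp
  have "(\<lambda>p. F1 p + F2 p + F3 p) \<in> borel_measurable borel" using mF by measurable
  from IS_iterated(1)[OF c(1) bnd_add[OF bnd_add[OF bF1 bF(1)] bF(2)] this] show ?thesis by (simp add: sl)
 qed
 \<comment> \<open>A quarter of \<open>Y\<close> is left on the right to be absorbed;
   \<open>Y\<close> is a real number, so subtracting it is legitimate.\<close>
 have Y: "Y \<le> 1/4 * Y + 15/m * XG + \<bar>\<beta>\<bar>/2 * X1"
 proof -
  have "IS c B (\<lambda>p. Wt \<beta> p * (u p * heat_op A u p)) = IS c B F2"
   by (rule cong) (simp add: u_def ho[OF t1(1)] F2_def)
  also have "\<dots> = IS c B (\<lambda>p. F1 p + F2 p + F3 p) + IS c B (\<lambda>p. - 1 * (F1 p + F3 p))"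
  proof -
   have "IS c B (\<lambda>p. (F1 p + F2 p + F3 p) + - 1 * (F1 p + F3 p)) = IS c B (\<lambda>p. F1 p + F2 p + F3 p) + IS c B (\<lambda>p. - 1 * (F1 p + F3 p))"
    by (rule IS_add[OF c(1) bnd_add[OF bnd_add[OF bF1 bF(1)] bF(2)] _ bnd_cmult[OF bnd_add[OF bF1 bF(2)]]]) (use mF in measurable)
   then show ?thesis by simp
  qed
  also have "\<dots> = IS c B (\<lambda>p. - 1 * (F1 p + F3 p))" by (simp add: ibp)
  also have "\<dots> \<le> IS c B (\<lambda>p. 1/4 * (Wt \<beta> p * quad u p) + 15/m * (Wt \<beta> p * (G p * G p)))"
  proof (rule IS_mono[OF c(1) bnd_cmult[OF bnd_add[OF bF1 bF(2)]] _ bnd_add[OF bnd_cmult[OF eY(1)] bnd_cmult[OF bnd_product1[OF c(1) dG(1) dG(1)]]]])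
   fix t and x :: "real^'n" assume "t \<in> {c..B}"
   then have t: "t > 0" using c by simp
   let ?p = "(t, x)"
   define z where "z = \<zeta> u ?p $ k"
   define y where "y = dd (0, axis k 1) u ?p"
   define gg where "gg = G ?p"
   have z: "(x \<bullet> w) / t * u ?p = 2 * z"
   proof -
    have "x \<bullet> w = (matrix_inv a *v x) $ k"
     using matrix_inv_symmetric_inner[OF a, of x "axis k 1"] by (simp add: w_def inner_axis)
    then show ?thesis using t by (simp add: z_def \<zeta>_def)
   qed
   have y2: "y\<^sup>2 \<le> (norm (grad u ?p))\<^sup>2"
    using component_le_norm_cart[of "grad u ?p" k] by (simp add: grad_def y_def abs_le_square_iff[symmetric])
   have z2: "z\<^sup>2 \<le> (norm (\<zeta> u ?p))\<^sup>2"
    using component_le_norm_cart[of "\<zeta> u ?p" k] by (simp add: z_def abs_le_square_iff[symmetric])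
   have "m/12 * (y\<^sup>2 + z\<^sup>2) \<le> m/12 * ((norm (grad u ?p))\<^sup>2 + (norm (\<zeta> u ?p))\<^sup>2)"
    using m y2 z2 by (intro mult_left_mono) auto
   also have "\<dots> \<le> 1/4 * quad u ?p" using quad_coercive[of u ?p] by (simp add: m_def)
   finally have q: "m/12 * (y\<^sup>2 + z\<^sup>2) \<le> 1/4 * quad u ?p" .
   \<comment> \<open>The coefficients are chosen so that the two Young inequalities together spend
     \<open>m/12 * (y^2 + z^2)\<close>, at most a quarter of \<open>quad\<close>. The costs in
     \<open>gg\<close> add up to \<open>3/m + 12/m = 15/m\<close>.\<close>
   have "- (y * gg) \<le> m/12 * y\<^sup>2 + 3/m * gg\<^sup>2"
   proof -
    have "0 \<le> (m * y + 6 * gg)\<^sup>2" by simp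
    also have "\<dots> = 12 * m * (m/12 * y\<^sup>2 + 3/m * gg\<^sup>2 + y * gg)"
     using m by (simp add: power2_eq_square field_simps)
    finally show ?thesis using m by (simp add: zero_le_mult_iff)
   qed
   moreover have "- (2 * z * gg) \<le> m/12 * z\<^sup>2 + 12/m * gg\<^sup>2"
   proof -
    have "0 \<le> (m * z + 12 * gg)\<^sup>2" by simp
    also have "\<dots> = 12 * m * (m/12 * z\<^sup>2 + 12/m * gg\<^sup>2 + 2 * z * gg)"
     using m by (simp add: power2_eq_square field_simps)
    finally show ?thesis using m by (simp add: zero_le_mult_iff)
   qed
   ultimately have "- (2 * z * gg + y * gg) \<le> 1/4 * quad u ?p + 15/m * gg\<^sup>2"
    using q by (simp add: distrib_left add_divide_distrib)
   then have "Wt \<beta> ?p * (- (2 * z * gg + y * gg)) \<le> Wt \<beta> ?p * (1/4 * quad u ?p + 15/m * gg\<^sup>2)"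
    by (intro mult_left_mono Wt0)
   moreover have "- 1 * (F1 ?p + F3 ?p) = Wt \<beta> ?p * (- (((x \<bullet> w) / t * u ?p) * gg + y * gg))"
    by (simp add: F1_def F3_def y_def gg_def algebra_simps)
   ultimately show "- 1 * (F1 ?p + F3 ?p) \<le> 1/4 * (Wt \<beta> ?p * quad u ?p) + 15/m * (Wt \<beta> ?p * (G ?p * G ?p))"
    unfolding z by (simp add: gg_def power2_eq_square algebra_simps)
  qed (use mF in measurable)
  also have "\<dots> = 1/4 * Y + 15/m * XG"
   unfolding Y_def XG_def IS_cmult[symmetric]
   by (rule IS_add[OF c(1) bnd_cmult[OF eY(1)] _ bnd_cmult[OF bnd_product1[OF c(1) dG(1) dG(1)]]]) measurable
  finally have 1: "IS c B (\<lambda>p. Wt \<beta> p * (u p * heat_op A u p)) \<le> 1/4 * Y + 15/m * XG" .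
  have "\<beta>/2 * IS c B (\<lambda>p. Wt (\<beta> - 1) p * (u p)\<^sup>2) = \<beta>/2 * X1" by (simp add: X1_def power2_eq_square)
  also have "\<dots> \<le> \<bar>\<beta>\<bar>/2 * X1"
   using X0nn by (intro mult_right_mono divide_right_mono abs_ge_self) auto
  finally show ?thesis using 1 eY(2) by linarith
 qed
 have "IS c B (\<lambda>p. Wt \<beta> p * (dd (0, axis i 1) u p * dd (0, axis i 1) u p)) \<le> IS c B (\<lambda>p. 3/m * (Wt \<beta> p * quad u p))"
 proof (rule IS_mono[OF c(1) bnd_product1[OF c(1) du(2) du(2)] _ bnd_cmult[OF eY(1)]])
  fix t x
  have "dd (0, axis i 1) u (t, x) * dd (0, axis i 1) u (t, x) \<le> 3/m * quad u (t, x)"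
   using dd_le_quad[of i u "(t, x)"] by (simp add: m_def power2_eq_square)
  then have "Wt \<beta> (t, x) * (dd (0, axis i 1) u (t, x) * dd (0, axis i 1) u (t, x)) \<le> Wt \<beta> (t, x) * (3/m * quad u (t, x))"
   by (intro mult_left_mono Wt0)
  then show "Wt \<beta> (t, x) * (dd (0, axis i 1) u (t, x) * dd (0, axis i 1) u (t, x)) \<le> 3/m * (Wt \<beta> (t, x) * quad u (t, x))"
   by (simp add: mult_ac)
 qed measurable
 also have "\<dots> = 3/m * Y" unfolding Y_def by (rule IS_cmult)
 also have "\<dots> \<le> 4/m * (15/m * XG + \<bar>\<beta>\<bar>/2 * X1)"
 proof -
  have imp: "3 * Y \<le> 4 * R" if "Y \<le> 1/4 * Y + R" for R using that by linarith
  have "3 * Y \<le> 4 * (15/m * XG + \<bar>\<beta>\<bar>/2 * X1)" by (rule imp) (use Y in \<open>simp only: add.assoc\<close>)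
  then have "3 * Y / m \<le> 4 * (15/m * XG + \<bar>\<beta>\<bar>/2 * X1) / m" using m by (intro divide_right_mono) auto
  then show ?thesis by simp
 qed
 also have "\<dots> \<le> 4/m * (15/m * XG + \<bar>\<beta>\<bar>/2 * (3/m * (1/2 * XG + (1/2 + \<bar>\<beta> - 1\<bar>/2) * (CS * XG))))"
 proof -
  have "3/m * (1/2 * XG + (1/2 + \<bar>\<beta> - 1\<bar>/2) * X0) \<le> 3/m * (1/2 * XG + (1/2 + \<bar>\<beta> - 1\<bar>/2) * (CS * XG))"
   using S m by (intro mult_left_mono add_left_mono) auto
  with X1 have "X1 \<le> 3/m * (1/2 * XG + (1/2 + \<bar>\<beta> - 1\<bar>/2) * (CS * XG))" by (rule order_trans)
  then show ?thesis using m by (intro mult_left_mono add_left_mono) auto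
 qed
 also have "\<dots> = dual_const TYPE('n) l L lam \<alpha> * XG"
  by (simp add: dual_const_def Let_def m_def[symmetric] CS_def[symmetric] \<beta>_def d_def algebra_simps)
 finally show ?thesis
  by (simp add: XG_def \<rho>_Wt \<beta>_def[symmetric] power2_eq_square u_def dd_heat_pot[OF A t1(1)])
qed

end

section \<open>Pairing with the adjoint problem\<close>

lemma dd_compose_linear:
 assumes "smooth f" "bounded_linear D"
 shows "dd e (\<lambda>x. f (D x)) x = dd (D e) f (D x)"
 by (rule dd_eqI[OF has_derivative_compose[OF bounded_linear_imp_has_derivative[OF assms(2)] smooth_has_derivative[OF assms(1)]]])

section \<open>Cutoffs, exhaustions of the strip, and slices near the final time\<close>

definition ball_cutoff :: "'a::euclidean_space \<Rightarrow> real" where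
 "ball_cutoff x = sstep (2 - x \<bullet> x)"

lemma ball_cutoff_test: "ball_cutoff \<in> test_functions UNIV"
proof (rule test_functionsI[of _ "cball 0 2"])
 have "real_polynomial_function (\<lambda>x::'a. 2 - (\<Sum>b\<in>Basis. (x \<bullet> b)\<^sup>2))"
  by (intro real_polynomial_function_diff real_polynomial_function_sum real_polynomial_function_power
    real_polynomial_function.intros bounded_linear_inner_left) auto
 moreover have "(\<lambda>x::'a. 2 - (\<Sum>b\<in>Basis. (x \<bullet> b)\<^sup>2)) = (\<lambda>x. 2 - x \<bullet> x)"
  by (rule ext, subst (2) euclidean_inner) (simp add: power2_eq_square)
 ultimately have "smooth (\<lambda>x::'a. 2 - x \<bullet> x)" using smooth_polynomial by metis
 then show "smooth (ball_cutoff :: 'a \<Rightarrow> real)" unfolding ball_cutoff_def[abs_def]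
  by (rule smooth_compose_real[OF smooth_sstep])
 show "ball_cutoff x = 0" if "x \<notin> cball 0 2" for x :: 'a
 proof -
  have "2 < norm x" using that by simp
  then have "2 * 2 < norm x * norm x" by (intro mult_strict_mono) auto
  then have "2 - x \<bullet> x \<le> 0" by (simp add: dot_square_norm power2_eq_square)
  then show ?thesis by (simp add: ball_cutoff_def sstep_le_0)
 qed
qed auto

lemma ball_cutoff_bounds: "0 \<le> ball_cutoff x" "ball_cutoff x \<le> 1"
 by (simp_all add: ball_cutoff_def sstep_nonneg sstep_le_1)

lemma ball_cutoff_one: "norm x \<le> 1 \<Longrightarrow> ball_cutoff x = 1"
 unfolding ball_cutoff_def by (intro sstep_ge_1) (simp add: dot_square_norm power_le_one)

lemma sstep_derivative_bounded:
 obtains K where "K > 0" "\<And>y. \<bar>dd 1 sstep y\<bar> \<le> K" "\<And>y. y < 0 \<or> 1 < y \<Longrightarrow> dd 1 sstep y = 0"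
proof -
 have z: "dd 1 sstep y = 0" if "y < 0 \<or> 1 < y" for y
 proof -
  have "(sstep has_derivative (\<lambda>_. 0)) (at y)"
  proof (cases "y < 0")
   case True
   show ?thesis
    by (rule has_derivative_transform_within_open[of "\<lambda>_. 0" _ _ _ "{..<0}"]) (use True in \<open>auto simp: sstep_le_0\<close>)
  next
   case False
   show ?thesis
    by (rule has_derivative_transform_within_open[of "\<lambda>_. 1" _ _ _ "{1<..}"]) (use False that in \<open>auto simp: sstep_ge_1\<close>)
  qed
  then show ?thesis by (rule dd_eqI)
 qed
 have "bounded (dd 1 sstep ` {0..1})"
  by (intro compact_imp_bounded compact_continuous_image smooth_continuous_on smooth_dd smooth_sstep) simp
 then obtain K where K: "K > 0" "\<And>y. y \<in> {0..1} \<Longrightarrow> \<bar>dd 1 sstep y\<bar> \<le> K"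
  unfolding bounded_pos by (metis image_eqI real_norm_def)
 show ?thesis
 proof (rule that[OF K(1) _ z])
  show "\<bar>dd 1 sstep y\<bar> \<le> K" for y using K z[of y] by (cases "y \<in> {0..1}") auto
 qed
qed

lemma strip_exhaustion:
 assumes "p \<in> strip c B"
 shows "\<forall>\<^sub>F n in sequentially. p \<in> {c + 1 / real (Suc n)..B - 1 / real (Suc n)} \<times> cball 0 (real n)"
proof -
 obtain t x where p: "p = (t, x)" "c < t" "t < B" using assms by (auto simp: strip_def)
 have "(\<lambda>n. 1 / real (Suc n)) \<longlonglongrightarrow> 0" by (rule LIMSEQ_Suc) (rule lim_1_over_n)
 then have "\<forall>\<^sub>F n in sequentially. 1 / real (Suc n) < min (t - c) (B - t)"
  using p by (intro order_tendstoD) auto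
 moreover have "\<forall>\<^sub>F n in sequentially. norm x \<le> real n"
  using real_arch_simple[of "norm x"] by (auto simp: eventually_sequentially) (meson of_nat_le_iff order_trans)
 ultimately show ?thesis by eventually_elim (auto simp: p)
qed

lemma strip_exhaustion_sub:
 "compact ({c + 1 / real (Suc n)..B - 1 / real (Suc n)} \<times> cball (0 :: real^'n) (real n))"
 "{c + 1 / real (Suc n)..B - 1 / real (Suc n)} \<times> cball (0 :: real^'n) (real n) \<subseteq> strip c B"
proof -
 show "compact ({c + 1 / real (Suc n)..B - 1 / real (Suc n)} \<times> cball (0 :: real^'n) (real n))"
  by (intro compact_Times) auto
 have "{c + e..B - e} \<times> X \<subseteq> strip c B" if "e > 0" for e and X :: "(real^'n) set"
  using that by (auto simp: strip_def)
 then show "{c + 1 / real (Suc n)..B - 1 / real (Suc n)} \<times> cball (0 :: real^'n) (real n) \<subseteq> strip c B"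
  by simp
qed

text \<open>Local integrability speaks of compact subsets only. Measurability on the whole strip is
  a limit along the exhaustion, and the indicator discards the arbitrary values outside.\<close>

lemma locally_integrable_measurable:
 fixes f :: "real \<times> (real^'n) \<Rightarrow> real"
 assumes "locally_integrable (strip c B) f"
 shows "(\<lambda>p. indicator (strip c B) p * f p) \<in> borel_measurable borel"
proof (rule borel_measurable_LIMSEQ_real)
 let ?K = "\<lambda>n. {c + 1 / real (Suc n)..B - 1 / real (Suc n)} \<times> cball (0 :: real^'n) (real n)"
 show "(\<lambda>p. indicator (?K n) p * f p) \<in> borel_measurable borel" for n
 proof -
  have "set_integrable lborel (?K n) f"
   using assms strip_exhaustion_sub[of c n B] unfolding locally_integrable_def by blast
  then have "(\<lambda>p. indicator (?K n) p *\<^sub>R f p) \<in> borel_measurable lborel"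
   unfolding set_integrable_def by (rule borel_measurable_integrable)
  then show ?thesis by simp
 qed
 show "(\<lambda>n. indicator (?K n) p * f p) \<longlonglongrightarrow> indicator (strip c B) p * f p" for p
 proof (rule tendsto_eventually)
  show "\<forall>\<^sub>F n in sequentially. indicator (?K n) p * f p = indicator (strip c B) p * f p"
  proof (cases "p \<in> strip c B")
   case True
   from strip_exhaustion[OF this] show ?thesis by eventually_elim (use True in auto)
  next
   case False
   then have "p \<notin> ?K n" for n using strip_exhaustion_sub(2)[of c n B] by blast
   then show ?thesis using False by simp
  qed
 qed
qed

lemma strip_borel [measurable]: "strip c B \<in> sets borel"
 unfolding strip_def by (intro borel_open open_Times) auto

lemma indicator_strip: "indicator (strip c B) p = indicator {c<..<B} (fst p)"
 by (cases p) (auto simp: strip_def indicator_def)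

text \<open>The margin at the initial end makes the potential vanish up to the time
  \<open>c0\<close>; the margin at the final end lets the time cutoff act beyond the support of the
  source.\<close>

lemma test_strip_shrink:
 fixes G :: "real \<times> (real^'n) \<Rightarrow> real"
 assumes G: "G \<in> test_functions (strip c B)" and c: "c < B"
 obtains c0 B1 where "c < c0" "c0 < B1" "B1 < B" "G \<in> test_functions (strip c0 B1)"
proof -
 obtain K where K: "compact K" "K \<subseteq> strip c B" "\<And>x. x \<notin> K \<Longrightarrow> G x = 0" using G by (auto elim!: test_functionsE)
 have "\<exists>c0 B1. c < c0 \<and> c0 < B1 \<and> B1 < B \<and> K \<subseteq> strip c0 B1"
 proof (cases "K = {}")
  case True
  then show ?thesis using c by (intro exI[of _ "(2*c + B)/3"] exI[of _ "(c + 2*B)/3"]) auto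
 next
  case False
  have ck: "continuous_on K (fst :: real \<times> (real^'n) \<Rightarrow> real)" by (intro continuous_intros)
  obtain p where p: "p \<in> K" "\<And>q. q \<in> K \<Longrightarrow> fst p \<le> fst q" using continuous_attains_inf[OF K(1) False ck] by blast
  obtain r where r: "r \<in> K" "\<And>q. q \<in> K \<Longrightarrow> fst q \<le> fst r" using continuous_attains_sup[OF K(1) False ck] by blast
  have "c < fst p" "fst r < B" using p(1) r(1) K(2) by (auto simp: strip_def)
  moreover have "fst p \<le> fst r" using p(2)[OF r(1)] .
  moreover have "K \<subseteq> strip ((c + fst p)/2) ((fst r + B)/2)"
  proof
   fix q assume "q \<in> K"
   then have "fst p \<le> fst q" "fst q \<le> fst r" using p(2) r(2) by blast+
   then show "q \<in> strip ((c + fst p)/2) ((fst r + B)/2)"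
    using \<open>c < fst p\<close> \<open>fst r < B\<close> by (cases q) (simp add: strip_def)
  qed
  ultimately show ?thesis by (intro exI[of _ "(c + fst p)/2"] exI[of _ "(fst r + B)/2"]) simp
 qed
 then obtain c0 B1 where "c < c0" "c0 < B1" "B1 < B" "K \<subseteq> strip c0 B1" by blast
 then show ?thesis using K test_smooth[OF G] by (intro that test_functionsI[of G K])
qed

text \<open>The trace belongs to a version of \<open>u\<close>. By Fubini almost every time slice of
  that version agrees almost everywhere with the slice of \<open>u\<close>, so smallness in
  \<open>L^2\<close> of balls passes to \<open>u\<close>.\<close>

lemma trace_small:
 fixes u :: "real \<times> (real^'n) \<Rightarrow> real"
 assumes tr: "has_trace c B u (\<lambda>_. 0)" and \<delta>: "\<delta> > 0"
 obtains b where "b < B" "AE t in lborel. b < t \<and> c < t \<and> t < B \<longrightarrow> (\<integral>\<^sup>+x\<in>cball 0 R. ennreal ((u (t, x))\<^sup>2) \<partial>lborel) \<le> ennreal \<delta>"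
proof -
 obtain v where v: "AE p in lborel. p \<in> strip c B \<longrightarrow> v p = u p" "H1loc_tendsto (\<lambda>t x. v (t, x)) (\<lambda>_. 0) (at_left B)"
  using tr unfolding has_trace_def by blast
 obtain Dv :: "real \<Rightarrow> real^'n \<Rightarrow> real^'n" and Dg :: "real^'n \<Rightarrow> real^'n" where "\<forall>R. ((\<lambda>t. \<integral>\<^sup>+x\<in>cball 0 R. ennreal ((v (t, x) - 0)\<^sup>2 + (norm (Dv t x - Dg x))\<^sup>2) \<partial>lborel) \<longlongrightarrow> 0) (at_left B)"
  using v(2) unfolding H1loc_tendsto_def by (elim exE conjE) (erule that)
 note D = this[rule_format, of R]
 have "\<forall>\<^sub>F t in at_left B. (\<integral>\<^sup>+x\<in>cball 0 R. ennreal ((v (t, x) - 0)\<^sup>2 + (norm (Dv t x - Dg x))\<^sup>2) \<partial>lborel) < ennreal \<delta>"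
  using D \<delta> by (intro order_tendstoD) auto
 then obtain b where b: "b < B" "\<And>t. b < t \<Longrightarrow> t < B \<Longrightarrow> (\<integral>\<^sup>+x\<in>cball 0 R. ennreal ((v (t, x) - 0)\<^sup>2 + (norm (Dv t x - Dg x))\<^sup>2) \<partial>lborel) < ennreal \<delta>"
  unfolding eventually_at_left_field by blast
 have "AE p in (lborel :: real measure) \<Otimes>\<^sub>M (lborel :: (real^'n) measure). p \<in> strip c B \<longrightarrow> v p = u p"
  unfolding lborel_prod by (rule v(1))
 from lborel_pair.AE_pair[OF this] have "AE t in lborel. AE x in lborel. (t, x) \<in> strip c B \<longrightarrow> v (t, x) = u (t, x)" .
 then have "AE t in lborel. b < t \<and> c < t \<and> t < B \<longrightarrow> (\<integral>\<^sup>+x\<in>cball 0 R. ennreal ((u (t, x))\<^sup>2) \<partial>lborel) \<le> ennreal \<delta>"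
 proof eventually_elim
  fix t assume t: "AE x in lborel. (t, x) \<in> strip c B \<longrightarrow> v (t, x) = u (t, x)"
  show "b < t \<and> c < t \<and> t < B \<longrightarrow> (\<integral>\<^sup>+x\<in>cball 0 R. ennreal ((u (t, x))\<^sup>2) \<partial>lborel) \<le> ennreal \<delta>"
  proof (intro impI)
   assume "b < t \<and> c < t \<and> t < B"
   then have s: "(t, x) \<in> strip c B" and bt: "b < t" "t < B" for x by (auto simp: strip_def)
   have "(\<integral>\<^sup>+x\<in>cball 0 R. ennreal ((u (t, x))\<^sup>2) \<partial>lborel) \<le> (\<integral>\<^sup>+x\<in>cball 0 R. ennreal ((v (t, x) - 0)\<^sup>2 + (norm (Dv t x - Dg x))\<^sup>2) \<partial>lborel)"
   proof (rule nn_integral_mono_AE)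
    show "AE x in lborel. ennreal ((u (t, x))\<^sup>2) * indicator (cball 0 R) x \<le> ennreal ((v (t, x) - 0)\<^sup>2 + (norm (Dv t x - Dg x))\<^sup>2) * indicator (cball 0 R) x"
     using t by eventually_elim (auto intro!: mult_right_mono ennreal_leI simp: s)
   qed
   also have "\<dots> \<le> ennreal \<delta>" using b(2)[OF bt] by (rule less_imp_le)
   finally show "(\<integral>\<^sup>+x\<in>cball 0 R. ennreal ((u (t, x))\<^sup>2) \<partial>lborel) \<le> ennreal \<delta>" .
  qed
 qed
 with b(1) show ?thesis by (rule that)
qed

section \<open>Squared norms on space-time and the weak adjoint identity\<close>

definition wgt :: "real \<Rightarrow> real^'n^'n \<Rightarrow> real \<times> (real^'n) \<Rightarrow> real" where
 "wgt \<alpha> a p = fst p powr \<alpha> * gauss (fst p *\<^sub>R a) (snd p)"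

text \<open>The square of \<open>wnorm\<close> as a single integral over space-time, suited to
  Cauchy-Schwarz and Fatou. The two agree by Tonelli once the function is jointly measurable on the
  strip.\<close>

definition wsq :: "real \<Rightarrow> real^'n^'n \<Rightarrow> real \<Rightarrow> real \<Rightarrow> (real \<times> (real^'n) \<Rightarrow> 'b::real_normed_vector) \<Rightarrow> ennreal" where
 "wsq \<alpha> a c B f = (NN p. ennreal (indicator {c<..<B} (fst p) * wgt \<alpha> a p * (norm (f p))\<^sup>2))"

lemma gauss_scaled:
 assumes a: "posdef (a :: real^'n^'n)" and t: "t > 0"
 shows "gauss (t *\<^sub>R a) x = exp (- (x \<bullet> (matrix_inv a *v x)) / (2 * t)) / (sqrt ((2 * pi) ^ CARD('n) * det a) * t powr (real CARD('n) / 2))"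
proof -
 have "matrix_inv (t *\<^sub>R a) = (1/t) *\<^sub>R matrix_inv a" using matrix_inv_scaleR[OF posdef_invertible[OF a]] t by simp
 moreover have "sqrt ((2 * pi) ^ CARD('n) * (t ^ CARD('n) * det a)) = sqrt ((2 * pi) ^ CARD('n) * det a) * t powr (real CARD('n) / 2)"
 proof -
  have "sqrt (t ^ CARD('n)) = t powr (real CARD('n) / 2)"
   using t by (simp add: powr_realpow[symmetric] powr_half_sqrt[symmetric] powr_powr)
  then show ?thesis by (simp add: real_sqrt_mult mult_ac)
 qed
 ultimately show ?thesis
  by (simp add: gauss_def det_scaleR scaleR_matrix_vector_assoc[symmetric])
qed

lemma wgt_measurable:
 assumes a: "posdef (a :: real^'n^'n)" and c: "0 \<le> c"
 shows "(\<lambda>p. indicator {c<..<B} (fst p) * wgt \<alpha> a p) \<in> borel_measurable borel"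
proof -
 have [measurable]: "(\<lambda>p :: real \<times> (real^'n). snd p \<bullet> (matrix_inv a *v snd p)) \<in> borel_measurable borel"
  by (intro borel_measurable_continuous_onI continuous_intros)
 have "(\<lambda>p :: real \<times> (real^'n). indicator {c<..<B} (fst p) * (fst p powr \<alpha> * (exp (- (snd p \<bullet> (matrix_inv a *v snd p)) / (2 * fst p)) / (sqrt ((2 * pi) ^ CARD('n) * det a) * fst p powr (real CARD('n) / 2))))) \<in> borel_measurable borel"
  by measurable
 also have "(\<lambda>p :: real \<times> (real^'n). indicator {c<..<B} (fst p) * (fst p powr \<alpha> * (exp (- (snd p \<bullet> (matrix_inv a *v snd p)) / (2 * fst p)) / (sqrt ((2 * pi) ^ CARD('n) * det a) * fst p powr (real CARD('n) / 2)))))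
  = (\<lambda>p. indicator {c<..<B} (fst p) * wgt \<alpha> a p)"
  using c by (auto simp: fun_eq_iff indicator_def wgt_def gauss_scaled[OF a])
 finally show ?thesis .
qed

lemma wgt_pos: "posdef a \<Longrightarrow> fst p > 0 \<Longrightarrow> wgt \<alpha> a p > 0"
 using posdef_det_pos[of a] by (simp add: wgt_def gauss_scaled)

lemma wsq_integrand_measurable:
 fixes f :: "real \<times> (real^'n) \<Rightarrow> 'b::{real_normed_vector, second_countable_topology}"
 assumes a: "posdef (a :: real^'n^'n)" and c: "0 \<le> c"
  and m: "(\<lambda>p. indicator (strip c B) p *\<^sub>R f p) \<in> borel_measurable borel"
 shows "(\<lambda>p. ennreal (indicator {c<..<B} (fst p) * wgt \<alpha> a p * (norm (f p))\<^sup>2)) \<in> borel_measurable lborel"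
proof -
 have eq: "ennreal (indicator {c<..<B} (fst p) * wgt \<alpha> a p * (norm (f p))\<^sup>2)
  = ennreal ((indicator {c<..<B} (fst p) * wgt \<alpha> a p) * (norm (indicator (strip c B) p *\<^sub>R f p))\<^sup>2)" for p
  by (cases p) (auto simp: strip_def indicator_def)
 show ?thesis unfolding eq using wgt_measurable[OF a c, of B \<alpha>] m by measurable
qed

lemma wnorm_eq_wsq:
 fixes f :: "real \<times> (real^'n) \<Rightarrow> 'b::{real_normed_vector, second_countable_topology}"
 assumes a: "posdef (a :: real^'n^'n)" and c: "0 \<le> c"
  and m: "(\<lambda>p. indicator (strip c B) p *\<^sub>R f p) \<in> borel_measurable borel"
 shows "wnorm \<alpha> c B (\<lambda>t x. gauss (t *\<^sub>R a) x) f = ennreal_sqrt (wsq \<alpha> a c B f)"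
proof -
 have "wsq \<alpha> a c B f = (NN t. NN x. ennreal (indicator {c<..<B} t * wgt \<alpha> a (t, x) * (norm (f (t, x)))\<^sup>2))"
 proof -
  have "(\<lambda>p. ennreal (indicator {c<..<B} (fst p) * wgt \<alpha> a p * (norm (f p))\<^sup>2)) \<in> borel_measurable borel"
   using wsq_integrand_measurable[OF a c m] by simp
  from nn_integral_lborel_pair[OF this] show ?thesis by (simp add: wsq_def)
 qed
 also have "\<dots> = (\<integral>\<^sup>+t\<in>{c<..<B}. (NN x. ennreal (t powr \<alpha> * gauss (t *\<^sub>R a) x * (norm (f (t, x)))\<^sup>2)) \<partial>lborel)"
  by (intro nn_integral_cong) (auto simp: indicator_def wgt_def)
 finally show ?thesis by (simp add: wnorm_def)
qed

lemma ennreal_CS_bound: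
 fixes f g :: "'a::euclidean_space \<Rightarrow> real"
 assumes m [measurable]: "f \<in> borel_measurable borel" "g \<in> borel_measurable borel"
  and A: "(NN x. (ennreal (f x))\<^sup>2) \<le> ennreal X" and B: "(NN x. (ennreal (g x))\<^sup>2) \<le> ennreal Y"
  and XY: "0 \<le> X" "0 \<le> Y"
 shows "(NN x. ennreal (f x) * ennreal (g x)) \<le> ennreal (sqrt (X * Y))"
proof -
 let ?I = "NN x. ennreal (f x) * ennreal (g x)"
 have "?I\<^sup>2 \<le> (NN x. (ennreal (f x))\<^sup>2) * (NN x. (ennreal (g x))\<^sup>2)"
  by (rule Cauchy_Schwarz_nn_integral) measurable
 also have "\<dots> \<le> ennreal X * ennreal Y" by (intro mult_mono A B) auto
 also have "\<dots> = ennreal (X * Y)" using XY by (simp add: ennreal_mult)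
 finally have le: "?I\<^sup>2 \<le> ennreal (X * Y)" .
 then have "?I\<^sup>2 < top" using ennreal_less_top le_less_trans by blast
 then have "?I < top" by (simp add: power_less_top_ennreal)
 then obtain r where r: "r \<ge> 0" "?I = ennreal r" by (cases ?I) auto
 have "r\<^sup>2 \<le> X * Y" using le r XY by (simp add: ennreal_power ennreal_le_iff)
 then have "r \<le> sqrt (X * Y)" by (rule real_le_rsqrt)
 then show ?thesis unfolding r(2) by (rule ennreal_leI)
qed

lemma abs_integral_le:
 fixes f :: "'a::euclidean_space \<Rightarrow> real"
 assumes "integrable lborel f" "(NN x. ennreal \<bar>f x\<bar>) \<le> ennreal r" "0 \<le> r"
 shows "\<bar>\<integral>x. f x \<partial>lborel\<bar> \<le> r"
proof -
 have "ennreal \<bar>\<integral>x. f x \<partial>lborel\<bar> \<le> ennreal r"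
  using integral_norm_bound_ennreal[OF assms(1)] assms(2) by (simp add: order_trans)
 then show ?thesis using assms(3) by (simp add: ennreal_le_iff)
qed

text \<open>The terms besides the first form the commutator of the heat operator with the cutoff;
  they are what \<open>pairing\<close> has to show negligible.\<close>

lemma heat_op_mult:
 fixes A :: "real^'n^'n"
 assumes s: "smooth \<eta>" "smooth \<Psi>"
 shows "heat_op A (\<lambda>p. \<eta> p * \<Psi> p) p = \<eta> p * heat_op A \<Psi> p + dd (1, 0) \<eta> p * \<Psi> p
  - (\<Sum>i\<in>UNIV. \<Sum>j\<in>UNIV. A $ i $ j * (dd (0, axis i 1) \<eta> p * dd (0, axis j 1) \<Psi> p
   + dd (0, axis j 1) \<eta> p * dd (0, axis i 1) \<Psi> p + dd (0, axis i 1) (dd (0, axis j 1) \<eta>) p * \<Psi> p))"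
proof -
 have 2: "dd e (dd e' (\<lambda>p. \<eta> p * \<Psi> p)) p = \<eta> p * dd e (dd e' \<Psi>) p + (dd e \<eta> p * dd e' \<Psi> p
   + dd e' \<eta> p * dd e \<Psi> p + dd e (dd e' \<eta>) p * \<Psi> p)" for e e'
 proof -
  have "dd e (dd e' (\<lambda>p. \<eta> p * \<Psi> p)) = dd e (\<lambda>p. \<eta> p * dd e' \<Psi> p + dd e' \<eta> p * \<Psi> p)"
   by (simp add: dd_mult[OF s])
  also have "\<dots> = (\<lambda>p. (\<eta> p * dd e (dd e' \<Psi>) p + dd e \<eta> p * dd e' \<Psi> p) + (dd e' \<eta> p * dd e \<Psi> p + dd e (dd e' \<eta>) p * \<Psi> p))"
   unfolding dd_add[OF smooth_mult[OF s(1) smooth_dd[OF s(2)]] smooth_mult[OF smooth_dd[OF s(1)] s(2)]]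
    dd_mult[OF s(1) smooth_dd[OF s(2)]] dd_mult[OF smooth_dd[OF s(1)] s(2)] by (rule refl)
  finally show ?thesis by simp
 qed
 show ?thesis unfolding heat_op_def 2
  by (simp add: dd_mult[OF s] distrib_left sum.distrib sum_distrib_left right_diff_distrib mult.left_commute)
qed

lemma frob_inner_sum: "frob_inner A (H :: real^'n^'n) = (\<Sum>i\<in>UNIV. \<Sum>j\<in>UNIV. A $ i $ j * H $ i $ j)"
 unfolding frob_inner_def trace_def matrix_matrix_mult_def transpose_def
 by (simp, rule sum.swap)

lemma P_op_measurable:
 assumes "locally_integrable (strip c B) ut" "\<And>i j. locally_integrable (strip c B) (\<lambda>p. Hu p $ i $ j)"
 shows "(\<lambda>p. indicator (strip c B) p * P_op A ut Hu p) \<in> borel_measurable borel"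
proof -
 have "(\<lambda>p. - (indicator (strip c B) p * ut p) - (\<Sum>i\<in>UNIV. \<Sum>j\<in>UNIV. A $ i $ j * (indicator (strip c B) p * Hu p $ i $ j))) \<in> borel_measurable borel"
  by (intro borel_measurable_diff borel_measurable_uminus borel_measurable_sum borel_measurable_times borel_measurable_const
    locally_integrable_measurable assms)
 then show ?thesis by (simp add: P_op_def frob_inner_sum right_diff_distrib sum_distrib_left mult.left_commute)
qed

definition weak_jet :: "real \<Rightarrow> real \<Rightarrow> (real \<times> (real^'n) \<Rightarrow> real) \<Rightarrow> (real \<times> (real^'n) \<Rightarrow> real) \<Rightarrow>
  (real \<times> (real^'n) \<Rightarrow> real^'n) \<Rightarrow> (real \<times> (real^'n) \<Rightarrow> real^'n^'n) \<Rightarrow> bool" where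
 "weak_jet c B u ut Du Hu \<longleftrightarrow> weak_deriv (strip c B) (1, 0) u ut \<and>
   (\<forall>i. weak_deriv (strip c B) (0, axis i 1) u (\<lambda>p. Du p $ i)) \<and>
   (\<forall>i j. weak_deriv (strip c B) (0, axis j 1) (\<lambda>p. Du p $ i) (\<lambda>p. Hu p $ i $ j))"

lemma weak_jetD:
 assumes W: "weak_jet c B u ut Du Hu" and \<phi>: "\<phi> \<in> test_functions (strip c B)"
 shows "(LB p. u p * dd (1, 0) \<phi> p) = - (LB p. ut p * \<phi> p)"
  "(LB p. u p * dd (0, axis i 1) (dd (0, axis j 1) \<phi>) p) = (LB p. Hu p $ i $ j * \<phi> p)"
  "locally_integrable (strip c B) u" "locally_integrable (strip c B) ut"
  "locally_integrable (strip c B) (\<lambda>p. Hu p $ i $ j)" "locally_integrable (strip c B) (\<lambda>p. Du p $ i)"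
proof -
 have w: "weak_deriv (strip c B) (1, 0) u ut" "weak_deriv (strip c B) (0, axis i 1) u (\<lambda>p. Du p $ i)"
  "weak_deriv (strip c B) (0, axis j 1) (\<lambda>p. Du p $ i) (\<lambda>p. Hu p $ i $ j)"
  using W by (auto simp: weak_jet_def)
 show "(LB p. u p * dd (1, 0) \<phi> p) = - (LB p. ut p * \<phi> p)"
  by (rule weak_derivD[OF w(1) \<phi>])
 show "(LB p. u p * dd (0, axis i 1) (dd (0, axis j 1) \<phi>) p) = (LB p. Hu p $ i $ j * \<phi> p)"
  using weak_derivD[OF w(2) test_dd[OF \<phi>]] weak_derivD[OF w(3) \<phi>] by simp
 show "locally_integrable (strip c B) u" "locally_integrable (strip c B) ut"
  "locally_integrable (strip c B) (\<lambda>p. Hu p $ i $ j)" "locally_integrable (strip c B) (\<lambda>p. Du p $ i)"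
  using w by (auto simp: weak_deriv_def)
qed

text \<open>One integration by parts in time and two in space, all read off from the weak
  derivatives of \<open>u\<close> because every derivative sits on a test function.\<close>

lemma weak_heat:
 fixes A :: "real^'n^'n"
 assumes W: "weak_jet c B u ut Du Hu" and \<phi>: "\<phi> \<in> test_functions (strip c B)"
 shows "(LB p. u p * heat_op A \<phi> p) = (LB p. P_op A ut Hu p * \<phi> p)"
  and "integrable lborel (\<lambda>p. P_op A ut Hu p * \<phi> p)"
proof -
 note W' = weak_jetD[OF W \<phi>]
 have i1: "integrable lborel (\<lambda>p. u p * f p)" if "f \<in> test_functions (strip c B)" for f
  by (rule integrable_mult_test[OF W'(3) that])
 have i2: "integrable lborel (\<lambda>p. ut p * \<phi> p)" "integrable lborel (\<lambda>p. Hu p $ i $ j * \<phi> p)" for i j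
  by (rule integrable_mult_test[OF W'(4) \<phi>], rule integrable_mult_test[OF W'(5) \<phi>])
 have "(LB p. u p * heat_op A \<phi> p)
  = (LB p. u p * dd (1, 0) \<phi> p - (\<Sum>i\<in>UNIV. \<Sum>j\<in>UNIV. A $ i $ j * (u p * dd (0, axis i 1) (dd (0, axis j 1) \<phi>) p)))"
  by (simp add: heat_op_def right_diff_distrib sum_distrib_left mult.left_commute)
 also have "\<dots> = (LB p. u p * dd (1, 0) \<phi> p) - (LB p. (\<Sum>i\<in>UNIV. \<Sum>j\<in>UNIV. A $ i $ j * (u p * dd (0, axis i 1) (dd (0, axis j 1) \<phi>) p)))"
  by (intro Bochner_Integration.integral_diff Bochner_Integration.integrable_sum integrable_mult_right i1 test_dd \<phi>)
 also have "(LB p. (\<Sum>i\<in>UNIV. \<Sum>j\<in>UNIV. A $ i $ j * (u p * dd (0, axis i 1) (dd (0, axis j 1) \<phi>) p)))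
  = (\<Sum>i\<in>UNIV. \<Sum>j\<in>UNIV. A $ i $ j * (LB p. u p * dd (0, axis i 1) (dd (0, axis j 1) \<phi>) p))"
 proof -
  have "(LB p. (\<Sum>i\<in>UNIV. \<Sum>j\<in>UNIV. A $ i $ j * (u p * dd (0, axis i 1) (dd (0, axis j 1) \<phi>) p)))
   = (\<Sum>i\<in>UNIV. LB p. (\<Sum>j\<in>UNIV. A $ i $ j * (u p * dd (0, axis i 1) (dd (0, axis j 1) \<phi>) p)))"
   by (intro Bochner_Integration.integral_sum Bochner_Integration.integrable_sum integrable_mult_right i1 test_dd \<phi>)
  also have "\<dots> = (\<Sum>i\<in>UNIV. \<Sum>j\<in>UNIV. LB p. A $ i $ j * (u p * dd (0, axis i 1) (dd (0, axis j 1) \<phi>) p))"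
   by (intro sum.cong refl Bochner_Integration.integral_sum integrable_mult_right i1 test_dd \<phi>)
  finally show ?thesis by simp
 qed
 also have "\<dots> = (\<Sum>i\<in>UNIV. \<Sum>j\<in>UNIV. A $ i $ j * (LB p. Hu p $ i $ j * \<phi> p))"
  by (simp only: weak_jetD(2)[OF W \<phi>])
 finally have L: "(LB p. u p * heat_op A \<phi> p) = - (LB p. ut p * \<phi> p) - (\<Sum>i\<in>UNIV. \<Sum>j\<in>UNIV. A $ i $ j * (LB p. Hu p $ i $ j * \<phi> p))"
  unfolding W'(1) .
 have P: "P_op A ut Hu p * \<phi> p = - (ut p * \<phi> p) - (\<Sum>i\<in>UNIV. \<Sum>j\<in>UNIV. A $ i $ j * (Hu p $ i $ j * \<phi> p))" for p
  by (simp add: P_op_def frob_inner_sum left_diff_distrib sum_distrib_right mult.assoc)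
 show "integrable lborel (\<lambda>p. P_op A ut Hu p * \<phi> p)"
  unfolding P by (intro Bochner_Integration.integrable_diff Bochner_Integration.integrable_minus Bochner_Integration.integrable_sum integrable_mult_right i2)
 have "(LB p. P_op A ut Hu p * \<phi> p) = - (LB p. ut p * \<phi> p) - (LB p. (\<Sum>i\<in>UNIV. \<Sum>j\<in>UNIV. A $ i $ j * (Hu p $ i $ j * \<phi> p)))"
  unfolding P by (subst Bochner_Integration.integral_diff)
   (auto intro!: Bochner_Integration.integrable_minus Bochner_Integration.integrable_sum integrable_mult_right i2)
 also have "(LB p. (\<Sum>i\<in>UNIV. \<Sum>j\<in>UNIV. A $ i $ j * (Hu p $ i $ j * \<phi> p)))
   = (\<Sum>i\<in>UNIV. LB p. (\<Sum>j\<in>UNIV. A $ i $ j * (Hu p $ i $ j * \<phi> p)))"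
  by (intro Bochner_Integration.integral_sum Bochner_Integration.integrable_sum integrable_mult_right i2)
 also have "\<dots> = (\<Sum>i\<in>UNIV. \<Sum>j\<in>UNIV. LB p. A $ i $ j * (Hu p $ i $ j * \<phi> p))"
  by (intro sum.cong refl Bochner_Integration.integral_sum integrable_mult_right i2)
 finally show "(LB p. u p * heat_op A \<phi> p) = (LB p. P_op A ut Hu p * \<phi> p)"
  unfolding L by simp
qed

definition xcut :: "real \<Rightarrow> real \<times> (real^'n) \<Rightarrow> real" where
 "xcut n p = ball_cutoff ((1/n) *\<^sub>R snd p)"

text \<open>Equal to 1 up to \<open>B - 2 * \<epsilon>\<close> and to 0 from
  \<open>B - \<epsilon>\<close> on. The empty layer of width \<open>\<epsilon>\<close> before
  \<open>B\<close> keeps supports compact inside the open strip.\<close>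

definition tcut :: "real \<Rightarrow> real \<Rightarrow> real \<times> (real^'n) \<Rightarrow> real" where
 "tcut B \<epsilon> p = sstep ((B - fst p) / \<epsilon> - 1)"

lemma xcut_linear: "bounded_linear (\<lambda>p :: real \<times> (real^'n). (1/n) *\<^sub>R snd p)"
 by (intro bounded_linear_const_scaleR bounded_linear_snd)

lemma smooth_xcut: "smooth (xcut n)"
 unfolding xcut_def[abs_def] by (rule smooth_compose_linear[OF test_smooth[OF ball_cutoff_test] xcut_linear])

lemma dd_xcut: "dd e (xcut n) = (\<lambda>p. (1/n) * dd (snd e) ball_cutoff ((1/n) *\<^sub>R snd p))"
proof
 fix p
 have "dd e (xcut n) p = dd ((1/n) *\<^sub>R snd e) ball_cutoff ((1/n) *\<^sub>R snd p)"
  unfolding xcut_def[abs_def] by (rule dd_compose_linear[OF test_smooth[OF ball_cutoff_test] xcut_linear])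
 then show "dd e (xcut n) p = (1/n) * dd (snd e) ball_cutoff ((1/n) *\<^sub>R snd p)"
  using linear_scale[OF smooth_linear_dd[OF test_smooth[OF ball_cutoff_test]], of "1/n" "snd e"] by simp
qed

lemma dd_dd_xcut: "dd e' (dd e (xcut n)) p = (1/n) * ((1/n) * dd (snd e') (dd (snd e) ball_cutoff) ((1/n) *\<^sub>R snd p))"
proof -
 let ?f = "dd (snd e) ball_cutoff :: real^'a \<Rightarrow> real"
 have sf: "smooth ?f" by (intro smooth_dd test_smooth[OF ball_cutoff_test])
 have s: "smooth (\<lambda>p :: real \<times> (real^'a). ?f ((1/n) *\<^sub>R snd p))" by (rule smooth_compose_linear[OF sf xcut_linear])
 have "dd e' (dd e (xcut n)) p = (1/n) * dd e' (\<lambda>p. ?f ((1/n) *\<^sub>R snd p)) p"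
  unfolding dd_xcut using dd_mult[OF smooth_const[of "1/n"] s, of e'] by (simp add: dd_const)
 also have "dd e' (\<lambda>p. ?f ((1/n) *\<^sub>R snd p)) p = dd ((1/n) *\<^sub>R snd e') ?f ((1/n) *\<^sub>R snd p)"
  by (rule dd_compose_linear[OF sf xcut_linear])
 also have "\<dots> = (1/n) * dd (snd e') ?f ((1/n) *\<^sub>R snd p)"
  using linear_scale[OF smooth_linear_dd[OF sf], of "1/n" "snd e'"] by simp
 finally show ?thesis .
qed

lemma xcut_bounds: "0 \<le> xcut n p" "xcut n p \<le> 1"
 by (simp_all add: xcut_def ball_cutoff_bounds)

lemma xcut_one: "n > 0 \<Longrightarrow> norm (snd p) \<le> n \<Longrightarrow> xcut n p = 1"
 unfolding xcut_def by (rule ball_cutoff_one) simp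

lemma xcut_zero: "n > 0 \<Longrightarrow> norm (snd p) > 2 * n \<Longrightarrow> xcut n p = 0"
proof -
 assume n: "n > 0" "norm (snd p) > 2 * n"
 let ?x = "(1/n) *\<^sub>R snd p"
 have "2 < norm ?x" using n by (simp add: field_simps)
 then have "2 * 2 < norm ?x * norm ?x" by (intro mult_strict_mono) auto
 then have "2 - ?x \<bullet> ?x \<le> 0" by (simp add: dot_square_norm power2_eq_square)
 then show ?thesis unfolding xcut_def ball_cutoff_def by (rule sstep_le_0)
qed

lemma tcut_affine: "((\<lambda>p :: real \<times> (real^'n). (B - fst p) / \<epsilon> - 1) has_derivative (\<lambda>e. - fst e / \<epsilon>)) (at p)"
 unfolding divide_inverse by (auto intro!: derivative_eq_intros)

lemma smooth_tcut: "smooth (tcut B \<epsilon> :: real \<times> (real^'n) \<Rightarrow> real)"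
proof -
 have "smooth (\<lambda>p :: real \<times> (real^'n). (B/\<epsilon> - 1) - (1/\<epsilon>) * fst p)"
  by (intro smooth_diff smooth_mult smooth_const smooth_linear bounded_linear_fst)
 also have "(\<lambda>p :: real \<times> (real^'n). (B/\<epsilon> - 1) - (1/\<epsilon>) * fst p) = (\<lambda>p. (B - fst p) / \<epsilon> - 1)"
  by (simp add: diff_divide_distrib fun_eq_iff)
 finally show ?thesis unfolding tcut_def[abs_def] by (rule smooth_compose_real[OF smooth_sstep])
qed

lemma dd_tcut: "dd e (tcut B \<epsilon> :: real \<times> (real^'n) \<Rightarrow> real) = (\<lambda>p. (- fst e / \<epsilon>) * dd 1 sstep ((B - fst p) / \<epsilon> - 1))"
proof
 fix p :: "real \<times> (real^'n)"
 have "dd e (tcut B \<epsilon>) p = dd (- fst e / \<epsilon>) sstep ((B - fst p) / \<epsilon> - 1)"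
  unfolding tcut_def[abs_def]
  by (rule dd_eqI[OF has_derivative_compose[OF tcut_affine smooth_has_derivative[OF smooth_sstep]]])
 also have "\<dots> = (- fst e / \<epsilon>) * dd 1 sstep ((B - fst p) / \<epsilon> - 1)"
  using linear_scale[OF smooth_linear_dd[OF smooth_sstep], of "- fst e / \<epsilon>" 1] by simp
 finally show "dd e (tcut B \<epsilon>) p = (- fst e / \<epsilon>) * dd 1 sstep ((B - fst p) / \<epsilon> - 1)" .
qed

lemma tcut_bounds: "0 \<le> tcut B \<epsilon> p" "tcut B \<epsilon> p \<le> 1"
 by (simp_all add: tcut_def sstep_nonneg sstep_le_1)

lemma tcut_one: "\<epsilon> > 0 \<Longrightarrow> fst p \<le> B - 2 * \<epsilon> \<Longrightarrow> tcut B \<epsilon> p = 1"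
 unfolding tcut_def by (rule sstep_ge_1) (simp add: field_simps)

lemma tcut_zero: "\<epsilon> > 0 \<Longrightarrow> fst p \<ge> B - \<epsilon> \<Longrightarrow> tcut B \<epsilon> p = 0"
 unfolding tcut_def by (rule sstep_le_0) (simp add: field_simps)

context parab
begin

section \<open>Pairing a second derivative of the function with a smooth source\<close>

definition ca :: real where "ca = sqrt ((2 * pi) ^ CARD('n) * det a)"

lemma ca_pos: "ca > 0"
 using posdef_det_pos[OF a] by (simp add: ca_def)

lemma wgt_\<rho>: "fst p > 0 \<Longrightarrow> wgt \<alpha> a p * (ca * \<rho> p) = 1"
proof -
 assume t: "fst p > 0"
 have "fst p powr \<alpha> * (fst p powr (d/2 - \<alpha>)) = fst p powr (d/2)" by (simp flip: powr_add)
 moreover have "exp (- Q (snd p) / (2 * fst p)) * exp (Q (snd p) / (2 * fst p)) = 1" by (simp flip: exp_add)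
 moreover have "wgt \<alpha> a p * (ca * \<rho> p) = (fst p powr \<alpha> * (fst p powr (d/2 - \<alpha>))) * (exp (- Q (snd p) / (2 * fst p)) * exp (Q (snd p) / (2 * fst p))) / fst p powr (d/2)"
 proof -
  have "wgt \<alpha> a p = fst p powr \<alpha> * (exp (- Q (snd p) / (2 * fst p)) / (ca * fst p powr (d/2)))"
   unfolding wgt_def gauss_scaled[OF a t] ca_def Q_def d_def ..
  then show ?thesis using ca_pos by (simp add: \<rho>_def)
 qed
 ultimately show ?thesis using t by simp
qed

lemma wgt_nonneg: "fst p > 0 \<Longrightarrow> 0 \<le> wgt \<alpha> a p"
 using wgt_pos[OF a, of p \<alpha>] by simp

text \<open>With reciprocal weights \<open>w\<close> and \<open>v\<close>, the product
  \<open>\<bar>u\<bar> * \<bar>f\<bar>\<close> is at most \<open>w * u^2 + v * f^2\<close>. The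
  first term is the finite norm of \<open>u\<close>, the second is integrable by decay.\<close>

lemma pair_finite:
 assumes c: "0 < c" and u: "(\<lambda>p. indicator (strip c B) p * u p) \<in> borel_measurable borel"
  and fin: "wsq \<alpha> a c B u < top" and f: "decays c B f" and mf [measurable]: "f \<in> borel_measurable borel"
 shows "(NN p. ennreal (indicator {c<..<B} (fst p) * \<bar>u p\<bar> * \<bar>f p\<bar>)) < top"
proof -
 let ?I = "\<lambda>p. indicator {c<..<B} (fst p) :: real"
 have [measurable]: "(\<lambda>p. ?I p * wgt \<alpha> a p) \<in> borel_measurable borel" by (rule wgt_measurable[OF a]) (use c in simp)
 have [measurable]: "(\<lambda>p. ?I p * u p) \<in> borel_measurable borel" using u by (simp add: indicator_strip)
 have eq: "?I p * wgt \<alpha> a p * (u p)\<^sup>2 = (?I p * wgt \<alpha> a p) * (?I p * u p)\<^sup>2" for p by (simp add: indicator_def)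
 have b: "bnd c B (\<lambda>p. ca * (Wt (d/2 - \<alpha>) p * (f p * f p)))"
  by (intro bnd_cmult bnd_product1 c f)
 have i: "integrable lborel (\<lambda>p. indicator {c..B} (fst p) * (ca * (Wt (d/2 - \<alpha>) p * (f p * f p))))"
  by (rule bnd_integrable[OF c b]) measurable
 have "(NN p. ennreal (?I p * \<bar>u p\<bar> * \<bar>f p\<bar>))
  \<le> (NN p. ennreal (?I p * wgt \<alpha> a p * (u p)\<^sup>2) + ennreal (norm (indicator {c..B} (fst p) * (ca * (Wt (d/2 - \<alpha>) p * (f p * f p))))))"
 proof (rule nn_integral_mono)
  fix p :: "real \<times> (real^'n)"
  show "ennreal (?I p * \<bar>u p\<bar> * \<bar>f p\<bar>) \<le> ennreal (?I p * wgt \<alpha> a p * (u p)\<^sup>2) + ennreal (norm (indicator {c..B} (fst p) * (ca * (Wt (d/2 - \<alpha>) p * (f p * f p)))))"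
  proof (cases "fst p \<in> {c<..<B}")
   case True
   then have t: "fst p > 0" using c by simp
   define w where "w = wgt \<alpha> a p"
   define v where "v = ca * \<rho> p"
   have w: "w > 0" "w * v = 1" using wgt_\<rho>[OF t] wgt_pos[OF a t] by (auto simp: w_def v_def)
   have v: "v > 0" using w by (metis zero_less_mult_pos zero_less_one)
   have "\<bar>u p\<bar> * \<bar>f p\<bar> \<le> w * (u p)\<^sup>2 + v * (f p)\<^sup>2"
   proof -
    have "0 \<le> (w * \<bar>u p\<bar> - \<bar>f p\<bar>)\<^sup>2 * v" using v by simp
    also have "\<dots> = (w * v) * (w * (u p)\<^sup>2) - 2 * (w * v) * (\<bar>u p\<bar> * \<bar>f p\<bar>) + v * (f p)\<^sup>2"
     by (simp add: power2_diff power_mult_distrib algebra_simps power2_eq_square)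
    finally have "2 * (\<bar>u p\<bar> * \<bar>f p\<bar>) \<le> w * (u p)\<^sup>2 + v * (f p)\<^sup>2" using w by simp
    then show ?thesis using mult_nonneg_nonneg[OF abs_ge_zero abs_ge_zero, of "u p" "f p"] by linarith
   qed
   then have "ennreal (\<bar>u p\<bar> * \<bar>f p\<bar>) \<le> ennreal (w * (u p)\<^sup>2 + v * (f p)\<^sup>2)" by (rule ennreal_leI)
   also have "\<dots> = ennreal (w * (u p)\<^sup>2) + ennreal (v * (f p)\<^sup>2)" using w v by (intro ennreal_plus) auto
   also have "v * (f p)\<^sup>2 = norm (indicator {c..B} (fst p) * (ca * (Wt (d/2 - \<alpha>) p * (f p * f p))))"
   proof -
    have "0 \<le> v * (f p)\<^sup>2" using v by simp
    moreover have "v * (f p)\<^sup>2 = indicator {c..B} (fst p) * (ca * (Wt (d/2 - \<alpha>) p * (f p * f p)))"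
     using True by (simp add: v_def \<rho>_Wt power2_eq_square)
    ultimately show ?thesis by simp
   qed
   finally show ?thesis using True by (simp add: w_def)
  qed simp
 qed
 also have "\<dots> = (NN p. ennreal (?I p * wgt \<alpha> a p * (u p)\<^sup>2)) + (NN p. ennreal (norm (indicator {c..B} (fst p) * (ca * (Wt (d/2 - \<alpha>) p * (f p * f p))))))"
  unfolding eq by (rule nn_integral_add) measurable
 also have "\<dots> < top"
  using fin i by (simp add: wsq_def integrable_iff_bounded)
 finally show ?thesis .
qed

text \<open>The primal weight and \<open>ca * \<rho>\<close> are reciprocal, so their square roots
  cancel in the Cauchy-Schwarz inequality.\<close>

lemma weighted_CS:
 assumes c: "0 < c" and f: "(\<lambda>p. indicator (strip c B) p * f p) \<in> borel_measurable borel"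
  and X: "wsq \<alpha> a c B f \<le> ennreal X" "0 \<le> X" and g: "decays c B g" and mg [measurable]: "g \<in> borel_measurable borel"
 shows "(NN p. ennreal (indicator {c<..<B} (fst p) * \<bar>f p\<bar> * \<bar>g p\<bar>)) \<le> ennreal (sqrt (X * (ca * IS c B (\<lambda>p. \<rho> p * (g p)\<^sup>2))))"
proof -
 let ?I = "\<lambda>p. indicator {c<..<B} (fst p) :: real"
 define W where "W p = ?I p * wgt \<alpha> a p" for p
 have W [measurable]: "W \<in> borel_measurable borel" unfolding W_def[abs_def] by (rule wgt_measurable[OF a]) (use c in simp)
 have Wp: "W p > 0" if "fst p \<in> {c<..<B}" for p using that c wgt_pos[OF a, of p \<alpha>] by (simp add: W_def)
 have W0: "W p \<ge> 0" for p using Wp[of p] by (cases "fst p \<in> {c<..<B}") (auto simp: W_def)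
 have [measurable]: "(\<lambda>p. ?I p * f p) \<in> borel_measurable borel" using f by (simp add: indicator_strip)
 define f1 where "f1 p = sqrt (W p) * \<bar>?I p * f p\<bar>" for p
 define g1 where "g1 p = ?I p * \<bar>g p\<bar> / sqrt (W p)" for p
 have IS_eq: "ennreal (ca * IS c B (\<lambda>p. \<rho> p * (g p)\<^sup>2)) = (NN p. ennreal (indicator {c..B} (fst p) * (ca * (Wt (d/2 - \<alpha>) p * (g p * g p)))))"
 proof -
  have i: "integrable lborel (\<lambda>p. indicator {c..B} (fst p) * (ca * (Wt (d/2 - \<alpha>) p * (g p * g p))))"
   by (rule bnd_integrable[OF c]) (intro bnd_cmult bnd_product1 c g, measurable)
  have "0 \<le> indicator {c..B} (fst p) * (ca * (Wt (d/2 - \<alpha>) p * (g p * g p)))" for p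
   using ca_pos by (intro mult_nonneg_nonneg[OF _ mult_nonneg_nonneg[OF _ mult_nonneg_nonneg[OF _ zero_le_square]]]) (auto simp: Wt_def)
  from nn_integral_eq_integral[OF i AE_I2[OF this]]
  show ?thesis using IS_cmult[of c B ca "\<lambda>p. Wt (d/2 - \<alpha>) p * (g p * g p)"]
   by (simp add: IS_def \<rho>_Wt power2_eq_square)
 qed
 have ISnn: "0 \<le> IS c B (\<lambda>p. \<rho> p * (g p)\<^sup>2)"
  unfolding IS_def by (intro Bochner_Integration.integral_nonneg mult_nonneg_nonneg) (auto simp: \<rho>_def)
 have "(NN p. ennreal (?I p * \<bar>f p\<bar> * \<bar>g p\<bar>)) = (NN p. ennreal (f1 p) * ennreal (g1 p))"
 proof (rule nn_integral_cong)
  fix p :: "real \<times> (real^'n)"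
  show "ennreal (?I p * \<bar>f p\<bar> * \<bar>g p\<bar>) = ennreal (f1 p) * ennreal (g1 p)"
  proof (cases "fst p \<in> {c<..<B}")
   case True
   then show ?thesis using Wp[OF True] by (simp add: f1_def g1_def ennreal_mult[symmetric])
  qed (simp add: f1_def)
 qed
 also have "\<dots> \<le> ennreal (sqrt (X * (ca * IS c B (\<lambda>p. \<rho> p * (g p)\<^sup>2))))"
 proof (rule ennreal_CS_bound)
  show "f1 \<in> borel_measurable borel" unfolding f1_def[abs_def] by measurable
  show "g1 \<in> borel_measurable borel" unfolding g1_def[abs_def] by measurable
  have "(NN p. (ennreal (f1 p))\<^sup>2) = wsq \<alpha> a c B f"
   unfolding wsq_def
  proof (rule nn_integral_cong)
   fix p :: "real \<times> (real^'n)"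
   have "(f1 p)\<^sup>2 = ?I p * wgt \<alpha> a p * (norm (f p))\<^sup>2"
   proof (cases "fst p \<in> {c<..<B}")
    case True
    then show ?thesis using W0[of p] by (simp add: f1_def power_mult_distrib) (simp add: W_def)
   qed (simp add: f1_def)
   moreover have "f1 p \<ge> 0" using W0[of p] by (simp add: f1_def)
   ultimately show "(ennreal (f1 p))\<^sup>2 = ennreal (?I p * wgt \<alpha> a p * (norm (f p))\<^sup>2)" by (simp add: ennreal_power)
  qed
  then show "(NN p. (ennreal (f1 p))\<^sup>2) \<le> ennreal X" using X by simp
  have "(NN p. (ennreal (g1 p))\<^sup>2) \<le> (NN p. ennreal (indicator {c..B} (fst p) * (ca * (Wt (d/2 - \<alpha>) p * (g p * g p)))))"
  proof (rule nn_integral_mono)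
   fix p :: "real \<times> (real^'n)"
   show "(ennreal (g1 p))\<^sup>2 \<le> ennreal (indicator {c..B} (fst p) * (ca * (Wt (d/2 - \<alpha>) p * (g p * g p))))"
   proof (cases "fst p \<in> {c<..<B}")
    case True
    then have t: "fst p > 0" using c by simp
    have "W p * (ca * \<rho> p) = 1" using wgt_\<rho>[OF t] True by (simp add: W_def)
    then have "ca * \<rho> p = 1 / W p" using Wp[OF True] by (simp add: field_simps)
    then have "(g1 p)\<^sup>2 = ca * (\<rho> p * (g p * g p))"
    proof -
     have "(g1 p)\<^sup>2 = (1 / W p) * (g p * g p)"
      using True Wp[OF True] by (simp add: g1_def power_divide) (simp add: power2_eq_square)
     then show ?thesis unfolding \<open>ca * \<rho> p = 1 / W p\<close>[symmetric] by simp
    qed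
    moreover have "g1 p \<ge> 0" using W0[of p] by (simp add: g1_def)
    ultimately show ?thesis using True by (simp add: ennreal_power \<rho>_Wt)
   qed (simp add: g1_def)
  qed
  then show "(NN p. (ennreal (g1 p))\<^sup>2) \<le> ennreal (ca * IS c B (\<lambda>p. \<rho> p * (g p)\<^sup>2))" by (simp only: IS_eq)
  show "0 \<le> ca * IS c B (\<lambda>p. \<rho> p * (g p)\<^sup>2)" using ca_pos ISnn by simp
 qed (rule X(2))
 finally show ?thesis .
qed

lemma decays_bounded:
 assumes "decays c B f" "0 < c"
 obtains M where "M > 0" "\<And>t x. t \<in> {c..B} \<Longrightarrow> \<bar>f (t, x)\<bar> \<le> M"
proof -
 have "\<exists>M\<ge>0. \<forall>t\<in>{c..B}. \<forall>x. \<bar>f (t, x)\<bar> \<le> M * exp (- \<kappa> * Q x / t)" using assms(1) by (simp only: decays_def)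
 then obtain M where M: "M \<ge> 0" "\<And>t x. t \<in> {c..B} \<Longrightarrow> \<bar>f (t, x)\<bar> \<le> M * exp (- \<kappa> * Q x / t)" by (elim exE conjE) (rule that, auto)
 show ?thesis
 proof (rule that[of "M + 1"])
  fix t and x :: "real^'n" assume t: "t \<in> {c..B}"
  have "exp (- \<kappa> * Q x / t) \<le> 1" using t assms(2) \<kappa> Q_bounds(3)[of x] by simp
  then have "M * exp (- \<kappa> * Q x / t) \<le> M * 1" using M(1) by (rule mult_left_mono)
  then show "\<bar>f (t, x)\<bar> \<le> M + 1" using M(2)[OF t, of x] by linarith
 qed (use M in simp)
qed

text \<open>The derivative of the time cutoff has size \<open>1/\<epsilon>\<close> on an interval of
  length \<open>\<epsilon>\<close>, so this term is an average of \<open>u\<close> over times close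
  to \<open>B\<close>, which the zero trace makes small. The radius \<open>2 * n\<close> is fixed
  beforehand, as the trace controls bounded balls only.\<close>

lemma trace_term_small:
 fixes u :: "real \<times> (real^'n) \<Rightarrow> real"
 assumes c: "0 < c" "c < B" "c \<le> b1" "b1 < B" and u: "(\<lambda>p. indicator (strip c B) p * u p) \<in> borel_measurable borel"
  and tr: "has_trace c B u (\<lambda>_. 0)" and M: "M > 0" "\<And>t x. t \<in> {c..B} \<Longrightarrow> \<bar>\<Psi> (t, x)\<bar> \<le> M"
  and e: "e > 0" and n: "n > 0"
 obtains \<epsilon> where "\<epsilon> > 0" "b1 \<le> B - 2 * \<epsilon>"
  "(NN p. ennreal \<bar>u p * (xcut n p * dd (1, 0) (tcut B \<epsilon>) p * \<Psi> p)\<bar>) \<le> ennreal e"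
proof -
 obtain K where K: "K > 0" "\<And>y. \<bar>dd 1 sstep y\<bar> \<le> K" "\<And>y. y < 0 \<or> 1 < y \<Longrightarrow> dd 1 sstep y = 0"
  using sstep_derivative_bounded by blast
 define V where "V = measure lborel (cball (0 :: real^'n) (2 * n))"
 have V: "V \<ge> 0" "emeasure lborel (cball (0 :: real^'n) (2 * n)) = ennreal V"
  using emeasure_bounded_finite[of "cball (0 :: real^'n) (2 * n)"]
  by (auto simp: V_def emeasure_eq_ennreal_measure less_top)
 have [measurable]: "cball (0 :: real^'n) (2 * n) \<in> sets borel" by simp
 \<comment> \<open>Chosen so that the product at the end equals \<open>e\<close>. The summand 1 in
   \<open>V + 1\<close> accounts for the quadratic term below.\<close>
 define \<delta> where "\<delta> = e / (K * M * (V + 1))"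
 have \<delta>: "\<delta> > 0" using e K M V by (simp add: \<delta>_def)
 obtain b where b: "b < B" "AE t in lborel. b < t \<and> c < t \<and> t < B \<longrightarrow> (\<integral>\<^sup>+x\<in>cball 0 (2 * n). ennreal ((u (t, x))\<^sup>2) \<partial>lborel) \<le> ennreal (\<delta>\<^sup>2)"
  using trace_small[OF tr, of "\<delta>\<^sup>2" "2 * n"] \<delta> by auto
 define bb where "bb = max b b1"
 define \<epsilon> where "\<epsilon> = (B - bb) / 3"
 have \<epsilon>: "\<epsilon> > 0" "bb \<le> B - 2 * \<epsilon>" "B - 2 * \<epsilon> > bb"
  using b(1) c by (auto simp: \<epsilon>_def bb_def field_simps)
 define us where "us p = indicator (strip c B) p * u p" for p
 have [measurable]: "us \<in> borel_measurable borel" using u by (simp add: us_def[abs_def])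
 have mus: "(\<lambda>x. us (t, x)) \<in> borel_measurable borel" for t
 proof -
  have "us \<in> borel_measurable (borel \<Otimes>\<^sub>M borel)" by (simp add: borel_prod)
  from measurable_Pair2[OF this, of t] show ?thesis by simp
 qed
 have [measurable]: "(\<lambda>p :: real \<times> (real^'n). indicat_real (cball 0 (2 * n)) (snd p)) \<in> borel_measurable borel"
  by (rule measurable_compose[OF snd_borel]) (intro borel_measurable_indicator, simp)
 define I where "I t = (indicator {B - 2 * \<epsilon>..B - \<epsilon>} t :: real)" for t
 have pw: "\<bar>u p * (xcut n p * dd (1, 0) (tcut B \<epsilon>) p * \<Psi> p)\<bar> \<le> (K / \<epsilon> * M) * (I (fst p) * (indicator (cball 0 (2 * n)) (snd p) * \<bar>us p\<bar>))" for p
 proof (cases "fst p \<in> {B - 2 * \<epsilon>..B - \<epsilon>} \<and> snd p \<in> cball 0 (2 * n)")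
  case True
  then have t: "fst p \<in> {c..B}" "p \<in> strip c B"
   using \<epsilon> c by (auto simp: strip_def bb_def mem_Times_iff)
  have "\<bar>xcut n p\<bar> \<le> 1" using xcut_bounds[of n p] by simp
  moreover have "\<bar>dd (1, 0) (tcut B \<epsilon>) p\<bar> \<le> K / \<epsilon>"
   using \<epsilon> K(2)[of "(B - fst p) / \<epsilon> - 1"] by (simp add: dd_tcut abs_mult field_simps)
  moreover have "\<bar>\<Psi> p\<bar> \<le> M" using M(2)[OF t(1), of "snd p"] by simp
  ultimately have "\<bar>xcut n p\<bar> * \<bar>dd (1, 0) (tcut B \<epsilon>) p\<bar> * \<bar>\<Psi> p\<bar> \<le> 1 * (K / \<epsilon>) * M"
   using K \<epsilon> M(1) by (intro mult_mono) auto
  then have "\<bar>u p\<bar> * (\<bar>xcut n p\<bar> * \<bar>dd (1, 0) (tcut B \<epsilon>) p\<bar> * \<bar>\<Psi> p\<bar>) \<le> \<bar>u p\<bar> * (1 * (K / \<epsilon>) * M)"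
   by (rule mult_left_mono) simp
  then show ?thesis using True t by (simp add: abs_mult us_def I_def mult_ac)
 next
  case False
  have "xcut n p * dd (1, 0) (tcut B \<epsilon>) p = 0"
  proof (cases "snd p \<in> cball 0 (2 * n)")
   case True
   with False have "fst p < B - 2 * \<epsilon> \<or> fst p > B - \<epsilon>" by auto
   then have "(B - fst p) / \<epsilon> - 1 > 1 \<or> (B - fst p) / \<epsilon> - 1 < 0" using \<epsilon> by (auto simp: field_simps)
   then have "dd 1 sstep ((B - fst p) / \<epsilon> - 1) = 0" using K(3) by blast
   then show ?thesis by (simp add: dd_tcut)
  next
   case F: False
   then show ?thesis using xcut_zero[OF n, of p] by simp
  qed
  then have "u p * (xcut n p * dd (1, 0) (tcut B \<epsilon>) p * \<Psi> p) = 0" by simp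
  moreover have "0 \<le> (K / \<epsilon> * M) * (I (fst p) * (indicator (cball 0 (2 * n)) (snd p) * \<bar>us p\<bar>))"
   using K M \<epsilon> by (simp add: I_def)
  ultimately show ?thesis by (simp only: abs_zero)
 qed
 have KM: "0 \<le> K / \<epsilon> * M" using K M \<epsilon> by simp
 have "(NN p. ennreal \<bar>u p * (xcut n p * dd (1, 0) (tcut B \<epsilon>) p * \<Psi> p)\<bar>)
  \<le> (NN p. ennreal (K / \<epsilon> * M) * ennreal (I (fst p) * (indicator (cball 0 (2 * n)) (snd p) * \<bar>us p\<bar>)))"
  using pw KM by (intro nn_integral_mono) (simp add: ennreal_mult'[symmetric] ennreal_leI)
 also have "\<dots> = ennreal (K / \<epsilon> * M) * (NN p. ennreal (I (fst p) * (indicator (cball 0 (2 * n)) (snd p) * \<bar>us p\<bar>)))"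
  unfolding I_def by (rule nn_integral_cmult) measurable
 also have "(NN p. ennreal (I (fst p) * (indicator (cball 0 (2 * n)) (snd p) * \<bar>us p\<bar>)))
  = (NN t. NN x. ennreal (I t * (indicator (cball 0 (2 * n)) x * \<bar>us (t, x)\<bar>)))"
 proof -
  have "(\<lambda>p. \<bar>us p\<bar>) \<in> borel_measurable borel" by (rule borel_measurable_abs) fact
  note [measurable] = this
  have "(\<lambda>p. ennreal (I (fst p) * (indicator (cball 0 (2 * n)) (snd p) * \<bar>us p\<bar>))) \<in> borel_measurable borel"
   unfolding I_def by measurable
  from nn_integral_lborel_pair[OF this] show ?thesis by (simp only: fst_conv snd_conv)
 qed
 also have "\<dots> \<le> (NN t. ennreal (\<delta> * (V + 1)) * indicator {B - 2 * \<epsilon>..B - \<epsilon>} t)"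
 proof (rule nn_integral_mono_AE)
  show "AE t in lborel. (NN x. ennreal (I t * (indicator (cball 0 (2 * n)) x * \<bar>us (t, x)\<bar>))) \<le> ennreal (\<delta> * (V + 1)) * indicator {B - 2 * \<epsilon>..B - \<epsilon>} t"
   using b(2)
  proof eventually_elim
   fix t assume t: "b < t \<and> c < t \<and> t < B \<longrightarrow> (\<integral>\<^sup>+x\<in>cball 0 (2 * n). ennreal ((u (t, x))\<^sup>2) \<partial>lborel) \<le> ennreal (\<delta>\<^sup>2)"
   show "(NN x. ennreal (I t * (indicator (cball 0 (2 * n)) x * \<bar>us (t, x)\<bar>))) \<le> ennreal (\<delta> * (V + 1)) * indicator {B - 2 * \<epsilon>..B - \<epsilon>} t"
   proof (cases "t \<in> {B - 2 * \<epsilon>..B - \<epsilon>}")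
    case True
    then have tt: "b < t" "c < t" "t < B" using \<epsilon> c by (auto simp: bb_def)
    note [measurable] = mus[of t]
    have us_u: "us (t, x) = u (t, x)" for x using tt by (simp add: us_def strip_def)
    have sq: "(NN x. ennreal (indicator (cball 0 (2 * n)) x * (us (t, x))\<^sup>2)) \<le> ennreal (\<delta>\<^sup>2)"
    proof -
     have "(NN x. ennreal (indicator (cball 0 (2 * n)) x * (us (t, x))\<^sup>2)) = (\<integral>\<^sup>+x\<in>cball 0 (2 * n). ennreal ((u (t, x))\<^sup>2) \<partial>lborel)"
      by (intro nn_integral_cong) (auto simp: indicator_def us_u)
     then show ?thesis using t tt by simp
    qed
    have "(NN x. ennreal (I t * (indicator (cball 0 (2 * n)) x * \<bar>us (t, x)\<bar>)))
     \<le> (NN x. ennreal \<delta> * indicator (cball 0 (2 * n)) x + ennreal (1/\<delta>) * ennreal (indicator (cball 0 (2 * n)) x * (us (t, x))\<^sup>2))"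
    proof (rule nn_integral_mono)
     fix x :: "real^'n"
     \<comment> \<open>A substitute for Cauchy-Schwarz on the ball: since the slice has squared norm
       at most \<open>\<delta>^2\<close>, integration gives
       \<open>\<delta> * V + \<delta>\<close>.\<close>
     have "\<bar>us (t, x)\<bar> \<le> \<delta> + 1/\<delta> * (us (t, x))\<^sup>2"
     proof (cases "\<bar>us (t, x)\<bar> \<le> \<delta>")
      case True
      then show ?thesis using \<delta> by (simp add: add_increasing2)
     next
      case False
      then have "\<delta> * \<bar>us (t, x)\<bar> \<le> \<bar>us (t, x)\<bar> * \<bar>us (t, x)\<bar>" by (intro mult_right_mono) auto
      then have "\<bar>us (t, x)\<bar> \<le> 1/\<delta> * (us (t, x))\<^sup>2" using \<delta> by (simp add: field_simps power2_eq_square)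
      then show ?thesis using \<delta> by linarith
     qed
     then have "ennreal \<bar>us (t, x)\<bar> \<le> ennreal (\<delta> + 1/\<delta> * (us (t, x))\<^sup>2)" by (rule ennreal_leI)
     also have "\<dots> = ennreal \<delta> + ennreal (1/\<delta> * (us (t, x))\<^sup>2)" using \<delta> by (intro ennreal_plus) auto
     also have "ennreal (1/\<delta> * (us (t, x))\<^sup>2) = ennreal (1/\<delta>) * ennreal ((us (t, x))\<^sup>2)"
      using \<delta> by (intro ennreal_mult) auto
     finally have "ennreal \<bar>us (t, x)\<bar> \<le> ennreal \<delta> + ennreal (1/\<delta>) * ennreal ((us (t, x))\<^sup>2)" .
     then show "ennreal (I t * (indicator (cball 0 (2 * n)) x * \<bar>us (t, x)\<bar>)) \<le> ennreal \<delta> * indicator (cball 0 (2 * n)) x + ennreal (1/\<delta>) * ennreal (indicator (cball 0 (2 * n)) x * (us (t, x))\<^sup>2)"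
      using True by (simp add: I_def indicator_def)
    qed
    also have "\<dots> = (\<integral>\<^sup>+x. ennreal \<delta> * indicator (cball 0 (2 * n)) x \<partial>(lborel :: (real^'n) measure)) + (NN x. ennreal (1/\<delta>) * ennreal (indicator (cball 0 (2 * n)) x * (us (t, x))\<^sup>2))"
     by (rule nn_integral_add) measurable
    also have "\<dots> = ennreal \<delta> * ennreal V + ennreal (1/\<delta>) * (NN x. ennreal (indicator (cball 0 (2 * n)) x * (us (t, x))\<^sup>2))"
    proof -
     have "(\<integral>\<^sup>+x. ennreal \<delta> * indicator (cball 0 (2 * n)) x \<partial>(lborel :: (real^'n) measure)) = ennreal \<delta> * ennreal V"
      by (subst nn_integral_cmult_indicator) (simp_all add: V)
     moreover have "(NN x. ennreal (1/\<delta>) * ennreal (indicator (cball 0 (2 * n)) x * (us (t, x))\<^sup>2)) = ennreal (1/\<delta>) * (NN x. ennreal (indicator (cball 0 (2 * n)) x * (us (t, x))\<^sup>2))"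
      by (rule nn_integral_cmult) measurable
     ultimately show ?thesis by simp
    qed
    also have "\<dots> \<le> ennreal \<delta> * ennreal V + ennreal (1/\<delta>) * ennreal (\<delta>\<^sup>2)"
     by (intro add_left_mono mult_left_mono sq) simp
    also have "\<dots> = ennreal (\<delta> * V + 1/\<delta> * \<delta>\<^sup>2)"
    proof -
     have "ennreal (\<delta> * V + 1/\<delta> * \<delta>\<^sup>2) = ennreal (\<delta> * V) + ennreal (1/\<delta> * \<delta>\<^sup>2)"
      using \<delta> V by (intro ennreal_plus) auto
     moreover have "ennreal (\<delta> * V) = ennreal \<delta> * ennreal V" using \<delta> V by (intro ennreal_mult) auto
     moreover have "ennreal (1/\<delta> * \<delta>\<^sup>2) = ennreal (1/\<delta>) * ennreal (\<delta>\<^sup>2)" using \<delta> by (intro ennreal_mult) auto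
     ultimately show ?thesis by (simp only:)
    qed
    also have "\<delta> * V + 1/\<delta> * \<delta>\<^sup>2 = \<delta> * (V + 1)" using \<delta> by (simp add: power2_eq_square distrib_left)
    finally show ?thesis using True by simp
   qed (simp add: I_def)
  qed
 qed
 also have "\<dots> = ennreal (\<delta> * (V + 1)) * ennreal \<epsilon>"
  using \<epsilon> by (subst nn_integral_cmult_indicator) auto
 also have "ennreal (K / \<epsilon> * M) * (ennreal (\<delta> * (V + 1)) * ennreal \<epsilon>) = ennreal (K / \<epsilon> * M * (\<delta> * (V + 1) * \<epsilon>))"
  using KM \<delta> V \<epsilon> by (simp add: ennreal_mult[symmetric])
 also have "K / \<epsilon> * M * (\<delta> * (V + 1) * \<epsilon>) = e"
  using K M V \<epsilon> by (simp add: \<delta>_def)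
 finally have "(NN p. ennreal \<bar>u p * (xcut n p * dd (1, 0) (tcut B \<epsilon>) p * \<Psi> p)\<bar>) \<le> ennreal e"
  by (simp add: mult_left_mono)
 moreover have "b1 \<le> B - 2 * \<epsilon>" using \<epsilon> by (simp add: bb_def)
 ultimately show ?thesis using \<epsilon>(1) by (intro that)
qed

text \<open>The potential \<open>\<Psi>\<close> is not compactly supported, so it is multiplied by a
  cutoff \<open>\<eta>\<close> in space and near the final time. The commutator splits into
  \<open>T1\<close>, with the time derivative of the cutoff, small by the zero trace, and
  \<open>E\<close>, with its space derivatives, of order \<open>1/n\<close> against an integrable
  function.\<close>

lemma pairing:
 fixes u :: "real \<times> (real^'n) \<Rightarrow> real"
 assumes c: "0 < c" "c < B" and W: "weak_jet c B u ut Du Hu" and tr: "has_trace c B u (\<lambda>_. 0)"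
  and fin: "wsq \<alpha> a c B u < top" and X: "wsq \<alpha> a c B (P_op A ut Hu) \<le> ennreal X" "0 \<le> X"
  and G: "G \<in> test_functions (strip c B)"
 shows "\<bar>\<integral>p. Hu p $ i $ j * G p \<partial>lborel\<bar> \<le> sqrt (X * (ca * (dual_const TYPE('n) l L lam \<alpha> * IS c B (\<lambda>p. \<rho> p * (G p)\<^sup>2))))"
proof -
 let ?e = "\<lambda>i. (0 :: real, axis i 1 :: real^'n)"
 define G2 where "G2 = dd (?e i) (dd (?e j) G)"
 obtain c0 b1 where cb: "c < c0" "c0 < b1" "b1 < B" and G': "G \<in> test_functions (strip c0 b1)"
  using test_strip_shrink[OF G c(2)] by blast
 have c0: "0 < c0" "0 \<le> c0" using c cb by auto
 have G2: "G2 \<in> test_functions (strip c0 b1)" unfolding G2_def by (intro test_dd G')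
 have G2': "G2 \<in> test_functions (strip c B)" unfolding G2_def by (intro test_dd G)
 define \<Psi> where "\<Psi> = heat_pot B A G2"
 have s\<Psi>: "smooth \<Psi>" unfolding \<Psi>_def by (rule smooth_heat_pot[OF A G2])
 have dd\<Psi>: "dd e \<Psi> = heat_pot B A (dd e G2)" for e unfolding \<Psi>_def by (rule dd_heat_pot[OF A G2])
 have \<Psi>0: "\<Psi> (t, x) = 0" "dd e \<Psi> (t, x) = 0" if "t \<le> c0" for t x e
  unfolding dd\<Psi> using heat_pot_zero[OF G2 that] heat_pot_zero[OF test_dd[OF G2] that] by (auto simp: \<Psi>_def)
 have dec: "decays c B \<Psi>" "decays c B (dd e \<Psi>)" for e
  unfolding dd\<Psi> unfolding \<Psi>_def
  using decays_heat_pot(1)[OF c(1) G2 c0(2)] decays_heat_pot(1)[OF c(1) test_dd[OF G2] c0(2)] by auto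
 have ho: "heat_op A \<Psi> (t, x) = G2 (t, x)" if "t \<le> B" for t x
  unfolding \<Psi>_def wconv_heat_op[OF A G2]
  by (rule heat_pot_heat_op[OF A G2]) (use c c0 that test_zero_outside[OF G2] in \<open>auto simp: strip_def\<close>)
 have m\<Psi> [measurable]: "\<Psi> \<in> borel_measurable borel" "dd e \<Psi> \<in> borel_measurable borel" for e
  using s\<Psi> by (auto intro: smooth_measurable)
 note lu = weak_jetD(3)[OF W G] and lt = weak_jetD(4)[OF W G] and lH = weak_jetD(5)[OF W G]
 have mu: "(\<lambda>p. indicator (strip c B) p * u p) \<in> borel_measurable borel"
  by (rule locally_integrable_measurable[OF lu])
 have mP: "(\<lambda>p. indicator (strip c B) p * P_op A ut Hu p) \<in> borel_measurable borel"
  by (rule P_op_measurable[OF lt lH])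
 define R0 where "R0 = sqrt (X * (ca * (dual_const TYPE('n) l L lam \<alpha> * IS c B (\<lambda>p. \<rho> p * (G p)\<^sup>2))))"
 have dual: "IS c B (\<lambda>p. \<rho> p * (\<Psi> p)\<^sup>2) \<le> dual_const TYPE('n) l L lam \<alpha> * IS c B (\<lambda>p. \<rho> p * (G p)\<^sup>2)"
  unfolding \<Psi>_def G2_def by (rule dual_estimate[OF c G])
 have ISnn: "0 \<le> IS c B (\<lambda>p. \<rho> p * (\<Psi> p)\<^sup>2)"
  unfolding IS_def by (intro Bochner_Integration.integral_nonneg mult_nonneg_nonneg) (auto simp: \<rho>_def)
 have R: "(NN p. ennreal (indicator {c<..<B} (fst p) * \<bar>P_op A ut Hu p\<bar> * \<bar>\<Psi> p\<bar>)) \<le> ennreal R0"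
 proof -
  have "sqrt (X * (ca * IS c B (\<lambda>p. \<rho> p * (\<Psi> p)\<^sup>2))) \<le> R0"
   unfolding R0_def using dual X(2) ca_pos by (intro real_sqrt_le_mono mult_left_mono) auto
  then show ?thesis using weighted_CS[OF c(1) mP X dec(1) m\<Psi>(1)] ennreal_leI order_trans by blast
 qed
 have R0: "0 \<le> R0" unfolding R0_def using ISnn dual X(2) ca_pos by simp
 obtain M where M: "M > 0" "\<And>t x. t \<in> {c..B} \<Longrightarrow> \<bar>\<Psi> (t, x)\<bar> \<le> M" using decays_bounded[OF dec(1) c(1)] by blast
 obtain C where C: "C > 0" "\<And>k x. \<bar>dd (axis k 1) ball_cutoff (x :: real^'n)\<bar> \<le> C"
  "\<And>k m x. \<bar>dd (axis k 1) (dd (axis m 1) ball_cutoff) (x :: real^'n)\<bar> \<le> C"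
 proof -
  have "\<exists>C. \<forall>k. C k > 0 \<and> (\<forall>x. \<bar>dd (axis k 1) ball_cutoff (x :: real^'n)\<bar> \<le> C k)"
  proof (rule choice, rule allI)
   fix k
   show "\<exists>M. M > 0 \<and> (\<forall>x. \<bar>dd (axis k 1) ball_cutoff (x :: real^'n)\<bar> \<le> M)"
    by (rule test_bounded[OF test_dd[OF ball_cutoff_test, where e="axis k 1"]]) blast
  qed
  then obtain C1 where C1: "\<And>k. C1 k > 0" "\<And>k x. \<bar>dd (axis k 1) ball_cutoff (x :: real^'n)\<bar> \<le> C1 k" by blast
  have "\<exists>C. \<forall>k. C k > 0 \<and> (\<forall>x. \<bar>dd (axis (fst k) 1) (dd (axis (snd k) 1) ball_cutoff) (x :: real^'n)\<bar> \<le> C k)"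
  proof (rule choice, rule allI)
   fix k
   show "\<exists>M. M > 0 \<and> (\<forall>x. \<bar>dd (axis (fst k) 1) (dd (axis (snd k) 1) ball_cutoff) (x :: real^'n)\<bar> \<le> M)"
    by (rule test_bounded[OF test_dd[OF test_dd[OF ball_cutoff_test, where e="axis (snd k) 1"], where e="axis (fst k) 1"]]) blast
  qed
  then obtain C2 where C2: "\<And>k. C2 k > 0" "\<And>k x. \<bar>dd (axis (fst k) 1) (dd (axis (snd k) 1) ball_cutoff) (x :: real^'n)\<bar> \<le> C2 k" by blast
  define C where "C = (\<Sum>k\<in>UNIV. C1 k) + (\<Sum>k\<in>UNIV. C2 k)"
  have s1: "C1 k \<le> (\<Sum>k\<in>UNIV. C1 k)" for k by (rule member_le_sum) (auto simp: less_imp_le C1)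
  have s2: "C2 k \<le> (\<Sum>k\<in>UNIV. C2 k)" for k by (rule member_le_sum) (auto simp: less_imp_le C2)
  show ?thesis
  proof (rule that[of C])
   show "C > 0" using s1[of undefined] s2[of undefined] C1(1)[of undefined] C2(1)[of undefined] unfolding C_def by linarith
   show "\<bar>dd (axis k 1) ball_cutoff x\<bar> \<le> C" for k and x :: "real^'n"
    using C1(2)[of k x] s1[of k] s2[of undefined] C2(1)[of undefined] unfolding C_def by linarith
   show "\<bar>dd (axis k 1) (dd (axis m 1) ball_cutoff) x\<bar> \<le> C" for k m and x :: "real^'n"
    using C2(2)[of "(k, m)" x] s2[of "(k, m)"] s1[of undefined] C1(1)[of undefined] unfolding C_def by simp
  qed
 qed
 \<comment> \<open>\<open>Eb\<close> bounds \<open>E\<close> up to the factor \<open>C / n\<close>,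
   whatever the cutoff parameters. Its integral \<open>Z\<close> against \<open>u\<close> is finite
   because \<open>\<Psi>\<close> and its gradient decay.\<close>
 define Eb where "Eb p = (\<Sum>i\<in>UNIV. \<Sum>j\<in>UNIV. \<bar>A $ i $ j\<bar> * (\<bar>dd (?e j) \<Psi> p\<bar> + \<bar>dd (?e i) \<Psi> p\<bar> + \<bar>\<Psi> p\<bar>))" for p
 define I where "I p = (indicator {c<..<B} (fst p) :: real)" for p :: "real \<times> (real^'n)"
 have Eb0: "0 \<le> Eb p" for p unfolding Eb_def by (intro sum_nonneg mult_nonneg_nonneg add_nonneg_nonneg) auto
 have mI [measurable]: "I \<in> borel_measurable borel" unfolding I_def[abs_def] by measurable
 have mIu [measurable]: "(\<lambda>p. I p * \<bar>u p\<bar>) \<in> borel_measurable borel"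
 proof -
  have "(\<lambda>p. \<bar>indicator (strip c B) p * u p\<bar>) \<in> borel_measurable borel" using mu by (rule borel_measurable_abs)
  then show ?thesis by (simp add: indicator_strip I_def abs_mult)
 qed
 have Zfin: "(NN p. ennreal (I p * \<bar>u p\<bar> * Eb p)) < top"
 proof -
  have pf: "(NN p. ennreal (I p * \<bar>u p\<bar> * \<bar>f p\<bar>)) < top" if "decays c B f" "f \<in> borel_measurable borel" for f
   unfolding I_def by (rule pair_finite[OF c(1) mu fin that])
  have fi: "integrable lborel (\<lambda>p. I p * \<bar>u p\<bar> * \<bar>f p\<bar>)" if "decays c B f" "f \<in> borel_measurable borel" for f
  proof (rule integrableI_nonneg)
   have [measurable]: "f \<in> borel_measurable borel" by (rule that)
   show "(\<lambda>p. I p * \<bar>u p\<bar> * \<bar>f p\<bar>) \<in> borel_measurable lborel" by measurable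
   show "(NN p. ennreal (I p * \<bar>u p\<bar> * \<bar>f p\<bar>)) < \<infinity>" using pf[OF that] by simp
  qed (auto simp: I_def)
  have "integrable lborel (\<lambda>p. \<Sum>i\<in>UNIV. \<Sum>j\<in>UNIV. \<bar>A $ i $ j\<bar> * (I p * \<bar>u p\<bar> * \<bar>dd (?e j) \<Psi> p\<bar> + I p * \<bar>u p\<bar> * \<bar>dd (?e i) \<Psi> p\<bar> + I p * \<bar>u p\<bar> * \<bar>\<Psi> p\<bar>))"
   by (intro Bochner_Integration.integrable_sum integrable_mult_right Bochner_Integration.integrable_add fi dec m\<Psi>)
  also have "(\<lambda>p. \<Sum>i\<in>UNIV. \<Sum>j\<in>UNIV. \<bar>A $ i $ j\<bar> * (I p * \<bar>u p\<bar> * \<bar>dd (?e j) \<Psi> p\<bar> + I p * \<bar>u p\<bar> * \<bar>dd (?e i) \<Psi> p\<bar> + I p * \<bar>u p\<bar> * \<bar>\<Psi> p\<bar>)) = (\<lambda>p. I p * \<bar>u p\<bar> * Eb p)"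
   unfolding Eb_def by (simp add: sum_distrib_left algebra_simps)
  finally have "(NN p. ennreal (norm (I p * \<bar>u p\<bar> * Eb p))) < \<infinity>" by (simp only: integrable_iff_bounded)
  moreover have "norm (I p * \<bar>u p\<bar> * Eb p) = I p * \<bar>u p\<bar> * Eb p" for p using Eb0[of p] by (simp add: I_def abs_mult)
  ultimately show ?thesis by simp
 qed
 then obtain Z where Z: "Z \<ge> 0" "(NN p. ennreal (I p * \<bar>u p\<bar> * Eb p)) = ennreal Z"
  by (cases "NN p. ennreal (I p * \<bar>u p\<bar> * Eb p)") auto
 obtain K where K: "compact K" "\<And>p. p \<notin> K \<Longrightarrow> G2 p = 0" using G2 by (auto elim!: test_functionsE)
 obtain r where r: "r > 0" "\<And>p. p \<in> K \<Longrightarrow> norm p \<le> r" using compact_imp_bounded[OF K(1)] unfolding bounded_pos by blast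
 have main: "\<bar>\<integral>p. Hu p $ i $ j * G p \<partial>lborel\<bar> \<le> R0 + 2 * e" if e: "e > 0" for e
 proof -
  \<comment> \<open>\<open>n \<ge> r\<close> puts the support of \<open>G2\<close> where the space
    cutoff is 1, \<open>n \<ge> 1\<close> allows one of the two factors \<open>1/n\<close> in second
    derivatives to be dropped, and the last entry makes \<open>E\<close> contribute at most
    \<open>e\<close>. The time scale \<open>\<epsilon>\<close> is chosen after
    \<open>n\<close>.\<close>
  define n where "n = max 1 (max r (C * Z / e))"
  have n: "n > 0" "n \<ge> 1" "n \<ge> r" "C * Z / n \<le> e"
  proof -
   show "n > 0" "n \<ge> 1" "n \<ge> r" by (auto simp: n_def)
   have "C * Z / e \<le> n" by (simp add: n_def)
   then show "C * Z / n \<le> e" using e \<open>n > 0\<close> by (simp add: field_simps)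
  qed
  have cb1: "c \<le> b1" using cb by simp
  obtain \<epsilon> where \<epsilon>: "\<epsilon> > 0" "b1 \<le> B - 2 * \<epsilon>"
   "(NN p. ennreal \<bar>u p * (xcut n p * dd (1, 0) (tcut B \<epsilon>) p * \<Psi> p)\<bar>) \<le> ennreal e"
   using trace_term_small[where \<Psi>=\<Psi>, OF c cb1 cb(3) mu tr M e n(1)] by blast
  define \<eta> where "\<eta> p = xcut n p * tcut B \<epsilon> p" for p :: "real \<times> (real^'n)"
  define \<phi> where "\<phi> p = \<eta> p * \<Psi> p" for p
  define T1 where "T1 p = xcut n p * dd (1, 0) (tcut B \<epsilon>) p * \<Psi> p" for p
  have s\<eta>: "smooth \<eta>" unfolding \<eta>_def[abs_def] by (intro smooth_mult smooth_xcut smooth_tcut)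
  have s\<phi>: "smooth \<phi>" unfolding \<phi>_def[abs_def] by (intro smooth_mult s\<eta> s\<Psi>)
  have sT1: "smooth T1" unfolding T1_def[abs_def] by (intro smooth_mult smooth_xcut smooth_dd smooth_tcut s\<Psi>)
  let ?K = "{c0..B - \<epsilon>} \<times> cball (0 :: real^'n) (2 * n)"
  have K1: "compact ?K" "?K \<subseteq> strip c B" using cb \<epsilon>(1) by (auto intro: compact_Times simp: strip_def)
  have out: "t < c0 \<or> B - \<epsilon> < t \<or> norm x > 2 * n" if "(t, x) \<notin> ?K" for t and x :: "real^'n" using that by auto
  have dtz: "dd (1, 0) (tcut B \<epsilon>) (t, x) = 0" if "B - \<epsilon> < t" for t and x :: "real^'n"
  proof -
   have "((tcut B \<epsilon> :: real \<times> (real^'n) \<Rightarrow> real) has_derivative (\<lambda>_. 0)) (at (t, x))"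
    by (rule has_derivative_transform_within_open[of "\<lambda>_. 0" _ _ _ "{B - \<epsilon><..} \<times> UNIV"])
     (use that \<epsilon>(1) in \<open>auto intro!: open_Times simp: tcut_zero\<close>)
   then show ?thesis by (rule dd_eqI)
  qed
  have t\<phi>: "\<phi> \<in> test_functions (strip c B)"
  proof (rule test_functionsI[OF s\<phi> K1])
   fix p assume "p \<notin> ?K"
   then show "\<phi> p = 0" using out[of "fst p" "snd p"] \<Psi>0(1)[of "fst p" "snd p"] tcut_zero[OF \<epsilon>(1), of B p] xcut_zero[OF n(1), of p]
    by (auto simp: \<phi>_def \<eta>_def)
  qed
  have tT1: "T1 \<in> test_functions (strip c B)"
  proof (rule test_functionsI[OF sT1 K1])
   fix p assume "p \<notin> ?K"
   then show "T1 p = 0" using out[of "fst p" "snd p"] \<Psi>0(1)[of "fst p" "snd p"] dtz[of "fst p" "snd p"] xcut_zero[OF n(1), of p]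
    by (auto simp: T1_def)
  qed
  have \<eta>_t: "dd (1, 0) \<eta> p = xcut n p * dd (1, 0) (tcut B \<epsilon>) p" for p
  proof -
   have "dd (0 :: real^'n) ball_cutoff x = 0" for x
    using linear_0[OF smooth_linear_dd[OF test_smooth[OF ball_cutoff_test]]] .
   then have "dd (1, 0 :: real^'n) (xcut n) p = 0" by (simp add: dd_xcut)
   then show ?thesis unfolding \<eta>_def[abs_def] dd_mult[OF smooth_xcut smooth_tcut] by simp
  qed
  have tcut_x: "dd (0, w) (tcut B \<epsilon>) = (\<lambda>_. 0)" for w :: "real^'n" by (simp add: dd_tcut)
  have \<eta>_x: "dd (?e k) \<eta> = (\<lambda>p. dd (?e k) (xcut n) p * tcut B \<epsilon> p)" for k
   unfolding \<eta>_def[abs_def] dd_mult[OF smooth_xcut smooth_tcut] tcut_x by simp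
  have \<eta>_xx: "dd (?e k) (dd (?e m) \<eta>) p = dd (?e k) (dd (?e m) (xcut n)) p * tcut B \<epsilon> p" for k m p
   unfolding \<eta>_x dd_mult[OF smooth_dd[OF smooth_xcut] smooth_tcut] tcut_x by simp
  define E where "E p = (\<Sum>i\<in>UNIV. \<Sum>j\<in>UNIV. A $ i $ j * (dd (?e i) \<eta> p * dd (?e j) \<Psi> p
   + dd (?e j) \<eta> p * dd (?e i) \<Psi> p + dd (?e i) (dd (?e j) \<eta>) p * \<Psi> p))" for p
  have key: "heat_op A \<phi> p = G2 p + T1 p - E p" for p
  proof -
   \<comment> \<open>The truncated potential is known to solve the equation only up to time
     \<open>B\<close>; after \<open>B\<close> the cutoff is zero, and on the support of
     \<open>G2\<close> it is one.\<close>
   have "\<eta> p * heat_op A \<Psi> p = G2 p"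
   proof (cases "fst p \<le> B")
    case True
    then have h: "heat_op A \<Psi> p = G2 p" using ho[of "fst p" "snd p"] by simp
    show ?thesis
    proof (cases "p \<in> K \<and> fst p < b1")
     case True
     then have "norm (snd p) \<le> r" using r(2)[of p] norm_snd_le[of "snd p" "fst p"] by simp
     then have "xcut n p = 1" using n by (intro xcut_one) auto
     moreover have "tcut B \<epsilon> p = 1" using True \<epsilon> by (intro tcut_one) auto
     ultimately show ?thesis by (simp add: h \<eta>_def)
    next
     case False
     then have "G2 p = 0" using K(2)[of p] test_zero_outside[OF G2, of p] by (cases p) (auto simp: strip_def)
     then show ?thesis by (simp add: h)
    qed
   next
    case False
    then have "\<eta> p = 0" using tcut_zero[OF \<epsilon>(1), of B p] \<epsilon>(1) by (simp add: \<eta>_def)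
    moreover have "G2 p = 0" using False cb test_zero_outside[OF G2, of p] by (cases p) (auto simp: strip_def)
    ultimately show ?thesis by simp
   qed
   then show ?thesis unfolding \<phi>_def[abs_def] heat_op_mult[OF s\<eta> s\<Psi>] \<eta>_t T1_def E_def by simp
  qed
  have tE: "E \<in> test_functions (strip c B)"
  proof -
   have "E = (\<lambda>p. (G2 p + T1 p) + (\<lambda>_. - 1) p * heat_op A \<phi> p)" by (simp add: key fun_eq_iff)
   also have "\<dots> \<in> test_functions (strip c B)"
    by (intro test_add test_mult test_heat_op G2' tT1 t\<phi> smooth_const)
   finally show ?thesis .
  qed
  have int: "integrable lborel (\<lambda>p. u p * f p)" if "f \<in> test_functions (strip c B)" for f
   by (rule integrable_mult_test[OF lu that])
  have "(LB p. Hu p $ i $ j * G p) = (LB p. u p * G2 p)"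
   unfolding G2_def by (rule weak_jetD(2)[OF W G, symmetric])
  also have "\<dots> = (LB p. (u p * heat_op A \<phi> p - u p * T1 p) + u p * E p)"
   by (intro Bochner_Integration.integral_cong) (auto simp: key algebra_simps)
  also have "\<dots> = ((LB p. u p * heat_op A \<phi> p) - (LB p. u p * T1 p)) + (LB p. u p * E p)"
   using int[OF test_heat_op[OF t\<phi>]] int[OF tT1] int[OF tE] by simp
  also have "(LB p. u p * heat_op A \<phi> p) = (LB p. P_op A ut Hu p * \<phi> p)"
   by (rule weak_heat(1)[OF W t\<phi>])
  finally have split: "(LB p. Hu p $ i $ j * G p) = ((LB p. P_op A ut Hu p * \<phi> p) - (LB p. u p * T1 p)) + (LB p. u p * E p)" .
  have b1: "\<bar>\<integral>p. P_op A ut Hu p * \<phi> p \<partial>lborel\<bar> \<le> R0"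
  proof (rule abs_integral_le[OF weak_heat(2)[OF W t\<phi>] _ R0])
   have "(NN p. ennreal \<bar>P_op A ut Hu p * \<phi> p\<bar>) \<le> (NN p. ennreal (indicator {c<..<B} (fst p) * \<bar>P_op A ut Hu p\<bar> * \<bar>\<Psi> p\<bar>))"
   proof (intro nn_integral_mono ennreal_leI)
    fix p :: "real \<times> (real^'n)"
    show "\<bar>P_op A ut Hu p * \<phi> p\<bar> \<le> indicator {c<..<B} (fst p) * \<bar>P_op A ut Hu p\<bar> * \<bar>\<Psi> p\<bar>"
    proof (cases "p \<in> strip c B")
     case True
     have "\<bar>\<eta> p\<bar> \<le> 1" using xcut_bounds[of n p] tcut_bounds[of B \<epsilon> p] by (simp add: \<eta>_def mult_le_one)
     then have "\<bar>P_op A ut Hu p\<bar> * (\<bar>\<eta> p\<bar> * \<bar>\<Psi> p\<bar>) \<le> \<bar>P_op A ut Hu p\<bar> * (1 * \<bar>\<Psi> p\<bar>)"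
      by (intro mult_left_mono mult_right_mono) auto
     then show ?thesis using True by (cases p) (simp add: \<phi>_def abs_mult strip_def)
    next
     case False
     then have "\<phi> p = 0" by (rule test_zero_outside[OF t\<phi>])
     then show ?thesis by (simp add: indicator_def)
    qed
   qed
   then show "(NN p. ennreal \<bar>P_op A ut Hu p * \<phi> p\<bar>) \<le> ennreal R0" using R by (rule order_trans)
  qed
  have b2: "\<bar>\<integral>p. u p * T1 p \<partial>lborel\<bar> \<le> e"
   by (rule abs_integral_le[OF int[OF tT1]]) (use \<epsilon>(3) e in \<open>auto simp: T1_def\<close>)
  have Ebound: "\<bar>E p\<bar> \<le> C / n * Eb p" for p
  proof -
   have x1: "\<bar>dd (?e k) \<eta> p\<bar> \<le> C / n" for k
   proof -
    have "\<bar>dd (?e k) \<eta> p\<bar> = (1/n) * \<bar>dd (axis k 1) ball_cutoff ((1/n) *\<^sub>R snd p)\<bar> * tcut B \<epsilon> p"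
     using n tcut_bounds[of B \<epsilon> p] by (simp add: \<eta>_x dd_xcut abs_mult)
    also have "\<dots> \<le> (1/n) * C * 1"
     using n C tcut_bounds[of B \<epsilon> p] by (intro mult_mono) auto
    finally show ?thesis by simp
   qed
   have x2: "\<bar>dd (?e k) (dd (?e m) \<eta>) p\<bar> \<le> C / n" for k m
   proof -
    have "\<bar>dd (?e k) (dd (?e m) \<eta>) p\<bar> = (1/n) * ((1/n) * \<bar>dd (axis k 1) (dd (axis m 1) ball_cutoff) ((1/n) *\<^sub>R snd p)\<bar>) * tcut B \<epsilon> p"
     using n tcut_bounds[of B \<epsilon> p] by (simp add: \<eta>_xx dd_dd_xcut abs_mult)
    also have "\<dots> \<le> (1/n) * (1 * C) * 1"
     using n C tcut_bounds[of B \<epsilon> p] by (intro mult_mono) auto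
    finally show ?thesis by simp
   qed
   have "\<bar>E p\<bar> \<le> (\<Sum>i\<in>UNIV. \<Sum>j\<in>UNIV. \<bar>A $ i $ j * (dd (?e i) \<eta> p * dd (?e j) \<Psi> p
     + dd (?e j) \<eta> p * dd (?e i) \<Psi> p + dd (?e i) (dd (?e j) \<eta>) p * \<Psi> p)\<bar>)"
    unfolding E_def by (rule order_trans[OF sum_abs sum_mono[OF sum_abs]])
   also have "\<dots> \<le> (\<Sum>i\<in>UNIV. \<Sum>j\<in>UNIV. C / n * (\<bar>A $ i $ j\<bar> * (\<bar>dd (?e j) \<Psi> p\<bar> + \<bar>dd (?e i) \<Psi> p\<bar> + \<bar>\<Psi> p\<bar>)))"
   proof (intro sum_mono)
    fix i j :: 'n
    have "\<bar>dd (?e i) \<eta> p * dd (?e j) \<Psi> p + dd (?e j) \<eta> p * dd (?e i) \<Psi> p + dd (?e i) (dd (?e j) \<eta>) p * \<Psi> p\<bar>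
     \<le> \<bar>dd (?e i) \<eta> p\<bar> * \<bar>dd (?e j) \<Psi> p\<bar> + \<bar>dd (?e j) \<eta> p\<bar> * \<bar>dd (?e i) \<Psi> p\<bar> + \<bar>dd (?e i) (dd (?e j) \<eta>) p\<bar> * \<bar>\<Psi> p\<bar>"
     unfolding abs_mult[symmetric] by linarith
    also have "\<dots> \<le> C / n * \<bar>dd (?e j) \<Psi> p\<bar> + C / n * \<bar>dd (?e i) \<Psi> p\<bar> + C / n * \<bar>\<Psi> p\<bar>"
     by (intro add_mono mult_right_mono x1 x2) auto
    finally have "\<bar>A $ i $ j\<bar> * \<bar>dd (?e i) \<eta> p * dd (?e j) \<Psi> p + dd (?e j) \<eta> p * dd (?e i) \<Psi> p + dd (?e i) (dd (?e j) \<eta>) p * \<Psi> p\<bar>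
     \<le> \<bar>A $ i $ j\<bar> * (C / n * \<bar>dd (?e j) \<Psi> p\<bar> + C / n * \<bar>dd (?e i) \<Psi> p\<bar> + C / n * \<bar>\<Psi> p\<bar>)"
     by (rule mult_left_mono) simp
    then show "\<bar>A $ i $ j * (dd (?e i) \<eta> p * dd (?e j) \<Psi> p + dd (?e j) \<eta> p * dd (?e i) \<Psi> p + dd (?e i) (dd (?e j) \<eta>) p * \<Psi> p)\<bar>
     \<le> C / n * (\<bar>A $ i $ j\<bar> * (\<bar>dd (?e j) \<Psi> p\<bar> + \<bar>dd (?e i) \<Psi> p\<bar> + \<bar>\<Psi> p\<bar>))"
     by (subst abs_mult) (simp only: distrib_left mult.left_commute[of _ "C / n"])
   qed
   also have "\<dots> = C / n * Eb p" by (simp only: Eb_def sum_distrib_left)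
   finally show ?thesis .
  qed
  have b3: "\<bar>\<integral>p. u p * E p \<partial>lborel\<bar> \<le> e"
  proof (rule abs_integral_le[OF int[OF tE]])
   have Cn: "C / n \<ge> 0" using C n by simp
   have "(NN p. ennreal \<bar>u p * E p\<bar>) \<le> (NN p. ennreal (C / n) * ennreal (I p * \<bar>u p\<bar> * Eb p))"
   proof (rule nn_integral_mono)
    fix p :: "real \<times> (real^'n)"
    have "\<bar>u p * E p\<bar> \<le> C / n * (I p * \<bar>u p\<bar> * Eb p)"
    proof (cases "p \<in> strip c B")
     case True
     have "\<bar>u p\<bar> * \<bar>E p\<bar> \<le> \<bar>u p\<bar> * (C / n * Eb p)" by (intro mult_left_mono Ebound) simp
     moreover have "I p = 1" using True by (cases p) (simp add: I_def strip_def)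
     ultimately show ?thesis by (simp add: abs_mult mult_ac)
    next
     case False
     then have "E p = 0" by (rule test_zero_outside[OF tE])
     moreover have "0 \<le> C / n * (I p * \<bar>u p\<bar> * Eb p)" using Eb0[of p] by (intro mult_nonneg_nonneg Cn) (auto simp: I_def)
     ultimately show ?thesis by simp
    qed
    then have "ennreal \<bar>u p * E p\<bar> \<le> ennreal (C / n * (I p * \<bar>u p\<bar> * Eb p))" by (rule ennreal_leI)
    also have "\<dots> = ennreal (C / n) * ennreal (I p * \<bar>u p\<bar> * Eb p)" using Cn Eb0[of p] by (intro ennreal_mult) (auto simp: I_def)
    finally show "ennreal \<bar>u p * E p\<bar> \<le> ennreal (C / n) * ennreal (I p * \<bar>u p\<bar> * Eb p)" .
   qed
   also have "\<dots> = ennreal (C / n) * (NN p. ennreal (I p * \<bar>u p\<bar> * Eb p))"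
   proof (rule nn_integral_cmult)
    have [measurable]: "Eb \<in> borel_measurable borel" unfolding Eb_def[abs_def] by measurable
    show "(\<lambda>p. ennreal (I p * \<bar>u p\<bar> * Eb p)) \<in> borel_measurable lborel" by measurable
   qed
   also have "\<dots> = ennreal (C / n * Z)" unfolding Z(2) using Cn Z(1) by (intro ennreal_mult[symmetric])
   also have "\<dots> \<le> ennreal e" using n(4) by (intro ennreal_leI) simp
   finally show "(NN p. ennreal \<bar>u p * E p\<bar>) \<le> ennreal e" .
  qed (use e in simp)
  show ?thesis unfolding split using b1 b2 b3 by linarith
 qed
 have "\<bar>\<integral>p. Hu p $ i $ j * G p \<partial>lborel\<bar> \<le> R0"
 proof (rule field_le_epsilon)
  fix e :: real assume "e > 0"
  then show "\<bar>\<integral>p. Hu p $ i $ j * G p \<partial>lborel\<bar> \<le> R0 + e" using main[of "e/2"] by simp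
 qed
 then show ?thesis by (simp add: R0_def)
qed

end

section \<open>From smooth sources to the weighted norm of the Hessian\<close>

definition strip_cutoff :: "real \<Rightarrow> real \<Rightarrow> nat \<Rightarrow> real \<times> (real^'n) \<Rightarrow> real" where
 "strip_cutoff c B n p = xcut (real (Suc n)) p * (tcut B (1 / (2 * real (Suc n))) p * tcut (- c) (1 / (2 * real (Suc n))) (- p))"

lemma strip_cutoff:
 shows strip_cutoff_test: "(strip_cutoff c B n :: real \<times> (real^'n) \<Rightarrow> real) \<in> test_functions (strip c B)"
  and strip_cutoff_bounds: "0 \<le> strip_cutoff c B n p" "strip_cutoff c B n p \<le> 1"
  and strip_cutoff_one: "p \<in> {c + 1 / real (Suc n)..B - 1 / real (Suc n)} \<times> cball 0 (real n) \<Longrightarrow> strip_cutoff c B n p = 1"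
proof -
 \<comment> \<open>Half of the margin of the \<open>n\<close>-th exhausting set: the cutoff is 1 on
   that set and reaches 0 before the ends of the strip.\<close>
 define \<epsilon> where "\<epsilon> = 1 / (2 * real (Suc n))"
 have \<epsilon>: "\<epsilon> > 0" "1 / real (Suc n) = 2 * \<epsilon>" by (simp_all add: \<epsilon>_def field_simps)
 have N: "real (Suc n) > 0" by simp
 \<comment> \<open>Reflection in time turns the cutoff at a final time into one at the initial
   time.\<close>
 have sn: "smooth (\<lambda>p :: real \<times> (real^'n). tcut (- c) \<epsilon> (- p))"
  by (rule smooth_compose_linear[OF smooth_tcut bounded_linear_minus[OF bounded_linear_ident]])
 have s: "smooth (strip_cutoff c B n :: real \<times> (real^'n) \<Rightarrow> real)"
  unfolding strip_cutoff_def[abs_def] \<epsilon>_def[symmetric] by (intro smooth_mult smooth_xcut smooth_tcut sn)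
 let ?K = "{c + \<epsilon>..B - \<epsilon>} \<times> cball (0 :: real^'n) (2 * real (Suc n))"
 show "(strip_cutoff c B n :: real \<times> (real^'n) \<Rightarrow> real) \<in> test_functions (strip c B)"
 proof (rule test_functionsI[OF s])
  show "compact ?K" by (intro compact_Times) auto
  show "?K \<subseteq> strip c B" using \<epsilon> by (auto simp: strip_def)
  show "strip_cutoff c B n p = 0" if "p \<notin> ?K" for p
  proof -
   have "norm (snd p) > 2 * real (Suc n) \<or> fst p \<ge> B - \<epsilon> \<or> fst (- p) \<ge> - c - \<epsilon>"
    using that by (cases p) auto
   then show ?thesis
    unfolding strip_cutoff_def \<epsilon>_def[symmetric] using xcut_zero[OF N, of p] tcut_zero[OF \<epsilon>(1), of B p] tcut_zero[OF \<epsilon>(1), of "- c" "- p"] by auto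
  qed
 qed
 show "0 \<le> strip_cutoff c B n p" "strip_cutoff c B n p \<le> 1"
  by (simp_all add: strip_cutoff_def xcut_bounds tcut_bounds mult_le_one)
 assume p: "p \<in> {c + 1 / real (Suc n)..B - 1 / real (Suc n)} \<times> cball 0 (real n)"
 have pt: "fst p \<le> B - 2 * \<epsilon>" "fst (- p) \<le> - c - 2 * \<epsilon>"
  using p unfolding \<epsilon>(2) by (auto simp: mem_Times_iff)
 have 1: "xcut (real (Suc n)) p = 1" using p by (intro xcut_one) (auto simp: mem_Times_iff)
 have 2: "tcut B \<epsilon> p = 1" by (rule tcut_one[OF \<epsilon>(1) pt(1)])
 have 3: "tcut (- c) \<epsilon> (- p) = 1" by (rule tcut_one[OF \<epsilon>(1) pt(2)])
 show "strip_cutoff c B n p = 1" unfolding strip_cutoff_def \<epsilon>_def[symmetric] 1 2 3 by simp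
qed

text \<open>A measurable function is an almost everywhere limit of continuous ones. These are
  truncated to \<open>[-M, M]\<close>, replaced by polynomials uniformly on the support of
  \<open>\<psi>\<close>, and multiplied by \<open>\<psi>\<close>; this makes them test functions
  with the common majorant \<open>(M + 1) * \<psi>\<close>.\<close>

lemma test_functions_dense:
 fixes g :: "'a::euclidean_space \<Rightarrow> real"
 assumes g: "g \<in> borel_measurable borel" and M: "0 \<le> M" "\<And>x. \<bar>g x\<bar> \<le> M"
  and \<psi>: "\<psi> \<in> test_functions \<Omega>" "\<And>x. 0 \<le> \<psi> x"
 obtains G where "\<And>k. G k \<in> test_functions \<Omega>" "\<And>k x. \<bar>G k x\<bar> \<le> (M + 1) * \<psi> x"
  "AE x in lborel. (\<lambda>k. G k x) \<longlonglongrightarrow> \<psi> x * g x"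
proof -
 have "g measurable_on UNIV"
  by (rule lebesgue_measurable_imp_measurable_on) (use g in \<open>auto intro: measurable_completion\<close>)
 then obtain N h where N: "negligible N" and h: "\<And>k. continuous_on UNIV (h k)" "\<And>x. x \<notin> N \<Longrightarrow> (\<lambda>k. h k x) \<longlonglongrightarrow> g x"
  unfolding measurable_on_def by auto
 obtain K where K: "compact K" "\<And>x. x \<notin> K \<Longrightarrow> \<psi> x = 0" using \<psi>(1) by (auto elim!: test_functionsE)
 define h' where "h' k x = max (- M) (min M (h (k :: nat) x))" for k x
 have h': "continuous_on K (h' k)" "\<bar>h' k x\<bar> \<le> M" for k x
  unfolding h'_def[abs_def] using M(1) by (auto intro!: continuous_intros continuous_on_subset[OF h(1)])
 have "\<exists>P. real_polynomial_function P \<and> (\<forall>x\<in>K. \<bar>h' k x - P x\<bar> < 1 / real (Suc k))" for k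
  using Stone_Weierstrass_real_polynomial_function[OF K(1) h'(1)[of k], of "1 / real (Suc k)"] by (metis of_nat_0_less_iff zero_less_Suc zero_less_divide_1_iff)
 then obtain P where P: "\<And>k. real_polynomial_function (P k)" "\<And>k x. x \<in> K \<Longrightarrow> \<bar>h' k x - P k x\<bar> < 1 / real (Suc k)" by metis
 show ?thesis
 proof (rule that[of "\<lambda>k x. \<psi> x * P k x"])
  show "(\<lambda>x. \<psi> x * P k x) \<in> test_functions \<Omega>" for k
   using test_mult[OF \<psi>(1) smooth_polynomial[OF P(1)[of k]]] by (simp add: mult.commute)
  show "\<bar>\<psi> x * P k x\<bar> \<le> (M + 1) * \<psi> x" for k x
  proof (cases "x \<in> K")
   case True
   have "1 / real (Suc k) \<le> 1" by simp
   then have "\<bar>P k x\<bar> \<le> M + 1" using P(2)[OF True, of k] h'(2)[of k x] by linarith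
   then show ?thesis using \<psi>(2)[of x] by (simp add: abs_mult mult.commute mult_left_mono)
  qed (simp add: K(2))
  have "AE x in lebesgue. x \<notin> N" using N by (simp add: negligible_iff_null_sets AE_not_in)
  then have "AE x in lborel. x \<notin> N" by (simp add: AE_completion_iff)
  then show "AE x in lborel. (\<lambda>k. \<psi> x * P k x) \<longlonglongrightarrow> \<psi> x * g x"
  proof eventually_elim
   case (elim x)
   show ?case
   proof (cases "x \<in> K")
    case True
    have "(\<lambda>k. h' k x) \<longlonglongrightarrow> max (- M) (min M (g x))"
     unfolding h'_def by (intro tendsto_intros h(2) elim)
    also have "max (- M) (min M (g x)) = g x" using M(2)[of x] by (simp add: abs_le_iff max_def min_def)
    finally have 1: "(\<lambda>k. h' k x) \<longlonglongrightarrow> g x" .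
    have "(\<lambda>k. h' k x - P k x) \<longlonglongrightarrow> 0"
    proof (rule Lim_null_comparison[OF always_eventually LIMSEQ_inverse_real_of_nat])
     show "\<forall>k. norm (h' k x - P k x) \<le> inverse (real (Suc k))"
      using P(2)[OF True] by (auto simp: inverse_eq_divide less_imp_le)
    qed
    from tendsto_diff[OF 1 this] have "(\<lambda>k. P k x) \<longlonglongrightarrow> g x" by simp
    then show ?thesis by (intro tendsto_mult tendsto_const)
   qed (simp add: K(2))
  qed
 qed
qed

context parab
begin

lemma dual_const_nonneg: "0 \<le> dual_const TYPE('n) l L lam \<alpha>"
proof -
 have "0 \<le> C1" "0 \<le> C2" by (rule C12)+
 then have "0 \<le> schur_const TYPE('n) l L lam" by (intro order_trans[OF _ CS_le]) auto
 then show ?thesis using l lam by (simp add: dual_const_def Let_def)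
qed

lemma integrable_\<rho>_test:
 assumes c: "0 < c" and G: "G \<in> test_functions (strip c B)"
 shows "integrable lborel (\<lambda>p. indicator {c..B} (fst p) * (\<rho> p * (G p)\<^sup>2))"
proof -
 have dec: "decays c B G" by (rule decays_heat_pot(2)[OF c G]) (use c in simp)
 have [measurable]: "G \<in> borel_measurable borel" using test_smooth[OF G] by (rule smooth_measurable)
 have "integrable lborel (\<lambda>p. indicator {c..B} (fst p) * (Wt (d/2 - \<alpha>) p * (G p * G p)))"
  by (rule bnd_integrable[OF c]) (intro bnd_product1 c dec, measurable)
 then show ?thesis by (simp add: \<rho>_Wt power2_eq_square)
qed

text \<open>Both sides of the pairing estimate are continuous under dominated almost everywhere
  convergence of the source, so it extends from test functions. As \<open>g\<close> lives where the
  cutoff equals 1, the limit \<open>?\<psi> * g\<close> is \<open>g\<close> itself.\<close>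

lemma pairing_measurable:
 fixes u :: "real \<times> (real^'n) \<Rightarrow> real"
 assumes c: "0 < c" "c < B" and W: "weak_jet c B u ut Du Hu" and tr: "has_trace c B u (\<lambda>_. 0)"
  and fin: "wsq \<alpha> a c B u < top" and X: "wsq \<alpha> a c B (P_op A ut Hu) \<le> ennreal X" "0 \<le> X"
  and g [measurable]: "g \<in> borel_measurable borel" and M: "0 \<le> M" "\<And>p. \<bar>g p\<bar> \<le> M"
  and supp: "\<And>p. strip_cutoff c B n p \<noteq> 1 \<Longrightarrow> g p = 0"
 shows "integrable lborel (\<lambda>p. Hu p $ i $ j * g p)"
  and "\<bar>\<integral>p. Hu p $ i $ j * g p \<partial>lborel\<bar> \<le> sqrt (X * (ca * (dual_const TYPE('n) l L lam \<alpha> * IS c B (\<lambda>p. \<rho> p * (g p)\<^sup>2))))"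
proof -
 let ?\<psi> = "strip_cutoff c B n :: real \<times> (real^'n) \<Rightarrow> real"
 note \<psi> = strip_cutoff_test[of c B n, where 'n='n]
 obtain G where G: "\<And>k. G k \<in> test_functions (strip c B)" "\<And>k p. \<bar>G k p\<bar> \<le> (M + 1) * ?\<psi> p"
  "AE p in lborel. (\<lambda>k. G k p) \<longlonglongrightarrow> ?\<psi> p * g p"
  using test_functions_dense[OF g M \<psi> strip_cutoff_bounds(1)] by blast
 have \<psi>g: "?\<psi> p * g p = g p" for p using supp[of p] by (cases "?\<psi> p = 1") auto
 note lH = weak_jetD(5)[OF W \<psi>, of i j]
 have int: "integrable lborel (\<lambda>p. Hu p $ i $ j * G k p)" for k by (rule integrable_mult_test[OF lH G(1)])
 have dom: "integrable lborel (\<lambda>p. (M + 1) * \<bar>Hu p $ i $ j * ?\<psi> p\<bar>)"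
  using integrable_mult_test[OF lH \<psi>] by (intro integrable_mult_right) simp
 have "(\<lambda>p. indicator (strip c B) p * Hu p $ i $ j) \<in> borel_measurable borel" by (rule locally_integrable_measurable[OF lH])
 then have "(\<lambda>p. (indicator (strip c B) p * Hu p $ i $ j) * g p) \<in> borel_measurable borel" by measurable
 also have "(\<lambda>p. (indicator (strip c B) p * Hu p $ i $ j) * g p) = (\<lambda>p. Hu p $ i $ j * g p)"
 proof
  fix p
  show "(indicator (strip c B) p * Hu p $ i $ j) * g p = Hu p $ i $ j * g p"
   using test_zero_outside[OF \<psi>, of p] supp[of p] by (cases "p \<in> strip c B") auto
 qed
 finally have m: "(\<lambda>p. Hu p $ i $ j * g p) \<in> borel_measurable lborel" by simp
 have lim: "AE p in lborel. (\<lambda>k. Hu p $ i $ j * G k p) \<longlonglongrightarrow> Hu p $ i $ j * g p"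
  using G(3) by eventually_elim (auto intro!: tendsto_mult simp: \<psi>g)
 have b: "norm (Hu p $ i $ j * G k p) \<le> (M + 1) * \<bar>Hu p $ i $ j * ?\<psi> p\<bar>" for k p
  using mult_left_mono[OF G(2)[of k p] abs_ge_zero[of "Hu p $ i $ j"]] strip_cutoff_bounds(1)[of c B n p]
  by (simp add: abs_mult mult_ac)
 have mk: "(\<lambda>p. Hu p $ i $ j * G k p) \<in> borel_measurable lborel" for k using int[of k] by simp
 show "integrable lborel (\<lambda>p. Hu p $ i $ j * g p)"
  by (rule integrable_dominated_convergence[OF m mk dom lim AE_I2[OF b]])
 have L1: "(\<lambda>k. LB p. Hu p $ i $ j * G k p) \<longlonglongrightarrow> (LB p. Hu p $ i $ j * g p)"
  by (rule integral_dominated_convergence[OF m mk dom lim AE_I2[OF b]])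
 have L2: "(\<lambda>k. IS c B (\<lambda>p. \<rho> p * (G k p)\<^sup>2)) \<longlonglongrightarrow> IS c B (\<lambda>p. \<rho> p * (g p)\<^sup>2)"
  unfolding IS_def
 proof (rule integral_dominated_convergence)
  have [measurable]: "G k \<in> borel_measurable borel" for k using test_smooth[OF G(1)] by (rule smooth_measurable)
  show "(\<lambda>p. indicator {c..B} (fst p) * (\<rho> p * (g p)\<^sup>2)) \<in> borel_measurable lborel"
   "(\<lambda>p. indicator {c..B} (fst p) * (\<rho> p * (G k p)\<^sup>2)) \<in> borel_measurable lborel" for k by measurable
  show "integrable lborel (\<lambda>p. (M + 1)\<^sup>2 * (indicator {c..B} (fst p) * (\<rho> p * (?\<psi> p)\<^sup>2)))"
   by (intro integrable_mult_right integrable_\<rho>_test c \<psi>)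
  show "AE p in lborel. (\<lambda>k. indicator {c..B} (fst p) * (\<rho> p * (G k p)\<^sup>2)) \<longlonglongrightarrow> indicator {c..B} (fst p) * (\<rho> p * (g p)\<^sup>2)"
   using G(3) by eventually_elim (auto intro!: tendsto_intros simp: \<psi>g)
  show "AE p in lborel. norm (indicator {c..B} (fst p) * (\<rho> p * (G k p)\<^sup>2)) \<le> (M + 1)\<^sup>2 * (indicator {c..B} (fst p) * (\<rho> p * (?\<psi> p)\<^sup>2))" for k
  proof (rule AE_I2)
   fix p
   have \<rho>0: "0 \<le> \<rho> p" by (simp add: \<rho>_def)
   have "(G k p)\<^sup>2 \<le> ((M + 1) * ?\<psi> p)\<^sup>2" using G(2)[of k p] by (rule abs_le_square_iff[THEN iffD1, OF order_trans]) simp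
   then have "indicator {c..B} (fst p) * (\<rho> p * (G k p)\<^sup>2) \<le> indicator {c..B} (fst p) * (\<rho> p * ((M + 1) * ?\<psi> p)\<^sup>2)"
    using \<rho>0 by (intro mult_left_mono) auto
   then show "norm (indicator {c..B} (fst p) * (\<rho> p * (G k p)\<^sup>2)) \<le> (M + 1)\<^sup>2 * (indicator {c..B} (fst p) * (\<rho> p * (?\<psi> p)\<^sup>2))"
    using \<rho>0 by (simp add: power_mult_distrib mult_ac)
  qed
 qed
 show "\<bar>\<integral>p. Hu p $ i $ j * g p \<partial>lborel\<bar> \<le> sqrt (X * (ca * (dual_const TYPE('n) l L lam \<alpha> * IS c B (\<lambda>p. \<rho> p * (g p)\<^sup>2))))"
 proof (rule LIMSEQ_le)
  show "(\<lambda>k. \<bar>\<integral>p. Hu p $ i $ j * G k p \<partial>lborel\<bar>) \<longlonglongrightarrow> \<bar>\<integral>p. Hu p $ i $ j * g p \<partial>lborel\<bar>" by (intro tendsto_rabs L1)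
  show "(\<lambda>k. sqrt (X * (ca * (dual_const TYPE('n) l L lam \<alpha> * IS c B (\<lambda>p. \<rho> p * (G k p)\<^sup>2)))))
   \<longlonglongrightarrow> sqrt (X * (ca * (dual_const TYPE('n) l L lam \<alpha> * IS c B (\<lambda>p. \<rho> p * (g p)\<^sup>2))))"
   by (intro tendsto_intros L2)
  show "\<exists>N. \<forall>k\<ge>N. \<bar>\<integral>p. Hu p $ i $ j * G k p \<partial>lborel\<bar> \<le> sqrt (X * (ca * (dual_const TYPE('n) l L lam \<alpha> * IS c B (\<lambda>p. \<rho> p * (G k p)\<^sup>2))))"
   using pairing[OF c W tr fin X G(1)] by blast
 qed
qed

text \<open>The extremal choice in duality: \<open>g\<close> is the weight times the Hessian entry,
  truncated in size and support to be admissible. If \<open>Y\<close> is the truncated squared norm,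
  the pairing reads \<open>Y \<le> sqrt (?D * X * Y)\<close>; truncation makes \<open>Y\<close>
  finite, so \<open>Y \<le> ?D * X\<close>, and Fatou's lemma removes the truncation.\<close>

lemma hessian_entry_bound:
 fixes u :: "real \<times> (real^'n) \<Rightarrow> real"
 assumes c: "0 < c" "c < B" and W: "weak_jet c B u ut Du Hu" and tr: "has_trace c B u (\<lambda>_. 0)"
  and fin: "wsq \<alpha> a c B u < top" and X: "wsq \<alpha> a c B (P_op A ut Hu) \<le> ennreal X" "0 \<le> X"
 shows "wsq \<alpha> a c B (\<lambda>p. Hu p $ i $ j) \<le> ennreal (dual_const TYPE('n) l L lam \<alpha> * X)"
proof -
 let ?D = "dual_const TYPE('n) l L lam \<alpha>"
 define h where "h p = indicator (strip c B) p * Hu p $ i $ j" for p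
 have h [measurable]: "h \<in> borel_measurable borel"
  unfolding h_def[abs_def] by (rule locally_integrable_measurable[OF weak_jetD(5)[OF W strip_cutoff_test[of c B 0]]])
 define w where "w p = indicator {c<..<B} (fst p) * wgt \<alpha> a p" for p
 have w [measurable]: "w \<in> borel_measurable borel" unfolding w_def[abs_def] by (rule wgt_measurable[OF a]) (use c in simp)
 have w0: "0 \<le> w p" for p using wgt_nonneg[of p] c by (cases "fst p \<in> {c<..<B}") (auto simp: w_def)
 let ?K = "\<lambda>n. {c + 1 / real (Suc n)..B - 1 / real (Suc n)} \<times> cball (0 :: real^'n) (real n)"
 have Kb [measurable]: "?K n \<in> sets borel" for n using strip_exhaustion_sub(1)[of c n B] by (rule borel_compact)
 define S where "S n p = (indicator (?K n) p * (if \<bar>w p * h p\<bar> \<le> real n then 1 else 0) :: real)" for n p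
 have S [measurable]: "S n \<in> borel_measurable borel" for n unfolding S_def[abs_def] by measurable
 have S01: "S n p = 0 \<or> S n p = 1 \<and> p \<in> strip c B \<and> strip_cutoff c B n p = 1 \<and> \<bar>w p * h p\<bar> \<le> real n" for n p
  using strip_exhaustion_sub(2)[of c n B] strip_cutoff_one[of p c n B] by (cases "p \<in> ?K n") (auto simp: S_def)
 have b: "(NN p. ennreal (S n p * (w p * (h p)\<^sup>2))) \<le> ennreal (?D * X)" for n
 proof -
  define g where "g p = S n p * (w p * h p)" for p
  have [measurable]: "g \<in> borel_measurable borel" unfolding g_def[abs_def] by measurable
  have g: "\<bar>g p\<bar> \<le> real n" "strip_cutoff c B n p \<noteq> 1 \<Longrightarrow> g p = 0" for p
   using S01[of n p] by (auto simp: g_def)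
  note pm = pairing_measurable[where g=g and M="real n" and n=n and i=i and j=j, OF c W tr fin X _ of_nat_0_le_iff g]
  have Hg: "Hu p $ i $ j * g p = S n p * (w p * (h p)\<^sup>2)" for p
   using S01[of n p] by (auto simp: g_def h_def power2_eq_square)
  define Y where "Y = (LB p. S n p * (w p * (h p)\<^sup>2))"
  have nn: "0 \<le> S n p * (w p * (h p)\<^sup>2)" for p using S01[of n p] w0[of p] by auto
  have Y0: "0 \<le> Y" unfolding Y_def by (rule Bochner_Integration.integral_nonneg) (rule nn)
  have i: "integrable lborel (\<lambda>p. S n p * (w p * (h p)\<^sup>2))" using pm(1) by (simp add: Hg)
  \<comment> \<open>Because the weights are reciprocal, the dual norm of this \<open>g\<close> is
    the truncated primal norm of the Hessian entry.\<close>
  have IY: "ca * IS c B (\<lambda>p. \<rho> p * (g p)\<^sup>2) = Y"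
  proof -
   have "ca * (indicator {c..B} (fst p) * (\<rho> p * (g p)\<^sup>2)) = S n p * (w p * (h p)\<^sup>2)" for p
   proof (cases "S n p = 0")
    case False
    then have s: "S n p = 1" "p \<in> strip c B" using S01[of n p] by auto
    then have f: "c < fst p" "fst p < B" by (auto simp: strip_def)
    have "w p * (ca * \<rho> p) = 1" using wgt_\<rho>[of p] f c by (simp add: w_def)
    then have "(w p * (ca * \<rho> p)) * (w p * (h p)\<^sup>2) = w p * (h p)\<^sup>2" by simp
    then show ?thesis using f s by (simp add: g_def power2_eq_square mult_ac)
   qed (simp add: g_def)
   then show ?thesis unfolding IS_def Y_def by (simp flip: integral_mult_right_zero)
  qed
  have "\<bar>Y\<bar> \<le> sqrt (X * (ca * (?D * IS c B (\<lambda>p. \<rho> p * (g p)\<^sup>2))))"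
   using pm(2) by (simp add: Hg Y_def)
  also have "X * (ca * (?D * IS c B (\<lambda>p. \<rho> p * (g p)\<^sup>2))) = (?D * X) * Y"
   unfolding IY[symmetric] by (simp only: mult_ac)
  finally have "Y \<le> sqrt ((?D * X) * Y)" by simp
  moreover have "Y \<le> z" if "Y \<le> sqrt (z * Y)" "0 \<le> z" for z
  proof (cases "Y = 0")
   case False
   then have "sqrt (z * Y) > 0" using that Y0 by linarith
   then have "z * Y > 0" by simp
   moreover have "Y\<^sup>2 \<le> (sqrt (z * Y))\<^sup>2" using that Y0 by (intro power_mono)
   ultimately have "Y * Y \<le> z * Y" by (simp add: power2_eq_square)
   then show ?thesis using False Y0 by simp
  qed (use that in simp)
  ultimately have "Y \<le> ?D * X" using X(2) dual_const_nonneg by simp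
  then show ?thesis using nn_integral_eq_integral[OF i AE_I2[OF nn]] by (simp add: Y_def ennreal_leI)
 qed
 have "wsq \<alpha> a c B (\<lambda>p. Hu p $ i $ j) \<le> (NN p. liminf (\<lambda>n. ennreal (S n p * (w p * (h p)\<^sup>2))))"
  unfolding wsq_def
 proof (rule nn_integral_mono)
  fix p :: "real \<times> (real^'n)"
  show "ennreal (indicator {c<..<B} (fst p) * wgt \<alpha> a p * (norm (Hu p $ i $ j))\<^sup>2) \<le> liminf (\<lambda>n. ennreal (S n p * (w p * (h p)\<^sup>2)))"
  proof (cases "p \<in> strip c B")
   case True
   obtain N where N: "\<bar>w p * h p\<bar> \<le> real N" using real_arch_simple by blast
   have "\<forall>\<^sub>F n in sequentially. S n p = 1"
    using strip_exhaustion[OF True] eventually_ge_at_top[of N]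
   proof eventually_elim
    case (elim n)
    then have "real N \<le> real n" by simp
    then show ?case using elim(1) N unfolding S_def by (simp del: of_nat_le_iff)
   qed
   then have "\<forall>\<^sub>F n in sequentially. ennreal (S n p * (w p * (h p)\<^sup>2)) = ennreal (w p * (h p)\<^sup>2)"
    by eventually_elim simp
   then have "liminf (\<lambda>n. ennreal (S n p * (w p * (h p)\<^sup>2))) = ennreal (w p * (h p)\<^sup>2)"
    by (intro lim_imp_Liminf trivial_limit_sequentially tendsto_eventually)
   then show ?thesis using True by (simp add: w_def h_def)
  next
   case False
   then have "indicator {c<..<B} (fst p) = (0 :: real)" by (simp flip: indicator_strip)
   then show ?thesis by simp
  qed
 qed
 also have "\<dots> \<le> liminf (\<lambda>n. NN p. ennreal (S n p * (w p * (h p)\<^sup>2)))"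
  by (rule nn_integral_liminf) measurable
 also have "\<dots> \<le> ennreal (?D * X)"
  by (rule order_trans[OF Liminf_mono[where g="\<lambda>_. ennreal (?D * X)"]])
   (auto simp: Liminf_const intro!: always_eventually b)
 finally show ?thesis .
qed

end

section \<open>The upper bound\<close>

lemma ennreal_sqrt_ennreal: "0 \<le> x \<Longrightarrow> ennreal_sqrt (ennreal x) = ennreal (sqrt x)"
 by (simp add: ennreal_sqrt_def)

lemma ennreal_sqrt_mono: "x \<le> y \<Longrightarrow> ennreal_sqrt x \<le> ennreal_sqrt y"
 by (cases x; cases y) (auto simp: ennreal_sqrt_def top_unique intro!: ennreal_leI)

lemma ennreal_sqrt_cmult: "0 < c \<Longrightarrow> ennreal_sqrt (ennreal c * y) = ennreal (sqrt c) * ennreal_sqrt y"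
 by (cases y) (auto simp: ennreal_sqrt_ennreal real_sqrt_mult ennreal_mult_top ennreal_sqrt_def simp flip: ennreal_mult)

lemma ennreal_sqrt_less_top: "ennreal_sqrt y < top \<longleftrightarrow> y < top"
 by (cases y) (auto simp: ennreal_sqrt_def)

text \<open>Over an infinite denominator the quotient is 0. Over a zero denominator the premise
  forces \<open>x = 0\<close>, and \<open>0 / 0 = 0\<close> in the convention used.\<close>

lemma ennreal_divide_leI:
 fixes x y k :: ennreal
 assumes "y < top \<Longrightarrow> x \<le> k * y"
 shows "x / y \<le> k"
proof (cases "y = 0 \<or> y = top")
 case True
 then show ?thesis using assms by (auto simp: divide_ennreal_def)
next
 case False
 then show ?thesis using assms by (intro divide_le_posI_ennreal) (auto simp: less_top zero_less_iff_neq_zero mult.commute)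
qed

text \<open>A finite bound \<open>k\<close> excludes a positive numerator over zero, where the
  quotient would be infinite.\<close>

lemma ennreal_le_of_divide_le:
 fixes x y k :: ennreal
 assumes "x / y \<le> k" "y < top" "k < top"
 shows "x \<le> k * y"
proof (cases "y = 0")
 case True
 then have "x = 0" using assms by (cases "x = 0") (auto simp: divide_ennreal_def ennreal_mult_top top_unique)
 then show ?thesis by simp
next
 case False
 have "x = x / y * y" using False assms(2)
  by (cases x; cases y) (auto simp: divide_ennreal ennreal_top_divide ennreal_top_mult simp flip: ennreal_mult)
 also have "\<dots> \<le> k * y" using assms(1) by (rule mult_right_mono) simp
 finally show ?thesis .
qed

lemma borel_measurable_matrix:
 fixes f :: "'b \<Rightarrow> real^'n^'m"
 assumes "\<And>i j. (\<lambda>p. f p $ i $ j) \<in> borel_measurable M"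
 shows "f \<in> borel_measurable M"
 unfolding borel_measurable_euclidean_space[of f]
proof
 fix b :: "real^'n^'m" assume "b \<in> Basis"
 then obtain i j where "b = axis i (axis j 1)" by (auto simp: Basis_vec_def)
 then show "(\<lambda>p. f p \<bullet> b) \<in> borel_measurable M" using assms[of i j] by (simp add: inner_axis)
qed

lemma H_op_measurable:
 assumes "\<And>i j. locally_integrable (strip c B) (\<lambda>p. Hu p $ i $ j)"
 shows "(\<lambda>p. indicator (strip c B) p *\<^sub>R H_op q Hu p) \<in> borel_measurable borel"
proof (rule borel_measurable_matrix)
 fix i j
 have "(\<lambda>p. \<Sum>k\<in>UNIV. (\<Sum>m\<in>UNIV. sqrt_mat q $ i $ m * (indicator (strip c B) p * Hu p $ m $ k)) * sqrt_mat q $ k $ j) \<in> borel_measurable borel"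
  by (intro borel_measurable_sum borel_measurable_times borel_measurable_const locally_integrable_measurable assms)
 then show "(\<lambda>p. (indicator (strip c B) p *\<^sub>R H_op q Hu p) $ i $ j) \<in> borel_measurable borel"
  by (simp add: H_op_def matrix_matrix_mult_def sum_distrib_left sum_distrib_right mult_ac)
qed

lemma norm_H_op_le:
 fixes L :: real
 assumes "posdef q" "elliptic l L (q :: real^'n^'n)"
 shows "(norm (H_op q Hu p))\<^sup>2 \<le> (CARD('n) * L)\<^sup>2 * (\<Sum>i\<in>UNIV. \<Sum>j\<in>UNIV. (Hu p $ i $ j)\<^sup>2)"
proof -
 let ?r = "sqrt_mat q"
 have r: "(norm ?r)\<^sup>2 \<le> CARD('n) * L" by (rule norm_sqrt_mat[OF assms])
 have "norm (H_op q Hu p) \<le> norm (?r ** Hu p) * norm ?r" unfolding H_op_def by (rule norm_matrix_mult_le)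
 also have "\<dots> \<le> norm ?r * norm (Hu p) * norm ?r" by (intro mult_right_mono norm_matrix_mult_le) simp
 finally have "norm (H_op q Hu p) \<le> (norm ?r)\<^sup>2 * norm (Hu p)" by (simp add: power2_eq_square mult_ac)
 also have "\<dots> \<le> CARD('n) * L * norm (Hu p)" by (intro mult_right_mono r) simp
 finally have "(norm (H_op q Hu p))\<^sup>2 \<le> (CARD('n) * L * norm (Hu p))\<^sup>2" by (intro power_mono) auto
 then show ?thesis by (simp add: power_mult_distrib norm_matrix_power2)
qed

lemma W0_spaceD:
 assumes "(u, ut, Du, Hu) \<in> W0_space \<alpha> c B F"
 shows "weak_jet c B u ut Du Hu" "has_trace c B u (\<lambda>_. 0)" "wnorm \<alpha> c B F u < top"
  "locally_integrable (strip c B) u" "locally_integrable (strip c B) ut" "locally_integrable (strip c B) (\<lambda>p. Hu p $ i $ j)"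
 using assms by (auto simp: W0_space_def W_space_def weak_jet_def weak_deriv_def)

lemma P_op_wsq:
 assumes a: "posdef (a :: real^'n^'n)" and c: "0 \<le> c" and u: "(u, ut, Du, Hu) \<in> W0_space \<alpha> c B (\<lambda>t x. gauss (t *\<^sub>R a) x)"
 shows "wnorm \<alpha> c B (\<lambda>t x. gauss (t *\<^sub>R a) x) (P_op A ut Hu) = ennreal_sqrt (wsq \<alpha> a c B (P_op A ut Hu))"
  "wnorm \<alpha> c B (\<lambda>t x. gauss (t *\<^sub>R a) x) (H_op q Hu) = ennreal_sqrt (wsq \<alpha> a c B (H_op q Hu))"
  "wnorm \<alpha> c B (\<lambda>t x. gauss (t *\<^sub>R a) x) u = ennreal_sqrt (wsq \<alpha> a c B u)"
proof -
 note l = W0_spaceD(4-6)[OF u]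
 show "wnorm \<alpha> c B (\<lambda>t x. gauss (t *\<^sub>R a) x) (P_op A ut Hu) = ennreal_sqrt (wsq \<alpha> a c B (P_op A ut Hu))"
  by (rule wnorm_eq_wsq[OF a c]) (simp only: real_scaleR_def, intro P_op_measurable l)
 show "wnorm \<alpha> c B (\<lambda>t x. gauss (t *\<^sub>R a) x) (H_op q Hu) = ennreal_sqrt (wsq \<alpha> a c B (H_op q Hu))"
  by (rule wnorm_eq_wsq[OF a c]) (intro H_op_measurable l)
 show "wnorm \<alpha> c B (\<lambda>t x. gauss (t *\<^sub>R a) x) u = ennreal_sqrt (wsq \<alpha> a c B u)"
  by (rule wnorm_eq_wsq[OF a c]) (simp only: real_scaleR_def, intro locally_integrable_measurable l)
qed

context parab
begin

lemma k_const_bound: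
 assumes c: "0 < c" "c < B" and q: "posdef q" "elliptic l L q"
 shows "k_const \<alpha> c B (\<lambda>t x. gauss (t *\<^sub>R a) x) A q
  \<le> ennreal (sqrt ((CARD('n) * L)\<^sup>2 * ((CARD('n))\<^sup>2 * dual_const TYPE('n) l L lam \<alpha>)))"
proof -
 let ?F = "\<lambda>t x. gauss (t *\<^sub>R a) x"
 let ?D = "dual_const TYPE('n) l L lam \<alpha>"
 \<comment> \<open>The first factor bounds the fourth power of the norm of
   \<open>sqrt_mat q\<close>, which stands on both sides of the Hessian in a squared norm. The
   factor \<open>(CARD('n))^2\<close> counts the Hessian entries, each bounded through
   \<open>?D\<close>.\<close>
 define k where "k = (CARD('n) * L)\<^sup>2 * ((CARD('n))\<^sup>2 * ?D)"
 have k: "0 \<le> k" using dual_const_nonneg by (simp add: k_def)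
 have "wnorm \<alpha> c B ?F (H_op q Hu) / wnorm \<alpha> c B ?F (P_op A ut Hu) \<le> ennreal (sqrt k)"
  if u: "(u, ut, Du, Hu) \<in> W0_space \<alpha> c B ?F" for u ut Du Hu
 proof (rule ennreal_divide_leI)
  have c0: "0 \<le> c" using c by simp
  note W = W0_spaceD[OF u] and n = P_op_wsq[OF a c0 u]
  assume "wnorm \<alpha> c B ?F (P_op A ut Hu) < top"
  then have "wsq \<alpha> a c B (P_op A ut Hu) < top" unfolding n ennreal_sqrt_less_top .
  then obtain X where X: "0 \<le> X" "wsq \<alpha> a c B (P_op A ut Hu) = ennreal X" by (cases "wsq \<alpha> a c B (P_op A ut Hu)") auto
  have fin: "wsq \<alpha> a c B u < top" using W(3) unfolding n ennreal_sqrt_less_top .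
  have e: "wsq \<alpha> a c B (\<lambda>p. Hu p $ i $ j) \<le> ennreal (?D * X)" for i j
   by (rule hessian_entry_bound[OF c W(1,2) fin eq_refl[OF X(2)] X(1)])
  have m [measurable]: "(\<lambda>p. indicator {c<..<B} (fst p) * wgt \<alpha> a p * (Hu p $ i $ j)\<^sup>2) \<in> borel_measurable borel" for i j
  proof -
   have "(\<lambda>p. (indicator {c<..<B} (fst p) * wgt \<alpha> a p) * (indicator (strip c B) p * Hu p $ i $ j)\<^sup>2) \<in> borel_measurable borel"
    by (intro borel_measurable_times borel_measurable_power wgt_measurable a c0 locally_integrable_measurable W(6))
   also have "(\<lambda>p. (indicator {c<..<B} (fst p) * wgt \<alpha> a p) * (indicator (strip c B) p * Hu p $ i $ j)\<^sup>2) = (\<lambda>p. indicator {c<..<B} (fst p) * wgt \<alpha> a p * (Hu p $ i $ j)\<^sup>2)"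
    by (auto simp: strip_def indicator_def)
   finally show ?thesis .
  qed
  have "wsq \<alpha> a c B (H_op q Hu) \<le> (NN p. (\<Sum>i\<in>UNIV. \<Sum>j\<in>UNIV. ennreal ((CARD('n) * L)\<^sup>2) * ennreal (indicator {c<..<B} (fst p) * wgt \<alpha> a p * (Hu p $ i $ j)\<^sup>2)))"
   unfolding wsq_def
  proof (rule nn_integral_mono)
   fix p :: "real \<times> (real^'n)"
   define w where "w = indicator {c<..<B} (fst p) * wgt \<alpha> a p"
   have w: "0 \<le> w" using wgt_nonneg[of p] c by (cases "fst p \<in> {c<..<B}") (auto simp: w_def)
   have "w * (norm (H_op q Hu p))\<^sup>2 \<le> w * ((CARD('n) * L)\<^sup>2 * (\<Sum>i\<in>UNIV. \<Sum>j\<in>UNIV. (Hu p $ i $ j)\<^sup>2))"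
    by (intro mult_left_mono norm_H_op_le[OF q] w)
   also have "\<dots> = (\<Sum>i\<in>UNIV. \<Sum>j\<in>UNIV. (CARD('n) * L)\<^sup>2 * (w * (Hu p $ i $ j)\<^sup>2))"
    by (simp add: sum_distrib_left mult_ac)
   finally have "ennreal (w * (norm (H_op q Hu p))\<^sup>2) \<le> ennreal (\<Sum>i\<in>UNIV. \<Sum>j\<in>UNIV. (CARD('n) * L)\<^sup>2 * (w * (Hu p $ i $ j)\<^sup>2))"
    by (rule ennreal_leI)
   also have "\<dots> = (\<Sum>i\<in>UNIV. \<Sum>j\<in>UNIV. ennreal ((CARD('n) * L)\<^sup>2) * ennreal (w * (Hu p $ i $ j)\<^sup>2))"
    using w by (simp add: sum_nonneg sum_ennreal[symmetric] ennreal_mult del: sum_ennreal)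
   finally show "ennreal (indicator {c<..<B} (fst p) * wgt \<alpha> a p * (norm (H_op q Hu p))\<^sup>2)
    \<le> (\<Sum>i\<in>UNIV. \<Sum>j\<in>UNIV. ennreal ((CARD('n) * L)\<^sup>2) * ennreal (indicator {c<..<B} (fst p) * wgt \<alpha> a p * (Hu p $ i $ j)\<^sup>2))"
    by (simp only: w_def)
  qed
  also have "\<dots> = (\<Sum>i\<in>UNIV. \<Sum>j\<in>UNIV. ennreal ((CARD('n) * L)\<^sup>2) * wsq \<alpha> a c B (\<lambda>p. Hu p $ i $ j))"
   by (simp add: nn_integral_sum nn_integral_cmult wsq_def)
  also have "\<dots> \<le> (\<Sum>i\<in>(UNIV :: 'n set). \<Sum>j\<in>(UNIV :: 'n set). ennreal ((CARD('n) * L)\<^sup>2) * ennreal (?D * X))"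
   by (intro sum_mono mult_left_mono e) simp
  also have "\<dots> = (\<Sum>i\<in>(UNIV :: 'n set). \<Sum>j\<in>(UNIV :: 'n set). ennreal ((CARD('n) * L)\<^sup>2 * (?D * X)))"
   using dual_const_nonneg X(1) by (intro sum.cong refl ennreal_mult[symmetric]) auto
  also have "\<dots> = ennreal (\<Sum>i\<in>(UNIV :: 'n set). \<Sum>j\<in>(UNIV :: 'n set). (CARD('n) * L)\<^sup>2 * (?D * X))"
   using dual_const_nonneg X(1) by (subst sum_ennreal, simp)+ simp
  also have "(\<Sum>i\<in>(UNIV :: 'n set). \<Sum>j\<in>(UNIV :: 'n set). (CARD('n) * L)\<^sup>2 * (?D * X)) = k * X"
   by (simp add: k_def power2_eq_square mult_ac)
  finally have "wsq \<alpha> a c B (H_op q Hu) \<le> ennreal (k * X)" .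
  from ennreal_sqrt_mono[OF this] show "wnorm \<alpha> c B ?F (H_op q Hu) \<le> ennreal (sqrt k) * wnorm \<alpha> c B ?F (P_op A ut Hu)"
   unfolding n X(2) using k X(1) by (simp add: ennreal_sqrt_ennreal real_sqrt_mult flip: ennreal_mult)
 qed
 then show ?thesis unfolding k_const_def k_def[symmetric] by (auto intro!: SUP_least)
qed

lemma P_delta0_bound:
 assumes q: "posdef q" "elliptic l L q"
 shows "P_delta0 \<alpha> a A q \<le> ennreal (sqrt ((CARD('n) * L)\<^sup>2 * ((CARD('n))\<^sup>2 * dual_const TYPE('n) l L lam \<alpha>)))"
 unfolding P_delta0_def by (rule SUP_least) (use k_const_bound[OF _ _ q] in auto)

end

section \<open>Parabolic dilations\<close>

text \<open>The integral of \<open>f\<close> is a supremum over simple functions, which reduces the claim to measurable \<open>f\<close>.\<close>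

lemma nn_integral_dilate_le:
 fixes f :: "'a::euclidean_space \<Rightarrow> ennreal"
 assumes c: "c > 0" and k: "k > 0"
 shows "(NN x. ennreal k * f (c *\<^sub>R x)) \<le> ennreal (k / c ^ DIM('a)) * (NN x. f x)"
proof -
 have "integral\<^sup>S lborel g \<le> ennreal (k / c ^ DIM('a)) * (NN x. f x)"
  if g: "simple_function lborel g" "g \<le> (\<lambda>x. ennreal k * f (c *\<^sub>R x))" for g
 proof -
  have m [measurable]: "g \<in> borel_measurable borel" using borel_measurable_simple_function[OF g(1)] by simp
  have le: "ennreal (1 / k) * g ((1 / c) *\<^sub>R y) \<le> f y" for y
  proof -
   have "ennreal (1 / k) * g ((1 / c) *\<^sub>R y) \<le> ennreal (1 / k) * (ennreal k * f (c *\<^sub>R (1 / c) *\<^sub>R y))"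
    using le_funD[OF g(2), of "(1 / c) *\<^sub>R y"] by (intro mult_left_mono) auto
   also have "\<dots> = f y" using c k by (simp add: mult.assoc[symmetric] ennreal_mult[symmetric])
   finally show ?thesis .
  qed
  have "integral\<^sup>S lborel g = (NN x. g x)" by (rule nn_integral_eq_simple_integral[OF g(1), symmetric])
  also have "(NN x. g x) = ennreal (k / c ^ DIM('a)) * (NN y. ennreal (1 / k) * g ((1 / c) *\<^sub>R y))"
  proof -
   have "(NN y. ennreal (1 / k) * g ((1 / c) *\<^sub>R y)) = ennreal (1 / k) * (NN y. g ((1 / c) *\<^sub>R y))"
    by (rule nn_integral_cmult) measurable
   also have "(NN y. g ((1 / c) *\<^sub>R y)) = ennreal (c ^ DIM('a)) * (NN x. g x)"
    using nn_integral_scale[of "\<lambda>y. g ((1 / c) *\<^sub>R y)" c] c by simp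
   finally show ?thesis using c k by (simp add: mult.assoc[symmetric] ennreal_mult[symmetric])
  qed
  also have "\<dots> \<le> ennreal (k / c ^ DIM('a)) * (NN x. f x)"
   by (intro mult_left_mono nn_integral_mono le) simp
  finally show ?thesis .
 qed
 then show ?thesis unfolding nn_integral_def[of lborel "\<lambda>x. ennreal k * f (c *\<^sub>R x)"] by (auto intro!: SUP_least)
qed

lemma nn_integral_dilate:
 fixes f :: "'a::euclidean_space \<Rightarrow> ennreal"
 assumes c: "c > 0" and k: "k > 0"
 shows "(NN x. ennreal k * f (c *\<^sub>R x)) = ennreal (k / c ^ DIM('a)) * (NN x. f x)"
proof (rule antisym[OF nn_integral_dilate_le[OF c k]])
 have "(NN x. f x) = (NN x. ennreal (1 / k) * (ennreal k * f (c *\<^sub>R ((1 / c) *\<^sub>R x))))"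
  using c k by (simp add: mult.assoc[symmetric] ennreal_mult[symmetric])
 also have "\<dots> \<le> ennreal (1 / k / (1 / c) ^ DIM('a)) * (NN x. ennreal k * f (c *\<^sub>R x))"
  using nn_integral_dilate_le[of "1/c" "1/k" "\<lambda>x. ennreal k * f (c *\<^sub>R x)"] c k by simp
 finally have "ennreal (k / c ^ DIM('a)) * (NN x. f x)
  \<le> ennreal (k / c ^ DIM('a)) * (ennreal (1 / k / (1 / c) ^ DIM('a)) * (NN x. ennreal k * f (c *\<^sub>R x)))"
  by (rule mult_left_mono) simp
 also have "\<dots> = (NN x. ennreal k * f (c *\<^sub>R x))"
  using c k by (simp add: mult.assoc[symmetric] ennreal_mult[symmetric] power_one_over field_simps)
 finally show "ennreal (k / c ^ DIM('a)) * (NN x. f x) \<le> (NN x. ennreal k * f (c *\<^sub>R x))" .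
qed

text \<open>A linear bijection with its inverse and its Jacobian, recorded through the change of
  variables for nonnegative integrals. Bochner integrals, null sets and weak derivatives are
  transported from this, for the scaling of space as well as for the parabolic scaling of
  space-time.\<close>

definition dilation :: "real \<Rightarrow> ('a::euclidean_space \<Rightarrow> 'a) \<Rightarrow> ('a \<Rightarrow> 'a) \<Rightarrow> bool" where
 "dilation \<kappa> D D' \<longleftrightarrow> 0 < \<kappa> \<and> bounded_linear D \<and> bounded_linear D' \<and> (\<forall>x. D (D' x) = x \<and> D' (D x) = x) \<and>
  (\<forall>f\<in>borel_measurable borel. (NN x. f x) = ennreal \<kappa> * (NN x. f (D x)))"

lemma dilation_nn_integral:
 "dilation \<kappa> D D' \<Longrightarrow> f \<in> borel_measurable borel \<Longrightarrow> (NN x. f x) = ennreal \<kappa> * (NN x. f (D x))"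
 unfolding dilation_def by blast

lemma dilation_scaleR:
 assumes "c > 0"
 shows "dilation (c ^ DIM('a)) (\<lambda>x :: 'a::euclidean_space. c *\<^sub>R x) (\<lambda>x. (1 / c) *\<^sub>R x)"
 unfolding dilation_def
proof (intro conjI ballI allI)
 fix f :: "'a \<Rightarrow> ennreal" assume "f \<in> borel_measurable borel"
 then show "(NN x. f x) = ennreal (c ^ DIM('a)) * (NN x. f (c *\<^sub>R x))" by (rule nn_integral_scale[OF _ assms])
qed (use assms in \<open>simp_all add: bounded_linear_scaleR_right\<close>)

lemma dilation_parabolic:
 assumes c: "c > 0"
 shows "dilation (c\<^sup>2 * c ^ CARD('n)) (\<lambda>p :: real \<times> (real^'n). (c\<^sup>2 * fst p, c *\<^sub>R snd p)) (\<lambda>p. (1 / c\<^sup>2 * fst p, (1 / c) *\<^sub>R snd p))"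
proof -
 have nn: "(NN p. f p) = ennreal (c\<^sup>2 * c ^ CARD('n)) * (NN p. f (c\<^sup>2 * fst p, c *\<^sub>R snd p))"
  if [measurable]: "f \<in> borel_measurable borel" for f :: "real \<times> (real^'n) \<Rightarrow> ennreal"
 proof -
  have g [measurable]: "(\<lambda>p :: real \<times> (real^'n). f (c\<^sup>2 * fst p, c *\<^sub>R snd p)) \<in> borel_measurable borel"
  proof -
   have "continuous_on UNIV (\<lambda>p :: real \<times> (real^'n). (c\<^sup>2 * fst p, c *\<^sub>R snd p))" by (intro continuous_intros)
   then have "(\<lambda>p :: real \<times> (real^'n). (c\<^sup>2 * fst p, c *\<^sub>R snd p)) \<in> borel_measurable borel" by (rule borel_measurable_continuous_onI)
   from measurable_compose[OF this that] show ?thesis .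
  qed
  have s1: "(NN x. h x) = ennreal (c\<^sup>2) * (NN t. h (c\<^sup>2 * t))" for h :: "real \<Rightarrow> ennreal"
   using nn_integral_dilate[of "c\<^sup>2" 1 h] c by (simp add: mult.assoc[symmetric] ennreal_mult[symmetric])
  have s2: "(NN x. h x) = ennreal (c ^ CARD('n)) * (NN x. h (c *\<^sub>R x))" for h :: "real^'n \<Rightarrow> ennreal"
   using nn_integral_dilate[of c 1 h] c by (simp add: mult.assoc[symmetric] ennreal_mult[symmetric])
  have "(NN p. f p) = (NN t. NN x. f (t, x))" by (rule nn_integral_lborel_pair) measurable
  also have "\<dots> = ennreal (c\<^sup>2) * (NN t. NN x. f (c\<^sup>2 * t, x))" by (rule s1)
  also have "\<dots> = ennreal (c\<^sup>2) * (NN t. ennreal (c ^ CARD('n)) * (NN x. f (c\<^sup>2 * t, c *\<^sub>R x)))" by (subst s2) (rule refl)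
  also have "(NN t. ennreal (c ^ CARD('n)) * (NN x. f (c\<^sup>2 * t, c *\<^sub>R x)))
   = ennreal (c ^ CARD('n)) * (NN t. (NN x. f (c\<^sup>2 * t, c *\<^sub>R x)))"
   using nn_integral_dilate[of 1 "c ^ CARD('n)" "\<lambda>t :: real. NN x. f (c\<^sup>2 * t, c *\<^sub>R x)"] c by simp
  also have "(NN t. (NN x. f (c\<^sup>2 * t, c *\<^sub>R x))) = (NN p. f (c\<^sup>2 * fst p, c *\<^sub>R snd p))"
   using nn_integral_lborel_pair[OF g] by simp
  finally show ?thesis using c by (simp add: mult.assoc[symmetric] ennreal_mult[symmetric])
 qed
 have bl: "bounded_linear (\<lambda>p :: real \<times> (real^'n). (s * fst p, r *\<^sub>R snd p))" for s r :: real
 proof (rule bounded_linear_Pair)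
  show "bounded_linear (\<lambda>p :: real \<times> (real^'n). s * fst p)" by (rule bounded_linear_const_mult[OF bounded_linear_fst])
  show "bounded_linear (\<lambda>p :: real \<times> (real^'n). r *\<^sub>R snd p)" by (rule bounded_linear_const_scaleR[OF bounded_linear_snd])
 qed
 show ?thesis unfolding dilation_def
 proof (intro conjI ballI allI)
  show "bounded_linear (\<lambda>p :: real \<times> (real^'n). (c\<^sup>2 * fst p, c *\<^sub>R snd p))" by (rule bl)
  show "bounded_linear (\<lambda>p :: real \<times> (real^'n). (1 / c\<^sup>2 * fst p, (1 / c) *\<^sub>R snd p))" by (rule bl)
   fix f :: "real \<times> (real^'n) \<Rightarrow> ennreal" assume "f \<in> borel_measurable borel"
  then show "(NN p. f p) = ennreal (c\<^sup>2 * c ^ CARD('n)) * (NN p. f (c\<^sup>2 * fst p, c *\<^sub>R snd p))" by (rule nn)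
 qed (use c in simp_all)
qed

lemma dilation_measurable:
 assumes "dilation \<kappa> D D'" shows "D \<in> borel_measurable borel"
proof -
 have "bounded_linear D" using assms by (simp only: dilation_def)
 then show ?thesis by (intro borel_measurable_continuous_onI linear_continuous_on)
qed

lemma dilation_integral:
 fixes f :: "'a::euclidean_space \<Rightarrow> real"
 assumes D: "dilation \<kappa> D D'" and f: "f \<in> borel_measurable borel"
 shows "(LB x. f (D x)) = (LB x. f x) / \<kappa>" "integrable lborel f \<Longrightarrow> integrable lborel (\<lambda>x. f (D x))"
proof -
 note [measurable] = dilation_measurable[OF D]
 have k: "\<kappa> > 0" using D by (simp add: dilation_def)
 have eq: "lborel = density (distr lborel borel D) (\<lambda>_. ennreal \<kappa>)"
 proof (rule measure_eqI)
  fix A :: "'a set" assume "A \<in> sets lborel"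
  then have A [measurable]: "A \<in> sets borel" by simp
  have "emeasure lborel A = (NN x. indicator A x)" by simp
  also have "\<dots> = ennreal \<kappa> * (NN x. indicator A (D x))"
   by (rule dilation_nn_integral[OF D]) measurable
  also have "\<dots> = (NN x. ennreal \<kappa> * indicator A (D x))" by (rule nn_integral_cmult[symmetric]) measurable
  also have "\<dots> = emeasure (density (distr lborel borel D) (\<lambda>_. ennreal \<kappa>)) A"
   by (simp add: emeasure_density nn_integral_distr)
  finally show "emeasure lborel A = emeasure (density (distr lborel borel D) (\<lambda>_. ennreal \<kappa>)) A" .
 qed simp
 have "(LB x. f x) = (\<integral>x. f x \<partial>density (distr lborel borel D) (\<lambda>_. ennreal \<kappa>))" using eq by simp
 also have "\<dots> = (\<integral>x. \<kappa> *\<^sub>R f x \<partial>distr lborel borel D)" using k f by (intro integral_density) auto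
 also have "\<dots> = (LB x. \<kappa> * f (D x))" using f by (subst integral_distr) auto
 finally show "(LB x. f (D x)) = (LB x. f x) / \<kappa>" using k by simp
 assume "integrable lborel f"
 then have "integrable (density (distr lborel borel D) (\<lambda>_. ennreal \<kappa>)) f" using eq by simp
 then have "integrable (distr lborel borel D) (\<lambda>x. \<kappa> *\<^sub>R f x)" using k f by (subst (asm) integrable_density) auto
 then have "integrable lborel (\<lambda>x. \<kappa> *\<^sub>R f (D x))" using f by (subst (asm) integrable_distr_eq) auto
 then show "integrable lborel (\<lambda>x. f (D x))" using k by simp
qed

lemma dilation_AE:
 assumes D: "dilation \<kappa> D D'" and P: "AE x in lborel. P x"
 shows "AE x in lborel. P (D x)"
proof -
 obtain N where "{x \<in> space lborel. \<not> P x} \<subseteq> N" and N': "emeasure lborel N = 0" "N \<in> sets lborel" using AE_E[OF P] .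
 then have N: "{x. \<not> P x} \<subseteq> N" "N \<in> sets borel" "emeasure lborel N = 0" by simp_all
 note [measurable] = dilation_measurable[OF D] N(2)
 have "(NN x. indicator N x) = ennreal \<kappa> * (NN x. indicator N (D x))"
  by (rule dilation_nn_integral[OF D]) measurable
 then have "ennreal \<kappa> * (NN x. indicator N (D x)) = 0" using N(3) by simp
 moreover have "\<kappa> > 0" using D by (simp only: dilation_def)
 ultimately have z: "(NN x. indicator N (D x)) = 0" by simp
 have "(\<lambda>x. indicator N (D x) :: ennreal) \<in> borel_measurable lborel" by measurable
 from nn_integral_0_iff_AE[OF this] have "AE x in lborel. indicator N (D x) = (0 :: ennreal)" using z by (rule iffD1)
 then show ?thesis
 proof eventually_elim
  case (elim x)
  then have "D x \<notin> N" by (auto simp: indicator_def split: if_splits)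
  then show ?case using N(1) by blast
 qed
qed

lemma weak_deriv_scaleR:
 assumes "weak_deriv \<Omega> e u v"
 shows "weak_deriv \<Omega> (c *\<^sub>R e) (\<lambda>x. k * u x) (\<lambda>x. k * (c * v x))"
proof (rule weak_derivI)
 have l: "locally_integrable \<Omega> u" "locally_integrable \<Omega> v" using assms by (auto simp: weak_deriv_def)
 have li: "locally_integrable \<Omega> (\<lambda>x. k * f x)" if "locally_integrable \<Omega> f" for k and f :: "'a \<Rightarrow> real"
  using that by (auto simp: locally_integrable_def intro!: set_integrable_mult_right)
 show "locally_integrable \<Omega> (\<lambda>x. k * u x)" "locally_integrable \<Omega> (\<lambda>x. k * (c * v x))" by (intro li l)+
 fix \<phi> assume \<phi>: "\<phi> \<in> test_functions \<Omega>"
 have "dd (c *\<^sub>R e) \<phi> x = c * dd e \<phi> x" for x using linear_cmul[OF smooth_linear_dd[OF test_smooth[OF \<phi>]]] by simp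
 then have "(LINT x|lborel. k * u x * dd (c *\<^sub>R e) \<phi> x) = (LINT x|lborel. (k * c) * (u x * dd e \<phi> x))" by (simp add: mult_ac)
 also have "\<dots> = - (LINT x|lborel. (k * c) * (v x * \<phi> x))" using weak_derivD[OF assms \<phi>] by simp
 finally show "(LINT x|lborel. k * u x * dd (c *\<^sub>R e) \<phi> x) = - (LINT x|lborel. k * (c * v x) * \<phi> x)" by (simp add: mult_ac)
qed

text \<open>The test function is transported by the inverse map. The chain rule turns the direction
  \<open>e\<close> into \<open>D e\<close>, and both integrals acquire the same Jacobian.\<close>

lemma weak_deriv_compose:
 assumes D: "dilation \<kappa> D D'" and w: "weak_deriv \<Omega> (D e) u v"
 shows "weak_deriv (D -` \<Omega>) e (\<lambda>x. u (D x)) (\<lambda>x. v (D x))"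
proof (rule weak_derivI)
 have bl: "bounded_linear D" "bounded_linear D'" and inv: "D (D' x) = x" "D' (D x) = x" for x using D by (auto simp: dilation_def)
 have l: "locally_integrable \<Omega> u" "locally_integrable \<Omega> v" using w by (auto simp: weak_deriv_def)
 have K: "compact (D ` K)" if "compact K" for K using that bl(1) by (intro compact_continuous_image linear_continuous_on)
 have li: "locally_integrable (D -` \<Omega>) (\<lambda>x. f (D x))" if "locally_integrable \<Omega> f" for f :: "'a \<Rightarrow> real"
  unfolding locally_integrable_def
 proof (intro allI impI)
  fix S assume S: "compact S \<and> S \<subseteq> D -` \<Omega>"
  then have "compact (D ` S)" "D ` S \<subseteq> \<Omega>" using K by auto
  then have "integrable lborel (\<lambda>x. indicator (D ` S) x * f x)"
   using that unfolding locally_integrable_def set_integrable_def by auto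
  from dilation_integral(2)[OF D _ this] this have "integrable lborel (\<lambda>x. indicator (D ` S) (D x) * f (D x))" by auto
  moreover have "indicator (D ` S) (D x) = (indicator S x :: real)" for x
   using inv(2) by (auto simp: indicator_def image_iff) metis
  ultimately show "set_integrable lborel S (\<lambda>x. f (D x))" by (simp add: set_integrable_def)
 qed
 show "locally_integrable (D -` \<Omega>) (\<lambda>x. u (D x))" "locally_integrable (D -` \<Omega>) (\<lambda>x. v (D x))" by (intro li l)+
 fix \<phi> assume \<phi>: "\<phi> \<in> test_functions (D -` \<Omega>)"
 define \<psi> where "\<psi> x = \<phi> (D' x)" for x
 obtain S where S: "compact S" "S \<subseteq> D -` \<Omega>" "\<And>x. x \<notin> S \<Longrightarrow> \<phi> x = 0" using \<phi> by (auto elim!: test_functionsE)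
 have s\<psi>: "smooth \<psi>" unfolding \<psi>_def[abs_def] by (rule smooth_compose_linear[OF test_smooth[OF \<phi>] bl(2)])
 have t\<psi>: "\<psi> \<in> test_functions \<Omega>"
 proof (rule test_functionsI[OF s\<psi> K[OF S(1)]])
  show "D ` S \<subseteq> \<Omega>" using S(2) by auto
  show "\<psi> x = 0" if "x \<notin> D ` S" for x
   unfolding \<psi>_def by (rule S(3)) (use that inv(1)[of x] in \<open>metis imageI\<close>)
 qed
 have dd\<phi>: "dd e \<phi> x = dd (D e) \<psi> (D x)" for x
  using dd_compose_linear[OF s\<psi> bl(1), of e x] by (simp add: \<psi>_def inv)
 have int: "integrable lborel (\<lambda>x. u x * dd (D e) \<psi> x)" "integrable lborel (\<lambda>x. v x * \<psi> x)"
  using integrable_mult_test[OF l(1) test_dd[OF t\<psi>]] integrable_mult_test[OF l(2) t\<psi>] by auto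
 then have m: "(\<lambda>x. u x * dd (D e) \<psi> x) \<in> borel_measurable borel" "(\<lambda>x. v x * \<psi> x) \<in> borel_measurable borel" by auto
 have "(LINT x|lborel. u (D x) * dd e \<phi> x) = (LINT x|lborel. u x * dd (D e) \<psi> x) / \<kappa>"
  unfolding dd\<phi> by (rule dilation_integral(1)[OF D m(1)])
 also have "(LINT x|lborel. u x * dd (D e) \<psi> x) = - (LINT x|lborel. v x * \<psi> x)" by (rule weak_derivD[OF w t\<psi>])
 also have "- (LINT x|lborel. v x * \<psi> x) / \<kappa> = - (LINT x|lborel. v (D x) * \<phi> x)"
  using dilation_integral(1)[OF D m(2)] by (simp add: \<psi>_def inv)
 finally show "(LINT x|lborel. u (D x) * dd e \<phi> x) = - (LINT x|lborel. v (D x) * \<phi> x)" .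
qed

text \<open>The function and its gradient scale differently, hence the crude factor
  \<open>1 + c^2\<close>. An inequality is enough to carry over finiteness and convergence to
  zero.\<close>

lemma H1_dilate_le:
 fixes g :: "real^'n \<Rightarrow> real" and G :: "real^'n \<Rightarrow> real^'n"
 assumes c: "c > 0"
 shows "(\<integral>\<^sup>+x\<in>cball 0 R. ennreal ((g (c *\<^sub>R x))\<^sup>2 + (norm (c *\<^sub>R G (c *\<^sub>R x)))\<^sup>2) \<partial>lborel)
  \<le> ennreal ((1 + c\<^sup>2) / c ^ CARD('n)) * (\<integral>\<^sup>+x\<in>cball 0 (c * R). ennreal ((g x)\<^sup>2 + (norm (G x))\<^sup>2) \<partial>lborel)"
proof -
 let ?f = "\<lambda>x. ennreal ((g x)\<^sup>2 + (norm (G x))\<^sup>2) * indicator (cball 0 (c * R)) x"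
 have "(\<integral>\<^sup>+x\<in>cball 0 R. ennreal ((g (c *\<^sub>R x))\<^sup>2 + (norm (c *\<^sub>R G (c *\<^sub>R x)))\<^sup>2) \<partial>lborel) \<le> (NN x. ennreal (1 + c\<^sup>2) * ?f (c *\<^sub>R x))"
 proof (rule nn_integral_mono)
  fix x :: "real^'n"
  have "x \<in> cball 0 R \<Longrightarrow> c *\<^sub>R x \<in> cball 0 (c * R)" using c by simp
  then have i: "indicator (cball 0 R) x \<le> (indicator (cball 0 (c * R)) (c *\<^sub>R x) :: ennreal)" by (auto simp: indicator_def)
  have "(g (c *\<^sub>R x))\<^sup>2 + c\<^sup>2 * (norm (G (c *\<^sub>R x)))\<^sup>2 \<le> (1 + c\<^sup>2) * ((g (c *\<^sub>R x))\<^sup>2 + (norm (G (c *\<^sub>R x)))\<^sup>2)"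
   by (simp add: algebra_simps)
  then have "ennreal ((g (c *\<^sub>R x))\<^sup>2 + (norm (c *\<^sub>R G (c *\<^sub>R x)))\<^sup>2) \<le> ennreal ((1 + c\<^sup>2) * ((g (c *\<^sub>R x))\<^sup>2 + (norm (G (c *\<^sub>R x)))\<^sup>2))"
   using c by (intro ennreal_leI) (simp add: power_mult_distrib)
  also have "\<dots> = ennreal (1 + c\<^sup>2) * ennreal ((g (c *\<^sub>R x))\<^sup>2 + (norm (G (c *\<^sub>R x)))\<^sup>2)" by (intro ennreal_mult) auto
  finally show "ennreal ((g (c *\<^sub>R x))\<^sup>2 + (norm (c *\<^sub>R G (c *\<^sub>R x)))\<^sup>2) * indicator (cball 0 R) x \<le> ennreal (1 + c\<^sup>2) * ?f (c *\<^sub>R x)"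
   unfolding mult.assoc[symmetric] by (rule mult_mono[OF _ i]) auto
 qed
 also have "\<dots> = ennreal ((1 + c\<^sup>2) / c ^ CARD('n)) * (NN x. ?f x)"
  using nn_integral_dilate[of c "1 + c\<^sup>2" ?f] c by (simp add: add_pos_nonneg)
 finally show ?thesis .
qed

lemma H1loc_dilate:
 assumes c: "c > 0" and H: "H1loc g Dg"
 shows "H1loc (\<lambda>x. g (c *\<^sub>R x)) (\<lambda>x. c *\<^sub>R Dg (c *\<^sub>R x))"
 unfolding H1loc_def
proof (intro conjI allI)
 fix i
 have "weak_deriv UNIV (axis i 1) g (\<lambda>x. Dg x $ i)" using H by (simp add: H1loc_def)
 from weak_deriv_scaleR[OF this, of c 1] have "weak_deriv UNIV (c *\<^sub>R axis i 1) g (\<lambda>x. c * Dg x $ i)" by simp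
 from weak_deriv_compose[OF dilation_scaleR[OF c] this] show "weak_deriv UNIV (axis i 1) (\<lambda>x. g (c *\<^sub>R x)) (\<lambda>x. (c *\<^sub>R Dg (c *\<^sub>R x)) $ i)" by simp
next
 fix R
 have "(\<integral>\<^sup>+x\<in>cball 0 (c * R). ennreal ((g x)\<^sup>2 + (norm (Dg x))\<^sup>2) \<partial>lborel) < top" using H by (simp add: H1loc_def)
 then show "(\<integral>\<^sup>+x\<in>cball 0 R. ennreal ((g (c *\<^sub>R x))\<^sup>2 + (norm (c *\<^sub>R Dg (c *\<^sub>R x)))\<^sup>2) \<partial>lborel) < top"
  by (intro le_less_trans[OF H1_dilate_le[OF c]]) (simp add: ennreal_mult_less_top)
qed

lemma has_trace_dilate:
 fixes u :: "real \<times> (real^'n) \<Rightarrow> real"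
 assumes c: "c > 0" and u: "has_trace s0 s1 u (\<lambda>_. 0)"
 shows "has_trace (s0 / c\<^sup>2) (s1 / c\<^sup>2) (\<lambda>p. u (c\<^sup>2 * fst p, c *\<^sub>R snd p)) (\<lambda>_. 0)"
proof -
 obtain v Dv Dg where v: "AE p in lborel. p \<in> strip s0 s1 \<longrightarrow> v p = u p" and g: "H1loc (\<lambda>_ :: real^'n. 0) Dg"
  and ev: "\<forall>\<^sub>F t in at_left s1. H1loc (\<lambda>x. v (t, x)) (Dv t)"
  and lim: "\<And>R. ((\<lambda>t. \<integral>\<^sup>+x\<in>cball 0 R. ennreal ((v (t, x) - 0)\<^sup>2 + (norm (Dv t x - Dg x))\<^sup>2) \<partial>lborel) \<longlongrightarrow> 0) (at_left s1)"
  using u unfolding has_trace_def H1loc_tendsto_def by blast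
 have fl: "filterlim (\<lambda>t. c\<^sup>2 * t) (at_left s1) (at_left (s1 / c\<^sup>2))"
  unfolding filterlim_at
 proof
  have "((\<lambda>t. c\<^sup>2 * t) \<longlongrightarrow> c\<^sup>2 * (s1 / c\<^sup>2)) (at_left (s1 / c\<^sup>2))" by (intro tendsto_intros)
  then show "((\<lambda>t. c\<^sup>2 * t) \<longlongrightarrow> s1) (at_left (s1 / c\<^sup>2))" using c by simp
  show "\<forall>\<^sub>F t in at_left (s1 / c\<^sup>2). c\<^sup>2 * t \<in> {..<s1} \<and> c\<^sup>2 * t \<noteq> s1"
   using c by (auto simp: eventually_at_filter field_simps)
 qed
 let ?D = "\<lambda>p :: real \<times> (real^'n). (c\<^sup>2 * fst p, c *\<^sub>R snd p)"
 show ?thesis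
  unfolding has_trace_def H1loc_tendsto_def
 proof (intro exI conjI allI)
  show "AE p in lborel. p \<in> strip (s0 / c\<^sup>2) (s1 / c\<^sup>2) \<longrightarrow> v (?D p) = u (?D p)"
   using dilation_AE[OF dilation_parabolic[OF c] v]
   by eventually_elim (use c in \<open>auto simp: strip_def field_simps\<close>)
  show "H1loc (\<lambda>_. 0) (\<lambda>x. c *\<^sub>R Dg (c *\<^sub>R x))" using H1loc_dilate[OF c g] by simp
  show "\<forall>\<^sub>F t in at_left (s1 / c\<^sup>2). H1loc (\<lambda>x. v (?D (t, x))) (\<lambda>x. c *\<^sub>R Dv (c\<^sup>2 * t) (c *\<^sub>R x))"
   using eventually_compose_filterlim[OF ev fl]
  proof eventually_elim
   case (elim t)
   from H1loc_dilate[OF c elim] show ?case by simp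
  qed
  fix R
  let ?I = "\<lambda>R t. \<integral>\<^sup>+x\<in>cball 0 R. ennreal ((v (t, x) - 0)\<^sup>2 + (norm (Dv t x - Dg x))\<^sup>2) \<partial>lborel"
  have l0: "((\<lambda>t. ?I (c * R) (c\<^sup>2 * t)) \<longlongrightarrow> 0) (at_left (s1 / c\<^sup>2))" by (rule filterlim_compose[OF lim fl])
  have "((\<lambda>t. ennreal ((1 + c\<^sup>2) / c ^ CARD('n)) * ?I (c * R) (c\<^sup>2 * t)) \<longlongrightarrow> ennreal ((1 + c\<^sup>2) / c ^ CARD('n)) * 0) (at_left (s1 / c\<^sup>2))"
   by (intro tendsto_mult_ennreal tendsto_const l0) auto
  then have l: "((\<lambda>t. ennreal ((1 + c\<^sup>2) / c ^ CARD('n)) * ?I (c * R) (c\<^sup>2 * t)) \<longlongrightarrow> 0) (at_left (s1 / c\<^sup>2))" by simp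
  show "((\<lambda>t. \<integral>\<^sup>+x\<in>cball 0 R. ennreal ((v (?D (t, x)) - 0)\<^sup>2 + (norm (c *\<^sub>R Dv (c\<^sup>2 * t) (c *\<^sub>R x) - c *\<^sub>R Dg (c *\<^sub>R x)))\<^sup>2) \<partial>lborel) \<longlongrightarrow> 0) (at_left (s1 / c\<^sup>2))"
  proof (rule tendsto_sandwich[OF _ _ tendsto_const l])
   show "\<forall>\<^sub>F t in at_left (s1 / c\<^sup>2). (\<integral>\<^sup>+x\<in>cball 0 R. ennreal ((v (?D (t, x)) - 0)\<^sup>2 + (norm (c *\<^sub>R Dv (c\<^sup>2 * t) (c *\<^sub>R x) - c *\<^sub>R Dg (c *\<^sub>R x)))\<^sup>2) \<partial>lborel)
    \<le> ennreal ((1 + c\<^sup>2) / c ^ CARD('n)) * ?I (c * R) (c\<^sup>2 * t)"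
   proof (intro always_eventually allI)
    fix t
    show "(\<integral>\<^sup>+x\<in>cball 0 R. ennreal ((v (?D (t, x)) - 0)\<^sup>2 + (norm (c *\<^sub>R Dv (c\<^sup>2 * t) (c *\<^sub>R x) - c *\<^sub>R Dg (c *\<^sub>R x)))\<^sup>2) \<partial>lborel)
     \<le> ennreal ((1 + c\<^sup>2) / c ^ CARD('n)) * ?I (c * R) (c\<^sup>2 * t)"
     using H1_dilate_le[OF c, where R=R and g="\<lambda>x. v (c\<^sup>2 * t, x) - 0" and G="\<lambda>x. Dv (c\<^sup>2 * t) x - Dg x"]
     by (simp only: fst_conv snd_conv scaleR_diff_right)
   qed
  qed simp
 qed
qed

text \<open>Self-similarity of the Gaussian with covariance \<open>t a\<close>. The factor is
  precisely the spatial Jacobian, so the weighted measure of each slice is preserved.\<close>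

lemma gauss_dilate:
 assumes a: "posdef (a :: real^'n^'n)" and c: "c > 0" and t: "t > 0"
 shows "gauss (t *\<^sub>R a) x = c ^ CARD('n) * gauss ((c\<^sup>2 * t) *\<^sub>R a) (c *\<^sub>R x)"
proof -
 have ct: "c\<^sup>2 * t > 0" using c t by simp
 have "(c\<^sup>2 * t) powr (real CARD('n) / 2) = (c powr 2) powr (real CARD('n) / 2) * t powr (real CARD('n) / 2)"
  using c t by (simp add: powr_mult powr_numeral)
 also have "(c powr 2) powr (real CARD('n) / 2) = c ^ CARD('n)" using c powr_realpow[of c "CARD('n)"] by (subst powr_powr) simp
 finally have e: "(c\<^sup>2 * t) powr (real CARD('n) / 2) = c ^ CARD('n) * t powr (real CARD('n) / 2)" .
 show ?thesis unfolding gauss_scaled[OF a t] gauss_scaled[OF a ct] e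
  using c t by (simp add: matrix_vector_mult_scaleR power2_eq_square field_simps)
qed

text \<open>The power of time contributes \<open>(1 / c^2) powr \<alpha>\<close> and the time
  integral another \<open>1 / c^2\<close>, while the spatial Jacobian is absorbed by the Gaussian.
  The function \<open>f\<close> is arbitrary, which is why dilations were established for all
  nonnegative functions.\<close>

lemma wnorm_dilate:
 fixes f :: "real \<times> (real^'n) \<Rightarrow> 'b::real_normed_vector"
 assumes a: "posdef (a :: real^'n^'n)" and c: "c > 0" and m: "m > 0" and s0: "0 \<le> s0"
 shows "wnorm \<alpha> (s0 / c\<^sup>2) (s1 / c\<^sup>2) (\<lambda>t x. gauss (t *\<^sub>R a) x) (\<lambda>p. m *\<^sub>R f (c\<^sup>2 * fst p, c *\<^sub>R snd p))
  = ennreal (sqrt (m\<^sup>2 * (1 / c\<^sup>2) powr \<alpha> / c\<^sup>2)) * wnorm \<alpha> s0 s1 (\<lambda>t x. gauss (t *\<^sub>R a) x) f"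
proof -
 define k where "k = m\<^sup>2 * (1 / c\<^sup>2) powr \<alpha>"
 have k: "k > 0" using m c by (simp add: k_def)
 define H where "H \<tau> = (NN y. ennreal (\<tau> powr \<alpha> * gauss (\<tau> *\<^sub>R a) y * (norm (f (\<tau>, y)))\<^sup>2))" for \<tau>
 have inner: "(NN x. ennreal (t powr \<alpha> * gauss (t *\<^sub>R a) x * (norm (m *\<^sub>R f (c\<^sup>2 * t, c *\<^sub>R x)))\<^sup>2)) = ennreal k * H (c\<^sup>2 * t)"
  if t: "t > 0" for t
 proof -
  have "t powr \<alpha> * gauss (t *\<^sub>R a) x * (norm (m *\<^sub>R f (c\<^sup>2 * t, c *\<^sub>R x)))\<^sup>2
   = (k * c ^ CARD('n)) * ((c\<^sup>2 * t) powr \<alpha> * gauss ((c\<^sup>2 * t) *\<^sub>R a) (c *\<^sub>R x) * (norm (f (c\<^sup>2 * t, c *\<^sub>R x)))\<^sup>2)" for x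
  proof -
   have "(1 / c\<^sup>2) powr \<alpha> * (c\<^sup>2 * t) powr \<alpha> = t powr \<alpha>" using c t by (simp flip: powr_mult)
   moreover have "k * (c\<^sup>2 * t) powr \<alpha> = m\<^sup>2 * ((1 / c\<^sup>2) powr \<alpha> * (c\<^sup>2 * t) powr \<alpha>)" by (simp add: k_def)
   ultimately have p: "t powr \<alpha> * m\<^sup>2 = k * (c\<^sup>2 * t) powr \<alpha>" by simp
   have "t powr \<alpha> * gauss (t *\<^sub>R a) x * (norm (m *\<^sub>R f (c\<^sup>2 * t, c *\<^sub>R x)))\<^sup>2 = (t powr \<alpha> * m\<^sup>2) * gauss (t *\<^sub>R a) x * (norm (f (c\<^sup>2 * t, c *\<^sub>R x)))\<^sup>2"
    by (simp add: power_mult_distrib)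
   then show ?thesis unfolding p gauss_dilate[OF a c t] by (simp only: mult_ac)
  qed
  then have "(NN x. ennreal (t powr \<alpha> * gauss (t *\<^sub>R a) x * (norm (m *\<^sub>R f (c\<^sup>2 * t, c *\<^sub>R x)))\<^sup>2))
   = (NN x. ennreal (k * c ^ CARD('n)) * (\<lambda>y. ennreal ((c\<^sup>2 * t) powr \<alpha> * gauss ((c\<^sup>2 * t) *\<^sub>R a) y * (norm (f (c\<^sup>2 * t, y)))\<^sup>2)) (c *\<^sub>R x))"
   using k c by (simp add: ennreal_mult')
  also have "\<dots> = ennreal ((k * c ^ CARD('n)) / c ^ DIM(real^'n)) * H (c\<^sup>2 * t)"
   unfolding H_def by (rule nn_integral_dilate) (use c k in auto)
  finally show ?thesis using c by simp
 qed
 have "(\<integral>\<^sup>+t\<in>{s0 / c\<^sup>2<..<s1 / c\<^sup>2}. (NN x. ennreal (t powr \<alpha> * gauss (t *\<^sub>R a) x * (norm (m *\<^sub>R f (c\<^sup>2 * t, c *\<^sub>R x)))\<^sup>2)) \<partial>lborel)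
  = (NN t. ennreal k * (\<lambda>\<tau>. H \<tau> * indicator {s0<..<s1} \<tau>) (c\<^sup>2 *\<^sub>R t))"
 proof (rule nn_integral_cong)
  fix t
  have iff: "t \<in> {s0 / c\<^sup>2<..<s1 / c\<^sup>2} \<longleftrightarrow> c\<^sup>2 * t \<in> {s0<..<s1}" using c by (auto simp: field_simps)
  have pos: "t > 0" if "t \<in> {s0 / c\<^sup>2<..<s1 / c\<^sup>2}" using that s0 c by (auto intro: le_less_trans[rotated])
  show "(NN x. ennreal (t powr \<alpha> * gauss (t *\<^sub>R a) x * (norm (m *\<^sub>R f (c\<^sup>2 * t, c *\<^sub>R x)))\<^sup>2)) * indicator {s0 / c\<^sup>2<..<s1 / c\<^sup>2} t
   = ennreal k * (\<lambda>\<tau>. H \<tau> * indicator {s0<..<s1} \<tau>) (c\<^sup>2 *\<^sub>R t)"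
  proof (cases "t \<in> {s0 / c\<^sup>2<..<s1 / c\<^sup>2}")
   case True
   then have "c\<^sup>2 * t \<in> {s0<..<s1}" using iff by blast
   then show ?thesis using True inner[OF pos[OF True]] by simp
  next
   case False
   then have "c\<^sup>2 * t \<notin> {s0<..<s1}" using iff by blast
   then show ?thesis using False by simp
  qed
 qed
 also have "\<dots> = ennreal (k / (c\<^sup>2) ^ DIM(real)) * (NN \<tau>. H \<tau> * indicator {s0<..<s1} \<tau>)"
  by (rule nn_integral_dilate) (use c k in auto)
 finally show ?thesis unfolding wnorm_def H_def k_def[symmetric]
  using ennreal_sqrt_cmult[of "k / c\<^sup>2"] k c by simp
qed

lemma ennreal_divide_cancel_le:
 assumes "0 < c"
 shows "x / y \<le> (ennreal c * x) / (ennreal c * y)"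
proof (cases "y = 0")
 case True
 then show ?thesis using assms by (cases "x = 0") (auto simp: divide_ennreal_def ennreal_mult_top ennreal_mult_eq_top_iff)
next
 case False
 show ?thesis
 proof (rule ennreal_divide_leI)
  assume "y < top"
  then obtain r where r: "y = ennreal r" "r > 0" using False by (cases y) (auto simp: less_le)
  show "x \<le> (ennreal c * x) / (ennreal c * y) * y"
  proof (cases x)
   case (real z)
   then show ?thesis using r assms by (simp add: divide_ennreal flip: ennreal_mult)
  next
   case top
   then show ?thesis using r assms by (simp add: ennreal_mult_top ennreal_top_divide ennreal_top_mult flip: ennreal_mult)
  qed
 qed
qed

lemma ennreal_sqrt_le_iff: "0 \<le> z \<Longrightarrow> ennreal_sqrt y \<le> ennreal z \<longleftrightarrow> y \<le> ennreal (z\<^sup>2)"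
proof (cases y)
 case (real r)
 assume z: "0 \<le> z"
 have "sqrt r \<le> z \<longleftrightarrow> r \<le> z\<^sup>2" using z real by (auto intro: real_le_lsqrt sqrt_le_D)
 then show ?thesis using real z by (simp add: ennreal_sqrt_ennreal)
qed (auto simp: ennreal_sqrt_def top_unique)

lemma H_op_scaleR: "H_op q (\<lambda>p. k *\<^sub>R Hu p) p = k *\<^sub>R H_op q Hu p"
 by (simp add: H_op_def vec_eq_iff matrix_matrix_mult_def sum_distrib_left sum_distrib_right mult_ac)

text \<open>The time derivative and the Hessian both scale by \<open>c^2\<close>, so numerator and
  denominator acquire the same factor \<open>z\<close>. The inequality for \<open>1 / c\<close> is
  the reverse one.\<close>

lemma k_const_dilate:
 assumes a: "posdef (a :: real^'n^'n)" and c: "c > 0" and s0: "0 \<le> s0"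
 shows "k_const \<alpha> s0 s1 (\<lambda>t x. gauss (t *\<^sub>R a) x) A q \<le> k_const \<alpha> (s0 / c\<^sup>2) (s1 / c\<^sup>2) (\<lambda>t x. gauss (t *\<^sub>R a) x) A q"
proof -
 let ?F = "\<lambda>t x. gauss (t *\<^sub>R a) x"
 let ?D = "\<lambda>p :: real \<times> (real^'n). (c\<^sup>2 * fst p, c *\<^sub>R snd p)"
 note dil = dilation_parabolic[OF c, where 'n='n]
 have vim: "?D -` strip s0 s1 = strip (s0 / c\<^sup>2) (s1 / c\<^sup>2)" using c by (auto simp: strip_def field_simps)
 have wd: "weak_deriv (strip (s0 / c\<^sup>2) (s1 / c\<^sup>2)) e (\<lambda>p. k * u (?D p)) (\<lambda>p. k * (m * v (?D p)))"
  if "weak_deriv (strip s0 s1) e' u v" "?D e = m *\<^sub>R e'" for e e' k m u v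
  using weak_deriv_compose[OF dil, of "strip s0 s1" e "\<lambda>p. k * u p" "\<lambda>p. k * (m * v p)"] weak_deriv_scaleR[OF that(1), of m k]
  unfolding that(2) vim by simp
 have "wnorm \<alpha> s0 s1 ?F (H_op q Hu) / wnorm \<alpha> s0 s1 ?F (P_op A ut Hu) \<le> k_const \<alpha> (s0 / c\<^sup>2) (s1 / c\<^sup>2) ?F A q"
  if w: "(u, ut, Du, Hu) \<in> W0_space \<alpha> s0 s1 ?F" for u ut Du Hu
 proof -
  define u' where "u' p = u (?D p)" for p
  define ut' where "ut' p = c\<^sup>2 * ut (?D p)" for p
  define Du' where "Du' p = c *\<^sub>R Du (?D p)" for p
  define Hu' where "Hu' p = c\<^sup>2 *\<^sub>R Hu (?D p)" for p
  have W: "weak_deriv (strip s0 s1) (1, 0) u ut" "\<And>i. weak_deriv (strip s0 s1) (0, axis i 1) u (\<lambda>p. Du p $ i)"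
   "\<And>i j. weak_deriv (strip s0 s1) (0, axis j 1) (\<lambda>p. Du p $ i) (\<lambda>p. Hu p $ i $ j)"
   "wnorm \<alpha> s0 s1 ?F u < top" "wnorm \<alpha> s0 s1 ?F ut < top" "wnorm \<alpha> s0 s1 ?F Du < top" "wnorm \<alpha> s0 s1 ?F Hu < top"
   "has_trace s0 s1 u (\<lambda>_. 0)"
   using w by (simp_all add: W0_space_def W_space_def)
  have c2: "c\<^sup>2 > 0" using c by simp
  have fin: "wnorm \<alpha> (s0 / c\<^sup>2) (s1 / c\<^sup>2) ?F (\<lambda>p. m *\<^sub>R f (?D p)) < top" if "wnorm \<alpha> s0 s1 ?F f < top" "m > 0"
   for m and f :: "real \<times> (real^'n) \<Rightarrow> 'b::real_normed_vector"
   unfolding wnorm_dilate[OF a c that(2) s0] using that(1) by (simp add: ennreal_mult_less_top)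
  have "(u', ut', Du', Hu') \<in> W0_space \<alpha> (s0 / c\<^sup>2) (s1 / c\<^sup>2) ?F"
   unfolding W0_space_def W_space_def mem_Collect_eq prod.case
  proof (intro conjI allI)
   show "weak_deriv (strip (s0 / c\<^sup>2) (s1 / c\<^sup>2)) (1, 0) u' ut'"
    using wd[OF W(1), of "(1, 0)" "c\<^sup>2" 1] by (simp add: u'_def[abs_def] ut'_def[abs_def])
   show "weak_deriv (strip (s0 / c\<^sup>2) (s1 / c\<^sup>2)) (0, axis i 1) u' (\<lambda>p. Du' p $ i)" for i
    using wd[OF W(2), of "(0, axis i 1)" c i 1] by (simp add: u'_def[abs_def] Du'_def[abs_def])
   show "weak_deriv (strip (s0 / c\<^sup>2) (s1 / c\<^sup>2)) (0, axis j 1) (\<lambda>p. Du' p $ i) (\<lambda>p. Hu' p $ i $ j)" for i j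
    using wd[OF W(3), of "(0, axis j 1)" c j c i] by (simp add: Du'_def[abs_def] Hu'_def[abs_def] power2_eq_square mult.assoc)
   show "wnorm \<alpha> (s0 / c\<^sup>2) (s1 / c\<^sup>2) ?F u' < top" using fin[OF W(4), of 1] by (simp add: u'_def[abs_def])
   show "wnorm \<alpha> (s0 / c\<^sup>2) (s1 / c\<^sup>2) ?F ut' < top" using fin[OF W(5) c2] by (simp add: ut'_def[abs_def])
   show "wnorm \<alpha> (s0 / c\<^sup>2) (s1 / c\<^sup>2) ?F Du' < top" using fin[OF W(6) c] by (simp add: Du'_def[abs_def])
   show "wnorm \<alpha> (s0 / c\<^sup>2) (s1 / c\<^sup>2) ?F Hu' < top" using fin[OF W(7) c2] by (simp add: Hu'_def[abs_def])
   show "has_trace (s0 / c\<^sup>2) (s1 / c\<^sup>2) u' (\<lambda>_. 0)" unfolding u'_def[abs_def] by (rule has_trace_dilate[OF c W(8)])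
  qed
  then have le: "wnorm \<alpha> (s0 / c\<^sup>2) (s1 / c\<^sup>2) ?F (H_op q Hu') / wnorm \<alpha> (s0 / c\<^sup>2) (s1 / c\<^sup>2) ?F (P_op A ut' Hu') \<le> k_const \<alpha> (s0 / c\<^sup>2) (s1 / c\<^sup>2) ?F A q"
   unfolding k_const_def by (rule SUP_upper2) simp
  have Hop: "H_op q Hu' = (\<lambda>p. c\<^sup>2 *\<^sub>R H_op q Hu (?D p))"
  proof
   fix p show "H_op q Hu' p = c\<^sup>2 *\<^sub>R H_op q Hu (?D p)"
    using H_op_scaleR[of q "c\<^sup>2" "\<lambda>p. Hu (?D p)" p] by (simp add: Hu'_def[abs_def] H_op_def)
  qed
  have Pop: "P_op A ut' Hu' = (\<lambda>p. c\<^sup>2 *\<^sub>R P_op A ut Hu (?D p))"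
  proof
   fix p show "P_op A ut' Hu' p = c\<^sup>2 *\<^sub>R P_op A ut Hu (?D p)"
    by (simp add: P_op_def frob_inner_sum ut'_def Hu'_def sum_distrib_left right_diff_distrib mult_ac)
  qed
  define z where "z = sqrt ((c\<^sup>2)\<^sup>2 * (1 / c\<^sup>2) powr \<alpha> / c\<^sup>2)"
  have z: "z > 0" using c by (simp add: z_def)
  have "wnorm \<alpha> s0 s1 ?F (H_op q Hu) / wnorm \<alpha> s0 s1 ?F (P_op A ut Hu)
   \<le> (ennreal z * wnorm \<alpha> s0 s1 ?F (H_op q Hu)) / (ennreal z * wnorm \<alpha> s0 s1 ?F (P_op A ut Hu))"
   by (rule ennreal_divide_cancel_le[OF z])
  also have "\<dots> = wnorm \<alpha> (s0 / c\<^sup>2) (s1 / c\<^sup>2) ?F (H_op q Hu') / wnorm \<alpha> (s0 / c\<^sup>2) (s1 / c\<^sup>2) ?F (P_op A ut' Hu')"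
   unfolding Hop Pop wnorm_dilate[OF a c c2 s0] z_def ..
  finally show ?thesis using le by (rule order_trans)
 qed
 then show ?thesis unfolding k_const_def[of \<alpha> s0 s1] by (auto intro!: SUP_least)
qed

section \<open>Intervals that start at time zero\<close>

lemma weak_deriv_subset: "weak_deriv \<Omega>' e u v \<Longrightarrow> \<Omega> \<subseteq> \<Omega>' \<Longrightarrow> weak_deriv \<Omega> e u v"
proof (rule weak_derivI)
 assume w: "weak_deriv \<Omega>' e u v" and s: "\<Omega> \<subseteq> \<Omega>'"
 then show "locally_integrable \<Omega> u" "locally_integrable \<Omega> v" unfolding weak_deriv_def locally_integrable_def by blast+
 fix \<phi> assume "\<phi> \<in> test_functions \<Omega>"
 from weak_derivD[OF w test_mono[OF this s]] show "(LINT x|lborel. u x * dd e \<phi> x) = - (LINT x|lborel. v x * \<phi> x)" .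
qed

lemma wnorm_mono_interval: "c0 \<le> c \<Longrightarrow> wnorm \<alpha> c B F f \<le> wnorm \<alpha> c0 B F f"
 unfolding wnorm_def by (intro ennreal_sqrt_mono nn_integral_mono) (auto simp: indicator_def)

text \<open>Raising the initial time keeps admissible functions admissible because the trace
  condition sits at the other end and no condition is imposed at the start.\<close>

lemma W0_space_restrict:
 fixes u :: "real \<times> (real^'n) \<Rightarrow> real"
 assumes w: "(u, ut, Du, Hu) \<in> W0_space \<alpha> c0 B F" and c: "c0 \<le> c"
 shows "(u, ut, Du, Hu) \<in> W0_space \<alpha> c B F"
proof -
 have s: "strip c B \<subseteq> strip c0 B" using c by (auto simp: strip_def)
 have fin: "wnorm \<alpha> c B F f < top" if "wnorm \<alpha> c0 B F f < top" for f :: "real \<times> (real^'n) \<Rightarrow> 'b::real_normed_vector"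
  by (rule le_less_trans[OF wnorm_mono_interval[OF c] that])
 have "has_trace c B u (\<lambda>_. 0)"
 proof -
  obtain v where v: "AE p in lborel. p \<in> strip c0 B \<longrightarrow> v p = u p" "H1loc_tendsto (\<lambda>t x. v (t, x)) (\<lambda>_. 0) (at_left B)"
   using w unfolding W0_space_def has_trace_def by auto
  have "AE p in lborel. p \<in> strip c B \<longrightarrow> v p = u p" using v(1) by eventually_elim (use s in auto)
  then show ?thesis using v(2) unfolding has_trace_def by blast
 qed
 then show ?thesis using w unfolding W0_space_def W_space_def mem_Collect_eq prod.case
  by (elim conjE) (intro conjI allI fin weak_deriv_subset[OF _ s]; simp)
qed

lemma wsq_le_of_restrictions:
 fixes f :: "real \<times> (real^'n) \<Rightarrow> 'b::{real_normed_vector, second_countable_topology}"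
 assumes a: "posdef (a :: real^'n^'n)"
  and m: "\<And>c. 0 < c \<Longrightarrow> (\<lambda>p. indicator (strip c B) p *\<^sub>R f p) \<in> borel_measurable borel"
  and le: "\<And>c. 0 < c \<Longrightarrow> c < B \<Longrightarrow> wsq \<alpha> a c B f \<le> Z" and B: "0 < B"
 shows "wsq \<alpha> a 0 B f \<le> Z"
proof -
 \<comment> \<open>The shift by 2 keeps every \<open>c n\<close> strictly below
   \<open>B\<close>.\<close>
 define c where "c n = B / real (n + 2)" for n
 have c: "0 < c n" "c n < B" for n using B divide_strict_left_mono[of 1 "real (n + 2)" B] by (auto simp: c_def)
 have lim: "c \<longlonglongrightarrow> 0"
 proof -
  have "(\<lambda>n. B * inverse (real (Suc (Suc n)))) \<longlonglongrightarrow> B * 0"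
   by (intro tendsto_mult tendsto_const LIMSEQ_Suc[OF LIMSEQ_inverse_real_of_nat])
  then show ?thesis by (simp add: c_def[abs_def] divide_inverse)
 qed
 let ?f = "\<lambda>c p. ennreal (indicator {c<..<B} (fst p) * wgt \<alpha> a p * (norm (f p))\<^sup>2)"
 have "wsq \<alpha> a 0 B f \<le> (NN p. liminf (\<lambda>n. ?f (c n) p))"
  unfolding wsq_def
 proof (rule nn_integral_mono)
  fix p :: "real \<times> (real^'n)"
  show "?f 0 p \<le> liminf (\<lambda>n. ?f (c n) p)"
  proof (cases "fst p \<in> {0<..<B}")
   case True
   then have "\<forall>\<^sub>F n in sequentially. c n < fst p" using order_tendstoD(2)[OF lim, of "fst p"] by simp
   then have "\<forall>\<^sub>F n in sequentially. ?f (c n) p = ?f 0 p" by eventually_elim (use True in auto)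
   then have "liminf (\<lambda>n. ?f (c n) p) = ?f 0 p"
    by (intro lim_imp_Liminf trivial_limit_sequentially tendsto_eventually)
   then show ?thesis by simp
  qed simp
 qed
 also have "\<dots> \<le> liminf (\<lambda>n. NN p. ?f (c n) p)"
  by (rule nn_integral_liminf) (rule wsq_integrand_measurable[OF a less_imp_le[OF c(1)] m[OF c(1)]])
 also have "\<dots> \<le> Z"
  by (rule order_trans[OF Liminf_mono[where g="\<lambda>_. Z"]])
   (use le[OF c] in \<open>auto simp: Liminf_const wsq_def intro!: always_eventually\<close>)
 finally show ?thesis .
qed

text \<open>\<open>P_delta0\<close> sees only intervals that stay away from 0. On each
  \<open>(c, B)\<close> the restriction of \<open>u\<close> obeys the bound, and the norm of
  \<open>P_op A ut Hu\<close> there is at most the one on \<open>(0, B)\<close>; Fatou's lemma then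
  lets \<open>c\<close> tend to 0.\<close>

lemma k_const_zero_le:
 assumes a: "posdef (a :: real^'n^'n)" and B: "0 < B"
 shows "k_const \<alpha> 0 B (\<lambda>t x. gauss (t *\<^sub>R a) x) A q \<le> P_delta0 \<alpha> a A q"
proof (cases "P_delta0 \<alpha> a A q < top")
 case True
 let ?F = "\<lambda>t x. gauss (t *\<^sub>R a) x"
 let ?P = "P_delta0 \<alpha> a A q"
 have "wnorm \<alpha> 0 B ?F (H_op q Hu) / wnorm \<alpha> 0 B ?F (P_op A ut Hu) \<le> ?P"
  if w: "(u, ut, Du, Hu) \<in> W0_space \<alpha> 0 B ?F" for u ut Du Hu
 proof (rule ennreal_divide_leI)
  assume fin: "wnorm \<alpha> 0 B ?F (P_op A ut Hu) < top"
  define Y where "Y = ?P * wnorm \<alpha> 0 B ?F (P_op A ut Hu)"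
  have "Y < top" unfolding Y_def using fin True by (simp add: ennreal_mult_less_top)
  then obtain z where z: "0 \<le> z" "Y = ennreal z" by (cases Y) auto
  note wr = W0_space_restrict[OF w less_imp_le]
  have "wsq \<alpha> a 0 B (H_op q Hu) \<le> ennreal (z\<^sup>2)"
  proof (rule wsq_le_of_restrictions[OF a _ _ B])
   fix c :: real assume c: "0 < c"
   show "(\<lambda>p. indicator (strip c B) p *\<^sub>R H_op q Hu p) \<in> borel_measurable borel"
    by (intro H_op_measurable W0_spaceD(6)[OF wr[OF c]])
   assume cB: "c < B"
   have mono: "wnorm \<alpha> c B ?F (P_op A ut Hu) \<le> wnorm \<alpha> 0 B ?F (P_op A ut Hu)" by (rule wnorm_mono_interval) (use c in simp)
   have "wnorm \<alpha> c B ?F (H_op q Hu) / wnorm \<alpha> c B ?F (P_op A ut Hu) \<le> k_const \<alpha> c B ?F A q"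
    unfolding k_const_def by (rule SUP_upper2[OF wr[OF c]]) simp
   also have "\<dots> \<le> ?P" unfolding P_delta0_def by (rule SUP_upper2[of "(c, B)"]) (use c cB in auto)
   finally have "wnorm \<alpha> c B ?F (H_op q Hu) \<le> ?P * wnorm \<alpha> c B ?F (P_op A ut Hu)"
    by (rule ennreal_le_of_divide_le[OF _ le_less_trans[OF mono fin] True])
   also have "\<dots> \<le> Y" unfolding Y_def by (intro mult_left_mono mono) simp
   finally have "ennreal_sqrt (wsq \<alpha> a c B (H_op q Hu)) \<le> ennreal z"
    unfolding P_op_wsq(2)[OF a less_imp_le[OF c] wr[OF c]] z(2) .
   then show "wsq \<alpha> a c B (H_op q Hu) \<le> ennreal (z\<^sup>2)" using ennreal_sqrt_le_iff[OF z(1)] by simp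
  qed
  then have "ennreal_sqrt (wsq \<alpha> a 0 B (H_op q Hu)) \<le> ennreal z" using ennreal_sqrt_le_iff[OF z(1)] by simp
  then show "wnorm \<alpha> 0 B ?F (H_op q Hu) \<le> ?P * wnorm \<alpha> 0 B ?F (P_op A ut Hu)"
   unfolding P_op_wsq(2)[OF a order_refl w] Y_def[symmetric] z(2) .
 qed
 then show ?thesis unfolding k_const_def by (auto intro!: SUP_least)
qed (simp add: not_less top_unique)

lemma K_const_eq_P_delta0:
 assumes a: "posdef (a :: real^'n^'n)" and T: "T > 0"
 shows "K_const \<alpha> {0<..<T} (\<lambda>t x. gauss (t *\<^sub>R a) x) A q = P_delta0 \<alpha> a A q"
proof (rule antisym)
 let ?F = "\<lambda>t x. gauss (t *\<^sub>R a) x"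
 have "k_const \<alpha> s0 s1 ?F A q \<le> P_delta0 \<alpha> a A q" if s: "s0 < s1" "{s0<..<s1} \<subseteq> {0<..<T}" for s0 s1
 proof -
  have "0 \<le> s0"
  proof (rule ccontr)
   assume "\<not> 0 \<le> s0"
   then have "min ((s0 + s1) / 2) (s0 / 2) \<in> {s0<..<s1}" using s(1) by (auto simp: min_def)
   then have "min ((s0 + s1) / 2) (s0 / 2) \<in> {0<..<T}" using s(2) by blast
   then show False using \<open>\<not> 0 \<le> s0\<close> by (auto simp: min_def split: if_splits)
  qed
  then consider "s0 = 0" | "0 < s0" by fastforce
  then show ?thesis
  proof cases
   case 1
   then show ?thesis using k_const_zero_le[OF a] s(1) by simp
  next
   case 2
   then show ?thesis unfolding P_delta0_def by (intro SUP_upper2[of "(s0, s1)"]) (use s in auto)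
  qed
 qed
 \<comment> \<open>The bound is free of the interval length, so the infimum over \<open>h\<close>
   may be tested at \<open>h = 1\<close>.\<close>
 then have "k_sup \<alpha> {0<..<T} ?F A q 1 \<le> P_delta0 \<alpha> a A q" unfolding k_sup_def by (auto intro!: SUP_least)
 then show "K_const \<alpha> {0<..<T} ?F A q \<le> P_delta0 \<alpha> a A q"
  unfolding K_const_eq_INF by (rule INF_lower2[of 1, rotated]) simp
 show "P_delta0 \<alpha> a A q \<le> K_const \<alpha> {0<..<T} ?F A q"
  unfolding K_const_eq_INF
 proof (rule INF_greatest)
  fix h :: real assume "h \<in> {0<..}"
  then have h: "h > 0" by simp
  show "P_delta0 \<alpha> a A q \<le> k_sup \<alpha> {0<..<T} ?F A q h"
   unfolding P_delta0_def
  proof (rule SUP_least, clarify)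
   fix c B :: real assume c: "0 < c" "c < B"
   \<comment> \<open>This dilation sends \<open>(c, B)\<close> to an interval ending at
     \<open>min T h\<close>, which lies in \<open>(0, T)\<close> and has length at most
     \<open>h\<close> however long \<open>(c, B)\<close> was.\<close>
   define r where "r = sqrt (B / min T h)"
   have r: "r > 0" "r\<^sup>2 = B / min T h" using c h T by (auto simp: r_def)
   have B: "B / r\<^sup>2 = min T h" using c h T by (simp add: r(2))
   have cr: "0 < c / r\<^sup>2" "c / r\<^sup>2 < B / r\<^sup>2" using c r(1) by (auto simp: divide_strict_right_mono)
   have "k_const \<alpha> c B ?F A q \<le> k_const \<alpha> (c / r\<^sup>2) (B / r\<^sup>2) ?F A q"
    by (rule k_const_dilate[OF a r(1)]) (use c in simp)
   also have "\<dots> \<le> k_sup \<alpha> {0<..<T} ?F A q h"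
    unfolding k_sup_def by (rule SUP_upper2[of "(c / r\<^sup>2, B / r\<^sup>2)"]) (use cr B in auto)
   finally show "k_const \<alpha> c B ?F A q \<le> k_sup \<alpha> {0<..<T} ?F A q h" .
  qed
 qed
qed

section \<open>Plane waves\<close>

lemma continuous_gauss: "continuous_on UNIV (gauss C)"
 unfolding gauss_def[abs_def] divide_inverse by (intro continuous_intros)

text \<open>Independence of \<open>t\<close> follows from self-similarity. The value itself cancels
  in the quotients.\<close>

lemma gauss_mass:
 assumes a: "posdef (a :: real^'n^'n)"
 obtains G where "G > 0" "\<And>t. t > 0 \<Longrightarrow> (NN x. ennreal (gauss (t *\<^sub>R a) x)) = ennreal G"
proof -
 obtain l L where l: "0 < l" "elliptic l L a" using posdef_elliptic[OF a] by blast
 define L' where "L' = max L 1"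
 have L': "L' > 0" by (simp add: L'_def)
 have e: "elliptic l L' a" using elliptic_mono[OF l(2), of l L'] by (simp add: L'_def)
 define k where "k = 1 / sqrt ((2 * pi) ^ CARD('n) * det a)"
 have k: "k > 0" using posdef_det_pos[OF a] by (simp add: k_def)
 have pos: "gauss a x > 0" for x using posdef_det_pos[OF a] by (simp add: gauss_def)
 have "integrable lborel (\<lambda>x :: real^'n. k * exp (- (1 / (2 * L')) * (x \<bullet> x)))"
  by (intro integrable_mult_right integrable_gauss) (use L' in simp)
 then have i: "integrable lborel (gauss a)"
 proof (rule Bochner_Integration.integrable_bound)
  show "gauss a \<in> borel_measurable lborel" using borel_measurable_continuous_onI[OF continuous_gauss[of a]] by simp
  show "AE x in lborel. norm (gauss a x) \<le> norm (k * exp (- (1 / (2 * L')) * (x \<bullet> x)))"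
  proof (rule AE_I2)
   fix x :: "real^'n"
   have "(x \<bullet> x) / L' \<le> x \<bullet> (matrix_inv a *v x)" by (rule matrix_inv_bounds(1)[OF a e l(1) L'])
   then have "gauss a x \<le> k * exp (- (1 / (2 * L')) * (x \<bullet> x))"
    unfolding gauss_def k_def using k by (simp add: k_def divide_right_mono)
   then show "norm (gauss a x) \<le> norm (k * exp (- (1 / (2 * L')) * (x \<bullet> x)))"
    using pos[of x] k by simp
  qed
 qed
 show ?thesis
 proof (rule that[of "LB x. gauss a x"])
  show "(LB x. gauss a x) > 0" by (rule integral_pos_lborel[OF i pos])
  fix t :: real assume t: "t > 0"
  define c where "c = 1 / sqrt t"
  have c: "c > 0" "c\<^sup>2 * t = 1" using t by (simp_all add: c_def power_divide)
  have "(NN x. ennreal (gauss (t *\<^sub>R a) x)) = (NN x. ennreal (c ^ CARD('n)) * (\<lambda>y. ennreal (gauss a y)) (c *\<^sub>R x))"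
   using gauss_dilate[OF a c(1) t] c by (simp add: ennreal_mult')
  also have "\<dots> = ennreal (c ^ CARD('n) / c ^ DIM(real^'n)) * (NN x. ennreal (gauss a x))"
   by (rule nn_integral_dilate) (use c in auto)
  also have "\<dots> = (NN x. ennreal (gauss a x))" using c by simp
  also have "\<dots> = ennreal (LB x. gauss a x)"
   by (rule nn_integral_eq_integral[OF i]) (simp add: less_imp_le[OF pos])
  finally show "(NN x. ennreal (gauss (t *\<^sub>R a) x)) = ennreal (LB x. gauss a x)" .
 qed
qed

definition plane_wave :: "real^'n \<Rightarrow> real \<Rightarrow> real \<times> (real^'n) \<Rightarrow> real" where
 "plane_wave \<xi> s p = exp (\<xi> \<bullet> snd p - s * fst p)"

lemma plane_wave_derivative:
 "((\<lambda>p. \<xi> \<bullet> snd p - s * fst p) has_derivative (\<lambda>e. \<xi> \<bullet> snd e - s * fst e)) (at p)"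
 by (auto intro!: derivative_eq_intros)

lemma smooth_plane_wave: "smooth (plane_wave \<xi> s)"
proof -
 have b: "bounded_linear (\<lambda>p :: real \<times> (real^'a). \<xi> \<bullet> snd p - s * fst p)"
  by (rule has_derivative_bounded_linear[OF plane_wave_derivative])
 show ?thesis unfolding plane_wave_def[abs_def] by (rule smooth_compose_linear[OF smooth_exp b])
qed

lemma dd_plane_wave: "dd e (plane_wave \<xi> s) p = (\<xi> \<bullet> snd e - s * fst e) * plane_wave \<xi> s p"
proof -
 have "(plane_wave \<xi> s has_derivative (\<lambda>e. exp (\<xi> \<bullet> snd p - s * fst p) * (\<xi> \<bullet> snd e - s * fst e))) (at p)"
  unfolding plane_wave_def[abs_def] by (rule has_derivative_compose[OF plane_wave_derivative DERIV_exp[unfolded has_field_derivative_def]])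
 then show ?thesis by (subst dd_eqI, assumption) (simp add: plane_wave_def)
qed

text \<open>Completing the square: multiplying the Gaussian by
  \<open>exp (2 * (\<xi> \<bullet> x))\<close> moves its centre to \<open>2 * t\<close> times
  \<open>a *v \<xi>\<close> and multiplies its mass by an exponential of
  \<open>2 * t * (\<xi> \<bullet> (a *v \<xi>))\<close>.\<close>

lemma gauss_plane_wave:
 assumes a: "posdef (a :: real^'n^'n)" and t: "t > 0"
 shows "gauss (t *\<^sub>R a) x * (plane_wave \<xi> s (t, x))\<^sup>2
  = gauss (t *\<^sub>R a) (x + (- 2 * t) *\<^sub>R (a *v \<xi>)) * exp (- (2 * (s - \<xi> \<bullet> (a *v \<xi>))) * t)"
proof -
 let ?b = "matrix_inv a"
 define v where "v = a *v \<xi>"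
 have bv: "?b *v v = \<xi>" unfolding v_def by (rule matrix_inv_mult(1)[OF posdef_invertible[OF a]])
 have vb: "v \<bullet> (?b *v x) = \<xi> \<bullet> x" using matrix_inv_symmetric_inner[OF a, of v x] by (simp only: bv)
 have q: "(x + (- 2 * t) *\<^sub>R v) \<bullet> (?b *v (x + (- 2 * t) *\<^sub>R v)) = x \<bullet> (?b *v x) - 4 * t * (\<xi> \<bullet> x) + 4 * t\<^sup>2 * (\<xi> \<bullet> v)"
  unfolding matrix_vector_right_distrib matrix_vector_mult_scaleR bv inner_add_left inner_add_right inner_scaleR_left inner_scaleR_right vb
  by (simp add: inner_commute power2_eq_square algebra_simps)
 have sq: "(plane_wave \<xi> s (t, x))\<^sup>2 = exp (2 * (\<xi> \<bullet> x - s * t))"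
  by (simp add: plane_wave_def exp_double[symmetric])
 have "- (x \<bullet> (?b *v x)) / (2 * t) + 2 * (\<xi> \<bullet> x - s * t)
  = - ((x + (- 2 * t) *\<^sub>R v) \<bullet> (?b *v (x + (- 2 * t) *\<^sub>R v))) / (2 * t) + - (2 * (s - \<xi> \<bullet> v)) * t"
  unfolding q using t by (simp add: field_simps power2_eq_square)
 then have e: "exp (- (x \<bullet> (?b *v x)) / (2 * t)) * exp (2 * (\<xi> \<bullet> x - s * t))
  = exp (- ((x + (- 2 * t) *\<^sub>R v) \<bullet> (?b *v (x + (- 2 * t) *\<^sub>R v))) / (2 * t)) * exp (- (2 * (s - \<xi> \<bullet> v)) * t)"
  unfolding exp_add[symmetric] by (rule arg_cong)
 show ?thesis unfolding gauss_scaled[OF a t] sq v_def[symmetric] times_divide_eq_left e ..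
qed

lemma plane_wave_mass:
 assumes a: "posdef (a :: real^'n^'n)"
 obtains G where "G > 0" "\<And>t \<xi> s. t > 0 \<Longrightarrow>
  (NN x. ennreal (gauss (t *\<^sub>R a) x * (plane_wave \<xi> s (t, x))\<^sup>2)) = ennreal (G * exp (- (2 * (s - \<xi> \<bullet> (a *v \<xi>))) * t))"
proof -
 obtain G where G: "G > 0" "\<And>t. t > 0 \<Longrightarrow> (NN x. ennreal (gauss (t *\<^sub>R a) x)) = ennreal G"
  using gauss_mass[OF a] by blast
 show ?thesis
 proof (rule that[OF G(1)])
  fix t s :: real and \<xi> :: "real^'n" assume t: "t > 0"
  let ?e = "exp (- (2 * (s - \<xi> \<bullet> (a *v \<xi>))) * t)"
  have [measurable]: "(\<lambda>x. ennreal (gauss (t *\<^sub>R a) x)) \<in> borel_measurable borel"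
   using borel_measurable_continuous_onI[OF continuous_gauss[of "t *\<^sub>R a"]] by measurable
  have "(NN x. ennreal (gauss (t *\<^sub>R a) x * (plane_wave \<xi> s (t, x))\<^sup>2))
   = (NN x. ennreal (gauss (t *\<^sub>R a) (x + (- 2 * t) *\<^sub>R (a *v \<xi>))) * ennreal ?e)"
   unfolding gauss_plane_wave[OF a t] by (simp add: ennreal_mult'')
  also have "\<dots> = (NN x. ennreal (gauss (t *\<^sub>R a) x) * ennreal ?e)"
   by (rule nn_integral_lborel_translate[where f="\<lambda>x. ennreal (gauss (t *\<^sub>R a) x) * ennreal ?e"]) measurable
  also have "\<dots> = ennreal G * ennreal ?e" by (subst nn_integral_multc) (auto simp: G(2)[OF t])
  also have "\<dots> = ennreal (G * ?e)" using G(1) by (simp add: ennreal_mult)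
  finally show "(NN x. ennreal (gauss (t *\<^sub>R a) x * (plane_wave \<xi> s (t, x))\<^sup>2)) = ennreal (G * ?e)" .
 qed
qed

lemma H1loc_smooth:
 fixes g :: "real^'n \<Rightarrow> real"
 assumes g: "smooth g" and G: "\<And>i x. dd (axis i 1) g x = Dg x $ i" and c: "continuous_on UNIV Dg"
 shows "H1loc g Dg"
 unfolding H1loc_def
proof (intro conjI allI)
 fix i
 have "dd (axis i 1) g = (\<lambda>x. Dg x $ i)" by (simp add: G fun_eq_iff)
 then show "weak_deriv UNIV (axis i 1) g (\<lambda>x. Dg x $ i)" using weak_deriv_smooth[OF g, of UNIV "axis i 1"] by simp
next
 fix R
 let ?f = "\<lambda>x. (g x)\<^sup>2 + (norm (Dg x))\<^sup>2"
 have "continuous_on (cball 0 R) ?f"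
  by (intro continuous_intros continuous_on_subset[OF c] smooth_continuous_on g) auto
 then have "bounded (?f ` cball 0 R)" by (intro compact_imp_bounded compact_continuous_image) auto
 then obtain M where M: "M > 0" "\<And>x. x \<in> cball 0 R \<Longrightarrow> norm (?f x) \<le> M" unfolding bounded_pos by blast
 have "(\<integral>\<^sup>+x\<in>cball 0 R. ennreal (?f x) \<partial>lborel) \<le> (NN x. ennreal M * indicator (cball (0 :: real^'n) R) x)"
 proof (rule nn_integral_mono)
  fix x :: "real^'n"
  show "ennreal (?f x) * indicator (cball 0 R) x \<le> ennreal M * indicator (cball 0 R) x"
  proof (cases "x \<in> cball 0 R")
   case True
   then have "?f x \<le> M" using M(2)[OF True] by simp
   from ennreal_leI[OF this] show ?thesis by (rule mult_right_mono) simp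
  qed simp
 qed
 also have "\<dots> = ennreal M * emeasure lborel (cball (0 :: real^'n) R)" by (simp add: nn_integral_cmult_indicator)
 also have "\<dots> < top" using emeasure_bounded_finite[of "cball (0 :: real^'n) R"] by (simp add: ennreal_mult_less_top)
 finally show "(\<integral>\<^sup>+x\<in>cball 0 R. ennreal (?f x) \<partial>lborel) < top" .
qed

text \<open>The numerator of the test quotient is bounded below only on the first half of
  \<open>(1, 2)\<close>, where \<open>2 - t \<ge> 1/2\<close>, whereas the denominator lives on all
  of it. This moves the second half onto the first.\<close>

lemma indicator_shift:
 fixes f :: "real \<Rightarrow> ennreal"
 assumes [measurable]: "f \<in> borel_measurable borel" and f: "\<And>t. 1 < t \<Longrightarrow> t < 3/2 \<Longrightarrow> f (t + 1/2) \<le> C * f t"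
 shows "(\<integral>\<^sup>+t\<in>{1<..<2}. f t \<partial>lborel) \<le> (1 + C) * (\<integral>\<^sup>+t\<in>{1<..<3/2}. f t \<partial>lborel)"
proof -
 have "(\<integral>\<^sup>+t\<in>{1<..<2}. f t \<partial>lborel) \<le> (NN t. f t * indicator {1<..<3/2} t + f t * indicator {3/2<..<2} t)"
 proof (rule nn_integral_mono_AE)
  have "AE t in lborel. t \<noteq> (3/2 :: real)" by (rule AE_lborel_singleton)
  then show "AE t in lborel. f t * indicator {1<..<2} t \<le> f t * indicator {1<..<3/2} t + f t * indicator {3/2<..<2} t"
   by eventually_elim (auto simp: indicator_def)
 qed
 also have "\<dots> = (\<integral>\<^sup>+t\<in>{1<..<3/2}. f t \<partial>lborel) + (\<integral>\<^sup>+t\<in>{3/2<..<2}. f t \<partial>lborel)" by (rule nn_integral_add) measurable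
 also have "(\<integral>\<^sup>+t\<in>{3/2<..<2}. f t \<partial>lborel) = (NN t. f (t + 1/2) * indicator {3/2<..<2} (t + 1/2))"
  by (rule nn_integral_lborel_translate[symmetric]) measurable
 also have "\<dots> \<le> (NN t. C * (f t * indicator {1<..<3/2} t))"
  by (rule nn_integral_mono) (use f in \<open>auto simp: indicator_def\<close>)
 also have "\<dots> = C * (\<integral>\<^sup>+t\<in>{1<..<3/2}. f t \<partial>lborel)" by (rule nn_integral_cmult) measurable
 finally show ?thesis by (simp add: distrib_right)
qed

lemma has_trace_plane_wave:
 "has_trace 1 2 (\<lambda>p. (2 - fst p) * plane_wave \<zeta> s p) (\<lambda>_. 0 :: real)" for \<zeta> :: "real^'n"
proof -
 let ?u = "\<lambda>t x. (2 - t) * plane_wave \<zeta> s (t, x)"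
 have H: "H1loc (?u t) (\<lambda>x. ?u t x *\<^sub>R \<zeta>)" for t
 proof (rule H1loc_smooth)
  have u: "?u t = (\<lambda>x. ((2 - t) * exp (- s * t)) * exp (\<zeta> \<bullet> x))"
   by (simp add: plane_wave_def fun_eq_iff exp_diff exp_minus field_simps)
  show "smooth (?u t)" unfolding u
   by (intro smooth_mult smooth_const smooth_compose_linear[OF smooth_exp bounded_linear_inner_right])
  have "((\<lambda>x. ((2 - t) * exp (- s * t)) * exp (\<zeta> \<bullet> x)) has_derivative (\<lambda>e. ((2 - t) * exp (- s * t)) * (exp (\<zeta> \<bullet> x) * (\<zeta> \<bullet> e)))) (at x)" for x
   by (intro has_derivative_mult_right has_derivative_compose[OF bounded_linear_imp_has_derivative[OF bounded_linear_inner_right] DERIV_exp[unfolded has_field_derivative_def]])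
  from dd_eqI[OF this] show "dd (axis i 1) (?u t) x = (?u t x *\<^sub>R \<zeta>) $ i" for i x
   unfolding u by (simp add: inner_axis fun_cong[OF u])
  show "continuous_on UNIV (\<lambda>x. ?u t x *\<^sub>R \<zeta>)" unfolding plane_wave_def by (intro continuous_intros)
 qed
 show ?thesis
  unfolding has_trace_def H1loc_tendsto_def
 proof (intro exI conjI allI)
  show "AE p in lborel. p \<in> strip 1 2 \<longrightarrow> (2 - fst p) * plane_wave \<zeta> s p = (2 - fst p) * plane_wave \<zeta> s p" by simp
  show "H1loc (\<lambda>_ :: real^'n. 0 :: real) (\<lambda>_. 0)" by (rule H1loc_smooth) (auto simp: smooth_const dd_const)
  show "\<forall>\<^sub>F t in at_left 2. H1loc (\<lambda>x. (2 - fst (t, x)) * plane_wave \<zeta> s (t, x)) (\<lambda>x. ?u t x *\<^sub>R \<zeta>)"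
   using H by simp
  fix R
  define M where "M = (exp (norm \<zeta> * \<bar>R\<bar> + 2 * \<bar>s\<bar>))\<^sup>2 * (1 + (norm \<zeta>)\<^sup>2)"
  define V where "V = measure lborel (cball (0 :: real^'n) R)"
  have V: "emeasure lborel (cball (0 :: real^'n) R) = ennreal V" "0 \<le> V"
   using emeasure_bounded_finite[of "cball (0 :: real^'n) R"] by (auto simp: V_def emeasure_eq_ennreal_measure less_top)
  have M: "0 \<le> M" by (simp add: M_def)
  let ?I = "\<lambda>t. \<integral>\<^sup>+x\<in>cball 0 R. ennreal (((2 - fst (t, x)) * plane_wave \<zeta> s (t, x) - 0)\<^sup>2 + (norm (?u t x *\<^sub>R \<zeta> - 0))\<^sup>2) \<partial>lborel"
  have le: "?I t \<le> ennreal ((2 - t)\<^sup>2 * M * V)" if t: "1 < t" "t < 2" for t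
  proof -
   have "?I t \<le> (NN x. ennreal ((2 - t)\<^sup>2 * M) * indicator (cball (0 :: real^'n) R) x)"
   proof (rule nn_integral_mono)
    fix x :: "real^'n"
    show "ennreal (((2 - fst (t, x)) * plane_wave \<zeta> s (t, x) - 0)\<^sup>2 + (norm (?u t x *\<^sub>R \<zeta> - 0))\<^sup>2) * indicator (cball 0 R) x
     \<le> ennreal ((2 - t)\<^sup>2 * M) * indicator (cball 0 R) x"
    proof (cases "x \<in> cball 0 R")
     case True
     have "\<zeta> \<bullet> x \<le> norm \<zeta> * norm x" by (rule norm_cauchy_schwarz)
     also have "\<dots> \<le> norm \<zeta> * \<bar>R\<bar>" using True by (intro mult_left_mono) auto
     finally have 1: "\<zeta> \<bullet> x \<le> norm \<zeta> * \<bar>R\<bar>" .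
     have "- (s * t) \<le> \<bar>s\<bar> * t" using t abs_ge_minus_self[of s] mult_right_mono[of "- s" "\<bar>s\<bar>" t] by simp
     also have "\<dots> \<le> \<bar>s\<bar> * 2" using t by (intro mult_left_mono) auto
     finally have "\<zeta> \<bullet> x - s * t \<le> norm \<zeta> * \<bar>R\<bar> + 2 * \<bar>s\<bar>" using 1 by simp
     then have "(plane_wave \<zeta> s (t, x))\<^sup>2 \<le> (exp (norm \<zeta> * \<bar>R\<bar> + 2 * \<bar>s\<bar>))\<^sup>2"
      by (intro power_mono) (auto simp: plane_wave_def)
     then have "(2 - t)\<^sup>2 * ((plane_wave \<zeta> s (t, x))\<^sup>2 * (1 + (norm \<zeta>)\<^sup>2)) \<le> (2 - t)\<^sup>2 * M"
      unfolding M_def by (intro mult_left_mono mult_right_mono) auto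
     moreover have "((2 - fst (t, x)) * plane_wave \<zeta> s (t, x) - 0)\<^sup>2 + (norm (?u t x *\<^sub>R \<zeta> - 0))\<^sup>2 = (2 - t)\<^sup>2 * ((plane_wave \<zeta> s (t, x))\<^sup>2 * (1 + (norm \<zeta>)\<^sup>2))"
      by (simp add: power_mult_distrib abs_mult, algebra)
     ultimately have "ennreal (((2 - fst (t, x)) * plane_wave \<zeta> s (t, x) - 0)\<^sup>2 + (norm (?u t x *\<^sub>R \<zeta> - 0))\<^sup>2) \<le> ennreal ((2 - t)\<^sup>2 * M)"
      by (intro ennreal_leI) (simp only:)
     then show ?thesis by (rule mult_right_mono) simp
    qed simp
   qed
   also have "\<dots> = ennreal ((2 - t)\<^sup>2 * M) * ennreal V" by (simp add: nn_integral_cmult_indicator V)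
   also have "\<dots> = ennreal ((2 - t)\<^sup>2 * M * V)" using M V by (intro ennreal_mult[symmetric]) auto
   finally show ?thesis .
  qed
  have "((\<lambda>t. ennreal ((2 - t)\<^sup>2 * M * V)) \<longlongrightarrow> ennreal ((2 - 2)\<^sup>2 * M * V)) (at_left 2)" by (intro tendsto_intros)
  then have l: "((\<lambda>t. ennreal ((2 - t)\<^sup>2 * M * V)) \<longlongrightarrow> 0) (at_left 2)" by simp
  show "(?I \<longlongrightarrow> 0) (at_left 2)"
  proof (rule tendsto_sandwich[OF _ _ tendsto_const l])
   show "\<forall>\<^sub>F t in at_left 2. ?I t \<le> ennreal ((2 - t)\<^sup>2 * M * V)"
    by (rule eventually_mono[OF eventually_at_left_real[of 1 2]]) (simp, rule le, auto)
  qed simp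
 qed
qed

text \<open>With \<open>s = \<zeta> \<bullet> (A *v \<zeta>)\<close> the wave solves the homogeneous
  equation, so applying \<open>P_op\<close> to \<open>u\<close> leaves only the term in which time
  differentiation hits \<open>2 - t\<close>, that is the wave itself. The Hessian is
  \<open>u\<close> times the matrix of products of components of \<open>\<zeta>\<close>. The bound
  has a factor free of \<open>\<zeta>\<close>, although the left side is quadratic in it.\<close>

lemma k_const_lower_bound:
 fixes a A q :: "real^'n^'n" and \<zeta> :: "real^'n"
 assumes a: "posdef a" and \<zeta>: "\<zeta> \<bullet> ((a - A) *v \<zeta>) \<le> 0" and \<alpha>: "0 \<le> \<alpha>"
  and k: "k_const \<alpha> 1 2 (\<lambda>t x. gauss (t *\<^sub>R a) x) A q = ennreal \<kappa>" "0 \<le> \<kappa>"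
 shows "norm (sqrt_mat q ** (\<chi> i j. \<zeta> $ i * \<zeta> $ j) ** sqrt_mat q) \<le> 2 * sqrt (1 + 2 powr \<alpha>) * \<kappa>"
proof -
 let ?F = "\<lambda>t x. gauss (t *\<^sub>R a) x"
 define X :: "real^'n^'n" where "X = (\<chi> i j. \<zeta> $ i * \<zeta> $ j)"
 define Y where "Y = sqrt_mat q ** X ** sqrt_mat q"
 define s where "s = \<zeta> \<bullet> (A *v \<zeta>)"
 \<comment> \<open>The sign hypothesis on \<open>a - A\<close> says exactly that the weighted mass
   of the squared wave, apart from the power of time, does not grow. So the two halves of
   \<open>(1, 2)\<close> compare with a constant free of \<open>\<zeta>\<close>.\<close>
 define K where "K = 2 * (s - \<zeta> \<bullet> (a *v \<zeta>))"
 have K: "0 \<le> K" using \<zeta> by (simp add: K_def s_def matrix_vector_mult_diff_rdistrib inner_diff_right)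
 define E where "E = plane_wave \<zeta> s"
 have E: "E p > 0" for p by (simp add: E_def plane_wave_def)
 have sE: "smooth E" unfolding E_def by (rule smooth_plane_wave)
 obtain G where G: "G > 0" "\<And>t. t > 0 \<Longrightarrow> (NN x. ennreal (gauss (t *\<^sub>R a) x * (E (t, x))\<^sup>2)) = ennreal (G * exp (- K * t))"
 proof (rule plane_wave_mass[OF a])
  fix G assume 1: "G > 0" and 2: "\<And>t (\<xi> :: real^'n) s. t > 0 \<Longrightarrow>
   (NN x. ennreal (gauss (t *\<^sub>R a) x * (plane_wave \<xi> s (t, x))\<^sup>2)) = ennreal (G * exp (- (2 * (s - \<xi> \<bullet> (a *v \<xi>))) * t))"
  show thesis by (rule that[OF 1]) (unfold E_def K_def, rule 2)
 qed
 define u where "u p = (2 - fst p) * E p" for p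
 define ut where "ut p = (- 1 - (2 - fst p) * s) * E p" for p
 define Du where "Du p = u p *\<^sub>R \<zeta>" for p
 define Hu where "Hu p = u p *\<^sub>R X" for p
 have dl: "((\<lambda>p :: real \<times> (real^'n). 2 - fst p) has_derivative (\<lambda>e. - fst e)) (at p)" for p
  by (auto intro!: derivative_eq_intros)
 have sl: "smooth (\<lambda>p :: real \<times> (real^'n). 2 - fst p)"
  by (intro smooth_diff smooth_const smooth_linear bounded_linear_fst)
 have su: "smooth u" unfolding u_def[abs_def] by (intro smooth_mult sl sE)
 have ddu: "dd e u p = ((2 - fst p) * (\<zeta> \<bullet> snd e - s * fst e) - fst e) * E p" for e p
 proof -
  have dE: "dd e E p = (\<zeta> \<bullet> snd e - s * fst e) * E p" unfolding E_def by (rule dd_plane_wave)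
  show ?thesis unfolding u_def[abs_def] dd_mult[OF sl sE] dd_eqI[OF dl] dE by (simp add: algebra_simps)
 qed
 have ddux: "dd (0, axis i 1) u = (\<lambda>p. u p * \<zeta> $ i)" for i by (simp add: ddu u_def fun_eq_iff inner_axis)
 define J where "J S = (\<integral>\<^sup>+t\<in>S. ennreal (t powr \<alpha> * (G * exp (- K * t))) \<partial>lborel)" for S
 have inner: "(NN x. ennreal (t powr \<alpha> * gauss (t *\<^sub>R a) x * (m * E (t, x))\<^sup>2)) = ennreal (m\<^sup>2) * ennreal (t powr \<alpha> * (G * exp (- K * t)))"
  if t: "t > 0" for t m
 proof (cases "m = 0")
  case False
  have "(NN x. ennreal (t powr \<alpha> * gauss (t *\<^sub>R a) x * (m * E (t, x))\<^sup>2))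
   = (NN x. ennreal (m\<^sup>2 * t powr \<alpha>) * (\<lambda>x. ennreal (gauss (t *\<^sub>R a) x * (E (t, x))\<^sup>2)) (1 *\<^sub>R x))"
   by (intro nn_integral_cong) (simp add: ennreal_mult'[symmetric] power_mult_distrib mult_ac)
  also have "\<dots> = ennreal (m\<^sup>2 * t powr \<alpha> / 1 ^ DIM(real^'n)) * ennreal (G * exp (- K * t))"
   unfolding G(2)[OF t, symmetric] by (rule nn_integral_dilate) (use t False in auto)
  finally show ?thesis using G(1) by (simp add: ennreal_mult'[symmetric] mult.assoc)
 qed simp
 have g0: "0 \<le> t powr \<alpha> * gauss (t *\<^sub>R a) x" if "t > 0" for t x
  using posdef_det_pos[OF a] that by (simp add: gauss_scaled[OF a that])
 have mJ: "(\<integral>\<^sup>+t\<in>S. ennreal (m\<^sup>2) * ennreal (t powr \<alpha> * (G * exp (- K * t))) \<partial>lborel) = ennreal (m\<^sup>2) * J S" if "S \<in> sets borel" for S m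
 proof -
  note [measurable] = that
  show ?thesis unfolding J_def mult.assoc by (rule nn_integral_cmult) measurable
 qed
 have up: "wnorm \<alpha> 1 2 ?F f \<le> ennreal_sqrt (ennreal (m\<^sup>2) * J {1<..<2})" if f: "\<And>t x. 1 < t \<Longrightarrow> t < 2 \<Longrightarrow> norm (f (t, x)) \<le> m * E (t, x)"
  for m and f :: "real \<times> (real^'n) \<Rightarrow> 'b::real_normed_vector"
 proof -
  have "(\<integral>\<^sup>+t\<in>{1<..<2}. (NN x. ennreal (t powr \<alpha> * gauss (t *\<^sub>R a) x * (norm (f (t, x)))\<^sup>2)) \<partial>lborel)
   \<le> (\<integral>\<^sup>+t\<in>{1<..<2}. ennreal (m\<^sup>2) * ennreal (t powr \<alpha> * (G * exp (- K * t))) \<partial>lborel)"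
  proof (rule nn_integral_mono)
   fix t :: real
   show "(NN x. ennreal (t powr \<alpha> * gauss (t *\<^sub>R a) x * (norm (f (t, x)))\<^sup>2)) * indicator {1<..<2} t
    \<le> ennreal (m\<^sup>2) * ennreal (t powr \<alpha> * (G * exp (- K * t))) * indicator {1<..<2} t"
   proof (cases "t \<in> {1<..<2}")
    case True
    then have t: "t > 0" by simp
    show ?thesis unfolding inner[OF t, symmetric]
     by (intro mult_right_mono nn_integral_mono ennreal_leI mult_left_mono power_mono f g0 t) (use True in auto)
   qed simp
  qed
  also have "\<dots> = ennreal (m\<^sup>2) * J {1<..<2}" by (rule mJ) simp
  finally show ?thesis unfolding wnorm_def by (rule ennreal_sqrt_mono)
 qed
 have low: "ennreal_sqrt (ennreal (m\<^sup>2) * J {1<..<3/2}) \<le> wnorm \<alpha> 1 2 ?F f" if f: "\<And>t x. 1 < t \<Longrightarrow> t < 3/2 \<Longrightarrow> m * E (t, x) \<le> norm (f (t, x))" "0 \<le> m"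
  for m and f :: "real \<times> (real^'n) \<Rightarrow> 'b::real_normed_vector"
 proof -
  have "ennreal (m\<^sup>2) * J {1<..<3/2} = (\<integral>\<^sup>+t\<in>{1<..<3/2}. ennreal (m\<^sup>2) * ennreal (t powr \<alpha> * (G * exp (- K * t))) \<partial>lborel)"
   by (rule mJ[symmetric]) simp
  also have "\<dots> \<le> (\<integral>\<^sup>+t\<in>{1<..<2}. (NN x. ennreal (t powr \<alpha> * gauss (t *\<^sub>R a) x * (norm (f (t, x)))\<^sup>2)) \<partial>lborel)"
  proof (rule nn_integral_mono)
   fix t :: real
   show "ennreal (m\<^sup>2) * ennreal (t powr \<alpha> * (G * exp (- K * t))) * indicator {1<..<3/2} t
    \<le> (NN x. ennreal (t powr \<alpha> * gauss (t *\<^sub>R a) x * (norm (f (t, x)))\<^sup>2)) * indicator {1<..<2} t"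
   proof (cases "t \<in> {1<..<3/2}")
    case True
    then have t: "t > 0" by simp
    show ?thesis unfolding inner[OF t, symmetric]
     using True f(2) less_imp_le[OF E]
     by (intro mult_mono nn_integral_mono ennreal_leI mult_left_mono power_mono f(1) g0 t) auto
   qed simp
  qed
  finally show ?thesis unfolding wnorm_def by (rule ennreal_sqrt_mono)
 qed
 have J2: "J {1<..<2} \<le> ennreal (1 + 2 powr \<alpha>) * J {1<..<3/2}"
 proof -
  have "J {1<..<2} \<le> (1 + ennreal (2 powr \<alpha>)) * J {1<..<3/2}"
   unfolding J_def
  proof (rule indicator_shift)
   fix t :: real assume t: "1 < t" "t < 3/2"
   have "(t + 1/2) powr \<alpha> \<le> (2 * t) powr \<alpha>" using t \<alpha> by (intro powr_mono2) auto
   also have "\<dots> = 2 powr \<alpha> * t powr \<alpha>" using t by (simp add: powr_mult)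
   finally have 1: "(t + 1/2) powr \<alpha> \<le> 2 powr \<alpha> * t powr \<alpha>" .
   have 2: "exp (- K * (t + 1/2)) \<le> exp (- K * t)" using K by (simp add: algebra_simps)
   have "(t + 1/2) powr \<alpha> * (G * exp (- K * (t + 1/2))) \<le> (2 powr \<alpha> * t powr \<alpha>) * (G * exp (- K * t))"
    using G(1) by (intro mult_mono 1 2) auto
   then have "ennreal ((t + 1/2) powr \<alpha> * (G * exp (- K * (t + 1/2)))) \<le> ennreal (2 powr \<alpha> * (t powr \<alpha> * (G * exp (- K * t))))"
    by (intro ennreal_leI) (simp add: mult.assoc)
   also have "\<dots> = ennreal (2 powr \<alpha>) * ennreal (t powr \<alpha> * (G * exp (- K * t)))" by (intro ennreal_mult') simp
   finally show "ennreal ((t + 1/2) powr \<alpha> * (G * exp (- K * (t + 1/2)))) \<le> ennreal (2 powr \<alpha>) * ennreal (t powr \<alpha> * (G * exp (- K * t)))" .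
  qed measurable
  then show ?thesis by (simp add: ennreal_plus)
 qed
 have "J {1<..<3/2} < top"
 proof -
  have "J {1<..<3/2} \<le> (NN t. ennreal (2 powr \<alpha> * G) * indicator {1<..<3/2} (t :: real))"
   unfolding J_def
  proof (rule nn_integral_mono)
   fix t :: real
   show "ennreal (t powr \<alpha> * (G * exp (- K * t))) * indicator {1<..<3/2} t \<le> ennreal (2 powr \<alpha> * G) * indicator {1<..<3/2} t"
   proof (cases "t \<in> {1<..<3/2}")
    case True
    have "t powr \<alpha> \<le> 2 powr \<alpha>" using True \<alpha> by (intro powr_mono2) auto
    moreover have "G * exp (- K * t) \<le> G * 1" using True K G(1) by (intro mult_left_mono) auto
    ultimately have "t powr \<alpha> * (G * exp (- K * t)) \<le> 2 powr \<alpha> * (G * 1)" using G(1) by (intro mult_mono) auto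
    then have "ennreal (t powr \<alpha> * (G * exp (- K * t))) \<le> ennreal (2 powr \<alpha> * G)" by (intro ennreal_leI) simp
    then show ?thesis by (rule mult_right_mono) simp
   qed simp
  qed
  also have "\<dots> = ennreal (2 powr \<alpha> * G) * ennreal (3/2 - 1)"
   by (subst nn_integral_cmult_indicator) (simp, subst emeasure_lborel_Ioo, auto)
  also have "\<dots> < top" by (rule ennreal_mult_less_top[THEN iffD2]) (intro disjI2 conjI ennreal_less_top)
  finally show ?thesis .
 qed
 moreover have "J {1<..<3/2} \<noteq> 0"
 proof
  assume "J {1<..<3/2} = 0"
  then have "AE t in lborel. ennreal (t powr \<alpha> * (G * exp (- K * t))) * indicator {1<..<3/2} t = 0"
   unfolding J_def by (subst (asm) nn_integral_0_iff_AE) auto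
  then have "AE t in lborel. t \<notin> {1<..<3/2 :: real}"
   by eventually_elim (use G(1) in \<open>auto simp: ennreal_eq_0_iff mult_le_0_iff not_le split: if_splits\<close>)
  then have "{1<..<3/2 :: real} \<in> null_sets lborel" by (subst AE_iff_null_sets) simp_all
  then have "emeasure lborel {1<..<3/2 :: real} = 0" by (rule null_setsD1)
  then show False by (subst (asm) emeasure_lborel_Ioo) auto
 qed
 ultimately obtain j where j: "j > 0" "J {1<..<3/2} = ennreal j" by (cases "J {1<..<3/2}") (auto simp: less_le)
 have "J {1<..<2} < top" by (rule le_less_trans[OF J2]) (simp add: j ennreal_mult_less_top)
 then have fin: "ennreal_sqrt (ennreal (m\<^sup>2) * J {1<..<2}) < top" for m by (simp add: ennreal_sqrt_less_top ennreal_mult_less_top)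
 have w: "(u, ut, Du, Hu) \<in> W0_space \<alpha> 1 2 ?F"
  unfolding W0_space_def W_space_def mem_Collect_eq prod.case
 proof (intro conjI allI)
  have "dd (1, 0) u = ut" by (simp add: ddu ut_def fun_eq_iff algebra_simps)
  then show "weak_deriv (strip 1 2) (1, 0) u ut" using weak_deriv_smooth[OF su, of "strip 1 2" "(1, 0)"] by simp
  show "weak_deriv (strip 1 2) (0, axis i 1) u (\<lambda>p. Du p $ i)" for i
   using weak_deriv_smooth[OF su, of "strip 1 2" "(0, axis i 1)"] by (simp add: ddux Du_def)
  show "weak_deriv (strip 1 2) (0, axis j 1) (\<lambda>p. Du p $ i) (\<lambda>p. Hu p $ i $ j)" for i j
   using weak_deriv_scaleR[OF weak_deriv_smooth[OF su, of "strip 1 2" "(0, axis j 1)"], of 1 "\<zeta> $ i"]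
   by (simp add: ddux Du_def Hu_def X_def mult_ac)
  have u1: "\<bar>u (t, x)\<bar> \<le> 1 * E (t, x)" if "1 < t" "t < 2" for t x
   unfolding u_def abs_mult using that less_imp_le[OF E] by (intro mult_mono) auto
  show "wnorm \<alpha> 1 2 ?F u < top" by (rule le_less_trans[OF up[of u 1] fin]) (simp only: real_norm_def, rule u1)
  show "wnorm \<alpha> 1 2 ?F ut < top"
  proof (rule le_less_trans[OF up[of ut "1 + \<bar>s\<bar>"] fin])
   fix t :: real and x :: "real^'n" assume t: "1 < t" "t < 2"
   have "\<bar>(2 - t) * s\<bar> \<le> 1 * \<bar>s\<bar>" unfolding abs_mult using t by (intro mult_right_mono) auto
   then have "\<bar>- 1 - (2 - t) * s\<bar> \<le> 1 + \<bar>s\<bar>" by linarith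
   then show "norm (ut (t, x)) \<le> (1 + \<bar>s\<bar>) * E (t, x)"
    unfolding ut_def real_norm_def abs_mult using less_imp_le[OF E] by (intro mult_mono) auto
  qed
  show "wnorm \<alpha> 1 2 ?F Du < top"
  proof (rule le_less_trans[OF up[of Du "norm \<zeta>"] fin])
   fix t :: real and x :: "real^'n" assume t: "1 < t" "t < 2"
   show "norm (Du (t, x)) \<le> norm \<zeta> * E (t, x)"
    using mult_left_mono[OF u1[OF t, of x] norm_ge_zero[of \<zeta>]] by (simp add: Du_def mult_ac)
  qed
  show "wnorm \<alpha> 1 2 ?F Hu < top"
  proof (rule le_less_trans[OF up[of Hu "norm X"] fin])
   fix t :: real and x :: "real^'n" assume t: "1 < t" "t < 2"
   show "norm (Hu (t, x)) \<le> norm X * E (t, x)"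
    using mult_left_mono[OF u1[OF t, of x] norm_ge_zero[of X]] by (simp add: Hu_def mult_ac)
  qed
  show "has_trace 1 2 u (\<lambda>_. 0)" unfolding u_def[abs_def] E_def by (rule has_trace_plane_wave)
 qed
 have Pop: "P_op A ut Hu = E"
 proof
  fix p
  have "frob_inner A X = s"
   by (simp add: frob_inner_sum X_def s_def inner_vec_def matrix_vector_mult_def sum_distrib_left mult_ac)
  moreover have "frob_inner A (Hu p) = u p * frob_inner A X" by (simp add: frob_inner_sum Hu_def sum_distrib_left mult_ac)
  ultimately show "P_op A ut Hu p = E p" by (simp add: P_op_def ut_def u_def algebra_simps)
 qed
 have Hop: "H_op q Hu p = u p *\<^sub>R Y" for p
  using H_op_scaleR[of q "u p" "\<lambda>_. X" p] by (simp add: Hu_def H_op_def Y_def)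
 have wP: "wnorm \<alpha> 1 2 ?F (P_op A ut Hu) \<le> ennreal (sqrt ((1 + 2 powr \<alpha>) * j))"
 proof -
  have "wnorm \<alpha> 1 2 ?F (P_op A ut Hu) \<le> ennreal_sqrt (ennreal (1\<^sup>2) * J {1<..<2})"
   unfolding Pop by (rule up) (use less_imp_le[OF E] in simp)
  also have "\<dots> \<le> ennreal_sqrt (ennreal ((1 + 2 powr \<alpha>) * j))"
   using J2 j by (intro ennreal_sqrt_mono) (simp add: ennreal_mult')
  finally show ?thesis using j by (simp add: ennreal_sqrt_ennreal)
 qed
 have wH: "ennreal (norm Y / 2 * sqrt j) \<le> wnorm \<alpha> 1 2 ?F (H_op q Hu)"
 proof -
  have "ennreal_sqrt (ennreal ((norm Y / 2)\<^sup>2) * J {1<..<3/2}) \<le> wnorm \<alpha> 1 2 ?F (H_op q Hu)"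
  proof (rule low)
   fix t :: real and x :: "real^'n" assume t: "1 < t" "t < 3/2"
   have "norm Y / 2 * E (t, x) = (1/2) * (norm Y * E (t, x))" by simp
   also have "\<dots> \<le> (2 - t) * (norm Y * E (t, x))" using t less_imp_le[OF E] by (intro mult_right_mono) auto
   finally show "norm Y / 2 * E (t, x) \<le> norm (H_op q Hu (t, x))"
    using t E[of "(t, x)"] by (simp add: Hop u_def abs_mult mult_ac)
  qed simp
  moreover have "ennreal_sqrt (ennreal ((norm Y / 2)\<^sup>2) * J {1<..<3/2}) = ennreal (norm Y / 2 * sqrt j)"
   using j ennreal_sqrt_ennreal[of "(norm Y / 2)\<^sup>2 * j"] by (simp add: ennreal_mult' real_sqrt_mult)
  ultimately show ?thesis by simp
 qed
 have "wnorm \<alpha> 1 2 ?F (H_op q Hu) / wnorm \<alpha> 1 2 ?F (P_op A ut Hu) \<le> ennreal \<kappa>"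
  unfolding k(1)[symmetric] k_const_def by (rule SUP_upper2[OF w]) simp
 then have "wnorm \<alpha> 1 2 ?F (H_op q Hu) \<le> ennreal \<kappa> * wnorm \<alpha> 1 2 ?F (P_op A ut Hu)"
  by (rule ennreal_le_of_divide_le) (use le_less_trans[OF wP] in auto)
 also have "\<dots> \<le> ennreal \<kappa> * ennreal (sqrt ((1 + 2 powr \<alpha>) * j))" by (intro mult_left_mono wP) simp
 also have "\<dots> = ennreal (\<kappa> * sqrt ((1 + 2 powr \<alpha>) * j))" using k(2) by (simp add: ennreal_mult')
 finally have "ennreal (norm Y / 2 * sqrt j) \<le> ennreal (\<kappa> * sqrt ((1 + 2 powr \<alpha>) * j))" using wH by (rule order_trans[rotated])
 then have "norm Y / 2 * sqrt j \<le> \<kappa> * sqrt ((1 + 2 powr \<alpha>) * j)" using k(2) j(1) by (simp add: ennreal_le_iff)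
 then have "norm Y / 2 * sqrt j \<le> (\<kappa> * sqrt (1 + 2 powr \<alpha>)) * sqrt j" by (simp add: real_sqrt_mult mult_ac)
 then have "norm Y / 2 \<le> \<kappa> * sqrt (1 + 2 powr \<alpha>)" using j(1) by simp
 then show ?thesis by (simp add: Y_def X_def mult_ac)
qed

text \<open>A bad direction may be rescaled: the sign condition is homogeneous, while the quantity
  bounded in \<open>k_const_lower_bound\<close> grows quadratically. It is not zero to begin with
  because \<open>sqrt_mat q\<close> is invertible.\<close>

lemma P_delta0_finite_imp_posdef:
 fixes a A q :: "real^'n^'n"
 assumes a: "posdef a" and A: "posdef A" and q: "posdef q" and \<alpha>: "0 \<le> \<alpha>" and fin: "P_delta0 \<alpha> a A q < top"
 shows "posdef (a - A)"
proof (rule ccontr)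
 let ?F = "\<lambda>t x. gauss (t *\<^sub>R a) x"
 assume "\<not> posdef (a - A)"
 moreover have "transpose (a - A) = a - A"
  using a A by (simp add: posdef_def transpose_def vec_eq_iff)
 ultimately obtain \<xi> where \<xi>: "\<xi> \<noteq> 0" "\<xi> \<bullet> ((a - A) *v \<xi>) \<le> 0" unfolding posdef_def by (auto simp: not_less)
 have "k_const \<alpha> 1 2 ?F A q \<le> P_delta0 \<alpha> a A q" unfolding P_delta0_def by (rule SUP_upper2[of "(1, 2)"]) auto
 then have "k_const \<alpha> 1 2 ?F A q < top" using fin by (rule le_less_trans)
 then obtain \<kappa> where \<kappa>: "0 \<le> \<kappa>" "k_const \<alpha> 1 2 ?F A q = ennreal \<kappa>" by (cases "k_const \<alpha> 1 2 ?F A q") auto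
 let ?r = "sqrt_mat q"
 define X :: "real^'n^'n" where "X = (\<chi> i j. \<xi> $ i * \<xi> $ j)"
 define N where "N = norm (?r ** X ** ?r)"
 have "?r ** X ** ?r \<noteq> 0"
 proof
  assume z: "?r ** X ** ?r = 0"
  have inv: "invertible ?r" by (rule posdef_invertible[OF sqrt_mat(1)[OF q]])
  have "X = (matrix_inv ?r ** ?r) ** X ** (?r ** matrix_inv ?r)" using matrix_inv_inverse[OF inv] by simp
  also have "\<dots> = matrix_inv ?r ** (?r ** X ** ?r) ** matrix_inv ?r" by (simp only: matrix_mul_assoc)
  also have "\<dots> = 0" unfolding z by (simp add: matrix_matrix_mult_def vec_eq_iff)
  finally have "X = 0" .
  obtain i where "\<xi> $ i \<noteq> 0" using \<xi>(1) by (auto simp: vec_eq_iff)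
  then show False using \<open>X = 0\<close> by (auto simp: X_def vec_eq_iff)
 qed
 then have N: "N > 0" by (simp add: N_def)
 define M where "M = 2 * sqrt (1 + 2 powr \<alpha>) * \<kappa>"
 have M: "0 \<le> M" using \<kappa> by (simp add: M_def)
 \<comment> \<open>The scale at which the quadratic quantity equals \<open>M + 1\<close> and so
   exceeds its bound \<open>M\<close>.\<close>
 define c where "c = sqrt ((M + 1) / N)"
 have c: "c\<^sup>2 = (M + 1) / N" using M N by (simp add: c_def)
 have "(c *\<^sub>R \<xi>) \<bullet> ((a - A) *v (c *\<^sub>R \<xi>)) \<le> 0"
  using mult_nonneg_nonpos[OF zero_le_power2[of c] \<xi>(2)] by (simp add: matrix_vector_mult_scaleR power2_eq_square mult.assoc)
 from k_const_lower_bound[OF a this \<alpha> \<kappa>(2,1)]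
 have "norm (?r ** (\<chi> i j. (c *\<^sub>R \<xi>) $ i * (c *\<^sub>R \<xi>) $ j) ** ?r) \<le> M" by (simp only: M_def)
 also have "(\<chi> i j. (c *\<^sub>R \<xi>) $ i * (c *\<^sub>R \<xi>) $ j) = c\<^sup>2 *\<^sub>R X"
  by (simp add: X_def vec_eq_iff power2_eq_square mult_ac)
 also have "?r ** (c\<^sup>2 *\<^sub>R X) ** ?r = c\<^sup>2 *\<^sub>R (?r ** X ** ?r)"
  using H_op_scaleR[of q "c\<^sup>2" "\<lambda>_ :: unit. X" "()"] by (simp add: H_op_def)
 finally have "c\<^sup>2 * N \<le> M" by (simp add: N_def)
 then show False using N unfolding c by simp
qed

theorem corollary4p14:
 fixes \<alpha> :: real
 assumes "\<alpha> \<ge> 0"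
 shows
  "(\<forall>T>0. \<forall>(a::real^'n^'n) A q. posdef a \<and> posdef A \<and> posdef q \<longrightarrow>
    K_const \<alpha> {0<..<T} (\<lambda>t x. gauss (t *\<^sub>R a) x) A q = P_delta0 \<alpha> a A q \<and>
    (K_const \<alpha> {0<..<T} (\<lambda>t x. gauss (t *\<^sub>R a) x) A q < top \<longleftrightarrow> posdef (a - A))) \<and>
   (\<forall>l L M. 0 < l \<and> l \<le> L \<and> 0 < M \<longrightarrow>
    (\<exists>C::real. \<forall>T>0. \<forall>(a::real^'n^'n) A q.
      posdef a \<and> posdef A \<and> posdef q \<and>
      elliptic l L a \<and> elliptic l L A \<and> elliptic l L q \<and>
      posdef (a - A) \<and> inverse (lambda_min (a - A)) \<le> M \<longrightarrow>
      K_const \<alpha> {0<..<T} (\<lambda>t x. gauss (t *\<^sub>R a) x) A q \<le> ennreal C))"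
proof (intro conjI allI impI)
 fix T :: real and a A q :: "real^'n^'n"
 assume T: "T > 0" and "posdef a \<and> posdef A \<and> posdef q"
 then have p: "posdef a" "posdef A" "posdef q" by auto
 show eq: "K_const \<alpha> {0<..<T} (\<lambda>t x. gauss (t *\<^sub>R a) x) A q = P_delta0 \<alpha> a A q"
  by (rule K_const_eq_P_delta0[OF p(1) T])
 show "K_const \<alpha> {0<..<T} (\<lambda>t x. gauss (t *\<^sub>R a) x) A q < top \<longleftrightarrow> posdef (a - A)"
  unfolding eq
 proof
  assume "P_delta0 \<alpha> a A q < top"
  then show "posdef (a - A)" by (rule P_delta0_finite_imp_posdef[OF p assms])
 next
  assume d: "posdef (a - A)"
  obtain l1 L1 where 1: "0 < l1" "elliptic l1 L1 a" using posdef_elliptic[OF p(1)] by blast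
  obtain l2 L2 where 2: "0 < l2" "elliptic l2 L2 A" using posdef_elliptic[OF p(2)] by blast
  obtain l3 L3 where 3: "0 < l3" "elliptic l3 L3 q" using posdef_elliptic[OF p(3)] by blast
  define l where "l = min l1 (min l2 l3)"
  define L where "L = max L1 (max L2 L3)"
  have e: "elliptic l L a" "elliptic l L A" "elliptic l L q"
   using elliptic_mono[OF 1(2)] elliptic_mono[OF 2(2)] elliptic_mono[OF 3(2)] by (auto simp: l_def L_def)
  interpret parab a A l L "lambda_min (a - A)" \<alpha>
   by unfold_locales (use p e 1(1) 2(1) 3(1) lambda_min[OF d] assms in \<open>auto simp: l_def\<close>)
  show "P_delta0 \<alpha> a A q < top" by (rule le_less_trans[OF P_delta0_bound[OF p(3) e(3)]]) simp
 qed
next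
 fix l L M :: real assume lLM: "0 < l \<and> l \<le> L \<and> 0 < M"
 show "\<exists>C::real. \<forall>T>0. \<forall>(a::real^'n^'n) A q.
      posdef a \<and> posdef A \<and> posdef q \<and>
      elliptic l L a \<and> elliptic l L A \<and> elliptic l L q \<and>
      posdef (a - A) \<and> inverse (lambda_min (a - A)) \<le> M \<longrightarrow>
      K_const \<alpha> {0<..<T} (\<lambda>t x. gauss (t *\<^sub>R a) x) A q \<le> ennreal C"
 \<comment> \<open>The witness is left open and determined by the final bound. It must not mention
   \<open>T\<close>, \<open>a\<close>, \<open>A\<close> or \<open>q\<close>, which is why the gap
   parameter below is \<open>inverse M\<close> and not the least eigenvalue.\<close>
 proof (intro exI allI impI, elim conjE)
  fix T :: real and a A q :: "real^'n^'n"
  assume T: "T > 0" and p: "posdef a" "posdef A" "posdef q" and e: "elliptic l L a" "elliptic l L A" "elliptic l L q"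
   and d: "posdef (a - A)" and M: "inverse (lambda_min (a - A)) \<le> M"
  note lm = lambda_min[OF d]
  have "inverse M \<le> lambda_min (a - A)" using le_imp_inverse_le[OF M] lm(1) by simp
  then have gap: "inverse M * (x \<bullet> x) \<le> x \<bullet> ((a - A) *v x)" for x
   by (intro order_trans[OF mult_right_mono lm(2)]) auto
  interpret parab a A l L "inverse M" \<alpha>
   by unfold_locales (use p e lLM gap assms in auto)
  show "K_const \<alpha> {0<..<T} (\<lambda>t x. gauss (t *\<^sub>R a) x) A q
   \<le> ennreal (sqrt ((CARD('n) * L)\<^sup>2 * ((CARD('n))\<^sup>2 * dual_const TYPE('n) l L (inverse M) \<alpha>)))"
   unfolding K_const_eq_P_delta0[OF p(1) T] by (rule P_delta0_bound[OF p(3) e(3)])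
 qed
qed

end
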